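(* Let $\Omega\subset\mathbb{R}^2$ be a bounded Lipschitz domain and let $u_0\in W^{1,2}(\Omega)\cap L^\infty(\Omega)$. Let $f:\mathbb{R}^2\to[0,\infty)$ be of the form $$f(\xi_1,\xi_2)=f_1(\xi_1)+f_2(\xi_2),$$ where $f_1,f_2:\mathbb{R}\to[0,\infty)$ are strictly convex functions of class $C^2$ which are of linear growth, i.e. for $i=1,2$ there are constants $a_1,a_3>0$, $a_2,a_4\ge 0$ (possibly depending on $i$) with $a_1|t|-a_2\le f_i(t)\le a_3|t|+a_4$ for all $t\in\mathbb{R}$. Suppose that there exist exponents $\mu_1,\mu_2>1$ and constants $c_i,\bar c_i>0$ such that for $i=1,2$ $$c_i(1+|t|)^{-\mu_i}\le f_i''(t)\le \bar c_i\qquad\text{for all } t\in\mathbb{R}.$$ If $\mu_1<2$, then there exists a generalized minimizer $u\in\mathcal{M}$ such that $$\partial_1u\in L^\chi_{\mathrm{loc}}(\Omega)\qquad\text{for every finite exponent }\chi.$$ The analogous result holds for $n\ge 3$: if $\Omega\subset\mathbb{R}^n$ is a bounded Lipschitz domain, $u_0\in W^{1,2}(\Omega)\cap L^\infty(\Omega)$, $f(\xi_1,\dots,\xi_n)=\sum_{i=1}^nf_i(\xi_i)$, where every $f_i:\mathbb{R}\to[0,\infty)$ is strictly convex, of class $C^2$, of linear growth (i.e. there are constants $a_1,a_3>0$, $a_2,a_4\ge 0$, possibly depending on $i$, with $a_1|t|-a_2\le f_i(t)\le a_3|t|+a_4$ for all $t\in\mathbb{R}$) and satisfies $c_i(1+|t|)^{-\mu_i}\le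 f_i''(t)\le\bar c_i$ for all $t\in\mathbb{R}$ with some $\mu_i>1$ and $c_i,\bar c_i>0$, and if $\mu_1<2$, then there exists $u\in\mathcal{M}$ with $\partial_1u\in L^\chi_{\mathrm{loc}}(\Omega)$ for every finite $\chi$.
   Context: For a bounded Lipschitz domain $\Omega\subset\mathbb{R}^n$, boundary datum $u_0$ and density $f:\mathbb{R}^n\to[0,\infty)$ put $J[w]:=\int_\Omega f(\nabla w)\,dx$ for $w\in u_0+W^{1,1}_0(\Omega)$. A $J$-minimizing sequence is a sequence $(w_k)$ in $u_0+W^{1,1}_0(\Omega)$ with $J[w_k]\to\inf_{u_0+W^{1,1}_0(\Omega)}J$. The set of generalized minimizers is $$\mathcal{M}:=\{v\in L^1(\Omega): v\text{ is an }L^1(\Omega)\text{-cluster point of some }J\text{-minimizing sequence from }u_0+W^{1,1}_0(\Omega)\}.$$ Elements of $\mathcal{M}$ belong to $\mathrm{BV}(\Omega)$; $\partial_1u\in L^\chi_{\mathrm{loc}}(\Omega)$ means that the distributional derivative $\partial_1u$ is represented by a function in $L^\chi_{\mathrm{loc}}(\Omega)$. *)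

theory Defs
  imports "HOL-Analysis.Analysis"
begin

text \<open>
  Elements of function spaces over \<open>\<Omega>\<close> are represented by total functions on the ambient space.
  Membership in the spaces below depends only on the a.e. class of the restriction to \<open>\<Omega>\<close>.
\<close>

section \<open>Domains\<close>

text \<open>
  \<open>Lipschitz_domain\<close>: near each boundary point, \<open>\<Omega>\<close> is the part of a ball strictly above the graph
  of a Lipschitz function \<open>\<gamma>\<close> over the hyperplane orthogonal to some unit vector \<open>\<nu>\<close>. Boundedness
  is a separate assumption.
\<close>

definition Lipschitz_domain :: "(real ^ 'n) set \<Rightarrow> bool" where
  "Lipschitz_domain \<Omega> \<longleftrightarrow>
     open \<Omega> \<and> connected \<Omega> \<and> \<Omega> \<noteq> {} \<and>
     (\<forall>x \<in> frontier \<Omega>. \<exists>r > 0. \<exists>\<nu>. norm \<nu> = 1 \<and>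
        (\<exists>(L::real) (\<gamma>::real ^ 'n \<Rightarrow> real). L-lipschitz_on {y. y \<bullet> \<nu> = 0} \<gamma> \<and>
           \<Omega> \<inter> ball x r = {y \<in> ball x r. \<gamma> (y - (y \<bullet> \<nu>) *\<^sub>R \<nu>) < y \<bullet> \<nu>}))"

section \<open>Lebesgue spaces\<close>

definition Lp :: "real \<Rightarrow> (real ^ 'n) set \<Rightarrow> (real ^ 'n \<Rightarrow> real) set" where
  "Lp p \<Omega> = {u \<in> borel_measurable (lebesgue_on \<Omega>).
               integrable (lebesgue_on \<Omega>) (\<lambda>x. \<bar>u x\<bar> powr p)}"

definition Lp_norm :: "real \<Rightarrow> (real ^ 'n) set \<Rightarrow> (real ^ 'n \<Rightarrow> real) \<Rightarrow> real" where
  "Lp_norm p \<Omega> u = (\<integral>x. \<bar>u x\<bar> powr p \<partial>lebesgue_on \<Omega>) powr (1 / p)"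

definition Linfty :: "(real ^ 'n) set \<Rightarrow> (real ^ 'n \<Rightarrow> real) set" where
  "Linfty \<Omega> = {u \<in> borel_measurable (lebesgue_on \<Omega>).
                \<exists>C. AE x in lebesgue_on \<Omega>. \<bar>u x\<bar> \<le> C}"

definition Lp_loc :: "real \<Rightarrow> (real ^ 'n) set \<Rightarrow> (real ^ 'n \<Rightarrow> real) set" where
  "Lp_loc p \<Omega> = {u. \<forall>K. compact K \<and> K \<subseteq> \<Omega> \<longrightarrow> u \<in> Lp p K}"

section \<open>Weak derivatives and Sobolev spaces\<close>

definition partial_deriv :: "'n \<Rightarrow> (real ^ 'n \<Rightarrow> real) \<Rightarrow> real ^ 'n \<Rightarrow> real" where
  "partial_deriv i \<phi> x = frechet_derivative \<phi> (at x) (axis i 1)"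

text \<open>
  A function is of class \<open>C\<^sup>\<infinity>\<close> iff all its iterated partial derivatives (the list collects
  the indices, the empty list giving the function itself) are everywhere totally differentiable.
\<close>

definition smooth :: "(real ^ 'n \<Rightarrow> real) \<Rightarrow> bool" where
  "smooth \<phi> \<longleftrightarrow> (\<forall>is x. foldr partial_deriv is \<phi> differentiable (at x))"

definition test_function :: "(real ^ 'n) set \<Rightarrow> (real ^ 'n \<Rightarrow> real) \<Rightarrow> bool" where
  "test_function \<Omega> \<phi> \<longleftrightarrow>
     smooth \<phi> \<and> compact (closure {x. \<phi> x \<noteq> 0}) \<and> closure {x. \<phi> x \<noteq> 0} \<subseteq> \<Omega>"

text \<open>The distributional derivative \<open>\<partial>\<^sub>i u\<close> is represented by the function \<open>g\<close>:\<close>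

definition has_weak_partial ::
  "(real ^ 'n) set \<Rightarrow> 'n \<Rightarrow> (real ^ 'n \<Rightarrow> real) \<Rightarrow> (real ^ 'n \<Rightarrow> real) \<Rightarrow> bool" where
  "has_weak_partial \<Omega> i u g \<longleftrightarrow>
     u \<in> Lp_loc 1 \<Omega> \<and> g \<in> Lp_loc 1 \<Omega> \<and>
     (\<forall>\<phi>. test_function \<Omega> \<phi> \<longrightarrow>
        (\<integral>x. u x * partial_deriv i \<phi> x \<partial>lebesgue_on \<Omega>)
          = - (\<integral>x. g x * \<phi> x \<partial>lebesgue_on \<Omega>))"

text \<open>A representative of the weak gradient (unique a.e., arbitrary if there is none):\<close>

definition weak_gradient ::
  "(real ^ 'n) set \<Rightarrow> (real ^ 'n \<Rightarrow> real) \<Rightarrow> real ^ 'n \<Rightarrow> real ^ 'n" where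
  "weak_gradient \<Omega> u x = (\<chi> i. (SOME g. has_weak_partial \<Omega> i u g) x)"

definition Sobolev :: "real \<Rightarrow> (real ^ 'n) set \<Rightarrow> (real ^ 'n \<Rightarrow> real) set" where
  "Sobolev p \<Omega> = {u \<in> Lp p \<Omega>. \<forall>i. \<exists>g \<in> Lp p \<Omega>. has_weak_partial \<Omega> i u g}"

text \<open>\<open>W\<^sup>1\<^sup>,\<^sup>p\<^sub>0(\<Omega>)\<close>, the closure of the test functions in the Sobolev norm:\<close>

definition Sobolev0 :: "real \<Rightarrow> (real ^ 'n) set \<Rightarrow> (real ^ 'n \<Rightarrow> real) set" where
  "Sobolev0 p \<Omega> = {u \<in> Sobolev p \<Omega>.
     \<exists>\<phi>. (\<forall>k::nat. test_function \<Omega> (\<phi> k)) \<and>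
         (\<lambda>k. Lp_norm p \<Omega> (\<lambda>x. \<phi> k x - u x)) \<longlonglongrightarrow> 0 \<and>
         (\<forall>i. (\<lambda>k. Lp_norm p \<Omega> (\<lambda>x. partial_deriv i (\<phi> k) x - weak_gradient \<Omega> u x $ i))
                \<longlonglongrightarrow> 0)}"

section \<open>The variational problem\<close>

definition admissible ::
  "(real ^ 'n) set \<Rightarrow> (real ^ 'n \<Rightarrow> real) \<Rightarrow> (real ^ 'n \<Rightarrow> real) set" where
  "admissible \<Omega> u0 = {w. (\<lambda>x. w x - u0 x) \<in> Sobolev0 1 \<Omega>}"

text \<open>
  The integral is a real number because only continuous densities of linear growth are
  considered: \<open>f (\<nabla>w)\<close> is then integrable for \<open>w\<close> in \<open>W\<^sup>1\<^sup>,\<^sup>1(\<Omega>)\<close> when \<open>\<Omega>\<close> is bounded.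
\<close>

definition energy ::
  "(real ^ 'n \<Rightarrow> real) \<Rightarrow> (real ^ 'n) set \<Rightarrow> (real ^ 'n \<Rightarrow> real) \<Rightarrow> real" where
  "energy f \<Omega> w = (\<integral>x. f (weak_gradient \<Omega> w x) \<partial>lebesgue_on \<Omega>)"

definition minimizing_sequence ::
  "(real ^ 'n \<Rightarrow> real) \<Rightarrow> (real ^ 'n) set \<Rightarrow> (real ^ 'n \<Rightarrow> real)
     \<Rightarrow> (nat \<Rightarrow> real ^ 'n \<Rightarrow> real) \<Rightarrow> bool" where
  "minimizing_sequence f \<Omega> u0 w \<longleftrightarrow>
     (\<forall>k. w k \<in> admissible \<Omega> u0) \<and>
     (\<lambda>k. energy f \<Omega> (w k)) \<longlonglongrightarrow> (INF v \<in> admissible \<Omega> u0. energy f \<Omega> v)"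

definition generalized_minimizers ::
  "(real ^ 'n \<Rightarrow> real) \<Rightarrow> (real ^ 'n) set \<Rightarrow> (real ^ 'n \<Rightarrow> real) \<Rightarrow> (real ^ 'n \<Rightarrow> real) set" where
  "generalized_minimizers f \<Omega> u0 = {v \<in> Lp 1 \<Omega>.
     \<exists>w. minimizing_sequence f \<Omega> u0 w \<and>
         (\<forall>e > 0. \<exists>\<^sub>F k in sequentially. Lp_norm 1 \<Omega> (\<lambda>x. w k x - v x) < e)}"

section \<open>Hypotheses on the density\<close>

definition strictly_convex :: "(real \<Rightarrow> real) \<Rightarrow> bool" where
  "strictly_convex g \<longleftrightarrow>
     (\<forall>s t \<theta>. s \<noteq> t \<and> 0 < \<theta> \<and> \<theta> < 1 \<longrightarrow>
        g ((1 - \<theta>) * s + \<theta> * t) < (1 - \<theta>) * g s + \<theta> * g t)"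

definition class_C2 :: "(real \<Rightarrow> real) \<Rightarrow> bool" where
  "class_C2 g \<longleftrightarrow>
     (\<forall>t. g differentiable (at t)) \<and> (\<forall>t. deriv g differentiable (at t)) \<and>
     continuous_on UNIV (deriv (deriv g))"

definition linear_growth :: "(real \<Rightarrow> real) \<Rightarrow> bool" where
  "linear_growth g \<longleftrightarrow>
     (\<exists>a1 a2 a3 a4. a1 > 0 \<and> a3 > 0 \<and> a2 \<ge> 0 \<and> a4 \<ge> 0 \<and>
        (\<forall>t. a1 * \<bar>t\<bar> - a2 \<le> g t \<and> g t \<le> a3 * \<bar>t\<bar> + a4))"

end

theory Submission
  imports Defs
begin

text \<open>
  Let \<open>F\<^sub>i\<close> be \<open>f\<^sub>i\<close> minus its tangent at \<open>0\<close>; this changes the energy by a constant only. The problem is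
  discretised: on a lattice of step \<open>h\<close> a minimiser \<open>v\<close> of the discrete energy, truncated at the bound of \<open>u\<^sub>0\<close>,
  that agrees with samples of a given competitor near the boundary satisfies a difference Euler equation. Testing
  its \<open>\<partial>\<^sub>1\<close>-difference with \<open>\<eta>\<^sup>2\<^sup>k D\<^sub>1v (1 + |D\<^sub>1v|\<^sup>2)\<^sup>N\<close> decouples the first direction because the energy splits,
  and a summation by parts that uses \<open>|v| \<le> B\<close> raises the controlled power of \<open>1 + |D\<^sub>1v|\<^sup>2\<close> by nearly \<open>1 - \<mu> / 2 > 0\<close>: all local
  \<open>L\<^sup>q\<close> norms of \<open>D\<^sub>1v\<close> are bounded independently of \<open>h\<close>. Smooth kernels transport \<open>v\<close> back to a
  competitor \<open>u\<^sub>0 + \<psi>\<close> with a test function \<open>\<psi>\<close> and, by Jensen's inequality, with no more energy than before up to a small error.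

  The pairs \<open>(\<psi>, G)\<close> with almost minimal energy, \<open>G\<close> locally close to \<open>\<partial>\<^sub>1(u\<^sub>0 + \<psi>)\<close> in \<open>L\<^sup>1\<close>, and \<open>G\<close> obeying these bounds are
  closed under midpoints. Hence choosing them with almost minimal weighted \<open>L\<^sup>2\<close> norm makes them a Cauchy sequence, which
  replaces weak compactness; Fatou's lemma gives \<open>L\<^sup>q\<close> bounds for the limit of \<open>G\<close>, for every \<open>q\<close>.
\<close>

section \<open>Smooth functions and partitions of unity\<close>

text \<open>A lattice minimiser exists by compactness, and its Euler equation may be differenced and
  tested with any function, so no second derivatives have to be established. The price is the chain
  rule: difference quotients may differ greatly between the ends of an edge, so edge estimates use
  the larger of the two values of \<open>Gam\<close>. The lower ellipticity bound is needed in the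
  first direction alone; in the others the increment of \<open>F' i\<close> itself serves as weight,
  and only its Lipschitz constant enters the error. Testing with power N makes the weight
  \<open>Gam\<close> to the power N - \<mu>/2 available. Young's inequality for an increment of
  power \<rho> = N + \<tau> then leaves 2 \<rho> - N + \<mu>/2, and this is N + 1 exactly if 4
  \<tau> = 2 - \<mu>. So sums of power N + 1 control sums of power N + 1 + \<tau>, and a high power
  of the cut-off lets the former be absorbed by the latter: every exponent is reached in one step,
  without a starting bound. Both passages between lattice and continuum have to respect Jensen's
  inequality, hence kernels whose derivatives are differences of other nonnegative kernels of unit
  mass.\<close>

coinductive smooth1 :: "(real \<Rightarrow> real) \<Rightarrow> bool" where
  smooth1I: "(\<And>t. (f has_real_derivative f' t) (at t)) \<Longrightarrow> smooth1 f' \<Longrightarrow> smooth1 f"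

lemma smooth1_deriv:
  assumes "smooth1 f"
  shows "(f has_real_derivative deriv f t) (at t)" "smooth1 (deriv f)"
proof -
  from assms obtain f' where f': "\<And>t. (f has_real_derivative f' t) (at t)" "smooth1 f'"
    by (metis smooth1.cases)
  then have "deriv f = f'"
    by (intro ext DERIV_imp_deriv)
  with f' show "(f has_real_derivative deriv f t) (at t)" "smooth1 (deriv f)"
    by auto
qed

lemma smooth1_isCont: "smooth1 f \<Longrightarrow> isCont f t"
  using DERIV_isCont smooth1_deriv(1) by blast

lemma smooth1_add:
  assumes "smooth1 f" "smooth1 g"
  shows "smooth1 (\<lambda>t. f t + g t)"
  using assms
proof (coinduction arbitrary: f g)
  case smooth1
  then show ?case
    by (intro exI[of _ "\<lambda>t. f t + g t"] exI[of _ "\<lambda>t. deriv f t + deriv g t"] conjI refl allI disjI1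
          DERIV_add smooth1_deriv exI[of _ "deriv f"] exI[of _ "deriv g"])
qed

lemma smooth1_affine:
  assumes "smooth1 f"
  shows "smooth1 (\<lambda>t. c * f (a * t + b))"
  using assms
proof (coinduction arbitrary: f c)
  case smooth1
  have "((\<lambda>t. c * f (a * t + b)) has_real_derivative (c * a) * deriv f (a * t + b)) (at t)" for t
    by (rule derivative_eq_intros DERIV_chain2[OF smooth1_deriv(1)[OF smooth1]] refl | simp)+
  then show ?case
    by (intro exI[of _ "\<lambda>t. c * f (a * t + b)"] exI[of _ "\<lambda>t. (c * a) * deriv f (a * t + b)"]
        exI[of _ "deriv f"] exI[of _ "c * a"] conjI refl allI disjI1 smooth1_deriv(2)[OF smooth1])
qed

lemma smooth1_diff:
  assumes "smooth1 f" "smooth1 g"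
  shows "smooth1 (\<lambda>t. f t - g t)"
  using smooth1_add[OF assms(1) smooth1_affine[OF assms(2), of "-1" 1 0]] by simp

text \<open>Products alone are not closed under differentiation, finite sums of products are; this
  class is the invariant for the coinduction in \<open>smooth1_mult\<close>.\<close>

inductive products1 :: "(real \<Rightarrow> real) \<Rightarrow> bool" where
  products1_mult: "smooth1 f \<Longrightarrow> smooth1 g \<Longrightarrow> products1 (\<lambda>t. f t * g t)"
| products1_add: "products1 f \<Longrightarrow> products1 g \<Longrightarrow> products1 (\<lambda>t. f t + g t)"

lemma products1_deriv:
  assumes "products1 f"
  shows "\<exists>f'. (\<forall>t. (f has_real_derivative f' t) (at t)) \<and> products1 f'"
  using assms
proof induction
  case (products1_mult f g)
  have "((\<lambda>t. f t * g t) has_real_derivative deriv f t * g t + f t * deriv g t) (at t)" for t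
    using DERIV_mult[OF smooth1_deriv(1)[OF products1_mult(1)] smooth1_deriv(1)[OF products1_mult(2)], of t]
    by (simp add: algebra_simps)
  moreover have "products1 (\<lambda>t. deriv f t * g t + f t * deriv g t)"
    using products1_mult by (intro products1.intros smooth1_deriv)
  ultimately show ?case
    by (intro exI[of _ "\<lambda>t. deriv f t * g t + f t * deriv g t"]) auto
next
  case (products1_add f g)
  then obtain f' g' where "\<And>t. (f has_real_derivative f' t) (at t)" "products1 f'"
    "\<And>t. (g has_real_derivative g' t) (at t)" "products1 g'" by auto
  then show ?case
    by (intro exI[of _ "\<lambda>t. f' t + g' t"]) (auto intro: DERIV_add products1.products1_add)
qed

lemma smooth1_mult:
  assumes "smooth1 f" "smooth1 g"
  shows "smooth1 (\<lambda>t. f t * g t)"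
proof -
  have "products1 h \<Longrightarrow> smooth1 h" for h
  proof (coinduction arbitrary: h)
    case smooth1
    then show ?case using products1_deriv by blast
  qed
  with assms show ?thesis by (blast intro: products1_mult)
qed

text \<open>Polynomials in 1/t times exp(-1/t), extended by zero. The family is closed under
  differentiation, so its smoothness follows by coinduction over the polynomial.\<close>

definition flat :: "real poly \<Rightarrow> real \<Rightarrow> real" where
  "flat p t = (if t \<le> 0 then 0 else poly p (1/t) * exp (- (1/t)))"

lemma poly_exp_neg_tendsto_0:
  fixes p :: "real poly"
  shows "((\<lambda>x. poly p x * exp (- x)) \<longlongrightarrow> 0) at_top"
proof -
  have "((\<lambda>x. \<Sum>i\<le>degree p. coeff p i * (x ^ i / exp x)) \<longlongrightarrow> (\<Sum>i\<le>degree p. coeff p i * 0)) at_top"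
    by (intro tendsto_sum tendsto_mult tendsto_const tendsto_power_div_exp_0)
  moreover have "(\<lambda>x. poly p x * exp (- x)) = (\<lambda>x. \<Sum>i\<le>degree p. coeff p i * (x ^ i / exp x))"
    by (auto simp: poly_altdef sum_distrib_right exp_minus divide_inverse mult.assoc)
  ultimately show ?thesis by simp
qed

text \<open>With s = 1/t, the derivative of p(s) exp(-s) in t is s^2 (p - p')(s) exp(-s). At 0 the
  one-sided difference quotients tend to 0 because the exponential beats every polynomial.\<close>

lemma flat_has_derivative:
  "(flat p has_real_derivative flat (monom 1 2 * (p - pderiv p)) t) (at t)"
proof -
  consider "t > 0" | "t < 0" | "t = 0" by linarith
  then show ?thesis
  proof cases
    case 1
    have "((\<lambda>t. poly p (1/t) * exp (- (1/t))) has_real_derivative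
        flat (monom 1 2 * (p - pderiv p)) t) (at t)"
      using 1 unfolding flat_def
      by (auto intro!: derivative_eq_intros DERIV_chain2[OF poly_DERIV] simp: poly_monom field_simps power2_eq_square)
    then show ?thesis
      by (rule DERIV_cong_ev[THEN iffD1, rotated 3])
        (use 1 in \<open>auto simp: flat_def eventually_nhds intro!: exI[of _ "{0<..}"]\<close>)
  next
    case 2
    have "((\<lambda>t. 0) has_real_derivative 0) (at t)" by simp
    then have "(flat p has_real_derivative 0) (at t)"
      by (rule DERIV_cong_ev[THEN iffD1, rotated 3])
        (use 2 in \<open>auto simp: flat_def eventually_nhds intro!: exI[of _ "{..<0}"]\<close>)
    with 2 show ?thesis by (simp add: flat_def)
  next
    case 3
    have right: "((\<lambda>h. flat p h / h) \<longlongrightarrow> 0) (at_right 0)"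
    proof -
      have "((\<lambda>x. poly (monom 1 1 * p) x * exp (- x)) \<longlongrightarrow> 0) at_top"
        by (rule poly_exp_neg_tendsto_0)
      then have "((\<lambda>h. poly (monom 1 1 * p) (inverse h) * exp (- inverse h)) \<longlongrightarrow> 0) (at_right 0)"
        using filterlim_compose filterlim_inverse_at_top_right by blast
      then show ?thesis
        by (rule Lim_transform_eventually)
          (auto simp: flat_def eventually_at_right_field poly_monom field_simps intro!: exI[of _ 1])
    qed
    have left: "((\<lambda>h. flat p h / h) \<longlongrightarrow> 0) (at_left 0)"
      by (rule Lim_transform_eventually[OF tendsto_const])
        (auto simp: flat_def eventually_at_left_field intro!: exI[of _ "-1"])
    have "((\<lambda>h. (flat p (0 + h) - flat p 0) / h) \<longlongrightarrow> 0) (at 0)"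
      using filterlim_split_at[OF left right] by (simp add: flat_def)
    then show ?thesis
      using 3 by (simp add: DERIV_def flat_def)
  qed
qed

lemma smooth1_flat: "smooth1 (flat p)"
proof (coinduction arbitrary: p)
  case smooth1
  show ?case using flat_has_derivative by blast
qed

section \<open>Smooth steps and one-dimensional kernels whose integer translates sum to one\<close>

definition smooth_step :: "(real \<Rightarrow> real) \<Rightarrow> bool" where
  "smooth_step T \<longleftrightarrow> smooth1 T \<and> mono T \<and> (\<forall>t\<le>-1. T t = 0) \<and> (\<forall>t\<ge>1. T t = 1)"

lemma smooth1_antiderivative:
  assumes "smooth1 f"
  obtains F where "\<And>t. (F has_real_derivative f t) (at t)" "smooth1 F" "F a = 0"
proof -
  have "\<exists>F. \<forall>t. (F has_real_derivative f t) (at t)"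
  proof -
    have "\<exists>F. \<forall>x::real. (F has_vector_derivative f x) (at x)"
    proof -
      show ?thesis
        using einterval_antiderivative[of "-\<infinity>" "\<infinity>" f] smooth1_isCont[OF assms] by auto
    qed
    then show ?thesis by (simp add: has_real_derivative_iff_has_vector_derivative)
  qed
  then obtain F where F: "\<And>t. (F has_real_derivative f t) (at t)" by blast
  have G: "((\<lambda>t. F t - F a) has_real_derivative f t) (at t)" for t
    using DERIV_diff[OF F DERIV_const[of "F a"], of t] by simp
  show thesis
    by (rule that[of "\<lambda>t. F t - F a"]) (use G assms in \<open>auto intro: smooth1I\<close>)
qed

lemma DERIV_const_interval:
  fixes F :: "real \<Rightarrow> real"
  assumes "\<And>t. (F has_real_derivative f t) (at t)" "\<And>t. t \<in> {a<..<b} \<Longrightarrow> f t = c" "a \<le> b"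
  shows "F b = F a + c * (b - a)"
proof (cases "a = b")
  case False
  then have "a < b" using assms(3) by simp
  then obtain z where "a < z" "z < b" "F b - F a = (b - a) * f z"
    using MVT2[of a b F f] assms(1) by blast
  then show ?thesis using assms(2)[of z] by (simp add: algebra_simps)
qed simp

text \<open>The step is the normalised primitive of exp(-1/t) exp(-1/(1-t)) on the unit interval.
  Vanishing already for \<open>t \<le> 0\<close>, not just for \<open>t \<le> -1\<close>, leaves
  room for the averaging over a unit interval in \<open>kernel1_pair_exists\<close>.\<close>

lemma smooth_step_exists: "\<exists>T. smooth_step T \<and> (\<forall>t\<le>0. T t = 0)"
proof -
  define e where "e = flat 1"
  have e: "e t = (if t \<le> 0 then 0 else exp (- (1/t)))" for t by (simp add: e_def flat_def)
  define b where "b t = e t * e (1 - t)" for t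
  have "smooth1 (\<lambda>t. e (1 - t))"
    using smooth1_affine[OF smooth1_flat[of 1], of 1 "-1" 1] by (simp add: e_def)
  then have sb: "smooth1 b"
    unfolding b_def e_def by (intro smooth1_mult smooth1_flat)
  have b0: "b t = 0" if "t \<le> 0 \<or> t \<ge> 1" for t using that by (auto simp: b_def e)
  have bp: "b t > 0" if "0 < t" "t < 1" for t using that by (auto simp: b_def e)
  have bn: "b t \<ge> 0" for t using b0[of t] bp[of t] by (metis less_eq_real_def not_le)
  obtain B where B: "\<And>t. (B has_real_derivative b t) (at t)" "smooth1 B" "B 0 = 0"
    using smooth1_antiderivative[OF sb] by blast
  have "\<exists>z. 0 < z \<and> z < 1 \<and> B 1 - B 0 = (1 - 0) * b z"
    by (rule MVT2) (use B in auto)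
  then have B1: "B 1 > 0" using bp B(3) by auto
  have mono: "mono B"
    by (rule monoI, rule DERIV_nonneg_imp_nondecreasing) (use B bn in auto)
  have lo: "B t = 0" if "t \<le> 0" for t
    using DERIV_const_interval[of B b t 0 0] B b0 that by auto
  have hi: "B t = B 1" if "t \<ge> 1" for t
    using DERIV_const_interval[of B b 1 t 0] B b0 that by auto
  have "smooth1 (\<lambda>t. (1 / B 1) * B (1 * t + 0))" by (rule smooth1_affine) fact
  then have "smooth_step (\<lambda>t. B t / B 1) \<and> (\<forall>t\<le>0. B t / B 1 = 0)"
    unfolding smooth_step_def
  proof (intro conjI allI impI monoI)
    show "B t / B 1 = 1" if "t \<ge> 1" for t using hi[OF that] B1 by simp
  qed (use B1 monoD[OF mono] lo in \<open>simp_all add: divide_right_mono\<close>)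
  then show ?thesis by blast
qed

text \<open>The sum over all integers is replaced by sums over arbitrary finite sets that contain
  every relevant translate, so that infinite sums never occur.\<close>

definition kernel1 :: "(real \<Rightarrow> real) \<Rightarrow> bool" where
  "kernel1 k \<longleftrightarrow> smooth1 k \<and> (\<forall>t. 0 \<le> k t) \<and> (\<forall>t. k t \<noteq> 0 \<longrightarrow> \<bar>t\<bar> \<le> 3) \<and>
     (\<forall>t S. finite S \<and> (\<forall>z. k (t - real_of_int z) \<noteq> 0 \<longrightarrow> z \<in> S) \<longrightarrow> (\<Sum>z\<in>S. k (t - real_of_int z)) = 1)"

lemma kernel1D:
  assumes "kernel1 k"
  shows "smooth1 k" "0 \<le> k t" "k t \<noteq> 0 \<Longrightarrow> \<bar>t\<bar> \<le> 3"
    "finite S \<Longrightarrow> (\<And>z. k (t - real_of_int z) \<noteq> 0 \<Longrightarrow> z \<in> S) \<Longrightarrow> (\<Sum>z\<in>S. k (t - real_of_int z)) = 1"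
  using assms unfolding kernel1_def by blast+

lemma sum_telescope_int:
  fixes T :: "int \<Rightarrow> real"
  shows "(\<Sum>z\<in>{a..<a + int n}. T z - T (z + 1)) = T a - T (a + int n)"
proof (induction n)
  case (Suc n)
  have "{a..<a + int (Suc n)} = insert (a + int n) {a..<a + int n}" by auto
  with Suc show ?case by (simp add: algebra_simps)
qed simp

text \<open>The sum over integer translates telescopes between a point where the step is 1 and one
  where it is 0. The shift \<open>c = 1\<close> provides the kernel k(t - 1), whose derivative is a
  backward difference.\<close>

lemma kernel1_step_difference:
  assumes T: "smooth_step T" and c: "c \<in> {0, 1}"
  shows "kernel1 (\<lambda>t. T (t + 1 - c) - T (t - c))"
proof -
  have sT: "smooth1 T" "mono T" and lo: "\<And>t. t \<le> -1 \<Longrightarrow> T t = 0" and hi: "\<And>t. t \<ge> 1 \<Longrightarrow> T t = 1"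
    using T by (auto simp: smooth_step_def)
  define k where "k t = T (t + 1 - c) - T (t - c)" for t
  have "smooth1 k"
    unfolding k_def using smooth1_diff[OF smooth1_affine[OF sT(1), of 1 1 "1 - c"] smooth1_affine[OF sT(1), of 1 1 "- c"]]
    by (simp add: algebra_simps)
  moreover have "0 \<le> k t" for t
    unfolding k_def using monoD[OF sT(2), of "t - c" "t + 1 - c"] by simp
  moreover have supp: "\<bar>t\<bar> \<le> 3" if "k t \<noteq> 0" for t
  proof (rule ccontr)
    assume "\<not> \<bar>t\<bar> \<le> 3"
    then consider "t > 3" | "t < -3" by linarith
    then have "k t = 0" using c by cases (auto simp: k_def lo hi)
    with that show False by simp
  qed
  moreover have "(\<Sum>z\<in>S. k (t - real_of_int z)) = 1"
    if S: "finite S" "\<And>z. k (t - real_of_int z) \<noteq> 0 \<Longrightarrow> z \<in> S" for t S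
  proof -
    \<comment> \<open>Eleven consecutive integers starting at this one contain all translates whose
      support (within distance 3) meets \<open>t\<close>, and their two ends lie beyond the rise of
      the step.\<close>
    define a where "a = \<lfloor>t\<rfloor> - 5"
    define A where "A = {a..<a + int 11}"
    have fl: "real_of_int \<lfloor>t\<rfloor> \<le> t" "t < real_of_int \<lfloor>t\<rfloor> + 1" by linarith+
    have A: "z \<in> A" if "k (t - real_of_int z) \<noteq> 0" for z
    proof -
      have "\<bar>t - real_of_int z\<bar> \<le> 3" using supp that by blast
      then show ?thesis unfolding A_def a_def using fl by auto linarith+
    qed
    have "(\<Sum>z\<in>S. k (t - real_of_int z)) = (\<Sum>z\<in>S \<union> A. k (t - real_of_int z))"
      using S by (intro sum.mono_neutral_left) (auto simp: A_def)
    also have "\<dots> = (\<Sum>z\<in>A. k (t - real_of_int z))"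
      using S(1) A by (intro sum.mono_neutral_right) (simp add: A_def, simp, blast)
    also have "\<dots> = (\<Sum>z\<in>A. T (t + 1 - c - real_of_int z) - T (t + 1 - c - real_of_int (z + 1)))"
      by (intro sum.cong) (auto simp: k_def algebra_simps)
    also have "\<dots> = T (t + 1 - c - real_of_int a) - T (t + 1 - c - real_of_int (a + int 11))"
      unfolding A_def by (rule sum_telescope_int)
    also have "\<dots> = 1"
    proof -
      have "T (t + 1 - c - real_of_int (a + int 11)) = 0"
      proof (rule lo)
        have "0 \<le> c" using c by auto
        moreover have "real_of_int (a + int 11) = real_of_int \<lfloor>t\<rfloor> + 6" by (simp add: a_def)
        ultimately show "t + 1 - c - real_of_int (a + int 11) \<le> -1" using fl by linarith
      qed
      moreover have "T (t + 1 - c - real_of_int a) = 1"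
        by (rule hi) (use fl c in \<open>auto simp: a_def\<close>)
      ultimately show ?thesis by simp
    qed
    finally show ?thesis .
  qed
  ultimately show ?thesis unfolding kernel1_def k_def by blast
qed

text \<open>As for B-splines, averaging over a unit interval turns differences into derivatives:
  \<open>T\<close> is the average of the step \<sigma> over [t, t+1], so T' = s, and k = T(t+1) -
  T(t) is the same average of \<open>s\<close>. Hence k' is the forward difference of
  \<open>s\<close>, again a kernel.\<close>

lemma kernel1_pair_exists:
  "\<exists>s k. kernel1 s \<and> kernel1 k \<and> kernel1 (\<lambda>t. k (t - 1)) \<and>
     (\<forall>t. (k has_real_derivative s (t + 1) - s t) (at t))"
proof -
  obtain \<sigma> where \<sigma>: "smooth_step \<sigma>" "\<And>t. t \<le> 0 \<Longrightarrow> \<sigma> t = 0" using smooth_step_exists by blast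
  then have sm: "smooth1 \<sigma>" and hi: "\<And>t. t \<ge> 1 \<Longrightarrow> \<sigma> t = 1" by (auto simp: smooth_step_def)
  define s where "s t = \<sigma> (t + 1) - \<sigma> t" for t
  have s: "kernel1 s"
    using kernel1_step_difference[OF \<sigma>(1), of 0] by (simp add: s_def[abs_def])
  obtain S where S: "\<And>t. (S has_real_derivative \<sigma> t) (at t)" "smooth1 S" "S 0 = 0"
    using smooth1_antiderivative[OF sm] by blast
  define T where "T t = S (t + 1) - S t" for t
  have shift: "((\<lambda>t. G (t + 1)) has_real_derivative g (t + 1)) (at t)"
    if "\<And>t. (G has_real_derivative g t) (at t)" for G g :: "real \<Rightarrow> real" and t
    using that[of "t + 1"] by (simp add: DERIV_shift)
  have dT: "(T has_real_derivative s t) (at t)" for t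
    unfolding T_def s_def by (intro DERIV_diff S shift)
  have "smooth1 T" using dT kernel1D(1)[OF s] by (rule smooth1I)
  moreover have "mono T"
    by (rule monoI, rule DERIV_nonneg_imp_nondecreasing) (use dT kernel1D(2)[OF s] in auto)
  \<comment> \<open>The primitive of \<sigma> is zero left of 0 and has slope one right of 1;
    therefore its increment over a unit interval is 0 left of -1 and 1 right of 1.\<close>
  moreover have S0: "S t = 0" if "t \<le> 0" for t
    using DERIV_const_interval[of S \<sigma> t 0 0] S \<sigma>(2) that by auto
  have S1: "S t = S 1 + (t - 1)" if "t \<ge> 1" for t
    using DERIV_const_interval[of S \<sigma> 1 t 1] S hi that by auto
  have "T t = 0" if "t \<le> -1" for t using that by (simp add: T_def S0)
  moreover have "T t = 1" if "t \<ge> 1" for t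
    using S1[of t] S1[of "t+1"] that by (simp add: T_def)
  ultimately have T: "smooth_step T" by (simp add: smooth_step_def)
  define k where "k t = T (t + 1) - T t" for t
  have "kernel1 k" "kernel1 (\<lambda>t. k (t - 1))"
    using kernel1_step_difference[OF T, of 0] kernel1_step_difference[OF T, of 1]
    by (simp_all add: k_def[abs_def])
  moreover have "(k has_real_derivative s (t + 1) - s t) (at t)" for t
    unfolding k_def by (intro DERIV_diff dT shift)
  ultimately show ?thesis using s by blast
qed

section \<open>Smooth functions of several variables\<close>

lemma partial_deriv_eq:
  "(f has_derivative f') (at x) \<Longrightarrow> partial_deriv i f x = f' (axis i 1)"
  unfolding partial_deriv_def by (simp add: frechet_derivative_at[symmetric])

text \<open>Replaces the lists of indices in \<open>smooth\<close> by an invariant class, so that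
  closure properties need one derivative only.\<close>

lemma smooth_coinduct:
  assumes "X f"
    and "\<And>f x. X f \<Longrightarrow> f differentiable (at x)"
    and "\<And>f i. X f \<Longrightarrow> X (partial_deriv i f)"
  shows "smooth f"
proof -
  have "X (foldr partial_deriv is f)" for "is"
    by (induction "is") (use assms in auto)
  then show ?thesis unfolding smooth_def using assms(2) by blast
qed

lemma smooth_differentiable: "smooth f \<Longrightarrow> f differentiable (at x)"
  unfolding smooth_def by (metis foldr.simps(1) id_apply)

lemma smooth_partial_deriv: "smooth f \<Longrightarrow> smooth (partial_deriv i f)"
  unfolding smooth_def
proof (intro allI)
  fix "is" x assume "\<forall>is x. foldr partial_deriv is f differentiable at x"
  then have "foldr partial_deriv (is @ [i]) f differentiable at x" by blast
  then show "foldr partial_deriv is (partial_deriv i f) differentiable at x" by simp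
qed

lemma smooth_continuous_on: "smooth f \<Longrightarrow> continuous_on A f"
  by (meson continuous_at_imp_continuous_on differentiable_imp_continuous_within smooth_differentiable)

lemma smooth_has_derivative:
  "smooth f \<Longrightarrow> (f has_derivative frechet_derivative f (at x)) (at x)"
  using frechet_derivative_works smooth_differentiable by blast

lemma partial_deriv_add:
  fixes f g :: "real ^ 'n \<Rightarrow> real"
  assumes "f differentiable (at x)" "g differentiable (at x)"
  shows "partial_deriv i (\<lambda>x. f x + g x) x = partial_deriv i f x + partial_deriv i g x"
proof -
  have "((\<lambda>x. f x + g x) has_derivative (\<lambda>y. frechet_derivative f (at x) y + frechet_derivative g (at x) y)) (at x)"
    using assms by (intro has_derivative_add) (auto simp: frechet_derivative_works)
  then show ?thesis unfolding partial_deriv_def by (simp add: frechet_derivative_at[symmetric])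
qed

lemma partial_deriv_mult:
  assumes "f differentiable (at x)" "g differentiable (at x)"
  shows "partial_deriv i (\<lambda>x. f x * g x) x = f x * partial_deriv i g x + partial_deriv i f x * g x"
proof -
  have "((\<lambda>x. f x * g x) has_derivative (\<lambda>y. f x * frechet_derivative g (at x) y + frechet_derivative f (at x) y * g x)) (at x)"
    using assms by (intro has_derivative_mult) (auto simp: frechet_derivative_works)
  then show ?thesis unfolding partial_deriv_def by (simp add: frechet_derivative_at[symmetric])
qed

inductive products :: "(real ^ 'n \<Rightarrow> real) \<Rightarrow> bool" where
  products_mult: "smooth f \<Longrightarrow> smooth g \<Longrightarrow> products (\<lambda>x. f x * g x)"
| products_add: "products f \<Longrightarrow> products g \<Longrightarrow> products (\<lambda>x. f x + g x)"

lemma products_smooth: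
  assumes "products f" shows "smooth f"
proof (rule smooth_coinduct[of products])
  show diff: "g differentiable (at x)" if "products g" for g :: "real ^ 'n \<Rightarrow> real" and x
    using that by induction (auto intro!: differentiable_mult differentiable_add intro: smooth_differentiable)
  show "products (partial_deriv i g)" if "products g" for g :: "real ^ 'n \<Rightarrow> real" and i
    using that
  proof induction
    case (products_mult f g)
    then have "partial_deriv i (\<lambda>x. f x * g x) = (\<lambda>x. f x * partial_deriv i g x + partial_deriv i f x * g x)"
      by (intro ext partial_deriv_mult smooth_differentiable)
    then show ?case
      by (simp add: products.products_add products.products_mult smooth_partial_deriv products_mult)
  next
    case (products_add f g)
    then have "partial_deriv i (\<lambda>x. f x + g x) = (\<lambda>x. partial_deriv i f x + partial_deriv i g x)"
      by (intro ext partial_deriv_add diff)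
    with products_add show ?case by (auto intro: products.intros)
  qed
qed fact

lemma smooth_mult: "smooth f \<Longrightarrow> smooth g \<Longrightarrow> smooth (\<lambda>x. f x * g x)"
  by (rule products_smooth[OF products_mult])

lemma partial_deriv_const [simp]: "partial_deriv i (\<lambda>_. c) x = 0"
  using partial_deriv_eq[of "\<lambda>_. c" "\<lambda>_. 0" x i] by simp

lemma smooth_const: "smooth (\<lambda>_. c)"
proof (rule smooth_coinduct[of "\<lambda>f. \<exists>c. f = (\<lambda>_. c)"])
  show "\<exists>d. partial_deriv i g = (\<lambda>_. d)" if "\<exists>c. g = (\<lambda>_. c)" for g :: "real ^ 'n \<Rightarrow> real" and i
  proof -
    from that obtain c where "g = (\<lambda>_. c)" by blast
    then have "partial_deriv i g = (\<lambda>_. 0)" using partial_deriv_const by blast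
    then show ?thesis by blast
  qed
qed auto

lemma smooth_cmult: "smooth f \<Longrightarrow> smooth (\<lambda>x. c * f x)"
  using smooth_mult[OF smooth_const] by blast

lemma smooth_add: 
  assumes "smooth f" "smooth g" shows "smooth (\<lambda>x. f x + g x)"
proof -
  have "products (\<lambda>x. 1 * f x + 1 * g x)"
    by (intro products_add products_mult smooth_const assms)
  then show ?thesis using products_smooth by simp
qed

lemma smooth_sum: "(\<And>j. j \<in> A \<Longrightarrow> smooth (f j)) \<Longrightarrow> smooth (\<lambda>x. \<Sum>j\<in>A. f j x)"
  by (induction A rule: infinite_finite_induct) (auto intro: smooth_const smooth_add)

lemma partial_deriv_cmult:
  "f differentiable (at x) \<Longrightarrow> partial_deriv i (\<lambda>x. c * f x) x = c * partial_deriv i f x"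
  by (subst partial_deriv_mult) auto

lemma partial_deriv_sum:
  assumes "\<And>j. j \<in> A \<Longrightarrow> f j differentiable (at x)"
  shows "partial_deriv i (\<lambda>x. \<Sum>j\<in>A. f j x) x = (\<Sum>j\<in>A. partial_deriv i (f j) x)"
proof -
  have "((\<lambda>x. \<Sum>j\<in>A. f j x) has_derivative (\<lambda>y. \<Sum>j\<in>A. frechet_derivative (f j) (at x) y)) (at x)"
    using assms by (intro has_derivative_sum) (auto simp: frechet_derivative_works)
  then show ?thesis unfolding partial_deriv_def by (simp add: frechet_derivative_at[symmetric])
qed

lemma partial_deriv_affine:
  fixes f :: "real ^ 'n \<Rightarrow> real"
  assumes "\<And>y. f differentiable (at y)"
  shows "partial_deriv i (\<lambda>x. f (c *\<^sub>R x + a)) x = c * partial_deriv i f (c *\<^sub>R x + a)"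
    "(\<lambda>x. f (c *\<^sub>R x + a)) differentiable (at x)"
proof -
  let ?D = "frechet_derivative f (at (c *\<^sub>R x + a))"
  have D: "(f has_derivative ?D) (at (c *\<^sub>R x + a))"
    using assms frechet_derivative_works by blast
  have "((\<lambda>x. f (c *\<^sub>R x + a)) has_derivative (\<lambda>y. ?D (c *\<^sub>R y))) (at x)"
    by (rule has_derivative_compose[of "\<lambda>x. c *\<^sub>R x + a" "\<lambda>y. c *\<^sub>R y" x UNIV f ?D])
      (use D in \<open>auto intro!: derivative_eq_intros\<close>)
  moreover have "?D (c *\<^sub>R y) = c * ?D y" for y
    using linear_scale[OF has_derivative_linear[OF D]] by simp
  ultimately have *: "((\<lambda>x. f (c *\<^sub>R x + a)) has_derivative (\<lambda>y. c * ?D y)) (at x)" by simp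
  show "partial_deriv i (\<lambda>x. f (c *\<^sub>R x + a)) x = c * partial_deriv i f (c *\<^sub>R x + a)"
    using partial_deriv_eq[OF *, of i] unfolding partial_deriv_def .
  show "(\<lambda>x. f (c *\<^sub>R x + a)) differentiable (at x)" using * differentiable_def by blast
qed

lemma smooth_affine:
  fixes f :: "real ^ 'n \<Rightarrow> real"
  assumes "smooth f" shows "smooth (\<lambda>x. f (c *\<^sub>R x + a))"
proof (rule smooth_coinduct[of "\<lambda>g. \<exists>d f. smooth f \<and> g = (\<lambda>x. d * f (c *\<^sub>R x + a))"])
  show "\<exists>d f'. smooth f' \<and> (\<lambda>x. f (c *\<^sub>R x + a)) = (\<lambda>x. d * f' (c *\<^sub>R x + a))"
    using assms by (intro exI[of _ 1] exI[of _ f]) auto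
  fix g :: "real ^ 'n \<Rightarrow> real" and i x
  assume "\<exists>d f. smooth f \<and> g = (\<lambda>x. d * f (c *\<^sub>R x + a))"
  then obtain d f where f: "smooth f" and g: "g = (\<lambda>x. d * f (c *\<^sub>R x + a))" by blast
  note diff = smooth_differentiable[OF f]
  show "g differentiable (at x)"
    unfolding g by (intro differentiable_mult differentiable_const partial_deriv_affine diff)
  have "partial_deriv i g = (\<lambda>x. (d * c) * partial_deriv i f (c *\<^sub>R x + a))"
    unfolding g by (rule ext) (simp add: partial_deriv_cmult partial_deriv_affine diff)
  then show "\<exists>d f. smooth f \<and> partial_deriv i g = (\<lambda>x. d * f (c *\<^sub>R x + a))"
    using smooth_partial_deriv[OF f] by blast
qed

text \<open>Tensor products reduce the calculus of kernels to one variable: a partial derivative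
  only exchanges one factor for its derivative.\<close>

definition tens :: "('n \<Rightarrow> real \<Rightarrow> real) \<Rightarrow> real ^ 'n \<Rightarrow> real" where
  "tens q x = (\<Prod>i\<in>UNIV. q i (x $ i))"

lemma tens_has_derivative:
  assumes "\<And>j. smooth1 (q j)"
  shows "(tens q has_derivative (\<lambda>y. \<Sum>i\<in>UNIV. (deriv (q i) (x $ i) * y $ i) * (\<Prod>j\<in>UNIV - {i}. q j (x $ j)))) (at x)"
  unfolding tens_def
proof (rule has_derivative_prod)
  fix i
  have "((\<lambda>x. q i (x $ i)) has_derivative (\<lambda>y. (*) (deriv (q i) (x $ i)) (y $ i))) (at x)"
    by (rule has_derivative_compose[of "\<lambda>x. x $ i"])
      (use smooth1_deriv(1)[OF assms] in \<open>auto simp: has_field_derivative_def intro!: bounded_linear_imp_has_derivative\<close>)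
  then show "((\<lambda>x. q i (x $ i)) has_derivative (\<lambda>y. deriv (q i) (x $ i) * y $ i)) (at x)" .
qed

lemma tens_upd: "tens (q(i := r)) x = r (x $ i) * (\<Prod>j\<in>UNIV - {i}. q j (x $ j))"
proof -
  have "tens (q(i := r)) x = r (x $ i) * (\<Prod>j\<in>UNIV - {i}. (q(i := r)) j (x $ j))"
    unfolding tens_def by (subst prod.remove[of UNIV i]) auto
  also have "(\<Prod>j\<in>UNIV - {i}. (q(i := r)) j (x $ j)) = (\<Prod>j\<in>UNIV - {i}. q j (x $ j))"
    by (rule prod.cong) auto
  finally show ?thesis .
qed

lemma partial_deriv_tens:
  assumes "\<And>j. smooth1 (q j)"
  shows "partial_deriv i (tens q) x = tens (q(i := deriv (q i))) x"
proof -
  have "partial_deriv i (tens q) x = (\<Sum>l\<in>UNIV. (deriv (q l) (x $ l) * axis i 1 $ l) * (\<Prod>j\<in>UNIV - {l}. q j (x $ j)))"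
    by (rule partial_deriv_eq[OF tens_has_derivative[OF assms]])
  also have "\<dots> = (\<Sum>l\<in>UNIV. if l = i then tens (q(i := deriv (q i))) x else 0)"
    by (rule sum.cong) (auto simp: axis_def tens_upd)
  finally show ?thesis by simp
qed

lemma smooth_tens:
  assumes "\<And>j. smooth1 (q j)"
  shows "smooth (tens q)"
proof (rule smooth_coinduct[of "\<lambda>f. \<exists>q. (\<forall>j. smooth1 (q j)) \<and> f = tens q"])
  show "\<exists>q'. (\<forall>j. smooth1 (q' j)) \<and> tens q = tens q'" using assms by blast
  fix f :: "real ^ 'n \<Rightarrow> real" and i x
  assume "\<exists>q. (\<forall>j. smooth1 (q j)) \<and> f = tens q"
  then obtain q where q: "\<And>j. smooth1 (q j)" and f: "f = tens q" by blast
  show "f differentiable (at x)" unfolding f differentiable_def using tens_has_derivative[of q x] q by blast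
  have "partial_deriv i f = tens (q(i := deriv (q i)))"
    unfolding f by (rule ext) (rule partial_deriv_tens[OF q])
  moreover have "\<forall>j. smooth1 ((q(i := deriv (q i))) j)" using q by (auto intro: smooth1_deriv)
  ultimately show "\<exists>q. (\<forall>j. smooth1 (q j)) \<and> partial_deriv i f = tens q" by blast
qed

section \<open>Kernels on the integer lattice as partitions of unity\<close>

definition lat :: "int ^ 'n \<Rightarrow> real ^ 'n" where
  "lat z = (\<chi> i. real_of_int (z $ i))"

lemma lat_nth [simp]: "lat z $ i = real_of_int (z $ i)" by (simp add: lat_def)

lemma lat_add: "lat (y + z) = lat y + lat z" by (simp add: vec_eq_iff)

lemma lat_diff: "lat (y - z) = lat y - lat z" by (simp add: vec_eq_iff)

lemma lat_axis: "lat (axis i 1) = axis i 1" by (simp add: vec_eq_iff axis_def)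

definition zbox :: "nat \<Rightarrow> (int ^ 'n) set" where
  "zbox N = {z. \<forall>i. \<bar>z $ i\<bar> \<le> int N}"

lemma vec_lambda_PiE_eq: "vec_lambda ` (UNIV \<rightarrow>\<^sub>E A) = {z :: 'a ^ 'n. \<forall>i. z $ i \<in> A}" for A :: "'a set"
proof (intro set_eqI iffI)
  fix z :: "'a ^ 'n" assume "z \<in> {z. \<forall>i. z $ i \<in> A}"
  then show "z \<in> vec_lambda ` (UNIV \<rightarrow>\<^sub>E A)"
    by (intro image_eqI[of _ _ "vec_nth z"]) auto
qed auto

lemma zbox_eq: "zbox N = vec_lambda ` (UNIV \<rightarrow>\<^sub>E {- int N..int N})"
  unfolding vec_lambda_PiE_eq zbox_def by (auto simp: abs_le_iff minus_le_iff)

lemma finite_zbox [simp]: "finite (zbox N)"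
  unfolding zbox_eq by (intro finite_imageI finite_PiE) auto

lemma inj_vec_lambda: "inj_on vec_lambda A"
  by (rule inj_on_inverseI[of _ vec_nth]) auto

lemma card_zbox: "card (zbox N :: (int ^ 'n) set) = (2 * N + 1) ^ CARD('n)"
  unfolding zbox_eq by (subst card_image[OF inj_vec_lambda]) (simp add: card_PiE nat_add_distrib nat_mult_distrib)

text \<open>Only continuity is demanded, which suffices for averaging; smoothness is assumed
  separately for kernels that get differentiated. The support condition is coordinatewise, so
  supports lie in boxes, and finite sets again stand in for the sum over the lattice.\<close>

definition kern :: "(real ^ 'n \<Rightarrow> real) \<Rightarrow> bool" where
  "kern p \<longleftrightarrow> continuous_on UNIV p \<and> (\<forall>x. 0 \<le> p x) \<and> (\<forall>x i. p x \<noteq> 0 \<longrightarrow> \<bar>x $ i\<bar> \<le> 3) \<and>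
     (\<forall>x S. finite S \<and> (\<forall>z. p (x - lat z) \<noteq> 0 \<longrightarrow> z \<in> S) \<longrightarrow> (\<Sum>z\<in>S. p (x - lat z)) = 1)"

lemma kernD:
  assumes "kern p"
  shows "continuous_on UNIV p" "0 \<le> p x" "p x \<noteq> 0 \<Longrightarrow> \<bar>x $ i\<bar> \<le> 3"
    "finite S \<Longrightarrow> (\<And>z. p (x - lat z) \<noteq> 0 \<Longrightarrow> z \<in> S) \<Longrightarrow> (\<Sum>z\<in>S. p (x - lat z)) = 1"
  using assms unfolding kern_def by blast+

lemma real_bounded_in_zbox:
  fixes x :: "real ^ 'n"
  shows "\<exists>N. \<forall>z. (\<forall>i. \<bar>(x - lat z) $ i\<bar> \<le> c) \<longrightarrow> z \<in> zbox N"
proof -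
  define N where "N = nat \<lceil>norm x + c\<rceil>"
  have "z \<in> zbox N" if z: "\<forall>i. \<bar>(x - lat z) $ i\<bar> \<le> c" for z
    unfolding zbox_def
  proof (intro CollectI allI)
    fix i
    have "\<bar>x $ i\<bar> \<le> norm x" by (rule component_le_norm_cart)
    moreover have "\<bar>x $ i - real_of_int (z $ i)\<bar> \<le> c" using z[rule_format, of i] by simp
    ultimately have "\<bar>real_of_int (z $ i)\<bar> \<le> norm x + c" by linarith
    then show "\<bar>z $ i\<bar> \<le> int N" unfolding N_def by linarith
  qed
  then show ?thesis by blast
qed

lemma kern_sum_le_1:
  assumes "kern p" "finite S"
  shows "(\<Sum>z\<in>S. p (x - lat z)) \<le> 1"
proof -
  obtain N where N: "\<And>z. (\<forall>i. \<bar>(x - lat z) $ i\<bar> \<le> 3) \<Longrightarrow> z \<in> zbox N"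
    using real_bounded_in_zbox by blast
  have "(\<Sum>z\<in>S. p (x - lat z)) \<le> (\<Sum>z\<in>S \<union> zbox N. p (x - lat z))"
    using assms by (intro sum_mono2) (auto intro: kernD)
  also have "\<dots> = 1"
  proof (rule kernD(4)[OF assms(1)])
    show "z \<in> S \<union> zbox N" if "p (x - lat z) \<noteq> 0" for z
      using N[of z] kernD(3)[OF assms(1) that] by blast
  qed (use assms in simp)
  finally show ?thesis .
qed

lemma kern_le_1: 
  assumes "kern p" shows "p x \<le> 1"
  using kern_sum_le_1[OF assms, of "{0}" x] by (simp add: lat_def zero_vec_def[symmetric])

text \<open>A product of one-dimensional sums over an interval expands into the sum over the lattice
  box, so the unit sums multiply.\<close>

lemma kern_tens:
  assumes q: "\<And>j. kernel1 (q j)"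
  shows "kern (tens q :: real ^ 'n \<Rightarrow> real)"
proof -
  have supp: "\<bar>x $ i\<bar> \<le> 3" if "tens q x \<noteq> 0" for x :: "real ^ 'n" and i
  proof -
    have "q i (x $ i) \<noteq> 0" using that unfolding tens_def by (metis finite UNIV_I prod_zero)
    then show ?thesis using kernel1D(3)[OF q] by blast
  qed
  have "(\<Sum>z\<in>S. tens q (x - lat z)) = 1"
    if S: "finite S" "\<forall>z. tens q (x - lat z) \<noteq> 0 \<longrightarrow> z \<in> S" for x :: "real ^ 'n" and S
  proof -
    obtain N where N: "\<And>z. (\<forall>i. \<bar>(x - lat z) $ i\<bar> \<le> 3) \<Longrightarrow> z \<in> zbox N"
      using real_bounded_in_zbox by blast
    have one: "(\<Sum>w\<in>{- int N..int N}. q i (x $ i - real_of_int w)) = 1" for i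
    proof (rule kernel1D(4)[OF q])
      fix w assume "q i (x $ i - real_of_int w) \<noteq> 0"
      then have w: "\<bar>x $ i - real_of_int w\<bar> \<le> 3" using kernel1D(3)[OF q] by blast
      \<comment> \<open>Completing the index \<open>w\<close> by the integer parts of the other
        coordinates gives a lattice point close to \<open>x\<close>; it lies in the box, hence
        \<open>w\<close> lies in its range.\<close>
      define z :: "int ^ 'n" where "z = (\<chi> j. if j = i then w else \<lfloor>x $ j\<rfloor>)"
      have "\<bar>(x - lat z) $ j\<bar> \<le> 3" for j using w by (auto simp: z_def) linarith
      then have "z \<in> zbox N" using N by blast
      then have "\<bar>z $ i\<bar> \<le> int N" by (simp add: zbox_def)
      then show "w \<in> {- int N..int N}" by (auto simp: z_def)
    qed simp
    have "(\<Sum>z\<in>S. tens q (x - lat z)) = (\<Sum>z\<in>S \<union> zbox N. tens q (x - lat z))"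
      using S by (intro sum.mono_neutral_left) auto
    also have "\<dots> = (\<Sum>z\<in>zbox N. tens q (x - lat z))"
      using S(1) N supp by (intro sum.mono_neutral_right) (simp, simp, blast)
    also have "\<dots> = (\<Sum>g\<in>UNIV \<rightarrow>\<^sub>E {- int N..int N}. tens q (x - lat (vec_lambda g)))"
      unfolding zbox_eq by (subst sum.reindex[OF inj_vec_lambda]) simp
    also have "\<dots> = (\<Sum>g\<in>UNIV \<rightarrow>\<^sub>E {- int N..int N}. \<Prod>i\<in>UNIV. q i (x $ i - real_of_int (g i)))"
      by (simp add: tens_def)
    also have "\<dots> = (\<Prod>i\<in>UNIV. \<Sum>w\<in>{- int N..int N}. q i (x $ i - real_of_int w))"
      by (rule prod_sum_PiE[symmetric]) auto
    also have "\<dots> = 1" by (simp add: one)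
    finally show ?thesis .
  qed
  moreover have "0 \<le> tens q x" for x :: "real ^ 'n"
    unfolding tens_def by (intro prod_nonneg) (use kernel1D(2)[OF q] in blast)
  moreover have "continuous_on UNIV (tens q :: real ^ 'n \<Rightarrow> real)"
    by (intro smooth_continuous_on smooth_tens kernel1D(1) q)
  ultimately show ?thesis
    unfolding kern_def using supp by blast
qed

abbreviation cube :: "real \<Rightarrow> (real ^ 'n) set" where
  "cube a \<equiv> cbox (\<chi> i. - a) (\<chi> i. a)"

lemma mem_cube: "x \<in> cube a \<longleftrightarrow> (\<forall>i. \<bar>x $ i\<bar> \<le> a)"
  by (auto simp: mem_box_cart abs_le_iff minus_le_iff)

lemma measure_cube:
  assumes "a \<ge> 0" shows "measure lebesgue (cube a :: (real ^ 'n) set) = (2 * a) ^ CARD('n)"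
proof -
  have "(0::real ^ 'n) \<in> cube a" unfolding mem_cube using assms by simp
  then have "(cube a :: (real ^ 'n) set) \<noteq> {}" by blast
  then show ?thesis by (simp add: content_cbox_cart)
qed

lemma integrable_indicator_cube: "integrable lebesgue (indicat_real (cube a :: (real ^ 'n) set))"
  by (rule integrable_real_indicator) (auto intro: emeasure_lborel_cbox_finite[unfolded infinity_ennreal_def])

lemma integral_indicator_cube:
  "a \<ge> 0 \<Longrightarrow> (\<integral>x. indicator (cube a :: (real ^ 'n) set) x \<partial>lebesgue) = (2 * a) ^ CARD('n)"
  using measure_cube[of a, where 'n='n] by simp

lemma integrable_compact_support:
  fixes f :: "real ^ 'n \<Rightarrow> real"
  assumes "continuous_on UNIV f" "compact K" "\<And>x. f x \<noteq> 0 \<Longrightarrow> x \<in> K"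
  shows "integrable lborel f" "integrable lebesgue f"
proof -
  have "integrable lborel (\<lambda>x. indicator K x *\<^sub>R f x)"
    by (rule borel_integrable_compact) (use assms continuous_on_subset[OF assms(1)] in auto)
  moreover have "(\<lambda>x. indicator K x *\<^sub>R f x) = f" using assms(3) by (auto simp: indicator_def fun_eq_iff)
  ultimately show "integrable lborel f" by simp
  then show "integrable lebesgue f" by (simp add: integrable_completion)
qed

lemma kern_scaled_support:
  assumes "kern p" "h > 0" "p ((1/h) *\<^sub>R x - lat z) \<noteq> 0"
  shows "\<bar>x $ i - h * real_of_int (z $ i)\<bar> \<le> 3 * h"
proof -
  have "\<bar>((1/h) *\<^sub>R x - lat z) $ i\<bar> \<le> 3" by (rule kernD(3)) (use assms in auto)
  then have "h * \<bar>x $ i / h - real_of_int (z $ i)\<bar> \<le> h * 3" using assms(2) by (intro mult_left_mono) auto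
  also have "h * \<bar>x $ i / h - real_of_int (z $ i)\<bar> = \<bar>h * (x $ i / h - real_of_int (z $ i))\<bar>"
    using assms(2) by (simp add: abs_mult)
  finally show ?thesis using assms(2) by (simp add: algebra_simps)
qed

lemma kern_scaled_continuous:
  assumes "kern p" shows "continuous_on A (\<lambda>x. p ((1/h) *\<^sub>R x - lat z))"
  by (rule continuous_on_compose2[OF kernD(1)[OF assms]]) (auto intro!: continuous_intros)

lemma kern_scaled_in_cube:
  fixes x :: "real ^ 'n"
  assumes "kern p" "h > 0" "p ((1/h) *\<^sub>R x - lat z) \<noteq> 0"
  shows "x \<in> cbox (h *\<^sub>R lat z - (\<chi> i. 3 * h)) (h *\<^sub>R lat z + (\<chi> i. 3 * h))"
  unfolding mem_box_cart
proof
  fix i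
  show "(h *\<^sub>R lat z - (\<chi> i. 3 * h)) $ i \<le> x $ i \<and> x $ i \<le> (h *\<^sub>R lat z + (\<chi> i. 3 * h)) $ i"
    using kern_scaled_support[OF assms, of i] by (auto simp: abs_le_iff)
qed

lemma kern_scaled_integrable:
  assumes "kern p" "h > 0"
  shows "integrable lebesgue (\<lambda>x. p ((1/h) *\<^sub>R x - lat z))"
  by (rule integrable_compact_support[OF kern_scaled_continuous[OF assms(1)] compact_cbox kern_scaled_in_cube[OF assms]])

lemma integral_affine_lborel:
  fixes f :: "real ^ 'n \<Rightarrow> real"
  assumes "f \<in> borel_measurable borel" "c > 0"
  shows "(\<integral>x. f (c *\<^sub>R x + a) \<partial>lborel) = (1/c) ^ CARD('n) * (\<integral>x. f x \<partial>lborel)"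
proof -
  have "(\<integral>x. f x \<partial>lborel) = (\<integral>x. f x \<partial>density (distr lborel borel (\<lambda>x. a + c *\<^sub>R x)) (\<lambda>_. \<bar>c\<bar>^CARD('n)))"
    using lborel_affine[of c a] assms(2) by simp
  also have "\<dots> = (\<integral>x. \<bar>c\<bar>^CARD('n) * f (a + c *\<^sub>R x) \<partial>lborel)"
    using assms by (subst integral_density) (auto simp: integral_distr)
  finally show ?thesis using assms by (simp add: power_one_over field_simps)
qed

lemma integral_kern_scaled_aux:
  fixes p :: "real ^ 'n \<Rightarrow> real"
  assumes "kern p" "h > 0"
  shows "(\<integral>x. p ((1/h) *\<^sub>R x - lat z) \<partial>lebesgue) = h ^ CARD('n) * (\<integral>x. p x \<partial>lebesgue)"
proof -
  have m: "p \<in> borel_measurable borel" using kernD(1)[OF assms(1)] by (simp add: borel_measurable_continuous_onI)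
  show ?thesis
    using integral_affine_lborel[OF m, of "1/h" "- lat z"] assms(2) m
    by (subst (1 2) integral_completion) auto
qed

text \<open>The translates over a box of size N sum to at most 1, to 0 outside the box enlarged by
  3, and to 1 inside the box shrunk by 3. Comparing volumes and letting N grow forces the integral
  to be 1.\<close>

lemma integral_kern:
  fixes p :: "real ^ 'n \<Rightarrow> real"
  assumes p: "kern p"
  shows "(\<integral>x. p x \<partial>lebesgue) = 1"
proof -
  let ?I = "\<integral>x. p x \<partial>lebesgue" and ?n = "CARD('n)"
  have shift: "(\<integral>x. p (x - lat z) \<partial>lebesgue) = ?I" for z
    using integral_kern_scaled_aux[OF p, of 1 z] by simp
  have int: "integrable lebesgue (\<lambda>x. p (x - lat z))" for z
    using kern_scaled_integrable[OF p, of 1 z] by simp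
  have tot: "(\<integral>x. (\<Sum>z\<in>zbox N. p (x - lat z)) \<partial>lebesgue) = (2 * real N + 1) ^ ?n * ?I" for N
    by (subst Bochner_Integration.integral_sum) (auto simp: int shift card_zbox add.commute)
  have upper: "(2 * real N + 1) ^ ?n * ?I \<le> (2 * (real N + 3)) ^ ?n" for N
  proof -
    have "(2 * real N + 1) ^ ?n * ?I \<le> (\<integral>x. indicator (cube (real N + 3) :: (real ^ 'n) set) x \<partial>lebesgue)"
      unfolding tot[symmetric]
    proof (rule Bochner_Integration.integral_mono)
      show "(\<Sum>z\<in>zbox N. p (x - lat z)) \<le> indicator (cube (real N + 3)) x" for x
      proof (cases "x \<in> cube (real N + 3)")
        case False
        have "p (x - lat z) = 0" if "z \<in> zbox N" for z
        proof (rule ccontr)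
          assume nz: "p (x - lat z) \<noteq> 0"
          have "\<bar>x $ i\<bar> \<le> real N + 3" for i
          proof -
            have "\<bar>(x - lat z) $ i\<bar> \<le> 3" using kernD(3)[OF p nz] .
            moreover have "\<bar>real_of_int (z $ i)\<bar> \<le> real N" using that unfolding zbox_def
              by (metis (mono_tags, lifting) mem_Collect_eq of_int_abs of_int_le_iff of_int_of_nat_eq)
            ultimately show ?thesis by simp
          qed
          with False show False unfolding mem_cube by blast
        qed
        with False show ?thesis by simp
      qed (use kern_sum_le_1[OF p] in auto)
      show "integrable lebesgue (indicat_real (cube (real N + 3) :: (real ^ 'n) set))"
        by (rule integrable_indicator_cube)
    qed (auto simp: int)
    then show ?thesis by (subst (asm) integral_indicator_cube) auto
  qed
  have lower: "(2 * real N) ^ ?n \<le> (2 * real (N + 3) + 1) ^ ?n * ?I" for N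
  proof -
    have "(\<integral>x. indicator (cube (real N) :: (real ^ 'n) set) x \<partial>lebesgue) \<le> (2 * real (N + 3) + 1) ^ ?n * ?I"
      unfolding tot[symmetric]
    proof (rule Bochner_Integration.integral_mono)
      show "indicator (cube (real N)) x \<le> (\<Sum>z\<in>zbox (N + 3). p (x - lat z))" for x
      proof (cases "x \<in> cube (real N)")
        case True
        have "(\<Sum>z\<in>zbox (N + 3). p (x - lat z)) = 1"
        proof (rule kernD(4)[OF p])
          fix z assume nz: "p (x - lat z) \<noteq> 0"
          have "\<bar>z $ i\<bar> \<le> int (N + 3)" for i
          proof -
            have "\<bar>(x - lat z) $ i\<bar> \<le> 3" using kernD(3)[OF p nz] .
            moreover have "\<bar>x $ i\<bar> \<le> real N" using True mem_cube by blast
            ultimately show ?thesis by simp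
          qed
          then show "z \<in> zbox (N + 3)" by (simp add: zbox_def)
        qed simp
        with True show ?thesis by simp
      qed (auto intro!: sum_nonneg kernD[OF p])
      show "integrable lebesgue (indicat_real (cube (real N) :: (real ^ 'n) set))"
        by (rule integrable_indicator_cube)
    qed (auto simp: int)
    then show ?thesis by (subst (asm) integral_indicator_cube) auto
  qed
  have "(\<lambda>N. ((2 * (real N + 3)) / (2 * real N + 1)) ^ ?n) \<longlonglongrightarrow> 1 ^ ?n"
    by (intro tendsto_power) real_asymp
  moreover have "?I \<le> ((2 * (real N + 3)) / (2 * real N + 1)) ^ ?n" for N
    using upper[of N] by (simp add: power_divide field_simps)
  ultimately have "?I \<le> 1" by (intro LIMSEQ_le_const) auto
  moreover have "(\<lambda>N. ((2 * real N) / (2 * real (N + 3) + 1)) ^ ?n) \<longlonglongrightarrow> 1 ^ ?n"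
    by (intro tendsto_power) real_asymp
  moreover have "((2 * real N) / (2 * real (N + 3) + 1)) ^ ?n \<le> ?I" for N
    using lower[of N] by (simp add: power_divide field_simps)
  ultimately show ?thesis by (intro antisym LIMSEQ_le_const2) auto
qed

lemma integral_kern_scaled:
  fixes p :: "real ^ 'n \<Rightarrow> real"
  assumes "kern p" "h > 0"
  shows "(\<integral>x. p ((1/h) *\<^sub>R x - lat z) \<partial>lebesgue) = h ^ CARD('n)"
  using integral_kern_scaled_aux[OF assms] integral_kern[OF assms(1)] by simp

text \<open>\<open>K\<close> interpolates lattice functions and \<open>L\<close> samples functions on the lattice; \<open>Ki\<close> and \<open>M\<close>
  transport difference quotients to derivatives and back.\<close>

locale lattice_kernels =
  fixes K L :: "real ^ 'n \<Rightarrow> real" and Ki M :: "'n \<Rightarrow> real ^ 'n \<Rightarrow> real"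
  assumes K: "kern K" "smooth K" and L: "kern L" and Ki: "\<And>i. kern (Ki i)" and M: "\<And>i. kern (M i)" "\<And>i. smooth (M i)"
    and partial_K: "\<And>i x. partial_deriv i K x = Ki i (x + axis i 1) - Ki i x"
    and partial_M: "\<And>i x. partial_deriv i (M i) x = L x - L (x - axis i 1)"

text \<open>With the pair \<open>s\<close>, \<open>k\<close> above, \<open>K\<close> uses
  \<open>k\<close> in all coordinates and \<open>Ki i\<close> exchanges the i-th factor for
  \<open>s\<close>, since k' is a difference of \<open>s\<close>. Dually \<open>L\<close> uses
  \<open>s\<close> everywhere and \<open>M i\<close> has the shifted factor k(t - 1) in coordinate
  i, whose derivative is the backward difference s(t) - s(t - 1).\<close>

lemma lattice_kernels_exist: "\<exists>K L Ki M. lattice_kernels (K :: real ^ 'n \<Rightarrow> real) L Ki M"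
proof -
  obtain s k where s: "kernel1 s" and k: "kernel1 k" "kernel1 (\<lambda>t. k (t - 1))"
    and dk: "\<And>t. (k has_real_derivative s (t + 1) - s t) (at t)"
    using kernel1_pair_exists by blast
  have dk': "((\<lambda>t. k (t - 1)) has_real_derivative s t - s (t - 1)) (at t)" for t
    using dk[of "t - 1"] DERIV_shift[of k "s t - s (t - 1)" t "-1"] by simp
  have eq: "deriv k = (\<lambda>t. s (t + 1) - s t)" "deriv (\<lambda>t. k (t - 1)) = (\<lambda>t. s t - s (t - 1))"
    using dk dk' by (auto intro: DERIV_imp_deriv)
  have off: "(\<Prod>j\<in>UNIV - {i}. q j ((x + c *\<^sub>R axis i 1) $ j)) = (\<Prod>j\<in>UNIV - {i}. q j (x $ j))"
    for i :: 'n and q :: "'n \<Rightarrow> real \<Rightarrow> real" and c :: real and x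
    by (rule prod.cong) (auto simp: axis_def)
  define K L Ki M where "K = tens (\<lambda>_::'n. k)" and "L = tens (\<lambda>_::'n. s)"
    and "Ki i = tens ((\<lambda>_::'n. k)(i := s))" and "M i = tens ((\<lambda>_::'n. s)(i := (\<lambda>t. k (t - 1))))" for i
  have "lattice_kernels K L Ki M"
  proof
    show "kern K" "kern L" "kern (Ki i)" "kern (M i)" for i
      unfolding K_def L_def Ki_def M_def using s k by (auto intro!: kern_tens)
    show "smooth K" "smooth (M i)" for i
      unfolding K_def M_def using s k by (auto intro!: smooth_tens kernel1D)
    fix i x
    have "partial_deriv i K x = tens ((\<lambda>_. k)(i := deriv k)) x"
      unfolding K_def by (rule partial_deriv_tens) (rule kernel1D(1)[OF k(1)])
    then show "partial_deriv i K x = Ki i (x + axis i 1) - Ki i x"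
      using off[where q="\<lambda>_. k" and c=1 and i=i and x=x] unfolding Ki_def eq tens_upd by (simp add: left_diff_distrib)
    have "L y = s (y $ i) * (\<Prod>j\<in>UNIV - {i}. s (y $ j))" for y
      using tens_upd[of "\<lambda>_. s" i s y] by (simp add: L_def fun_upd_idem)
    moreover have "partial_deriv i (M i) x = tens ((\<lambda>_. s)(i := deriv (\<lambda>t. k (t - 1)))) x"
      unfolding M_def by (subst partial_deriv_tens) (auto intro!: kernel1D(1) s k)
    ultimately show "partial_deriv i (M i) x = L x - L (x - axis i 1)"
      using off[where q="\<lambda>_. s" and c="-1" and i=i and x=x] unfolding eq tens_upd by (simp add: left_diff_distrib)
  qed
  then show ?thesis by blast
qed

section \<open>Higher integrability of lattice minimisers\<close>

definition Gam :: "real \<Rightarrow> real" where "Gam t = 1 + t\<^sup>2"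

lemma Gam_ge_1: "1 \<le> Gam t" and Gam_pos: "0 < Gam t"
  unfolding Gam_def by (simp, smt (verit) zero_le_power2)

lemma Gam_mono: "\<bar>s\<bar> \<le> \<bar>t\<bar> \<Longrightarrow> Gam s \<le> Gam t"
  unfolding Gam_def using abs_le_square_iff by auto

text \<open>The function by which the differenced Euler equation is tested: odd, increasing for
  \<rho> \<ge> 0, with a derivative comparable to \<open>Gam t powr \<rho>\<close>.\<close>

definition pw :: "real \<Rightarrow> real \<Rightarrow> real" where "pw \<rho> t = t * Gam t powr \<rho>"

lemma pw_minus: "pw \<rho> (- t) = - pw \<rho> t" by (simp add: pw_def Gam_def)

lemma pw_derivative:
  "(pw \<rho> has_real_derivative Gam t powr \<rho> + 2 * \<rho> * t\<^sup>2 * Gam t powr (\<rho> - 1)) (at t)"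
proof -
  have "1 + t\<^sup>2 > 0" using Gam_pos[of t] by (simp add: Gam_def)
  then show ?thesis
    unfolding pw_def Gam_def
    by (auto intro!: derivative_eq_intros simp: powr_diff field_simps power2_eq_square)
qed

lemma pw_derivative_bounds:
  assumes "\<rho> \<ge> 0"
  shows "Gam t powr \<rho> \<le> Gam t powr \<rho> + 2 * \<rho> * t\<^sup>2 * Gam t powr (\<rho> - 1)"
    "Gam t powr \<rho> + 2 * \<rho> * t\<^sup>2 * Gam t powr (\<rho> - 1) \<le> (1 + 2 * \<rho>) * Gam t powr \<rho>"
proof -
  show "Gam t powr \<rho> \<le> Gam t powr \<rho> + 2 * \<rho> * t\<^sup>2 * Gam t powr (\<rho> - 1)" using assms by simp
  have "t\<^sup>2 * Gam t powr (\<rho> - 1) \<le> Gam t * Gam t powr (\<rho> - 1)"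
    by (intro mult_right_mono) (auto simp: Gam_def)
  also have "\<dots> = Gam t powr \<rho>" using Gam_pos[of t] by (simp add: powr_diff)
  finally have "(2 * \<rho>) * (t\<^sup>2 * Gam t powr (\<rho> - 1)) \<le> (2 * \<rho>) * Gam t powr \<rho>"
    using assms by (intro mult_left_mono) auto
  then show "Gam t powr \<rho> + 2 * \<rho> * t\<^sup>2 * Gam t powr (\<rho> - 1) \<le> (1 + 2 * \<rho>) * Gam t powr \<rho>"
    by (simp add: algebra_simps)
qed

lemma Gam_between: "a \<le> t \<Longrightarrow> t \<le> b \<Longrightarrow> Gam t \<le> max (Gam a) (Gam b)"
proof -
  assume "a \<le> t" "t \<le> b"
  then have "\<bar>t\<bar> \<le> \<bar>a\<bar> \<or> \<bar>t\<bar> \<le> \<bar>b\<bar>" by linarith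
  then show ?thesis using Gam_mono by (meson max.coboundedI1 max.coboundedI2)
qed

lemma pw_diff_le:
  assumes "\<rho> \<ge> 0" "a \<le> b"
  shows "pw \<rho> b - pw \<rho> a \<le> (1 + 2 * \<rho>) * max (Gam a) (Gam b) powr \<rho> * (b - a)"
proof (cases "a = b")
  case False
  then have "a < b" using assms by simp
  then obtain z where z: "a < z" "z < b"
    "pw \<rho> b - pw \<rho> a = (b - a) * (Gam z powr \<rho> + 2 * \<rho> * z\<^sup>2 * Gam z powr (\<rho> - 1))"
    using MVT2[of a b "pw \<rho>", OF _ pw_derivative] by blast
  have "Gam z powr \<rho> \<le> max (Gam a) (Gam b) powr \<rho>"
    using Gam_between[of a z b] z Gam_pos[of z] assms by (intro powr_mono2) auto
  then have "Gam z powr \<rho> + 2 * \<rho> * z\<^sup>2 * Gam z powr (\<rho> - 1) \<le> (1 + 2 * \<rho>) * max (Gam a) (Gam b) powr \<rho>"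
    using pw_derivative_bounds(2)[OF assms(1), of z] assms
    by (smt (verit, best) mult_left_mono)
  then have "(b - a) * (Gam z powr \<rho> + 2 * \<rho> * z\<^sup>2 * Gam z powr (\<rho> - 1)) \<le> (b - a) * ((1 + 2 * \<rho>) * max (Gam a) (Gam b) powr \<rho>)"
    using assms by (intro mult_left_mono) auto
  then show ?thesis unfolding z(3) by (simp only: mult_ac)
qed simp

lemma pw_mono: "\<rho> \<ge> 0 \<Longrightarrow> a \<le> b \<Longrightarrow> pw \<rho> a \<le> pw \<rho> b"
proof (rule DERIV_nonneg_imp_nondecreasing[of a b "pw \<rho>"])
  fix x assume "\<rho> \<ge> 0"
  then show "\<exists>y. (pw \<rho> has_real_derivative y) (at x) \<and> 0 \<le> y"
    using pw_derivative pw_derivative_bounds(1)[of \<rho> x] by (metis order_trans powr_ge_zero)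
qed

text \<open>On the quarter of the interval next to its larger end, \<open>\<bar>t\<bar>\<close> is at least half its maximum.\<close>

lemma pw_diff_ge:
  assumes "\<rho> \<ge> 0" "a \<le> b"
  shows "(1/4) powr (\<rho> + 1) * max (Gam a) (Gam b) powr \<rho> * (b - a) \<le> pw \<rho> b - pw \<rho> a"
proof -
  have key: "(1/4) powr (\<rho> + 1) * max (Gam a) (Gam b) powr \<rho> * (b - a) \<le> pw \<rho> b - pw \<rho> a"
    if "a < b" "\<bar>a\<bar> \<le> b" for a b
  proof -
    define p where "p = b - (b - a) / 4"
    have p: "p < b" "a \<le> p" "b / 2 \<le> p" using that by (auto simp: p_def field_simps)
    obtain z where z: "p < z" "z < b"
      "pw \<rho> b - pw \<rho> p = (b - p) * (Gam z powr \<rho> + 2 * \<rho> * z\<^sup>2 * Gam z powr (\<rho> - 1))"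
      using MVT2[of p b "pw \<rho>", OF _ pw_derivative] p by blast
    have "Gam (b / 2) \<le> Gam z" by (rule Gam_mono) (use z p that in linarith)
    moreover have "Gam b / 4 \<le> Gam (b / 2)" by (simp add: Gam_def power_divide)
    ultimately have "(Gam b / 4) powr \<rho> \<le> Gam z powr \<rho>"
      using assms Gam_pos[of b] by (intro powr_mono2) auto
    also have "\<dots> \<le> Gam z powr \<rho> + 2 * \<rho> * z\<^sup>2 * Gam z powr (\<rho> - 1)"
      by (rule pw_derivative_bounds) fact
    finally have "(b - p) * (Gam b / 4) powr \<rho> \<le> pw \<rho> b - pw \<rho> p"
      unfolding z(3) using p by (intro mult_left_mono) auto
    also have "\<dots> \<le> pw \<rho> b - pw \<rho> a" using pw_mono[OF assms(1) p(2)] by simp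
    finally have "(b - p) * (Gam b / 4) powr \<rho> \<le> pw \<rho> b - pw \<rho> a" .
    moreover have "max (Gam a) (Gam b) = Gam b" using Gam_mono[of a b] that by simp
    moreover have "(Gam b / 4) powr \<rho> = (1/4) powr \<rho> * Gam b powr \<rho>"
      using Gam_pos[of b] by (simp add: powr_divide)
    ultimately show ?thesis by (simp add: p_def powr_add mult_ac)
  qed
  consider "a = b" | "a < b" "\<bar>a\<bar> \<le> b" | "a < b" "\<bar>b\<bar> \<le> - a" using assms by linarith
  then show ?thesis
  proof cases
    case 3
    then show ?thesis using key[of "- b" "- a"] by (simp add: pw_minus max.commute Gam_def)
  qed (use key in auto)
qed

lemma abs_pw_le: "\<bar>pw \<rho> t\<bar> \<le> Gam t powr (\<rho> + 1/2)"
proof -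
  have "\<bar>t\<bar> \<le> sqrt (Gam t)" by (rule real_le_rsqrt) (simp add: Gam_def)
  then have "\<bar>t\<bar> * Gam t powr \<rho> \<le> sqrt (Gam t) * Gam t powr \<rho>" by (intro mult_right_mono) auto
  then show ?thesis using Gam_pos[of t] by (simp add: pw_def abs_mult powr_add powr_half_sqrt mult.commute)
qed

lemma abs_power_diff_le:
  fixes x y \<delta> :: real
  assumes "0 \<le> x" "0 \<le> y" "\<bar>y - x\<bar> \<le> \<delta>"
  shows "\<bar>y ^ k - x ^ k\<bar> \<le> real k * \<delta> * (x ^ (k - 1) + y ^ (k - 1))"
proof -
  have key: "\<bar>y ^ k - x ^ k\<bar> \<le> real k * \<delta> * (x ^ (k - 1) + y ^ (k - 1))"
    if "0 \<le> x" "x < y" "y - x \<le> \<delta>" for x y :: real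
  proof -
    note xy = that(2)
    obtain z where z: "x < z" "z < y" "y ^ k - x ^ k = (y - x) * (real k * z ^ (k - 1))"
    proof -
      have "\<exists>z>x. z < y \<and> y ^ k - x ^ k = (y - x) * (real k * z ^ (k - 1))"
        by (rule MVT2[OF xy]) (auto intro!: derivative_eq_intros)
      then show thesis using that by blast
    qed
    have "\<bar>y ^ k - x ^ k\<bar> = (y - x) * (real k * z ^ (k - 1))"
      unfolding z(3) using that z by (intro abs_of_nonneg mult_nonneg_nonneg) auto
    also have "\<dots> \<le> \<delta> * (real k * (x ^ (k - 1) + y ^ (k - 1)))"
    proof (intro mult_mono mult_left_mono)
      have "z ^ (k - 1) \<le> y ^ (k - 1)" using z that by (intro power_mono) auto
      then show "z ^ (k - 1) \<le> x ^ (k - 1) + y ^ (k - 1)" using that by (smt (verit) zero_le_power)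
    qed (use that z in \<open>auto intro!: mult_nonneg_nonneg\<close>)
    finally show ?thesis by (simp add: mult_ac)
  qed
  consider "x = y" | "x < y" | "y < x" by linarith
  then show ?thesis
  proof cases
    case 1 then show ?thesis using assms by simp
  next
    case 2 then show ?thesis using key[of x y] assms by simp
  next
    case 3 then show ?thesis using key[of y x] assms by (simp add: abs_minus_commute add.commute)
  qed
qed

lemma max_powr_le:
  fixes x y :: real shows "max x y powr r \<le> x powr r + y powr r"
  by (simp add: max_def)

lemma power_double_diff: "(x::real) ^ (2 * k - 2) = (x\<^sup>2) ^ (k - 1)"
proof -
  have "2 * k - 2 = 2 * (k - 1)" by simp
  then show ?thesis by (simp only: power_mult)
qed

lemma scaled_young:
  fixes p q Q :: real
  assumes "Q > 0" shows "p * q / 2 \<le> p\<^sup>2 * Q / 8 + q\<^sup>2 / (2 * Q)"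
proof -
  have "0 \<le> (p * Q / 2 - q)\<^sup>2 / (2 * Q)" using assms by simp
  also have "\<dots> = p\<^sup>2 * Q / 8 - p * q / 2 + q\<^sup>2 / (2 * Q)"
    using assms by (simp add: power2_eq_square field_simps)
  finally show ?thesis by linarith
qed

text \<open>The Caccioppoli inequality on a single edge, where \<open>a\<close> and \<open>b\<close>
  are the difference quotients at its ends and \<Delta> is the increment of the derivative of the
  density. The product rule produces a term with the increment of the cut-off, which Young's
  inequality splits with the slope of \<open>pw N\<close> as weight. No lower bound relating
  \<Delta> to b - a is used, so the inequality serves the degenerate directions too.\<close>

lemma edge_inequality:
  fixes a b \<Delta> \<eta> \<eta>' \<delta> cbar N :: real and k :: nat
  assumes N: "N \<ge> 0" and \<Delta>: "0 \<le> \<Delta> * (b - a)" "\<bar>\<Delta>\<bar> \<le> cbar * \<bar>b - a\<bar>" and cbar: "0 \<le> cbar"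
    and \<eta>: "0 \<le> \<eta>" "0 \<le> \<eta>'" "\<bar>\<eta>' - \<eta>\<bar> \<le> \<delta>"
  shows "(\<eta> ^ (2 * k) + \<eta>' ^ (2 * k)) * (\<Delta> * (pw N b - pw N a)) / 4
      - 4 * cbar * (real k)\<^sup>2 * 4 powr (N + 1) * \<delta>\<^sup>2 * ((\<eta> ^ (2 * k - 2) + \<eta>' ^ (2 * k - 2)) * (Gam a powr (N + 1) + Gam b powr (N + 1)))
     \<le> \<Delta> * (\<eta>' ^ (2 * k) * pw N b - \<eta> ^ (2 * k) * pw N a)"
    (is "?L1 - ?L2 \<le> ?R")
proof (cases "a = b")
  case True
  then have "\<Delta> = 0" using \<Delta>(2) by simp
  then show ?thesis using cbar \<eta> by (auto intro!: mult_nonneg_nonneg)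
next
  case False
  define d where "d = b - a"
  have d: "d \<noteq> 0" using False by (simp add: d_def)
  \<comment> \<open>\<open>A\<close> and \<open>Q\<close> are the slopes of the two increments over
    b - a. \<open>A\<close> is bounded by \<open>cbar\<close> and may be arbitrarily small,
    \<open>Q\<close> is bounded below by the weight at the larger end.\<close>
  define A Q w w' G m where "A = \<Delta> / d" and "Q = (pw N b - pw N a) / d" and "w = \<eta> ^ k" and "w' = \<eta>' ^ k"
    and "G = \<bar>pw N a\<bar> + \<bar>pw N b\<bar>" and "m = max (Gam a) (Gam b)"
  have m: "m > 0" unfolding m_def using Gam_pos[of a] by simp
  have A: "0 \<le> A" "A \<le> cbar"
  proof -
    show "0 \<le> A" using \<Delta>(1) d unfolding A_def d_def[symmetric] by (simp add: zero_le_divide_iff zero_le_mult_iff)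
    have "\<bar>A\<bar> \<le> cbar" using \<Delta>(2) d unfolding A_def d_def[symmetric] by (simp add: abs_divide divide_le_eq)
    then show "A \<le> cbar" by simp
  qed
  have Q: "(1/4) powr (N + 1) * m powr N \<le> Q"
  proof (cases "a < b")
    case True
    then show ?thesis using pw_diff_ge[OF N, of a b] by (simp add: Q_def d_def m_def le_divide_eq)
  next
    case False
    then have "b < a" using \<open>a \<noteq> b\<close> by simp
    moreover have "Q = (pw N a - pw N b) / (a - b)" unfolding Q_def d_def
      using minus_divide_divide[of "pw N b - pw N a" "b - a"] by simp
    ultimately show ?thesis using pw_diff_ge[OF N, of b a] by (simp add: m_def max.commute le_divide_eq)
  qed
  have Qpos: "Q > 0" using Q m by (smt (verit) mult_pos_pos powr_gt_zero divide_pos_pos zero_less_numeral zero_less_one)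
  have ww: "\<bar>w' - w\<bar> \<le> real k * \<delta> * (\<eta> ^ (k - 1) + \<eta>' ^ (k - 1))"
    unfolding w_def w'_def by (rule abs_power_diff_le) (use \<eta> in auto)
  have "(w' - w)\<^sup>2 = \<bar>w' - w\<bar>\<^sup>2" by simp
  also have "\<dots> \<le> (real k * \<delta> * (\<eta> ^ (k - 1) + \<eta>' ^ (k - 1)))\<^sup>2"
    using ww by (intro power_mono) auto
  also have "\<dots> = (real k)\<^sup>2 * \<delta>\<^sup>2 * (\<eta> ^ (k - 1) + \<eta>' ^ (k - 1))\<^sup>2" by (simp add: power_mult_distrib)
  also have "\<dots> \<le> (real k)\<^sup>2 * \<delta>\<^sup>2 * (2 * (\<eta> ^ (2 * k - 2) + \<eta>' ^ (2 * k - 2)))"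
  proof (intro mult_left_mono)
    have sq: "(t ^ (k - 1))\<^sup>2 = t ^ (2 * k - 2)" for t :: real
      by (simp add: power_mult[symmetric] mult.commute diff_mult_distrib2)
    have "(x + y)\<^sup>2 \<le> 2 * (x\<^sup>2 + y\<^sup>2)" for x y :: real
      using zero_le_power2[of "x - y"] by (simp add: power2_eq_square algebra_simps)
    from this[of "\<eta> ^ (k - 1)" "\<eta>' ^ (k - 1)"]
    show "(\<eta> ^ (k - 1) + \<eta>' ^ (k - 1))\<^sup>2 \<le> 2 * (\<eta> ^ (2 * k - 2) + \<eta>' ^ (2 * k - 2))" unfolding sq .
  qed auto
  finally have w2: "(w' - w)\<^sup>2 \<le> (real k)\<^sup>2 * \<delta>\<^sup>2 * (2 * (\<eta> ^ (2 * k - 2) + \<eta>' ^ (2 * k - 2)))" .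
  have G2: "G\<^sup>2 / Q \<le> 4 * 4 powr (N + 1) * (Gam a powr (N + 1) + Gam b powr (N + 1))"
  proof -
    have "\<bar>pw N t\<bar> \<le> m powr (N + 1/2)" if "Gam t \<le> m" for t
      using abs_pw_le[of N t] powr_mono2[of "N + 1/2" "Gam t" m] that Gam_pos[of t] N by linarith
    then have "G \<le> 2 * m powr (N + 1/2)" unfolding G_def m_def by (smt (verit) max.cobounded1 max.cobounded2)
    then have "G\<^sup>2 \<le> (2 * m powr (N + 1/2))\<^sup>2" unfolding G_def by (intro power_mono) auto
    also have "\<dots> = 4 * m powr (2 * N + 1)"
      by (simp add: power_mult_distrib power2_eq_square powr_add[symmetric])
    finally have "G\<^sup>2 / Q \<le> (4 * m powr (2 * N + 1)) / ((1/4) powr (N + 1) * m powr N)"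
      using Q Qpos m by (intro frac_le) auto
    also have "\<dots> = 4 * 4 powr (N + 1) * m powr (N + 1)"
      using m by (simp add: powr_divide powr_add[symmetric] powr_diff[symmetric] field_simps)
    also have "\<dots> \<le> 4 * 4 powr (N + 1) * (Gam a powr (N + 1) + Gam b powr (N + 1))"
      unfolding m_def by (intro mult_left_mono max_powr_le) auto
    finally show ?thesis .
  qed
  have wsq: "t ^ (2 * k) = (t ^ k)\<^sup>2" for t :: real by (simp add: power_mult[symmetric] mult.commute)
  have eqs: "\<Delta> = A * d" "pw N b - pw N a = Q * d" using d by (auto simp: A_def Q_def)
  have "\<bar>(w'\<^sup>2 - w\<^sup>2) * d * (pw N a + pw N b)\<bar> / 2 \<le> (\<bar>d\<bar> * (w + w')) * (\<bar>w' - w\<bar> * G) / 2"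
  proof -
    have "\<bar>(w'\<^sup>2 - w\<^sup>2) * d * (pw N a + pw N b)\<bar> = \<bar>d\<bar> * (w + w') * \<bar>w' - w\<bar> * \<bar>pw N a + pw N b\<bar>"
      using \<eta> unfolding power2_eq_square square_diff_square_factored abs_mult
      by (simp add: w_def w'_def)
    also have "\<dots> \<le> \<bar>d\<bar> * (w + w') * \<bar>w' - w\<bar> * G"
      unfolding G_def using \<eta> by (intro mult_left_mono) (auto simp: w_def w'_def)
    finally show ?thesis by (simp add: mult_ac)
  qed
  also have "\<dots> \<le> (\<bar>d\<bar> * (w + w'))\<^sup>2 * Q / 8 + (\<bar>w' - w\<bar> * G)\<^sup>2 / (2 * Q)"
    by (rule scaled_young) fact
  also have "(\<bar>d\<bar> * (w + w'))\<^sup>2 * Q / 8 \<le> (w\<^sup>2 + w'\<^sup>2) * (Q * d\<^sup>2) / 4"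
  proof -
    have "(w + w')\<^sup>2 \<le> 2 * (w\<^sup>2 + w'\<^sup>2)"
      using zero_le_power2[of "w - w'"] by (simp add: power2_eq_square algebra_simps)
    then have A: "(Q * d\<^sup>2) * (w + w')\<^sup>2 \<le> (Q * d\<^sup>2) * (2 * (w\<^sup>2 + w'\<^sup>2))"
      using Qpos by (intro mult_left_mono) auto
    have B: "(\<bar>d\<bar> * (w + w'))\<^sup>2 * Q = (Q * d\<^sup>2) * (w + w')\<^sup>2" by (simp add: power_mult_distrib)
    have "(\<bar>d\<bar> * (w + w'))\<^sup>2 * Q / 8 \<le> (Q * d\<^sup>2) * (2 * (w\<^sup>2 + w'\<^sup>2)) / 8"
      unfolding B by (rule divide_right_mono[OF A]) simp
    also have "\<dots> = (w\<^sup>2 + w'\<^sup>2) * (Q * d\<^sup>2) / 4"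
    proof -
      have "q * (2 * s) / 8 = s * q / 4" for q s :: real by simp
      then show ?thesis .
    qed
    finally show ?thesis .
  qed
  also have "(\<bar>w' - w\<bar> * G)\<^sup>2 / (2 * Q) = (w' - w)\<^sup>2 * (G\<^sup>2 / Q) / 2"
    by (simp add: power_mult_distrib)
  also have "\<dots> \<le> ((real k)\<^sup>2 * \<delta>\<^sup>2 * (2 * (\<eta> ^ (2 * k - 2) + \<eta>' ^ (2 * k - 2))))
      * (4 * 4 powr (N + 1) * (Gam a powr (N + 1) + Gam b powr (N + 1))) / 2"
    using Qpos \<eta> by (intro divide_right_mono mult_mono w2 G2) auto
  also have "\<dots> = 4 * (real k)\<^sup>2 * 4 powr (N + 1) * \<delta>\<^sup>2 * ((\<eta> ^ (2 * k - 2) + \<eta>' ^ (2 * k - 2)) * (Gam a powr (N + 1) + Gam b powr (N + 1)))"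
  proof -
    have "(x * y * (2 * s)) * (4 * z * t) / 2 = 4 * x * z * y * (s * t)" for x y z s t :: real by simp
    then show ?thesis .
  qed
  finally have main: "\<bar>(w'\<^sup>2 - w\<^sup>2) * d * (pw N a + pw N b)\<bar> / 2 \<le> (w\<^sup>2 + w'\<^sup>2) * (Q * d\<^sup>2) / 4
     + 4 * (real k)\<^sup>2 * 4 powr (N + 1) * \<delta>\<^sup>2 * ((\<eta> ^ (2 * k - 2) + \<eta>' ^ (2 * k - 2)) * (Gam a powr (N + 1) + Gam b powr (N + 1)))"
    (is "_ \<le> ?T1 + ?T2") by simp
  have T2: "0 \<le> ?T2" using \<eta> by (intro mult_nonneg_nonneg) auto
  have "?R = A * (d * (w'\<^sup>2 * pw N b - w\<^sup>2 * pw N a))"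
    unfolding wsq w_def[symmetric] w'_def[symmetric] eqs by simp
  \<comment> \<open>Symmetric discrete product rule: mean of the weights times the increment, plus
    increment of the weights times the mean.\<close>
  also have "d * (w'\<^sup>2 * pw N b - w\<^sup>2 * pw N a) = (w\<^sup>2 + w'\<^sup>2) / 2 * (d * (pw N b - pw N a)) + (w'\<^sup>2 - w\<^sup>2) * d * (pw N a + pw N b) / 2"
    by (simp add: field_simps)
  also have "d * (pw N b - pw N a) = Q * d\<^sup>2" unfolding eqs by (simp add: power2_eq_square)
  finally have R: "?R = A * ((w\<^sup>2 + w'\<^sup>2) / 2 * (Q * d\<^sup>2) + (w'\<^sup>2 - w\<^sup>2) * d * (pw N a + pw N b) / 2)" .
  \<comment> \<open>Multiplying by \<open>A\<close> only at the end puts the same \<open>A\<close>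
    on the good term and on the absorbed one; in the remaining error it is estimated by
    \<open>cbar\<close>.\<close>
  have "A * ((w\<^sup>2 + w'\<^sup>2) / 2 * (Q * d\<^sup>2) - (?T1 + ?T2)) \<le> ?R"
    unfolding R by (rule mult_left_mono[OF _ A(1)]) (use main in linarith)
  moreover have "A * ((w\<^sup>2 + w'\<^sup>2) / 2 * (Q * d\<^sup>2) - (?T1 + ?T2)) = ?L1 - A * ?T2"
    unfolding wsq w_def[symmetric] w'_def[symmetric] eqs by (simp add: power2_eq_square field_simps)
  moreover have "A * ?T2 \<le> cbar * ?T2" using A(2) T2 by (rule mult_right_mono)
  moreover have "cbar * ?T2 = ?L2" by simp
  ultimately show ?thesis by linarith
qed

text \<open>Every point carrying a nonzero value lies in \<open>S\<close> together with its backward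
  shift, so a translation of the finite sum creates no boundary terms.\<close>

lemma sum_translate:
  fixes G :: "'a :: ab_group_add \<Rightarrow> real"
  assumes "finite S" "\<And>z. G z \<noteq> 0 \<Longrightarrow> z \<in> S \<and> z - e \<in> S"
  shows "(\<Sum>z\<in>S. G (z + e)) = (\<Sum>z\<in>S. G z)"
proof -
  have "(\<Sum>z\<in>S. G (z + e)) = (\<Sum>z\<in>{z \<in> S. G (z + e) \<noteq> 0}. G (z + e))"
    using assms(1) by (intro sum.mono_neutral_right) auto
  also have "\<dots> = (\<Sum>z\<in>{z \<in> S. G z \<noteq> 0}. G z)"
    by (rule sum.reindex_bij_witness[of _ "\<lambda>z. z - e" "\<lambda>z. z + e"])
      (use assms(2) in \<open>auto, (metis add_diff_cancel_right')?\<close>)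
  also have "\<dots> = (\<Sum>z\<in>S. G z)"
    using assms(1) by (intro sum.mono_neutral_left) auto
  finally show ?thesis .
qed

text \<open>Either \<eta>^2 x^\<tau> is at least 1/\<epsilon>, and the first term on the right
  dominates, or it is smaller, and then the left side is at most (\<eta>^2
  x^\<tau>)^(\<sigma>/\<tau>). The second case needs \<sigma>/\<tau> \<le> k - 1, which decides how
  large the cut-off power has to be.\<close>

lemma young_absorb:
  fixes x \<eta> \<sigma> \<tau> \<epsilon> :: real
  assumes "1 \<le> x" "0 \<le> \<eta>" "\<eta> \<le> 1" "0 < \<tau>" "0 \<le> \<sigma>" "\<sigma> / \<tau> \<le> real k - 1" "0 < \<epsilon>" "2 \<le> k"
  shows "\<eta> ^ (2 * k - 2) * x powr \<sigma> \<le> \<epsilon> * (\<eta> ^ (2 * k) * x powr (\<sigma> + \<tau>)) + (1 / \<epsilon>) powr (\<sigma> / \<tau>)"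
proof (cases "1 / \<epsilon> \<le> \<eta>\<^sup>2 * x powr \<tau>")
  case True
  then have "1 \<le> \<epsilon> * (\<eta>\<^sup>2 * x powr \<tau>)" using assms by (simp add: field_simps)
  then have "\<eta> ^ (2 * k - 2) * x powr \<sigma> * 1 \<le> \<eta> ^ (2 * k - 2) * x powr \<sigma> * (\<epsilon> * (\<eta>\<^sup>2 * x powr \<tau>))"
    using assms by (intro mult_left_mono) auto
  also have "\<dots> = \<epsilon> * ((\<eta> ^ (2 * k - 2) * \<eta>\<^sup>2) * x powr (\<sigma> + \<tau>))" by (simp add: powr_add mult_ac)
  also have "\<eta> ^ (2 * k - 2) * \<eta>\<^sup>2 = \<eta> ^ (2 * k)"
  proof -
    have "2 * k = (2 * k - 2) + 2" using assms(8) by simp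
    then show ?thesis by (metis power_add)
  qed
  finally show ?thesis by (smt (verit) powr_ge_zero)
next
  case False
  show ?thesis
  proof (cases "\<eta> = 0")
    case True
    then show ?thesis using assms by (auto simp: power_0_left)
  next
    case nz: False
    then have pos: "\<eta> > 0" using assms by simp
    have "\<eta> ^ (2 * k - 2) = (\<eta>\<^sup>2) ^ (k - 1)" by (rule power_double_diff)
    also have "\<dots> = (\<eta>\<^sup>2) powr (real k - 1)" using powr_realpow[of "\<eta>\<^sup>2" "k - 1"] pos assms(8) by (simp add: of_nat_diff)
    also have "\<dots> \<le> (\<eta>\<^sup>2) powr (\<sigma> / \<tau>)"
      using assms pos by (intro powr_mono') (auto simp: power_le_one)
    finally have "\<eta> ^ (2 * k - 2) * x powr \<sigma> \<le> (\<eta>\<^sup>2) powr (\<sigma> / \<tau>) * (x powr \<tau>) powr (\<sigma> / \<tau>)"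
      using assms by (simp add: powr_powr mult_right_mono)
    also have "\<dots> = (\<eta>\<^sup>2 * x powr \<tau>) powr (\<sigma> / \<tau>)" using assms by (simp add: powr_mult)
    also have "\<dots> \<le> (1 / \<epsilon>) powr (\<sigma> / \<tau>)" using False assms by (intro powr_mono2) auto
    finally show ?thesis using assms
      by (smt (verit) mult_nonneg_nonneg powr_ge_zero zero_le_power)
  qed
qed

text \<open>With p = 2k - 2, the first summand collects the own and the exchanged contribution of
  each node from its two edges; the second pays for exchanging the ends of an edge, with at most two
  edges per node of the support and two exchanges per edge.\<close>

definition edge_const :: "nat \<Rightarrow> real \<Rightarrow> real \<Rightarrow> real \<Rightarrow> real" where
  "edge_const k \<sigma> L M = 2 * (1 + 2 ^ (2 * k - 2)) + 4 * 2 ^ (2 * k - 2) * (L ^ (2 * k - 2) * (1 + 4 * M\<^sup>2) powr \<sigma>)"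

text \<open>Here \<open>u\<close> is the lattice minimiser bounded by \<open>M\<close>,
  \<open>E\<close> carries the cut-off \<eta>, and \<open>S\<close> is a finite set large enough
  that all shifts by \<open>e i\<close> and \<open>e one\<close> stay inside. The Euler equation is
  assumed for test functions on \<open>E\<close> and its shift, because the one in use is a
  difference in direction \<open>one\<close> of a function on \<open>E\<close>. Every constant
  derived below depends on \<open>L\<close>, \<open>M\<close>, the ellipticity data and the
  exponents, but neither on \<open>h\<close> nor on \<open>S\<close> and \<open>E\<close>.\<close>

locale discrete_solution =
  fixes e :: "'n::finite \<Rightarrow> 'a::ab_group_add" and one :: 'n
    and h L M c cbar \<mu> N \<tau> :: real and k :: nat
    and S E :: "'a set" and u \<eta> :: "'a \<Rightarrow> real" and F' :: "'n \<Rightarrow> real \<Rightarrow> real"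
  assumes h: "0 < h" "h \<le> 1" and L: "0 \<le> L" and u: "\<And>z. \<bar>u z\<bar> \<le> M"
    and \<eta>: "\<And>z. 0 \<le> \<eta> z" "\<And>z. \<eta> z \<le> 1" "\<And>z. \<eta> z \<noteq> 0 \<Longrightarrow> z \<in> E" "\<And>z i. \<bar>\<eta> (z + e i) - \<eta> z\<bar> \<le> h * L"
    and S: "finite S" "\<And>z i. z \<in> E \<Longrightarrow> z \<in> S \<and> z - e i \<in> S \<and> z + e one \<in> S \<and> z - e i + e one \<in> S"
    and F'_mono: "\<And>i s t. s \<le> t \<Longrightarrow> F' i s \<le> F' i t"
    and F'_lip: "\<And>i s t. s \<le> t \<Longrightarrow> F' i t - F' i s \<le> cbar * (t - s)"
    and F'_lower: "\<And>s t. s \<le> t \<Longrightarrow> c * max (Gam s) (Gam t) powr (- \<mu> / 2) * (t - s) \<le> F' one t - F' one s"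
    and c: "0 < c" "0 \<le> cbar"
    and euler: "\<And>\<phi>. (\<And>z. \<phi> z \<noteq> 0 \<Longrightarrow> z \<in> E \<or> z - e one \<in> E) \<Longrightarrow>
       (\<Sum>i\<in>UNIV. \<Sum>z\<in>S. F' i ((u (z + e i) - u z) / h) * (\<phi> (z + e i) - \<phi> z)) = 0"
    and N: "0 \<le> N" and \<tau>: "0 < \<tau>" "4 * \<tau> = 2 - \<mu>" "\<tau> \<le> 1/2" and k: "2 \<le> k" "(N + 1) / \<tau> \<le> real k - 1"
begin

definition v :: "'a \<Rightarrow> real" where "v z = (u (z + e one) - u z) / h"

abbreviation "\<Delta> i z \<equiv> F' i ((u (z + e one + e i) - u (z + e one)) / h) - F' i ((u (z + e i) - u z) / h)"

abbreviation "X i z \<equiv> (\<eta> z ^ (2 * k - 2) + \<eta> (z + e i) ^ (2 * k - 2)) * (Gam (v z) powr (N + 1) + Gam (v (z + e i)) powr (N + 1))"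

definition Y :: real where "Y = (\<Sum>z\<in>S. \<eta> z ^ (2 * k - 2) * Gam (v z) powr (N + 1))"

lemma M_nonneg: "0 \<le> M" using u[of 0] by linarith

lemma finite_E: "finite E" by (rule finite_subset[OF _ S(1)]) (use S(2) in blast)

text \<open>Testing with a backward difference in direction \<open>one\<close> and translating that
  half of the sum moves the difference onto \<open>F'\<close>: this is the differentiated Euler
  equation, tested with the cut-off power times \<open>pw N\<close> of the difference
  quotient.\<close>

lemma discrete_euler:
  "(\<Sum>i\<in>UNIV. \<Sum>z\<in>S. \<Delta> i z * (\<eta> (z + e i) ^ (2 * k) * pw N (v (z + e i)) - \<eta> z ^ (2 * k) * pw N (v z))) = 0"
proof -
  define \<theta> where "\<theta> z = \<eta> z ^ (2 * k) * pw N (v z)" for z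
  have \<theta>: "z \<in> E" if "\<theta> z \<noteq> 0" for z
    using that \<eta>(3)[of z] k(1) by (auto simp: \<theta>_def power_0_left split: if_splits)
  \<comment> \<open>A backward difference, so that the translation by \<open>e one\<close> below
    turns it into a forward difference of the \<open>F'\<close> terms.\<close>
  define \<phi> where "\<phi> z = \<theta> z - \<theta> (z - e one)" for z
  define d where "d i z = (u (z + e i) - u z) / h" for i z
  define G where "G i z = F' i (d i z) * (\<theta> (z - e one + e i) - \<theta> (z - e one))" for i z
  have "0 = (\<Sum>i\<in>UNIV. \<Sum>z\<in>S. F' i (d i z) * (\<phi> (z + e i) - \<phi> z))"
    unfolding d_def by (rule euler[symmetric]) (use \<theta> in \<open>auto simp: \<phi>_def, metis\<close>)
  also have "\<dots> = (\<Sum>i\<in>UNIV. \<Sum>z\<in>S. F' i (d i z) * (\<theta> (z + e i) - \<theta> z) - G i z)"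
    by (intro sum.cong refl) (simp add: \<phi>_def G_def algebra_simps)
  also have "\<dots> = (\<Sum>i\<in>UNIV. (\<Sum>z\<in>S. F' i (d i z) * (\<theta> (z + e i) - \<theta> z)) - (\<Sum>z\<in>S. G i (z + e one)))"
  proof (intro sum.cong refl)
    fix i
    have "(\<Sum>z\<in>S. G i (z + e one)) = (\<Sum>z\<in>S. G i z)"
    proof (rule sum_translate[OF S(1)])
      fix z assume "G i z \<noteq> 0"
      then have "\<theta> (z - e one + e i) \<noteq> 0 \<or> \<theta> (z - e one) \<noteq> 0" by (auto simp: G_def)
      then consider "z - e one + e i \<in> E" | "z - e one \<in> E" using \<theta> by blast
      then show "z \<in> S \<and> z - e one \<in> S"
      proof cases
        case 1 then show ?thesis using S(2)[of "z - e one + e i" i] by (simp add: algebra_simps)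
      next
        case 2 then show ?thesis using S(2)[of "z - e one"] by auto
      qed
    qed
    then show "(\<Sum>z\<in>S. F' i (d i z) * (\<theta> (z + e i) - \<theta> z) - G i z) = (\<Sum>z\<in>S. F' i (d i z) * (\<theta> (z + e i) - \<theta> z)) - (\<Sum>z\<in>S. G i (z + e one))"
      by (simp add: sum_subtractf)
  qed
  also have "\<dots> = (\<Sum>i\<in>UNIV. \<Sum>z\<in>S. - (\<Delta> i z * (\<theta> (z + e i) - \<theta> z)))"
    unfolding sum_subtractf[symmetric]
    by (intro sum.cong refl) (simp add: G_def d_def algebra_simps)
  finally show ?thesis by (simp add: sum_negf \<theta>_def)
qed

text \<open>Difference quotients in different directions commute. Hence the increments \<Delta> are
  controlled by the increments of \<open>v\<close> along the same edge, in every direction.\<close>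

lemma v_diff: "(u (z + e one + e i) - u (z + e one)) / h - (u (z + e i) - u z) / h = v (z + e i) - v z"
  by (simp add: v_def diff_divide_distrib[symmetric] add.commute add.left_commute)

lemma Delta_props: "0 \<le> \<Delta> i z * (v (z + e i) - v z)" "\<bar>\<Delta> i z\<bar> \<le> cbar * \<bar>v (z + e i) - v z\<bar>"
proof -
  let ?s = "(u (z + e i) - u z) / h" and ?t = "(u (z + e one + e i) - u (z + e one)) / h"
  have *: "v (z + e i) - v z = ?t - ?s" using v_diff by simp
  show "0 \<le> \<Delta> i z * (v (z + e i) - v z)"
    unfolding * using F'_mono[of ?s ?t i] F'_mono[of ?t ?s i] by (cases "?s \<le> ?t") (auto simp: zero_le_mult_iff)
  show "\<bar>\<Delta> i z\<bar> \<le> cbar * \<bar>v (z + e i) - v z\<bar>"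
    unfolding * using F'_mono[of ?s ?t i] F'_mono[of ?t ?s i] F'_lip[of ?s ?t i] F'_lip[of ?t ?s i]
    by (cases "?s \<le> ?t") (auto simp: abs_if)
qed

text \<open>The only pointwise information is |v| \<le> 2M/h. A factor h^(2k-2) compensates it
  because N + 1 \<le> (N + 1)/\<tau> \<le> k - 1.\<close>

lemma Gam_v_le: "(h * L) ^ (2 * k - 2) * Gam (v z) powr (N + 1) \<le> L ^ (2 * k - 2) * (1 + 4 * M\<^sup>2) powr (N + 1)"
proof -
  have "\<bar>u (z + e one) - u z\<bar> \<le> 2 * M" using u[of z] u[of "z + e one"] by linarith
  then have "(u (z + e one) - u z)\<^sup>2 \<le> (2 * M)\<^sup>2" by (rule power2_le_iff_abs_le[THEN iffD2, rotated]) (use M_nonneg in simp)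
  then have "(v z)\<^sup>2 * h\<^sup>2 \<le> 4 * M\<^sup>2" using h by (simp add: v_def power_divide power_mult_distrib)
  moreover have "h\<^sup>2 \<le> 1" using h by (simp add: power_le_one)
  ultimately have "Gam (v z) * h\<^sup>2 \<le> 1 + 4 * M\<^sup>2" by (simp add: Gam_def algebra_simps)
  then have "(Gam (v z) * h\<^sup>2) powr (N + 1) \<le> (1 + 4 * M\<^sup>2) powr (N + 1)"
    using N Gam_pos[of "v z"] h by (intro powr_mono2) auto
  then have 1: "Gam (v z) powr (N + 1) * (h\<^sup>2) powr (N + 1) \<le> (1 + 4 * M\<^sup>2) powr (N + 1)"
    using Gam_pos[of "v z"] h by (simp add: powr_mult)
  have "N + 1 \<le> (N + 1) / \<tau>" using \<tau> N by (simp add: le_divide_eq mult_left_le)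
  then have kN: "N + 1 \<le> real k - 1" using k by linarith
  have "h ^ (2 * k - 2) = (h\<^sup>2) ^ (k - 1)" by (rule power_double_diff)
  also have "\<dots> = (h\<^sup>2) powr (real k - 1)" using powr_realpow[of "h\<^sup>2" "k - 1"] h k by (simp add: of_nat_diff)
  also have "\<dots> \<le> (h\<^sup>2) powr (N + 1)" using kN h by (intro powr_mono') (auto simp: power_le_one)
  finally have "h ^ (2 * k - 2) * Gam (v z) powr (N + 1) \<le> (h\<^sup>2) powr (N + 1) * Gam (v z) powr (N + 1)"
    by (rule mult_right_mono) simp
  then have "h ^ (2 * k - 2) * Gam (v z) powr (N + 1) \<le> (1 + 4 * M\<^sup>2) powr (N + 1)" using 1 by (simp add: mult.commute)
  then have "L ^ (2 * k - 2) * (h ^ (2 * k - 2) * Gam (v z) powr (N + 1)) \<le> L ^ (2 * k - 2) * (1 + 4 * M\<^sup>2) powr (N + 1)"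
    using L by (intro mult_left_mono) auto
  then show ?thesis by (simp add: power_mult_distrib mult_ac)
qed

text \<open>A cut-off value at one end of an edge may meet a large difference quotient at the other end; the error
  \<open>(h L)\<^sup>2\<^sup>k\<^sup>-\<^sup>2\<close> made by exchanging the ends compensates the trivial bound \<open>2 M / h\<close> of the quotient.\<close>

lemma power_swap:
  assumes "0 \<le> x" "0 \<le> y" "\<bar>x - y\<bar> \<le> h * L"
  shows "x ^ (2 * k - 2) * Gam (v z) powr (N + 1) \<le>
    2 ^ (2 * k - 2) * (y ^ (2 * k - 2) * Gam (v z) powr (N + 1) + L ^ (2 * k - 2) * (1 + 4 * M\<^sup>2) powr (N + 1))"
proof -
  let ?p = "2 * k - 2"
  have hL: "0 \<le> h * L" using h L by simp
  have "x ^ ?p \<le> (2 * max y (h * L)) ^ ?p" using assms by (intro power_mono) auto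
  also have "\<dots> \<le> 2 ^ ?p * (y ^ ?p + (h * L) ^ ?p)"
  proof -
    have "max y (h * L) ^ ?p \<le> y ^ ?p + (h * L) ^ ?p"
      using zero_le_power[OF assms(2), of ?p] zero_le_power[OF hL, of ?p] by (simp only: max_def split: if_split) linarith
    then show ?thesis unfolding power_mult_distrib[of 2] by (intro mult_left_mono) auto
  qed
  finally have "x ^ ?p * Gam (v z) powr (N + 1) \<le> 2 ^ ?p * (y ^ ?p + (h * L) ^ ?p) * Gam (v z) powr (N + 1)"
    by (rule mult_right_mono) simp
  also have "\<dots> = 2 ^ ?p * (y ^ ?p * Gam (v z) powr (N + 1) + (h * L) ^ ?p * Gam (v z) powr (N + 1))"
    by (simp add: algebra_simps)
  also have "\<dots> \<le> 2 ^ ?p * (y ^ ?p * Gam (v z) powr (N + 1) + L ^ ?p * (1 + 4 * M\<^sup>2) powr (N + 1))"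
    by (intro mult_left_mono add_left_mono Gam_v_le) auto
  finally show ?thesis .
qed

text \<open>\<open>X\<close> also contains the mixed products of the cut-off at one end and
  \<open>Gam\<close> at the other; \<open>power_swap\<close> brings both to the same node at the
  price of a constant on each edge meeting \<open>E\<close>.\<close>

lemma edge_sum: "(\<Sum>z\<in>S. X i z) \<le> edge_const k (N + 1) L M * (Y + card E)"
proof -
  let ?p = "2 * k - 2" and ?B = "L ^ (2 * k - 2) * (1 + 4 * M\<^sup>2) powr (N + 1)"
  let ?y = "\<lambda>z. \<eta> z ^ ?p * Gam (v z) powr (N + 1)"
  \<comment> \<open>The edges on which some cut-off value may be nonzero. Each node of
    \<open>E\<close> belongs to at most two of them.\<close>
  define T where "T = {z \<in> S. z \<in> E \<or> z + e i \<in> E}"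
  have p: "?p > 0" using k by simp
  have B: "0 \<le> ?B" using L by simp
  have "X i z \<le> (1 + 2 ^ ?p) * (?y z + ?y (z + e i)) + (if z \<in> T then 2 * 2 ^ ?p * ?B else 0)" if "z \<in> S" for z
  proof (cases "z \<in> T")
    case True
    have "\<eta> z ^ ?p * Gam (v (z + e i)) powr (N + 1) \<le> 2 ^ ?p * (?y (z + e i) + ?B)"
      using \<eta>(4)[of z i] by (intro power_swap \<eta>) (simp add: abs_minus_commute)
    moreover have "\<eta> (z + e i) ^ ?p * Gam (v z) powr (N + 1) \<le> 2 ^ ?p * (?y z + ?B)"
      using \<eta>(4)[of z i] by (intro power_swap \<eta>)
    ultimately show ?thesis using True by (simp add: algebra_simps)
  next
    case False
    then have "z \<notin> E" "z + e i \<notin> E" using that by (auto simp: T_def)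
    then have "\<eta> z = 0" "\<eta> (z + e i) = 0" using \<eta>(3) by blast+
    then show ?thesis using p False by (simp add: power_0_left)
  qed
  then have "(\<Sum>z\<in>S. X i z) \<le> (\<Sum>z\<in>S. (1 + 2 ^ ?p) * (?y z + ?y (z + e i)) + (if z \<in> T then 2 * 2 ^ ?p * ?B else 0))"
    by (rule sum_mono)
  also have "\<dots> = (1 + 2 ^ ?p) * ((\<Sum>z\<in>S. ?y z) + (\<Sum>z\<in>S. ?y (z + e i))) + (\<Sum>z\<in>T. 2 * 2 ^ ?p * ?B)"
  proof -
    have "S \<inter> {x. x \<in> T} = T" by (auto simp: T_def)
    then show ?thesis using S(1)
      by (simp add: sum.distrib sum_distrib_left[symmetric] sum.If_cases)
  qed
  also have "(\<Sum>z\<in>S. ?y (z + e i)) = (\<Sum>z\<in>S. ?y z)"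
  proof (rule sum_translate[OF S(1)])
    fix z assume "?y z \<noteq> 0"
    then have "z \<in> E" using \<eta>(3)[of z] p by (auto simp: power_0_left)
    then show "z \<in> S \<and> z - e i \<in> S" using S(2) by blast
  qed
  also have "(\<Sum>z\<in>T. 2 * 2 ^ ?p * ?B) \<le> 2 * card E * (2 * 2 ^ ?p * ?B)"
  proof -
    have "T \<subseteq> E \<union> (\<lambda>z. z - e i) ` E" by (auto simp: T_def image_iff) (metis add_diff_cancel_right')
    then have "card T \<le> card (E \<union> (\<lambda>z. z - e i) ` E)" using finite_E by (intro card_mono) auto
    also have "\<dots> \<le> card E + card ((\<lambda>z. z - e i) ` E)" by (rule card_Un_le)
    also have "\<dots> \<le> 2 * card E" using card_image_le[OF finite_E, of "\<lambda>z. z - e i"] by simp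
    finally have "real (card T) \<le> 2 * real (card E)" by linarith
    then have "real (card T) * (2 * 2 ^ ?p * ?B) \<le> 2 * real (card E) * (2 * 2 ^ ?p * ?B)"
      using B by (intro mult_right_mono) auto
    then show ?thesis by simp
  qed
  also have "(1 + 2 ^ ?p) * ((\<Sum>z\<in>S. ?y z) + (\<Sum>z\<in>S. ?y z)) + 2 * card E * (2 * 2 ^ ?p * ?B)
     \<le> edge_const k (N + 1) L M * (Y + card E)"
  proof -
    have "0 \<le> Y" unfolding Y_def using \<eta>(1) by (intro sum_nonneg mult_nonneg_nonneg) auto
    then have "0 \<le> 4 * 2 ^ ?p * ?B * Y" "0 \<le> 2 * (1 + 2 ^ ?p) * real (card E)" using B by auto
    then show ?thesis unfolding edge_const_def Y_def[symmetric] by (simp add: algebra_simps)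
  qed
  finally show ?thesis by simp
qed

definition "C1 = 4 * cbar * (real k)\<^sup>2 * 4 powr (N + 1)"

text \<open>Summing the edge inequality over all directions leaves zero on the right by the Euler
  equation. All good terms are nonnegative, so those of direction \<open>one\<close> may be kept
  alone; the error carries the factor (h L)^2 from the increments of the cut-off.\<close>

lemma caccioppoli:
  "(\<Sum>z\<in>S. (\<eta> z ^ (2 * k) + \<eta> (z + e one) ^ (2 * k)) * (\<Delta> one z * (pw N (v (z + e one)) - pw N (v z))))
    \<le> 4 * C1 * (h * L)\<^sup>2 * (real CARD('n) * (edge_const k (N + 1) L M * (Y + card E)))"
proof -
  let ?W = "\<lambda>i z. (\<eta> z ^ (2 * k) + \<eta> (z + e i) ^ (2 * k)) * (\<Delta> i z * (pw N (v (z + e i)) - pw N (v z)))"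
  have C1: "0 \<le> C1" unfolding C1_def using c by simp
  have W: "0 \<le> ?W i z" for i z
  proof -
    have "0 \<le> \<Delta> i z * (pw N (v (z + e i)) - pw N (v z))"
      using Delta_props(1)[of i z] Delta_props(2)[of i z] pw_mono[OF N, of "v z" "v (z + e i)"] pw_mono[OF N, of "v (z + e i)" "v z"]
      by (cases "v (z + e i) = v z") (auto simp: zero_le_mult_iff)
    then show ?thesis using \<eta>(1) by simp
  qed
  have "(\<Sum>i\<in>UNIV. \<Sum>z\<in>S. ?W i z / 4 - C1 * (h * L)\<^sup>2 * X i z) \<le>
     (\<Sum>i\<in>UNIV. \<Sum>z\<in>S. \<Delta> i z * (\<eta> (z + e i) ^ (2 * k) * pw N (v (z + e i)) - \<eta> z ^ (2 * k) * pw N (v z)))"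
    unfolding C1_def
    by (intro sum_mono edge_inequality N Delta_props c \<eta>)
  also have "\<dots> = 0" by (rule discrete_euler)
  finally have "(\<Sum>i\<in>UNIV. \<Sum>z\<in>S. ?W i z) \<le> 4 * (C1 * (h * L)\<^sup>2 * (\<Sum>i\<in>UNIV. \<Sum>z\<in>S. X i z))"
    by (simp add: sum_subtractf sum_divide_distrib[symmetric] sum_distrib_left[symmetric])
  moreover have "(\<Sum>z\<in>S. ?W one z) \<le> (\<Sum>i\<in>UNIV. \<Sum>z\<in>S. ?W i z)"
    by (rule member_le_sum) (auto intro!: sum_nonneg W)
  moreover have "(\<Sum>i\<in>UNIV. \<Sum>z\<in>S. X i z) \<le> (\<Sum>i\<in>(UNIV::'n set). edge_const k (N + 1) L M * (Y + card E))"
    by (intro sum_mono edge_sum)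
  then have "C1 * (h * L)\<^sup>2 * (\<Sum>i\<in>UNIV. \<Sum>z\<in>S. X i z) \<le> C1 * (h * L)\<^sup>2 * (real CARD('n) * (edge_const k (N + 1) L M * (Y + card E)))"
    using C1 by (intro mult_left_mono) auto
  ultimately show ?thesis by linarith
qed

definition "c0 = c * (1/4) powr (N + 1)"

definition "\<rho> = N + \<tau>"

text \<open>The first summand is the cost of Young's inequality when \<open>v\<close> varies along
  the edge, the second comes from the variation of the cut-off.\<close>

definition "C2 = (1 + 2 * \<rho>)\<^sup>2 / (4 * c0) + 2 * real k * L"

lemma Delta_one: "c * max (Gam (v z)) (Gam (v (z + e one))) powr (- \<mu> / 2) * \<bar>v (z + e one) - v z\<bar> \<le> \<bar>\<Delta> one z\<bar>"
proof -
  have d: "\<Delta> one z = F' one (v (z + e one)) - F' one (v z)" by (simp add: v_def)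
  show ?thesis unfolding d
    using F'_lower[of "v z" "v (z + e one)"] F'_lower[of "v (z + e one)" "v z"]
    by (cases "v z \<le> v (z + e one)") (auto simp: max.commute)
qed

text \<open>Both factors have the same sign and are bounded below with the same weight
  \<open>m z\<close>, the larger value on the edge, so the exponents -\<mu>/2 and N simply
  add.\<close>

lemma product_lower:
  defines "m z \<equiv> max (Gam (v z)) (Gam (v (z + e one)))"
  shows "c0 * m z powr (N - \<mu> / 2) * (v (z + e one) - v z)\<^sup>2 \<le> \<Delta> one z * (pw N (v (z + e one)) - pw N (v z))"
proof -
  let ?d = "v (z + e one) - v z" and ?g = "pw N (v (z + e one)) - pw N (v z)"
  have m: "m z > 0" unfolding m_def using Gam_pos[of "v z"] by simp
  have g: "(1/4) powr (N + 1) * m z powr N * \<bar>?d\<bar> \<le> \<bar>?g\<bar>"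
    using pw_diff_ge[OF N, of "v z" "v (z + e one)"] pw_diff_ge[OF N, of "v (z + e one)" "v z"]
    by (cases "v z \<le> v (z + e one)") (auto simp: m_def max.commute)
  have "c0 * m z powr (N - \<mu> / 2) * ?d\<^sup>2 = (c * m z powr (- \<mu> / 2) * \<bar>?d\<bar>) * ((1/4) powr (N + 1) * m z powr N * \<bar>?d\<bar>)"
  proof -
    have "m z powr (N - \<mu> / 2) = m z powr (- \<mu> / 2) * m z powr N" by (simp add: powr_add[symmetric])
    moreover have "?d\<^sup>2 = \<bar>?d\<bar> * \<bar>?d\<bar>" by (simp add: power2_eq_square)
    ultimately show ?thesis unfolding c0_def by (simp only: mult_ac)
  qed
  also have "\<dots> \<le> \<bar>\<Delta> one z\<bar> * \<bar>?g\<bar>"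
    using g Delta_one[of z] c m unfolding m_def[symmetric] by (intro mult_mono) auto
  also have "\<dots> = \<Delta> one z * ?g"
  proof -
    have "0 \<le> \<Delta> one z * ?g"
      using Delta_props(1)[of one z] Delta_props(2)[of one z] pw_mono[OF N, of "v z" "v (z + e one)"] pw_mono[OF N, of "v (z + e one)" "v z"]
      by (cases "v (z + e one) = v z") (auto simp: zero_le_mult_iff)
    then show ?thesis by (simp only: abs_mult[symmetric] abs_of_nonneg)
  qed
  finally show ?thesis .
qed

text \<open>Prepares a summation by parts: the increment of the cut-off times
  \<open>pw \<rho>\<close> is split into a part that the Caccioppoli inequality controls and a part
  with the power N + 1. The factor 1/h^2 of the former meets the h^2 on the right of
  \<open>caccioppoli\<close>.\<close>

lemma edge_increment:
  "\<bar>\<eta> (z + e one) ^ (2 * k) * pw \<rho> (v (z + e one)) - \<eta> z ^ (2 * k) * pw \<rho> (v z)\<bar> / h \<le>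
    (\<eta> z ^ (2 * k) + \<eta> (z + e one) ^ (2 * k)) * (\<Delta> one z * (pw N (v (z + e one)) - pw N (v z))) / (4 * h\<^sup>2)
    + C2 * X one z"
proof -
  define a b y y' where "a = v z" and "b = v (z + e one)" and "y = \<eta> z" and "y' = \<eta> (z + e one)"
  define m D where "m = max (Gam a) (Gam b)" and "D = \<Delta> one z * (pw N b - pw N a)"
  let ?p = "2 * k - 2"
  have m1: "1 \<le> m" unfolding m_def using Gam_ge_1[of a] by simp
  then have m: "m > 0" by simp
  have y: "0 \<le> y" "y \<le> 1" "0 \<le> y'" "y' \<le> 1" "\<bar>y' - y\<bar> \<le> h * L" by (auto simp: y_def y'_def \<eta>)
  have rho: "\<rho> \<ge> 0" using N \<tau> by (simp add: \<rho>_def)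
  have c0: "c0 > 0" unfolding c0_def using c by simp
  have sig: "max (Gam a) (Gam b) powr r \<le> Gam a powr (N + 1) + Gam b powr (N + 1)" if "r \<le> N + 1" for r
    using powr_mono[OF that m1] max_powr_le[of "Gam a" "Gam b" "N + 1"] unfolding m_def by linarith
  have low: "t ^ (2 * k) \<le> t ^ ?p" "t ^ (2 * k - 1) \<le> t ^ ?p" if "0 \<le> t" "t \<le> 1" for t :: real
    using that by (auto intro!: power_decreasing)
  have Dlow: "c0 * m powr (N - \<mu> / 2) * (b - a)\<^sup>2 \<le> D"
    unfolding D_def m_def a_def b_def by (rule product_lower)
  have psi: "\<bar>pw \<rho> b - pw \<rho> a\<bar> \<le> (1 + 2 * \<rho>) * m powr \<rho> * \<bar>b - a\<bar>"
    using pw_diff_le[OF rho, of a b] pw_diff_le[OF rho, of b a] pw_mono[OF rho, of a b] pw_mono[OF rho, of b a]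
    by (cases "a \<le> b") (auto simp: m_def max.commute)
  have first: "\<bar>pw \<rho> b - pw \<rho> a\<bar> / h \<le> D / (2 * h\<^sup>2) + (1 + 2 * \<rho>)\<^sup>2 / (2 * c0) * (Gam a powr (N + 1) + Gam b powr (N + 1))"
  proof -
    \<comment> \<open>The coefficient of the squared increment in \<open>product_lower\<close>;
      taking it as Young weight makes the quadratic term exactly absorbable by
      \<open>D\<close>.\<close>
    define q where "q = c0 * m powr (N - \<mu> / 2)"
    have q: "q > 0" unfolding q_def using c0 m by simp
    have "\<bar>pw \<rho> b - pw \<rho> a\<bar> / h \<le> (\<bar>b - a\<bar> / h) * ((1 + 2 * \<rho>) * m powr \<rho>)"
      using psi h by (simp add: field_simps)
    also have "\<dots> = (2 * \<bar>b - a\<bar> / h) * ((1 + 2 * \<rho>) * m powr \<rho>) / 2" by simp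
    also have "\<dots> \<le> (2 * \<bar>b - a\<bar> / h)\<^sup>2 * q / 8 + ((1 + 2 * \<rho>) * m powr \<rho>)\<^sup>2 / (2 * q)"
      by (rule scaled_young) fact
    also have "(2 * \<bar>b - a\<bar> / h)\<^sup>2 * q / 8 = (q * (b - a)\<^sup>2) / (2 * h\<^sup>2)"
      by (simp add: power_divide power_mult_distrib)
    also have "(q * (b - a)\<^sup>2) / (2 * h\<^sup>2) \<le> D / (2 * h\<^sup>2)"
      using Dlow unfolding q_def by (intro divide_right_mono) auto
    also have "((1 + 2 * \<rho>) * m powr \<rho>)\<^sup>2 / (2 * q) = (1 + 2 * \<rho>)\<^sup>2 / (2 * c0) * m powr (N + 1)"
    proof -
      \<comment> \<open>The balance of exponents that fixes \<tau>: two powers \<rho> from Young's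
        inequality, minus the available N - \<mu>/2.\<close>
      have "N + 1 = \<rho> + \<rho> - (N - \<mu> / 2)" using \<tau>(2) by (simp add: \<rho>_def field_simps)
      then have "m powr (N + 1) = m powr \<rho> * m powr \<rho> / m powr (N - \<mu> / 2)" by (simp only: powr_add powr_diff)
      then show ?thesis unfolding q_def by (simp add: power_mult_distrib power2_eq_square mult_ac)
    qed
    also have "\<dots> \<le> (1 + 2 * \<rho>)\<^sup>2 / (2 * c0) * (Gam a powr (N + 1) + Gam b powr (N + 1))"
      using c0 sig[of "N + 1"] unfolding m_def by (intro mult_left_mono) auto
    finally show ?thesis by simp
  qed
  have second: "\<bar>y' ^ (2 * k) - y ^ (2 * k)\<bar> * \<bar>pw \<rho> a + pw \<rho> b\<bar> / h \<le>
     2 * (2 * real k * L) * ((y ^ ?p + y' ^ ?p) * (Gam a powr (N + 1) + Gam b powr (N + 1)))"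
  proof -
    have "\<bar>y' ^ (2 * k) - y ^ (2 * k)\<bar> \<le> real (2 * k) * (h * L) * (y ^ (2 * k - 1) + y' ^ (2 * k - 1))"
      by (rule abs_power_diff_le) (use y in auto)
    also have "\<dots> \<le> real (2 * k) * (h * L) * (y ^ ?p + y' ^ ?p)"
      using h L y by (intro mult_left_mono add_mono low) auto
    finally have 1: "\<bar>y' ^ (2 * k) - y ^ (2 * k)\<bar> \<le> real (2 * k) * (h * L) * (y ^ ?p + y' ^ ?p)" .
    have "\<bar>pw \<rho> t\<bar> \<le> max (Gam a) (Gam b) powr (\<rho> + 1/2)" if "Gam t \<le> m" for t
      using abs_pw_le[of \<rho> t] powr_mono2[of "\<rho> + 1/2" "Gam t" m] that Gam_pos[of t] rho unfolding m_def by linarith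
    then have "\<bar>pw \<rho> a\<bar> + \<bar>pw \<rho> b\<bar> \<le> 2 * max (Gam a) (Gam b) powr (\<rho> + 1/2)" unfolding m_def
      by (smt (verit) max.cobounded1 max.cobounded2)
    \<comment> \<open>Here \<tau> \<le> 1/2 is used: \<rho> + 1/2 must not exceed N + 1.\<close>
    also have "\<dots> \<le> 2 * (Gam a powr (N + 1) + Gam b powr (N + 1))"
      using \<tau> by (intro mult_left_mono sig) (auto simp: \<rho>_def)
    finally have 2: "\<bar>pw \<rho> a + pw \<rho> b\<bar> \<le> 2 * (Gam a powr (N + 1) + Gam b powr (N + 1))" by linarith
    have "\<bar>y' ^ (2 * k) - y ^ (2 * k)\<bar> * \<bar>pw \<rho> a + pw \<rho> b\<bar> \<le>
      (real (2 * k) * (h * L) * (y ^ ?p + y' ^ ?p)) * (2 * (Gam a powr (N + 1) + Gam b powr (N + 1)))"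
      using h L y by (intro mult_mono 1 2) auto
    then have "\<bar>y' ^ (2 * k) - y ^ (2 * k)\<bar> * \<bar>pw \<rho> a + pw \<rho> b\<bar> / h \<le>
      (real (2 * k) * (h * L) * (y ^ ?p + y' ^ ?p)) * (2 * (Gam a powr (N + 1) + Gam b powr (N + 1))) / h"
      using h by (intro divide_right_mono) auto
    also have "\<dots> = 2 * (2 * real k * L) * ((y ^ ?p + y' ^ ?p) * (Gam a powr (N + 1) + Gam b powr (N + 1)))"
    proof -
      have "(real (2 * k) * (h * L) * s) * (2 * t) / h = 2 * (2 * real k * L) * (s * t)" for s t using h by simp
      then show ?thesis .
    qed
    finally show ?thesis .
  qed
  have "\<bar>y' ^ (2 * k) * pw \<rho> b - y ^ (2 * k) * pw \<rho> a\<bar> =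
    \<bar>(y ^ (2 * k) + y' ^ (2 * k)) * (pw \<rho> b - pw \<rho> a) / 2 + (y' ^ (2 * k) - y ^ (2 * k)) * (pw \<rho> a + pw \<rho> b) / 2\<bar>"
    by (rule arg_cong[of _ _ abs]) (simp add: field_simps)
  also have "\<dots> \<le> (y ^ (2 * k) + y' ^ (2 * k)) * \<bar>pw \<rho> b - pw \<rho> a\<bar> / 2 + \<bar>y' ^ (2 * k) - y ^ (2 * k)\<bar> * \<bar>pw \<rho> a + pw \<rho> b\<bar> / 2"
    using y by (intro order.trans[OF abs_triangle_ineq]) (simp add: abs_mult)
  finally have "\<bar>y' ^ (2 * k) * pw \<rho> b - y ^ (2 * k) * pw \<rho> a\<bar> / h \<le>
    ((y ^ (2 * k) + y' ^ (2 * k)) * \<bar>pw \<rho> b - pw \<rho> a\<bar> / 2 + \<bar>y' ^ (2 * k) - y ^ (2 * k)\<bar> * \<bar>pw \<rho> a + pw \<rho> b\<bar> / 2) / h"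
    using h by (intro divide_right_mono) auto
  also have "\<dots> = (y ^ (2 * k) + y' ^ (2 * k)) / 2 * (\<bar>pw \<rho> b - pw \<rho> a\<bar> / h) + (\<bar>y' ^ (2 * k) - y ^ (2 * k)\<bar> * \<bar>pw \<rho> a + pw \<rho> b\<bar> / h) / 2"
    using h by (simp add: field_simps)
  also have "\<dots> \<le> (y ^ (2 * k) + y' ^ (2 * k)) / 2 * (D / (2 * h\<^sup>2) + (1 + 2 * \<rho>)\<^sup>2 / (2 * c0) * (Gam a powr (N + 1) + Gam b powr (N + 1)))
     + (2 * (2 * real k * L) * ((y ^ ?p + y' ^ ?p) * (Gam a powr (N + 1) + Gam b powr (N + 1)))) / 2"
    using y by (intro add_mono mult_left_mono divide_right_mono first second) auto
  also have "\<dots> = (y ^ (2 * k) + y' ^ (2 * k)) * D / (4 * h\<^sup>2)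
     + (1 + 2 * \<rho>)\<^sup>2 / (4 * c0) * ((y ^ (2 * k) + y' ^ (2 * k)) * (Gam a powr (N + 1) + Gam b powr (N + 1)))
     + 2 * real k * L * ((y ^ ?p + y' ^ ?p) * (Gam a powr (N + 1) + Gam b powr (N + 1)))"
  proof -
    have "w / 2 * (D / (2 * r) + q / (2 * c0) * g) + (2 * (2 * real k * L) * (t * g)) / 2
      = w * D / (4 * r) + q / (4 * c0) * (w * g) + 2 * real k * L * (t * g)" for w D r q g t
      by (simp add: algebra_simps)
    then show ?thesis .
  qed
  also have "\<dots> \<le> (y ^ (2 * k) + y' ^ (2 * k)) * D / (4 * h\<^sup>2)
     + (1 + 2 * \<rho>)\<^sup>2 / (4 * c0) * ((y ^ ?p + y' ^ ?p) * (Gam a powr (N + 1) + Gam b powr (N + 1)))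
     + 2 * real k * L * ((y ^ ?p + y' ^ ?p) * (Gam a powr (N + 1) + Gam b powr (N + 1)))"
    using c0 y by (intro add_mono mult_left_mono mult_right_mono low) auto
  also have "\<dots> = (y ^ (2 * k) + y' ^ (2 * k)) * D / (4 * h\<^sup>2) + C2 * ((y ^ ?p + y' ^ ?p) * (Gam a powr (N + 1) + Gam b powr (N + 1)))"
    unfolding C2_def by (simp only: distrib_right add.assoc)
  finally show ?thesis unfolding a_def b_def y_def y'_def D_def .
qed

definition "A2 = 1 + M * ((C1 * L\<^sup>2 * real CARD('n) + C2) * edge_const k (N + 1) L M)"

text \<open>Since \<open>Gam\<close> is 1 + v^2, the power N + 1 + \<tau> equals \<open>Gam\<close>
  to the power \<rho> plus v times \<open>pw \<rho> v\<close>. In the second term \<open>v\<close>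
  is a difference quotient of \<open>u\<close>, so the difference passes to the other factor and |u|
  \<le> M remains; \<open>edge_increment\<close> and \<open>caccioppoli\<close> then give only the
  power N + 1.\<close>

lemma higher_power_le:
  "(\<Sum>z\<in>S. \<eta> z ^ (2 * k) * Gam (v z) powr (N + 1 + \<tau>)) \<le> A2 * (Y + card E)"
proof -
  let ?\<chi> = "\<lambda>z. \<eta> z ^ (2 * k) * pw \<rho> (v z)"
  let ?W = "\<lambda>z. (\<eta> z ^ (2 * k) + \<eta> (z + e one) ^ (2 * k)) * (\<Delta> one z * (pw N (v (z + e one)) - pw N (v z)))"
  let ?A1 = "edge_const k (N + 1) L M"
  have Y: "0 \<le> Y" unfolding Y_def using \<eta>(1) by (intro sum_nonneg mult_nonneg_nonneg) auto
  have c0: "c0 > 0" unfolding c0_def using c by simp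
  have C2: "0 \<le> C2" unfolding C2_def using c0 L by simp
  have parts: "(\<Sum>z\<in>S. v z * ?\<chi> z) = (\<Sum>z\<in>S. u (z + e one) * (?\<chi> z - ?\<chi> (z + e one)) / h)"
  proof -
    have "(\<Sum>z\<in>S. u (z + e one) * ?\<chi> (z + e one)) = (\<Sum>z\<in>S. u z * ?\<chi> z)"
    proof (rule sum_translate[OF S(1)])
      fix z assume "u z * ?\<chi> z \<noteq> 0"
      then have "z \<in> E" using \<eta>(3)[of z] k by (auto simp: power_0_left)
      then show "z \<in> S \<and> z - e one \<in> S" using S(2) by blast
    qed
    then have "(\<Sum>z\<in>S. u (z + e one) * (?\<chi> z - ?\<chi> (z + e one)) / h) = (\<Sum>z\<in>S. (u (z + e one) * ?\<chi> z - u z * ?\<chi> z) / h)"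
      by (simp add: sum_divide_distrib[symmetric] right_diff_distrib sum_subtractf)
    also have "\<dots> = (\<Sum>z\<in>S. v z * ?\<chi> z)"
      by (intro sum.cong refl) (simp add: v_def left_diff_distrib)
    finally show ?thesis by simp
  qed
  have "(\<Sum>z\<in>S. v z * ?\<chi> z) \<le> (\<Sum>z\<in>S. M * (?W z / (4 * h\<^sup>2) + C2 * X one z))"
    unfolding parts
  proof (rule sum_mono)
    fix z
    have "u (z + e one) * (?\<chi> z - ?\<chi> (z + e one)) / h \<le> \<bar>u (z + e one)\<bar> * (\<bar>?\<chi> (z + e one) - ?\<chi> z\<bar> / h)"
    proof -
      have "u (z + e one) * (?\<chi> z - ?\<chi> (z + e one)) \<le> \<bar>u (z + e one)\<bar> * \<bar>?\<chi> (z + e one) - ?\<chi> z\<bar>"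
        using abs_ge_self[of "u (z + e one) * (?\<chi> z - ?\<chi> (z + e one))"] by (simp only: abs_mult abs_minus_commute)
      then show ?thesis using h by (simp add: divide_right_mono)
    qed
    also have "\<dots> \<le> M * (?W z / (4 * h\<^sup>2) + C2 * X one z)"
      using h by (intro mult_mono u edge_increment M_nonneg) auto
    finally show "u (z + e one) * (?\<chi> z - ?\<chi> (z + e one)) / h \<le> M * (?W z / (4 * h\<^sup>2) + C2 * X one z)" .
  qed
  also have "\<dots> = M * ((\<Sum>z\<in>S. ?W z) / (4 * h\<^sup>2) + C2 * (\<Sum>z\<in>S. X one z))"
    by (simp add: sum_distrib_left[symmetric] sum.distrib sum_divide_distrib[symmetric])
  also have "\<dots> \<le> M * ((4 * C1 * (h * L)\<^sup>2 * (real CARD('n) * (?A1 * (Y + card E)))) / (4 * h\<^sup>2) + C2 * (?A1 * (Y + card E)))"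
    using C2 M_nonneg by (intro mult_left_mono add_mono divide_right_mono caccioppoli edge_sum) auto
  also have "(4 * C1 * (h * L)\<^sup>2 * (real CARD('n) * (?A1 * (Y + card E)))) / (4 * h\<^sup>2) = C1 * L\<^sup>2 * real CARD('n) * (?A1 * (Y + card E))"
    using h by (simp add: power_mult_distrib)
  finally have main: "(\<Sum>z\<in>S. v z * ?\<chi> z) \<le> (A2 - 1) * (Y + card E)"
    by (simp add: A2_def algebra_simps)
  have "(\<Sum>z\<in>S. \<eta> z ^ (2 * k) * Gam (v z) powr (N + 1 + \<tau>)) = (\<Sum>z\<in>S. \<eta> z ^ (2 * k) * Gam (v z) powr \<rho> + v z * ?\<chi> z)"
  proof (intro sum.cong refl)
    fix z
    have "Gam (v z) powr (N + 1 + \<tau>) = Gam (v z) * Gam (v z) powr \<rho>"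
    proof -
      have "N + 1 + \<tau> = 1 + \<rho>" by (simp add: \<rho>_def)
      then show ?thesis using Gam_pos[of "v z"] by (simp only: powr_add powr_one)
    qed
    also have "\<dots> = Gam (v z) powr \<rho> + v z * pw \<rho> (v z)"
      by (simp add: pw_def) (simp add: Gam_def algebra_simps power2_eq_square)
    finally show "\<eta> z ^ (2 * k) * Gam (v z) powr (N + 1 + \<tau>) = \<eta> z ^ (2 * k) * Gam (v z) powr \<rho> + v z * ?\<chi> z"
      by (simp add: algebra_simps)
  qed
  also have "\<dots> = (\<Sum>z\<in>S. \<eta> z ^ (2 * k) * Gam (v z) powr \<rho>) + (\<Sum>z\<in>S. v z * ?\<chi> z)"
    by (rule sum.distrib)
  also have "(\<Sum>z\<in>S. \<eta> z ^ (2 * k) * Gam (v z) powr \<rho>) \<le> Y"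
    unfolding Y_def
  proof (intro sum_mono mult_mono)
    show "\<eta> z ^ (2 * k) \<le> \<eta> z ^ (2 * k - 2)" for z using \<eta> by (intro power_decreasing) auto
    show "Gam (v z) powr \<rho> \<le> Gam (v z) powr (N + 1)" for z
      using \<tau> Gam_ge_1 by (intro powr_mono) (auto simp: \<rho>_def)
  qed (use \<eta> in auto)
  finally have "(\<Sum>z\<in>S. \<eta> z ^ (2 * k) * Gam (v z) powr (N + 1 + \<tau>)) \<le> Y + (A2 - 1) * (Y + card E)" using main by linarith
  then show ?thesis by (simp add: algebra_simps)
qed

definition "higher_const = 2 * A2 * ((2 * A2) powr ((N + 1) / \<tau>) + 1)"

text \<open>\<open>higher_power_le\<close> bounds the higher power by the lower one
  \<open>Y\<close>, and \<open>young_absorb\<close> bounds \<open>Y\<close> by a small multiple of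
  the higher power plus a constant per node. As all sums are finite, the absorption is legitimate
  without any prior estimate.\<close>

theorem higher_integrability:
  "(\<Sum>z\<in>S. \<eta> z ^ (2 * k) * Gam (v z) powr (N + 1 + \<tau>)) \<le> higher_const * card E"
proof -
  let ?H = "\<Sum>z\<in>S. \<eta> z ^ (2 * k) * Gam (v z) powr (N + 1 + \<tau>)"
  have c0: "c0 > 0" unfolding c0_def using c by simp
  have A2: "1 \<le> A2" unfolding A2_def using M_nonneg L c c0
    by (simp add: C1_def C2_def edge_const_def)
  \<comment> \<open>Chosen so that A2 times \<epsilon> equals 1/2 and half of the left side can be
    absorbed.\<close>
  define \<epsilon> where "\<epsilon> = 1 / (2 * A2)"
  have \<epsilon>: "\<epsilon> > 0" "1 / \<epsilon> = 2 * A2" using A2 by (auto simp: \<epsilon>_def)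
  have restrict: "(\<Sum>z\<in>S. f z) = (\<Sum>z\<in>E. f z)" if "\<And>z. z \<notin> E \<Longrightarrow> f z = 0" for f :: "'a \<Rightarrow> real"
    using S that by (intro sum.mono_neutral_right) auto
  have zero: "\<eta> z = 0" if "z \<notin> E" for z using \<eta>(3) that by blast
  have "Y = (\<Sum>z\<in>E. \<eta> z ^ (2 * k - 2) * Gam (v z) powr (N + 1))"
    unfolding Y_def by (rule restrict) (use zero k in \<open>auto simp: power_0_left\<close>)
  also have "\<dots> \<le> (\<Sum>z\<in>E. \<epsilon> * (\<eta> z ^ (2 * k) * Gam (v z) powr (N + 1 + \<tau>)) + (1 / \<epsilon>) powr ((N + 1) / \<tau>))"
    by (intro sum_mono young_absorb) (use Gam_ge_1 \<eta> \<tau> N k \<epsilon> in auto)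
  also have "\<dots> = \<epsilon> * (\<Sum>z\<in>E. \<eta> z ^ (2 * k) * Gam (v z) powr (N + 1 + \<tau>)) + card E * (1 / \<epsilon>) powr ((N + 1) / \<tau>)"
    by (simp add: sum.distrib sum_distrib_left)
  also have "(\<Sum>z\<in>E. \<eta> z ^ (2 * k) * Gam (v z) powr (N + 1 + \<tau>)) = ?H"
    by (rule restrict[symmetric]) (use zero k in \<open>auto simp: power_0_left\<close>)
  finally have "Y \<le> \<epsilon> * ?H + card E * (2 * A2) powr ((N + 1) / \<tau>)" unfolding \<epsilon> .
  then have "?H \<le> A2 * ((\<epsilon> * ?H + card E * (2 * A2) powr ((N + 1) / \<tau>)) + card E)"
    using higher_power_le A2 by (smt (verit) mult_left_mono)
  also have "\<dots> = ?H / 2 + A2 * ((2 * A2) powr ((N + 1) / \<tau>) + 1) * card E"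
    using A2 by (simp add: \<epsilon>_def field_simps)
  finally show ?thesis by (simp add: higher_const_def)
qed

end

section \<open>Sampling and interpolation\<close>

definition clamp_abs :: "real \<Rightarrow> real \<Rightarrow> real" where "clamp_abs M x = max (- M) (min M x)"

lemma clamp_abs_props:
  assumes "0 \<le> M"
  shows "\<bar>clamp_abs M x\<bar> \<le> M" "\<bar>x\<bar> \<le> M \<Longrightarrow> clamp_abs M x = x" "\<bar>clamp_abs M x\<bar> \<le> \<bar>x\<bar>"
    "a \<le> b \<Longrightarrow> 0 \<le> clamp_abs M b - clamp_abs M a" "a \<le> b \<Longrightarrow> clamp_abs M b - clamp_abs M a \<le> b - a"
  using assms by (auto simp: clamp_abs_def max_def min_def)

definition lattice_energy ::
  "('n::finite \<Rightarrow> real \<Rightarrow> real) \<Rightarrow> ('n \<Rightarrow> 'a::ab_group_add) \<Rightarrow> real \<Rightarrow> 'a set \<Rightarrow> ('a \<Rightarrow> real) \<Rightarrow> real" where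
  "lattice_energy F e h S w = (\<Sum>i\<in>UNIV. \<Sum>z\<in>S. F i ((w (z + e i) - w z) / h))"

text \<open>Truncation shrinks each increment towards 0 without changing its sign, and the densities
  are smallest at 0 and monotone on either side.\<close>

lemma lattice_energy_clamp:
  assumes "\<And>i s t. 0 \<le> s \<Longrightarrow> s \<le> t \<Longrightarrow> F i s \<le> F i t" "\<And>i s t. t \<le> s \<Longrightarrow> s \<le> 0 \<Longrightarrow> F i s \<le> F i t"
    and h: "0 < h" and M: "0 \<le> M"
  shows "lattice_energy F e h S (\<lambda>z. clamp_abs M (w z)) \<le> lattice_energy F e h S w"
  unfolding lattice_energy_def
proof (intro sum_mono)
  fix i z
  let ?a = "w z" and ?b = "w (z + e i)"
  show "F i ((clamp_abs M ?b - clamp_abs M ?a) / h) \<le> F i ((?b - ?a) / h)"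
  proof (cases "?a \<le> ?b")
    case True
    then show ?thesis using clamp_abs_props(4,5)[OF M True] h by (intro assms(1) divide_right_mono) auto
  next
    case False
    then have "?b \<le> ?a" by simp
    from clamp_abs_props(4,5)[OF M this] h show ?thesis
      by (intro assms(2) divide_right_mono) (auto simp: divide_le_0_iff)
  qed
qed

text \<open>A continuous function attains its minimum on a compact product of intervals. Restricting
  the values to [-M, M] costs nothing: the truncation of any competitor keeps the prescribed values,
  which are bounded by \<open>M\<close>, and does not raise the energy.\<close>

lemma lattice_minimiser_exists:
  fixes F :: "'n::finite \<Rightarrow> real \<Rightarrow> real" and e :: "'n \<Rightarrow> 'a::ab_group_add"
  assumes cont: "\<And>i. continuous_on UNIV (F i)"
    and mono: "\<And>i s t. 0 \<le> s \<Longrightarrow> s \<le> t \<Longrightarrow> F i s \<le> F i t" "\<And>i s t. t \<le> s \<Longrightarrow> s \<le> 0 \<Longrightarrow> F i s \<le> F i t"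
    and h: "0 < h" and M: "0 \<le> M" and g: "\<And>z. \<bar>g z\<bar> \<le> M"
  obtains u where "\<And>z. z \<notin> P \<Longrightarrow> u z = g z" "\<And>z. \<bar>u z\<bar> \<le> M"
    "\<And>w. (\<And>z. z \<notin> P \<Longrightarrow> w z = g z) \<Longrightarrow> lattice_energy F e h S u \<le> lattice_energy F e h S w"
proof -
  \<comment> \<open>Free values on \<open>P\<close>, one-point factors elsewhere. The product is
    compact by Tychonoff's theorem even though the lattice is infinite; the energy sees finitely
    many coordinates only.\<close>
  define B where "B = (\<Pi>\<^sub>E z\<in>UNIV. if z \<in> P then {- M..M} else {g z})"
  have "compactin (product_topology (\<lambda>_. euclidean) UNIV) B"
    unfolding B_def compactin_PiE by auto
  then have "compact B" by (simp add: euclidean_product_topology)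
  moreover have gB: "g \<in> B" using g by (auto simp: B_def abs_le_iff minus_le_iff)
  moreover have "continuous_on B (lattice_energy F e h S)"
    unfolding lattice_energy_def
    by (intro continuous_on_sum continuous_on_compose2[OF cont] continuous_intros
        continuous_on_subset[OF continuous_on_product_coordinates]) (use h in auto)
  ultimately obtain u where u: "u \<in> B" "\<And>w. w \<in> B \<Longrightarrow> lattice_energy F e h S u \<le> lattice_energy F e h S w"
    using continuous_attains_inf[of B "lattice_energy F e h S"] by blast
  have uB: "u z \<in> (if z \<in> P then {- M..M} else {g z})" for z
    using u(1) unfolding B_def by (rule PiE_mem) simp
  show thesis
  proof
    show "u z = g z" if "z \<notin> P" for z using uB[of z] that by simp
    show "\<bar>u z\<bar> \<le> M" for z using uB[of z] g[of z] by (auto split: if_splits)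
    fix w assume w: "\<And>z. z \<notin> P \<Longrightarrow> w z = g z"
    have "(\<lambda>z. clamp_abs M (w z)) \<in> B"
    proof -
      have "clamp_abs M (w z) \<in> (if z \<in> P then {- M..M} else {g z})" for z
        using clamp_abs_props(1)[OF M, of "w z"] clamp_abs_props(2)[OF M g[of z]] w[of z]
        by (auto simp: abs_le_iff minus_le_iff)
      then show ?thesis by (auto simp: B_def)
    qed
    then have "lattice_energy F e h S u \<le> lattice_energy F e h S (\<lambda>z. clamp_abs M (w z))" by (rule u(2))
    also have "\<dots> \<le> lattice_energy F e h S w" by (rule lattice_energy_clamp[OF mono h M])
    finally show "lattice_energy F e h S u \<le> lattice_energy F e h S w" .
  qed
qed

lemma lattice_minimiser_euler:
  assumes F: "\<And>i t. (F i has_real_derivative F' i t) (at t)" and h: "0 < h"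
    and min: "\<And>w. (\<And>z. z \<notin> P \<Longrightarrow> w z = u z) \<Longrightarrow> lattice_energy F e h S u \<le> lattice_energy F e h S w"
    and \<phi>: "\<And>z. \<phi> z \<noteq> 0 \<Longrightarrow> z \<in> P"
  shows "(\<Sum>i\<in>UNIV. \<Sum>z\<in>S. F' i ((u (z + e i) - u z) / h) * (\<phi> (z + e i) - \<phi> z)) = 0"
proof -
  define G where "G t = lattice_energy F e h S (\<lambda>z. u z + t * \<phi> z)" for t
  let ?D = "\<Sum>i\<in>UNIV. \<Sum>z\<in>S. F' i ((u (z + e i) - u z) / h) * ((\<phi> (z + e i) - \<phi> z) / h)"
  have "(G has_real_derivative ?D) (at 0)"
    unfolding G_def lattice_energy_def
  proof (intro DERIV_sum)
    fix i z
    have "((\<lambda>t. (u (z + e i) + t * \<phi> (z + e i) - (u z + t * \<phi> z)) / h) has_real_derivative (\<phi> (z + e i) - \<phi> z) / h) (at 0)"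
      using h by (auto intro!: derivative_eq_intros)
    moreover have "(F i has_real_derivative F' i ((u (z + e i) - u z) / h)) (at ((u (z + e i) + 0 * \<phi> (z + e i) - (u z + 0 * \<phi> z)) / h))"
      using F by simp
    ultimately show "((\<lambda>t. F i ((u (z + e i) + t * \<phi> (z + e i) - (u z + t * \<phi> z)) / h)) has_real_derivative
        F' i ((u (z + e i) - u z) / h) * ((\<phi> (z + e i) - \<phi> z) / h)) (at 0)"
      by (rule DERIV_chain2[rotated])
  qed
  moreover have "G 0 \<le> G t" for t
  proof -
    have "lattice_energy F e h S u \<le> G t" unfolding G_def by (rule min) (use \<phi> in auto)
    then show ?thesis by (simp add: G_def)
  qed
  ultimately have "?D = 0" using DERIV_local_min[of G ?D 0 1] by auto
  also have "?D = (\<Sum>i\<in>UNIV. \<Sum>z\<in>S. F' i ((u (z + e i) - u z) / h) * (\<phi> (z + e i) - \<phi> z)) / h"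
    by (simp add: sum_divide_distrib)
  finally show ?thesis using h by simp
qed

definition covers :: "real \<Rightarrow> real \<Rightarrow> (int ^ 'n) set \<Rightarrow> bool" where
  "covers h R S \<longleftrightarrow> finite S \<and> (\<forall>z. (\<forall>i. \<bar>h * real_of_int (z $ i)\<bar> \<le> R) \<longrightarrow> z \<in> S)"

lemma covers_exists:
  assumes "h > 0" obtains S :: "(int ^ 'n) set" where "covers h R S"
proof -
  obtain N where N: "\<And>z::int ^ 'n. (\<forall>i. \<bar>(0 - lat z) $ i\<bar> \<le> R / h) \<Longrightarrow> z \<in> zbox N"
    using real_bounded_in_zbox[of 0 "R / h"] by blast
  have "covers h R (zbox N :: (int ^ 'n) set)"
    unfolding covers_def
  proof (intro conjI allI impI N)
    fix z :: "int ^ 'n" and i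
    assume "\<forall>i. \<bar>h * real_of_int (z $ i)\<bar> \<le> R"
    then show "\<bar>(0 - lat z) $ i\<bar> \<le> R / h" using assms by (simp add: abs_mult pos_le_divide_eq mult.commute)
  qed simp
  then show thesis using that by blast
qed

section \<open>Averaging on the lattice and interpolating back\<close>

definition samp :: "(real ^ 'n \<Rightarrow> real) \<Rightarrow> real \<Rightarrow> (real ^ 'n \<Rightarrow> real) \<Rightarrow> int ^ 'n \<Rightarrow> real" where
  "samp q h V z = (\<integral>x. V x * q ((1/h) *\<^sub>R x - lat z) \<partial>lebesgue) / h ^ CARD('n)"

definition intp :: "(real ^ 'n \<Rightarrow> real) \<Rightarrow> real \<Rightarrow> (int ^ 'n) set \<Rightarrow> (int ^ 'n \<Rightarrow> real) \<Rightarrow> real ^ 'n \<Rightarrow> real" where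
  "intp p h S w x = (\<Sum>z\<in>S. w z * p ((1/h) *\<^sub>R x - lat z))"

lemma kern_scaled_measurable:
  assumes "kern p" shows "(\<lambda>x. p ((1/h) *\<^sub>R x - lat z)) \<in> borel_measurable lebesgue"
  by (intro measurable_completion) (simp add: borel_measurable_continuous_onI[OF kern_scaled_continuous[OF assms]])

lemma samp_integrable:
  assumes "kern q" "integrable lebesgue V"
  shows "integrable lebesgue (\<lambda>x. V x * q ((1/h) *\<^sub>R x - lat z))"
proof (rule Bochner_Integration.integrable_bound[OF assms(2)])
  show "(\<lambda>x. V x * q ((1/h) *\<^sub>R x - lat z)) \<in> borel_measurable lebesgue"
    using assms kern_scaled_measurable by (intro borel_measurable_times) auto
  show "AE x in lebesgue. norm (V x * q ((1/h) *\<^sub>R x - lat z)) \<le> norm (V x)"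
    using kernD(2)[OF assms(1)] kern_le_1[OF assms(1)] by (auto simp: abs_mult mult_left_le)
qed

lemma intp_integrable:
  assumes "kern p" "h > 0" shows "integrable lebesgue (intp p h S w)"
  unfolding intp_def by (intro Bochner_Integration.integrable_sum integrable_mult_right kern_scaled_integrable assms)

lemma integral_intp:
  fixes S :: "(int ^ 'n) set"
  assumes "kern p" "h > 0"
  shows "(\<integral>x. intp p h S w x \<partial>lebesgue) = h ^ CARD('n) * (\<Sum>z\<in>S. w z)"
  unfolding intp_def
  by (subst Bochner_Integration.integral_sum)
    (auto intro!: integrable_mult_right kern_scaled_integrable assms simp: integral_kern_scaled[OF assms] sum_distrib_right mult.commute)

lemma abs_intp_le: "kern p \<Longrightarrow> \<bar>intp p h S w x\<bar> \<le> intp p h S (\<lambda>z. \<bar>w z\<bar>) x"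
  unfolding intp_def by (intro order.trans[OF sum_abs] sum_mono) (simp add: abs_mult kernD)

lemma intp_bound:
  assumes p: "kern p" "finite S" and "\<And>z. z \<in> S \<Longrightarrow> \<bar>w z\<bar> \<le> M" "0 \<le> M"
  shows "\<bar>intp p h S w x\<bar> \<le> M"
proof -
  have "\<bar>intp p h S w x\<bar> \<le> (\<Sum>z\<in>S. \<bar>w z\<bar> * p ((1/h) *\<^sub>R x - lat z))"
    using abs_intp_le[OF p(1)] by (simp add: intp_def)
  also have "\<dots> \<le> (\<Sum>z\<in>S. M * p ((1/h) *\<^sub>R x - lat z))"
    by (intro sum_mono mult_right_mono assms kernD)
  also have "\<dots> = M * (\<Sum>z\<in>S. p ((1/h) *\<^sub>R x - lat z))" by (simp add: sum_distrib_left)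
  also have "\<dots> \<le> M * 1" by (intro mult_left_mono kern_sum_le_1 assms)
  finally show ?thesis by simp
qed

text \<open>The missing mass is placed at the value 0, where \<open>F\<close> vanishes. This is
  needed near the boundary of \<open>S\<close>, where the kernels need not sum to one.\<close>

lemma jensen_subprobability:
  fixes F :: "real \<Rightarrow> real"
  assumes "convex_on UNIV F" "F 0 = 0" "finite S" "\<And>z. z \<in> S \<Longrightarrow> 0 \<le> p z" "sum p S \<le> 1"
  shows "F (\<Sum>z\<in>S. w z * p z) \<le> (\<Sum>z\<in>S. F (w z) * p z)"
proof -
  define a where "a z = (case z of None \<Rightarrow> 1 - sum p S | Some z \<Rightarrow> p z)" for z
  define y where "y z = (case z of None \<Rightarrow> 0 | Some z \<Rightarrow> w z)" for z
  let ?S = "insert None (Some ` S)"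
  have sums: "(\<Sum>z\<in>?S. f z) = f None + (\<Sum>z\<in>S. f (Some z))" for f :: "_ \<Rightarrow> real"
    using assms(3) by (subst sum.insert) (auto simp: sum.reindex)
  have "F (\<Sum>z\<in>?S. a z *\<^sub>R y z) \<le> (\<Sum>z\<in>?S. a z * F (y z))"
    by (rule convex_on_sum[OF _ _ assms(1)]) (use assms in \<open>auto simp: sums a_def\<close>)
  then show ?thesis unfolding sums by (simp add: a_def y_def assms(2) mult.commute)
qed

lemma intp_jensen:
  fixes F :: "real \<Rightarrow> real" and S :: "(int ^ 'n) set"
  assumes F: "convex_on UNIV F" "F 0 = 0" and p: "kern p" and S: "finite S"
  shows "F (intp p h S w x) \<le> intp p h S (\<lambda>z. F (w z)) x"
  unfolding intp_def by (rule jensen_subprobability[OF F S]) (auto intro: kernD[OF p] kern_sum_le_1[OF p S])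

lemma samp_diff:
  assumes "kern q" "integrable lebesgue V" "integrable lebesgue W"
  shows "samp q h (\<lambda>x. V x - W x) z = samp q h V z - samp q h W z"
  unfolding samp_def left_diff_distrib
  by (subst Bochner_Integration.integral_diff) (auto intro!: samp_integrable assms simp: diff_divide_distrib)

lemma abs_samp_le:
  assumes "kern q" "integrable lebesgue V" "h > 0"
  shows "\<bar>samp q h V z\<bar> \<le> samp q h (\<lambda>x. \<bar>V x\<bar>) z"
proof -
  have "\<bar>\<integral>x. V x * q ((1/h) *\<^sub>R x - lat z) \<partial>lebesgue\<bar> \<le> (\<integral>x. \<bar>V x * q ((1/h) *\<^sub>R x - lat z)\<bar> \<partial>lebesgue)"
    by (rule integral_abs_bound)
  then show ?thesis unfolding samp_def using assms(3) by (simp add: abs_mult kernD[OF assms(1)] divide_right_mono)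
qed

lemma samp_local_bound:
  fixes V :: "real ^ 'n \<Rightarrow> real"
  assumes q: "kern q" and h: "h > 0" and V: "integrable lebesgue V"
    and b: "AE x in lebesgue. q ((1/h) *\<^sub>R x - lat z) \<noteq> 0 \<longrightarrow> \<bar>V x - c\<bar> \<le> M"
  shows "\<bar>samp q h V z - c\<bar> \<le> M"
proof -
  let ?q = "\<lambda>x. q ((1/h) *\<^sub>R x - lat z)"
  have i: "(\<integral>x. (V x - c) * ?q x \<partial>lebesgue) = (\<integral>x. V x * ?q x \<partial>lebesgue) - c * h ^ CARD('n)"
    unfolding left_diff_distrib
    by (subst Bochner_Integration.integral_diff)
      (auto intro!: samp_integrable V q integrable_mult_right kern_scaled_integrable h simp: integral_kern_scaled[OF q h])
  have int: "integrable lebesgue (\<lambda>x. (V x - c) * ?q x)"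
    unfolding left_diff_distrib
    by (intro Bochner_Integration.integrable_diff samp_integrable V q integrable_mult_right kern_scaled_integrable h)
  have "\<bar>\<integral>x. (V x - c) * ?q x \<partial>lebesgue\<bar> \<le> (\<integral>x. \<bar>(V x - c) * ?q x\<bar> \<partial>lebesgue)" by (rule integral_abs_bound)
  also have "\<dots> \<le> (\<integral>x. M * ?q x \<partial>lebesgue)"
  proof (rule integral_mono_AE)
    show "AE x in lebesgue. \<bar>(V x - c) * ?q x\<bar> \<le> M * ?q x"
      using b
    proof eventually_elim
      case (elim x)
      then show ?case using kernD(2)[OF q, of "(1/h) *\<^sub>R x - lat z"]
        by (cases "?q x = 0") (auto simp: abs_mult mult_right_mono)
    qed
  qed (use int in \<open>auto intro!: integrable_mult_right kern_scaled_integrable q h\<close>)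
  also have "\<dots> = M * h ^ CARD('n)" by (simp add: integral_kern_scaled[OF q h])
  finally have "\<bar>(\<integral>x. V x * ?q x \<partial>lebesgue) - c * h ^ CARD('n)\<bar> \<le> M * h ^ CARD('n)" unfolding i .
  then have "\<bar>(\<integral>x. V x * ?q x \<partial>lebesgue) - c * h ^ CARD('n)\<bar> / h ^ CARD('n) \<le> M"
    using h by (simp add: divide_le_eq)
  moreover have "samp q h V z - c = ((\<integral>x. V x * ?q x \<partial>lebesgue) - c * h ^ CARD('n)) / h ^ CARD('n)"
    using h by (simp add: samp_def field_simps)
  ultimately show ?thesis using h by (simp add: abs_divide)
qed

lemma samp_eq_0:
  assumes "kern q" "\<And>x. q ((1/h) *\<^sub>R x - lat z) \<noteq> 0 \<Longrightarrow> V x = 0"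
  shows "samp q h V z = 0"
proof -
  have "(\<lambda>x. V x * q ((1/h) *\<^sub>R x - lat z)) = (\<lambda>_. 0)" using assms(2) by (auto simp: fun_eq_iff)
  then show ?thesis by (simp add: samp_def)
qed

lemma sum_samp_le:
  fixes V :: "real ^ 'n \<Rightarrow> real"
  assumes q: "kern q" and h: "h > 0" and V: "integrable lebesgue V" "\<And>x. 0 \<le> V x" and S: "finite S"
  shows "h ^ CARD('n) * (\<Sum>z\<in>S. samp q h V z) \<le> (\<integral>x. V x \<partial>lebesgue)"
proof -
  have "h ^ CARD('n) * (\<Sum>z\<in>S. samp q h V z) = (\<Sum>z\<in>S. \<integral>x. V x * q ((1/h) *\<^sub>R x - lat z) \<partial>lebesgue)"
    unfolding samp_def sum_divide_distrib[symmetric] using h by simp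
  also have "\<dots> = (\<integral>x. (\<Sum>z\<in>S. V x * q ((1/h) *\<^sub>R x - lat z)) \<partial>lebesgue)"
    by (rule Bochner_Integration.integral_sum[symmetric]) (intro samp_integrable q V)
  also have "\<dots> \<le> (\<integral>x. V x \<partial>lebesgue)"
  proof (rule Bochner_Integration.integral_mono)
    show "(\<Sum>z\<in>S. V x * q ((1/h) *\<^sub>R x - lat z)) \<le> V x" for x
      using kern_sum_le_1[OF q S, of "(1/h) *\<^sub>R x"] V(2)[of x] by (simp add: sum_distrib_left[symmetric] mult_left_le)
  qed (auto intro!: Bochner_Integration.integrable_sum samp_integrable q V)
  finally show ?thesis .
qed

text \<open>Jensen's inequality by integrating the supporting line at the sampled mean
  \<open>?m\<close>; the kernel divided by h^n is a probability density.\<close>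

lemma samp_jensen:
  fixes V :: "real ^ 'n \<Rightarrow> real"
  assumes q: "kern q" and h: "h > 0" and V: "integrable lebesgue V" "integrable lebesgue (\<lambda>x. F (V x))"
    and tangent: "\<And>m y. F y \<ge> F m + D m * (y - m)"
  shows "F (samp q h V z) \<le> samp q h (\<lambda>x. F (V x)) z"
proof -
  let ?q = "\<lambda>x. q ((1/h) *\<^sub>R x - lat z)" and ?m = "samp q h V z" and ?n = "CARD('n)"
  have hn: "h ^ ?n > 0" using h by simp
  have "(\<integral>x. (F ?m - D ?m * ?m) * ?q x + D ?m * (V x * ?q x) \<partial>lebesgue) \<le> (\<integral>x. F (V x) * ?q x \<partial>lebesgue)"
  proof (rule Bochner_Integration.integral_mono)
    fix x
    have "(F ?m + D ?m * (V x - ?m)) * ?q x \<le> F (V x) * ?q x"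
      by (intro mult_right_mono tangent kernD[OF q])
    then show "(F ?m - D ?m * ?m) * ?q x + D ?m * (V x * ?q x) \<le> F (V x) * ?q x" by (simp add: algebra_simps)
  qed (auto intro!: Bochner_Integration.integrable_add integrable_mult_right samp_integrable kern_scaled_integrable q V h)
  also have "(\<integral>x. (F ?m - D ?m * ?m) * ?q x + D ?m * (V x * ?q x) \<partial>lebesgue)
    = (F ?m - D ?m * ?m) * h ^ ?n + D ?m * (\<integral>x. V x * ?q x \<partial>lebesgue)"
    by (subst Bochner_Integration.integral_add)
      (auto intro!: integrable_mult_right samp_integrable kern_scaled_integrable q V h simp: integral_kern_scaled[OF q h])
  also have "(\<integral>x. V x * ?q x \<partial>lebesgue) = ?m * h ^ ?n" using h unfolding samp_def by simp
  finally have "F ?m * h ^ ?n \<le> (\<integral>x. F (V x) * ?q x \<partial>lebesgue)" by (simp add: algebra_simps)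
  then show ?thesis using hn unfolding samp_def[of q h "\<lambda>x. F (V x)"] by (simp add: le_divide_eq)
qed

text \<open>The translated kernels sum to at most one and each has integral h^n, so sampling
  followed by interpolation does not increase the L1 norm. This uniform stability carries
  convergence from continuous functions to all integrable ones.\<close>

lemma intp_samp_L1:
  fixes V :: "real ^ 'n \<Rightarrow> real"
  assumes p: "kern p" and q: "kern q" and h: "h > 0" and V: "integrable lebesgue V" and S: "finite S"
  shows "(\<integral>x. \<bar>intp p h S (samp q h V) x\<bar> \<partial>lebesgue) \<le> (\<integral>x. \<bar>V x\<bar> \<partial>lebesgue)"
proof -
  have "(\<integral>x. \<bar>intp p h S (samp q h V) x\<bar> \<partial>lebesgue) \<le> (\<integral>x. intp p h S (\<lambda>z. \<bar>samp q h V z\<bar>) x \<partial>lebesgue)"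
    by (intro Bochner_Integration.integral_mono abs_intp_le p integrable_abs intp_integrable h)
  also have "\<dots> = h ^ CARD('n) * (\<Sum>z\<in>S. \<bar>samp q h V z\<bar>)" by (rule integral_intp[OF p h])
  also have "\<dots> \<le> h ^ CARD('n) * (\<Sum>z\<in>S. samp q h (\<lambda>x. \<bar>V x\<bar>) z)"
    using h by (intro mult_left_mono sum_mono abs_samp_le q V) auto
  also have "\<dots> \<le> (\<integral>x. \<bar>V x\<bar> \<partial>lebesgue)"
    by (rule sum_samp_le[OF q h _ _ S]) (use V in auto)
  finally show ?thesis .
qed

lemma intp_samp_local:
  assumes p: "kern p" and q: "kern q" and h: "h > 0" and "p ((1/h) *\<^sub>R x - lat z) \<noteq> 0" "q ((1/h) *\<^sub>R y - lat z) \<noteq> 0"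
  shows "\<bar>x $ i - y $ i\<bar> \<le> 6 * h"
  using kern_scaled_support[OF p h assms(4), of i] kern_scaled_support[OF q h assms(5), of i] by linarith

lemma norm_le_sup: 
  fixes x :: "real ^ 'n"
  assumes "\<And>i. \<bar>x $ i\<bar> \<le> a" shows "norm x \<le> real CARD('n) * a"
  using norm_le_l1_cart[of x] sum_bounded_above[of UNIV "\<lambda>i. \<bar>x $ i\<bar>" a] assms by simp

text \<open>Two kernels meeting in one node see points within 6h of each other in every coordinate,
  so uniform continuity makes the error small. The radii add the reach 3h \<le> 3 of a kernel once
  more at each stage: points in the cube of radius R + 6, nodes within R + 9, sampled points within
  R + 12.\<close>

lemma intp_samp_continuous:
  fixes f :: "real ^ 'n \<Rightarrow> real"
  assumes p: "kern p" and q: "kern q" and f: "continuous_on UNIV f" "\<And>x. x \<notin> cube R \<Longrightarrow> f x = 0" and \<epsilon>: "\<epsilon> > 0" and R: "R \<ge> 0"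
  shows "\<exists>h0>0. h0 \<le> 1 \<and> (\<forall>h S. 0 < h \<and> h < h0 \<and> covers h (R + 9) S \<longrightarrow>
     (\<integral>x. \<bar>f x - intp p h S (samp q h f) x\<bar> \<partial>lebesgue) < \<epsilon>)"
proof -
  let ?n = "CARD('n)"
  define V where "V = (2 * (R + 6)) ^ ?n"
  have V: "V > 0" unfolding V_def using R by simp
  define \<delta> where "\<delta> = \<epsilon> / (2 * V)"
  have \<delta>: "\<delta> > 0" using \<epsilon> V by (simp add: \<delta>_def)
  have fint: "integrable lebesgue f"
    by (rule integrable_compact_support[OF f(1) compact_cbox]) (use f(2) in blast)
  have "uniformly_continuous_on (cube (R + 12)) f"
    by (rule compact_uniformly_continuous[OF continuous_on_subset[OF f(1)]]) auto
  then obtain d where d: "d > 0" "\<And>x y. x \<in> cube (R + 12) \<Longrightarrow> y \<in> cube (R + 12) \<Longrightarrow> dist y x < d \<Longrightarrow> dist (f y) (f x) < \<delta>"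
    unfolding uniformly_continuous_on_def using \<delta> by metis
  \<comment> \<open>The divisor converts the coordinatewise distance 6h into a Euclidean distance
    below \<open>d\<close>.\<close>
  define h0 where "h0 = min 1 (d / (6 * real ?n + 1))"
  have h0: "h0 > 0" "h0 \<le> 1" using d(1) by (auto simp: h0_def intro!: divide_pos_pos add_nonneg_pos)
  have "(\<integral>x. \<bar>f x - intp p h S (samp q h f) x\<bar> \<partial>lebesgue) < \<epsilon>"
    if h: "0 < h" "h < h0" and S: "covers h (R + 9) S" for h S
  proof -
    have h1: "h \<le> 1" using h h0 by simp
    have finS: "finite S" using S by (simp add: covers_def)
    have hd: "real ?n * (6 * h) < d"
    proof -
      have "h < d / (6 * real ?n + 1)" using h by (simp add: h0_def)
      moreover have "0 < 6 * real ?n + 1" by (intro add_nonneg_pos) auto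
      ultimately have "h * (6 * real ?n + 1) < d" by (simp add: pos_less_divide_eq)
      then show ?thesis using h by (simp add: algebra_simps)
    qed
    have bound: "\<bar>f x - intp p h S (samp q h f) x\<bar> \<le> \<delta> * indicator (cube (R + 6)) x" for x
    proof (cases "x \<in> cube (R + 6)")
      case True
      have one: "(\<Sum>z\<in>S. p ((1/h) *\<^sub>R x - lat z)) = 1"
      proof (rule kernD(4)[OF p finS])
        fix z assume nz: "p ((1/h) *\<^sub>R x - lat z) \<noteq> 0"
        have "\<bar>h * real_of_int (z $ i)\<bar> \<le> R + 9" for i
          using kern_scaled_support[OF p h(1) nz, of i] True[unfolded mem_cube, rule_format, of i] h1 by linarith
        then show "z \<in> S" using S unfolding covers_def by blast
      qed
      have "\<bar>samp q h f z - f x\<bar> \<le> \<delta>" if pz: "p ((1/h) *\<^sub>R x - lat z) \<noteq> 0" for z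
      proof (rule samp_local_bound[OF q h(1) fint], intro AE_I2 impI)
        fix y assume "q ((1/h) *\<^sub>R y - lat z) \<noteq> 0"
        then have close: "\<bar>x $ i - y $ i\<bar> \<le> 6 * h" for i using intp_samp_local[OF p q h(1) pz] by blast
        have "norm (y - x) \<le> real ?n * (6 * h)"
          by (rule norm_le_sup) (use close in \<open>simp add: abs_minus_commute\<close>)
        then have 1: "dist y x < d" using hd by (simp add: dist_norm)
        have 2: "x \<in> cube (R + 12)" unfolding mem_cube
        proof
          fix i show "\<bar>x $ i\<bar> \<le> R + 12" using True[unfolded mem_cube, rule_format, of i] by linarith
        qed
        have 3: "y \<in> cube (R + 12)" unfolding mem_cube
        proof
          fix i show "\<bar>y $ i\<bar> \<le> R + 12" using close[of i] True[unfolded mem_cube, rule_format, of i] h1 by linarith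
        qed
        have "dist (f y) (f x) < \<delta>" by (rule d(2)[OF 2 3 1])
        then show "\<bar>f y - f x\<bar> \<le> \<delta>" by (simp add: dist_real_def)
      qed
      then have "\<bar>(samp q h f z - f x) * p ((1/h) *\<^sub>R x - lat z)\<bar> \<le> \<delta> * p ((1/h) *\<^sub>R x - lat z)" for z
        using kernD(2)[OF p, of "(1/h) *\<^sub>R x - lat z"]
        by (cases "p ((1/h) *\<^sub>R x - lat z) = 0") (auto simp: abs_mult mult_right_mono)
      then have "(\<Sum>z\<in>S. \<bar>(samp q h f z - f x) * p ((1/h) *\<^sub>R x - lat z)\<bar>) \<le> (\<Sum>z\<in>S. \<delta> * p ((1/h) *\<^sub>R x - lat z))"
        by (intro sum_mono)
      also have "\<dots> = \<delta>" by (simp add: sum_distrib_left[symmetric] one)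
      finally have "\<bar>\<Sum>z\<in>S. (samp q h f z - f x) * p ((1/h) *\<^sub>R x - lat z)\<bar> \<le> \<delta>"
        by (rule order_trans[OF sum_abs])
      also have "(\<Sum>z\<in>S. (samp q h f z - f x) * p ((1/h) *\<^sub>R x - lat z)) = intp p h S (samp q h f) x - f x"
        by (simp add: intp_def left_diff_distrib sum_subtractf sum_distrib_left[symmetric] one)
      finally show ?thesis using True by (simp add: abs_minus_commute)
    next
      case False
      then obtain i where i: "\<bar>x $ i\<bar> > R + 6" unfolding mem_cube by (auto simp: not_le)
      have "samp q h f z = 0" if pz: "p ((1/h) *\<^sub>R x - lat z) \<noteq> 0" for z
      proof (rule samp_eq_0[OF q])
        fix y assume "q ((1/h) *\<^sub>R y - lat z) \<noteq> 0"
        then have "\<bar>x $ i - y $ i\<bar> \<le> 6 * h" using intp_samp_local[OF p q h(1) pz] by blast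
        then have "\<bar>y $ i\<bar> > R" using i h1 by linarith
        then have "y \<notin> cube R" unfolding mem_cube by (meson not_le)
        then show "f y = 0" by (rule f(2))
      qed
      then have "intp p h S (samp q h f) x = 0" unfolding intp_def by (intro sum.neutral) auto
      moreover have "x \<notin> cube R"
      proof
        assume "x \<in> cube R"
        then have "\<bar>x $ i\<bar> \<le> R" unfolding mem_cube by blast
        with i show False by simp
      qed
      ultimately show ?thesis using f(2) False by simp
    qed
    have "(\<integral>x. \<bar>f x - intp p h S (samp q h f) x\<bar> \<partial>lebesgue) \<le> (\<integral>x. \<delta> * indicator (cube (R + 6) :: (real ^ 'n) set) x \<partial>lebesgue)"
      by (intro Bochner_Integration.integral_mono bound integrable_abs Bochner_Integration.integrable_diff fint intp_integrable p h
          integrable_mult_right integrable_indicator_cube)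
    also have "\<dots> = \<delta> * V" unfolding V_def using R by (subst integral_mult_right_zero, subst integral_indicator_cube) auto
    also have "\<dots> < \<epsilon>" using \<epsilon> V by (simp add: \<delta>_def)
    finally show ?thesis .
  qed
  then show ?thesis using h0 by blast
qed

text \<open>Truncation at height \<open>m\<close> costs little by dominated convergence. A
  measurable function is an almost everywhere limit of continuous ones; these, truncated at the same
  height and multiplied by a continuous cut-off of the cube, are dominated as well.\<close>

lemma L1_continuous_approximation:
  fixes V :: "real ^ 'n \<Rightarrow> real"
  assumes V: "integrable lebesgue V" "\<And>x. x \<notin> cube R \<Longrightarrow> V x = 0" and \<epsilon>: "\<epsilon> > 0"
  obtains f where "continuous_on UNIV f" "\<And>x. x \<notin> cube (R + 1) \<Longrightarrow> f x = 0" "(\<integral>x. \<bar>V x - f x\<bar> \<partial>lebesgue) < \<epsilon>"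
proof (cases "cube R = ({} :: (real ^ 'n) set)")
  case True
  then have "V = (\<lambda>_. 0)" using V(2) by auto
  then show thesis using that[of "\<lambda>_. 0"] \<epsilon> by simp
next
  case ne: False
  have Vm: "V \<in> borel_measurable lebesgue" using V by auto
  have "(\<lambda>m. \<integral>x. \<bar>V x - clamp_abs (real m) (V x)\<bar> \<partial>lebesgue) \<longlonglongrightarrow> (\<integral>x. 0 \<partial>(lebesgue :: (real ^ 'n) measure))"
  proof (rule integral_dominated_convergence[where w="\<lambda>x. 2 * \<bar>V x\<bar>"])
    show "AE x in lebesgue. (\<lambda>m. \<bar>V x - clamp_abs (real m) (V x)\<bar>) \<longlonglongrightarrow> 0"
    proof (rule AE_I2)
      fix x
      have "eventually (\<lambda>m. \<bar>V x - clamp_abs (real m) (V x)\<bar> = 0) sequentially"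
        using eventually_ge_at_top[of "nat \<lceil>\<bar>V x\<bar>\<rceil>"]
      proof eventually_elim
        case (elim m)
        then have "\<bar>V x\<bar> \<le> real m" by linarith
        then show ?case by (simp add: clamp_abs_props)
      qed
      then show "(\<lambda>m. \<bar>V x - clamp_abs (real m) (V x)\<bar>) \<longlonglongrightarrow> 0" by (rule tendsto_eventually)
    qed
    show "AE x in lebesgue. norm \<bar>V x - clamp_abs (real m) (V x)\<bar> \<le> 2 * \<bar>V x\<bar>" for m
      using clamp_abs_props(3)[of "real m"] by (intro AE_I2) (smt (verit) of_nat_0_le_iff real_norm_def)
  qed (use V Vm in \<open>auto simp: clamp_abs_def\<close>)
  then have "eventually (\<lambda>m. (\<integral>x. \<bar>V x - clamp_abs (real m) (V x)\<bar> \<partial>lebesgue) < \<epsilon> / 2) sequentially"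
    using order_tendstoD(2)[where a="\<epsilon> / 2"] \<epsilon> by fastforce
  then obtain m where m: "(\<integral>x. \<bar>V x - clamp_abs (real m) (V x)\<bar> \<partial>lebesgue) < \<epsilon> / 2"
    using eventually_happens'[of sequentially] by auto
  obtain N g where g: "negligible N" "\<And>n. continuous_on UNIV (g n :: real ^ 'n \<Rightarrow> real)"
    "\<And>x. x \<notin> N \<Longrightarrow> (\<lambda>n. g n x) \<longlonglongrightarrow> V x"
    using lebesgue_measurable_imp_measurable_on_real[OF Vm, of UNIV] unfolding measurable_on_def by auto
  define \<zeta> :: "real ^ 'n \<Rightarrow> real" where "\<zeta> x = max 0 (1 - infdist x (cube R))" for x
  have \<zeta>: "continuous_on UNIV \<zeta>" "\<And>x. 0 \<le> \<zeta> x" "\<And>x. \<zeta> x \<le> 1"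
    unfolding \<zeta>_def by (auto intro!: continuous_intros simp: infdist_nonneg)
  have \<zeta>1: "\<zeta> x = 1" if "x \<in> cube R" for x using that by (simp add: \<zeta>_def)
  have \<zeta>0: "\<zeta> x = 0" if out: "x \<notin> cube (R + 1)" for x
  proof -
    obtain i where i: "\<bar>x $ i\<bar> > R + 1" using out mem_cube[of x "R + 1"] by (meson not_le)
    have "1 \<le> infdist x (cube R)"
      unfolding infdist_notempty[OF ne]
    proof (rule cINF_greatest[OF ne])
      fix y :: "real ^ 'n" assume "y \<in> cube R"
      then have "\<bar>y $ i\<bar> \<le> R" unfolding mem_cube by blast
      then have "1 \<le> \<bar>(x - y) $ i\<bar>" using i by simp
      also have "\<dots> \<le> dist x y" unfolding dist_norm by (rule component_le_norm_cart)
      finally show "1 \<le> dist x y" .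
    qed
    then show ?thesis by (simp add: \<zeta>_def)
  qed
  define f where "f n x = clamp_abs (real m) (g n x) * \<zeta> x" for n x
  have fc: "continuous_on UNIV (f n)" for n
    unfolding f_def clamp_abs_def by (intro continuous_intros g \<zeta>)
  have f0: "f n x = 0" if "x \<notin> cube (R + 1)" for n x using \<zeta>0[OF that] by (simp add: f_def)
  have fint: "integrable lebesgue (f n)" for n
    by (rule integrable_compact_support[OF fc compact_cbox]) (use f0 in blast)
  have "(\<lambda>n. \<integral>x. \<bar>clamp_abs (real m) (V x) - f n x\<bar> \<partial>lebesgue) \<longlonglongrightarrow> (\<integral>x. 0 \<partial>(lebesgue :: (real ^ 'n) measure))"
  proof (rule integral_dominated_convergence[where w="\<lambda>x. \<bar>V x\<bar> + real m * indicator (cube (R + 1)) x"])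
    have "AE x in lebesgue. x \<notin> N" using g(1) by (simp add: AE_not_in negligible_iff_null_sets)
    then show "AE x in lebesgue. (\<lambda>n. \<bar>clamp_abs (real m) (V x) - f n x\<bar>) \<longlonglongrightarrow> 0"
    proof eventually_elim
      case (elim x)
      have "(\<lambda>n. f n x) \<longlonglongrightarrow> clamp_abs (real m) (V x) * \<zeta> x"
        unfolding f_def clamp_abs_def by (intro tendsto_intros tendsto_max tendsto_min g(3) elim)
      moreover have "clamp_abs (real m) (V x) * \<zeta> x = clamp_abs (real m) (V x)"
        using \<zeta>1[of x] V(2)[of x] by (cases "x \<in> cube R") (auto simp: clamp_abs_def)
      ultimately have "(\<lambda>n. \<bar>clamp_abs (real m) (V x) - f n x\<bar>) \<longlonglongrightarrow> \<bar>clamp_abs (real m) (V x) - clamp_abs (real m) (V x)\<bar>"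
        by (intro tendsto_intros) simp
      then show ?case by simp
    qed
    show "AE x in lebesgue. norm \<bar>clamp_abs (real m) (V x) - f n x\<bar> \<le> \<bar>V x\<bar> + real m * indicator (cube (R + 1)) x" for n
    proof (rule AE_I2)
      fix x
      have "\<bar>f n x\<bar> \<le> real m * indicator (cube (R + 1)) x"
      proof (cases "x \<in> cube (R + 1)")
        case True
        have "\<bar>f n x\<bar> \<le> real m * 1"
          unfolding f_def abs_mult using \<zeta>(2,3)[of x] by (intro mult_mono clamp_abs_props(1)) auto
        then show ?thesis using True by simp
      qed (simp add: f0)
      moreover have "\<bar>clamp_abs (real m) (V x)\<bar> \<le> \<bar>V x\<bar>" by (rule clamp_abs_props) simp
      ultimately show "norm \<bar>clamp_abs (real m) (V x) - f n x\<bar> \<le> \<bar>V x\<bar> + real m * indicator (cube (R + 1)) x"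
        by simp
    qed
    show "integrable lebesgue (\<lambda>x::real ^ 'n. \<bar>V x\<bar> + real m * indicator (cube (R + 1)) x)"
      by (intro Bochner_Integration.integrable_add integrable_mult_right integrable_indicator_cube integrable_abs V)
    show "(\<lambda>x. \<bar>clamp_abs (real m) (V x) - f n x\<bar>) \<in> borel_measurable lebesgue" for n
      using Vm fint[of n] by (auto simp: clamp_abs_def)
  qed simp
  then have "eventually (\<lambda>n. (\<integral>x. \<bar>clamp_abs (real m) (V x) - f n x\<bar> \<partial>lebesgue) < \<epsilon> / 2) sequentially"
    using order_tendstoD(2)[where a="\<epsilon> / 2"] \<epsilon> by fastforce
  then obtain n where n: "(\<integral>x. \<bar>clamp_abs (real m) (V x) - f n x\<bar> \<partial>lebesgue) < \<epsilon> / 2"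
    using eventually_happens'[of sequentially] by auto
  have cint: "integrable lebesgue (\<lambda>x. clamp_abs (real m) (V x))"
    by (rule Bochner_Integration.integrable_bound[OF V(1)])
      (use Vm in \<open>auto simp: clamp_abs_props(3) clamp_abs_def[abs_def] intro!: AE_I2\<close>)
  have "(\<integral>x. \<bar>V x - f n x\<bar> \<partial>lebesgue) \<le> (\<integral>x. \<bar>V x - clamp_abs (real m) (V x)\<bar> + \<bar>clamp_abs (real m) (V x) - f n x\<bar> \<partial>lebesgue)"
    by (rule Bochner_Integration.integral_mono) (use V cint fint in \<open>auto intro!: Bochner_Integration.integrable_add\<close>)
  also have "\<dots> = (\<integral>x. \<bar>V x - clamp_abs (real m) (V x)\<bar> \<partial>lebesgue) + (\<integral>x. \<bar>clamp_abs (real m) (V x) - f n x\<bar> \<partial>lebesgue)"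
    by (rule Bochner_Integration.integral_add) (use V cint fint in auto)
  also have "\<dots> < \<epsilon>" using m n by simp
  finally show thesis using that[of "f n"] fc f0 by blast
qed

text \<open>Density argument: split \<open>V\<close> into a continuous function of compact support
  and an L1-small remainder, whose image stays small by \<open>intp_samp_L1\<close>.\<close>

proposition intp_samp_converges:
  fixes V :: "real ^ 'n \<Rightarrow> real"
  assumes p: "kern p" and q: "kern q" and V: "integrable lebesgue V" "\<And>x. x \<notin> cube R \<Longrightarrow> V x = 0" and \<epsilon>: "\<epsilon> > 0" and R: "R \<ge> 0"
  shows "\<exists>h0>0. h0 \<le> 1 \<and> (\<forall>h S. 0 < h \<and> h < h0 \<and> covers h (R + 10) S \<longrightarrow>
     (\<integral>x. \<bar>V x - intp p h S (samp q h V) x\<bar> \<partial>lebesgue) < \<epsilon>)"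
proof -
  obtain f where f: "continuous_on UNIV f" "\<And>x. x \<notin> cube (R + 1) \<Longrightarrow> f x = 0" "(\<integral>x. \<bar>V x - f x\<bar> \<partial>lebesgue) < \<epsilon> / 3"
    by (rule L1_continuous_approximation[OF V, where \<epsilon>="\<epsilon> / 3"]) (use \<epsilon> in auto)
  have fint: "integrable lebesgue f"
    by (rule integrable_compact_support[OF f(1) compact_cbox]) (use f(2) in blast)
  obtain h0 where h0: "h0 > 0" "h0 \<le> 1"
    "\<And>h S. 0 < h \<Longrightarrow> h < h0 \<Longrightarrow> covers h (R + 1 + 9) S \<Longrightarrow> (\<integral>x. \<bar>f x - intp p h S (samp q h f) x\<bar> \<partial>lebesgue) < \<epsilon> / 3"
  proof -
    have "\<epsilon> / 3 > 0" "R + 1 \<ge> 0" using \<epsilon> R by auto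
    from intp_samp_continuous[OF p q f(1,2) this] that show thesis by blast
  qed
  have "(\<integral>x. \<bar>V x - intp p h S (samp q h V) x\<bar> \<partial>lebesgue) < \<epsilon>"
    if h: "0 < h" "h < h0" and S: "covers h (R + 10) S" for h S
  proof -
    have finS: "finite S" using S by (simp add: covers_def)
    have "R + 1 + 9 = R + 10" by simp
    then have S': "covers h (R + 1 + 9) S" using S by (simp only:)
    let ?T = "\<lambda>W. intp p h S (samp q h W)"
    have T: "?T V x = ?T f x + ?T (\<lambda>x. V x - f x) x" for x
      unfolding intp_def by (simp add: samp_diff[OF q V(1) fint] sum.distrib[symmetric] algebra_simps)
    note int = V fint intp_integrable[OF p h(1)]
    have "(\<integral>x. \<bar>V x - ?T V x\<bar> \<partial>lebesgue) \<le> (\<integral>x. \<bar>V x - f x\<bar> + \<bar>f x - ?T f x\<bar> + \<bar>?T (\<lambda>x. V x - f x) x\<bar> \<partial>lebesgue)"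
    proof (rule Bochner_Integration.integral_mono)
      show "\<bar>V x - ?T V x\<bar> \<le> \<bar>V x - f x\<bar> + \<bar>f x - ?T f x\<bar> + \<bar>?T (\<lambda>x. V x - f x) x\<bar>" for x
        unfolding T[of x] by linarith
    qed (use int in \<open>auto intro!: Bochner_Integration.integrable_add integrable_abs Bochner_Integration.integrable_diff\<close>)
    also have "\<dots> = (\<integral>x. \<bar>V x - f x\<bar> \<partial>lebesgue) + (\<integral>x. \<bar>f x - ?T f x\<bar> \<partial>lebesgue) + (\<integral>x. \<bar>?T (\<lambda>x. V x - f x) x\<bar> \<partial>lebesgue)"
      by (subst Bochner_Integration.integral_add; (subst Bochner_Integration.integral_add)?)
        (use int in \<open>auto intro!: Bochner_Integration.integrable_add integrable_abs Bochner_Integration.integrable_diff\<close>)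
    also have "(\<integral>x. \<bar>?T (\<lambda>x. V x - f x) x\<bar> \<partial>lebesgue) \<le> (\<integral>x. \<bar>V x - f x\<bar> \<partial>lebesgue)"
      by (rule intp_samp_L1[OF p q h(1) _ finS]) (use int in auto)
    finally show ?thesis using f(3) h0(3)[OF h S'] by linarith
  qed
  then show ?thesis using h0(1,2) by blast
qed

section \<open>Test functions and weak derivatives\<close>

text \<open>Neighbourhoods in the maximum norm: kernel supports are boxes, and widths then add
  without dimensional constants.\<close>

definition thick :: "(real ^ 'n) set \<Rightarrow> real \<Rightarrow> (real ^ 'n) set" where
  "thick K d = {x. \<exists>y\<in>K. \<forall>i. \<bar>x $ i - y $ i\<bar> \<le> d}"

lemma thickI: "y \<in> K \<Longrightarrow> (\<And>i. \<bar>x $ i - y $ i\<bar> \<le> d) \<Longrightarrow> x \<in> thick K d"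
  unfolding thick_def by blast

lemma subset_thick: "0 \<le> d \<Longrightarrow> K \<subseteq> thick K d"
  by (auto intro: thickI)

lemma thick_mono: "K \<subseteq> K' \<Longrightarrow> d \<le> d' \<Longrightarrow> thick K d \<subseteq> thick K' d'"
  unfolding thick_def by (auto, meson order_trans subsetD)

lemma thick_thick: "thick (thick K a) b \<subseteq> thick K (a + b)"
proof
  fix x assume "x \<in> thick (thick K a) b"
  then obtain y w where "w \<in> K" "\<forall>i. \<bar>y $ i - w $ i\<bar> \<le> a" "\<forall>i. \<bar>x $ i - y $ i\<bar> \<le> b" unfolding thick_def by blast
  moreover have "\<bar>x $ i - w $ i\<bar> \<le> a + b" if "\<bar>y $ i - w $ i\<bar> \<le> a" "\<bar>x $ i - y $ i\<bar> \<le> b" for i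
    using that by linarith
  ultimately show "x \<in> thick K (a + b)"
    by (intro thickI[of w]) auto
qed

lemma compact_thick:
  assumes "compact K" shows "compact (thick K d)"
proof -
  have "thick K d = (\<Union>x\<in>K. \<Union>y\<in>cube d. {x + y})"
  proof (intro set_eqI iffI)
    fix x assume "x \<in> thick K d"
    then obtain y where "y \<in> K" "\<forall>i. \<bar>x $ i - y $ i\<bar> \<le> d" unfolding thick_def by blast
    then have "y \<in> K" "x - y \<in> cube d" unfolding mem_cube by auto
    then show "x \<in> (\<Union>x\<in>K. \<Union>y\<in>cube d. {x + y})"
      by (intro UN_I[of y] UN_I[of "x - y"]) auto
  next
    fix x assume "x \<in> (\<Union>x\<in>K. \<Union>y\<in>cube d. {x + y})"
    then obtain y w where "y \<in> K" "w \<in> cube d" "x = y + w" by blast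
    then show "x \<in> thick K d" unfolding mem_cube by (intro thickI[of y]) auto
  qed
  then show ?thesis using compact_sums'[OF assms compact_cbox] by simp
qed

lemma thick_subset_open:
  assumes "compact K" "open \<Omega>" "K \<subseteq> \<Omega>"
  obtains d where "d > 0" "thick K d \<subseteq> (\<Omega> :: (real ^ 'n) set)"
proof -
  obtain \<epsilon> where \<epsilon>: "\<epsilon> > 0" "(\<Union>x\<in>K. cball x \<epsilon>) \<subseteq> \<Omega>"
    using compact_subset_open_imp_cball_epsilon_subset[OF assms] by blast
  define d where "d = \<epsilon> / real CARD('n)"
  have "d > 0" using \<epsilon> by (simp add: d_def)
  moreover have "thick K d \<subseteq> \<Omega>"
  proof
    fix x assume "x \<in> thick K d"
    then obtain y where y: "y \<in> K" "\<And>i. \<bar>x $ i - y $ i\<bar> \<le> d" unfolding thick_def by blast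
    have "norm (x - y) \<le> real CARD('n) * d" by (rule norm_le_sup) (use y(2) in simp)
    then have "x \<in> cball y \<epsilon>" by (simp add: d_def dist_norm norm_minus_commute)
    with y(1) \<epsilon>(2) show "x \<in> \<Omega>" by blast
  qed
  ultimately show thesis using that by blast
qed

lemma test_functionD:
  assumes "test_function \<Omega> \<phi>"
  shows "smooth \<phi>" "compact (closure {x. \<phi> x \<noteq> 0})" "closure {x. \<phi> x \<noteq> 0} \<subseteq> \<Omega>"
    "\<phi> x \<noteq> 0 \<Longrightarrow> x \<in> closure {x. \<phi> x \<noteq> 0}" "x \<notin> \<Omega> \<Longrightarrow> \<phi> x = 0"
proof -
  show "smooth \<phi>" "compact (closure {x. \<phi> x \<noteq> 0})" and sub: "closure {x. \<phi> x \<noteq> 0} \<subseteq> \<Omega>"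
    using assms by (simp_all add: test_function_def)
  show mem: "x \<in> closure {x. \<phi> x \<noteq> 0}" if "\<phi> x \<noteq> 0" using that closure_subset[of "{x. \<phi> x \<noteq> 0}"] by blast
  show "\<phi> x = 0" if "x \<notin> \<Omega>" using that mem sub by blast
qed

lemma test_functionI:
  assumes "smooth \<phi>" "compact K" "K \<subseteq> \<Omega>" "\<And>x. \<phi> x \<noteq> 0 \<Longrightarrow> x \<in> K"
  shows "test_function \<Omega> \<phi>"
proof -
  have "closure {x. \<phi> x \<noteq> 0} \<subseteq> K"
    using assms(2,4) compact_imp_closed by (intro closure_minimal) auto
  then show ?thesis unfolding test_function_def using assms
    by (meson bounded_subset closed_closure compact_eq_bounded_closed order_trans)
qed

lemma partial_deriv_outside:
  assumes "x \<notin> closure {x. \<phi> x \<noteq> 0}" shows "partial_deriv i \<phi> x = 0"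
proof -
  have "((\<lambda>_. 0) has_derivative (\<lambda>_. 0)) (at x)" by simp
  then have "(\<phi> has_derivative (\<lambda>_. 0)) (at x)"
  proof (rule has_derivative_transform_within_open)
    show "open (- closure {x. \<phi> x \<noteq> 0})" by (intro open_Compl closed_closure)
    show "x \<in> - closure {x. \<phi> x \<noteq> 0}" using assms by simp
    show "0 = \<phi> y" if "y \<in> - closure {x. \<phi> x \<noteq> 0}" for y
      using that closure_subset[of "{x. \<phi> x \<noteq> 0}"] by auto
  qed
  then show ?thesis using partial_deriv_eq by fastforce
qed

lemma test_function_partial_deriv:
  assumes "test_function \<Omega> \<phi>" shows "test_function \<Omega> (partial_deriv i \<phi>)"
  by (rule test_functionI[OF smooth_partial_deriv[OF test_functionD(1)[OF assms]] test_functionD(2,3)[OF assms]])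
    (use partial_deriv_outside in blast)

lemma test_function_mult_smooth:
  assumes "test_function \<Omega> \<phi>" "smooth \<psi>"
  shows "test_function \<Omega> (\<lambda>x. \<phi> x * \<psi> x)"
  by (rule test_functionI[OF smooth_mult[OF test_functionD(1)[OF assms(1)] assms(2)] test_functionD(2,3)[OF assms(1)]])
    (use test_functionD(4)[OF assms(1)] in auto)

lemma test_function_cmult: "test_function \<Omega> \<phi> \<Longrightarrow> test_function \<Omega> (\<lambda>x. c * \<phi> x)"
  using test_function_mult_smooth[OF _ smooth_const, of \<Omega> \<phi> c] by (simp add: mult.commute)

lemma test_function_add:
  assumes "test_function \<Omega> \<phi>" "test_function \<Omega> \<psi>"
  shows "test_function \<Omega> (\<lambda>x. \<phi> x + \<psi> x)"
proof (rule test_functionI)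
  show "smooth (\<lambda>x. \<phi> x + \<psi> x)" using assms by (intro smooth_add test_functionD(1))
  show "compact (closure {x. \<phi> x \<noteq> 0} \<union> closure {x. \<psi> x \<noteq> 0})" using assms by (intro compact_Un test_functionD(2))
  show "closure {x. \<phi> x \<noteq> 0} \<union> closure {x. \<psi> x \<noteq> 0} \<subseteq> \<Omega>" using assms by (intro Un_least test_functionD(3))
  show "x \<in> closure {x. \<phi> x \<noteq> 0} \<union> closure {x. \<psi> x \<noteq> 0}" if "\<phi> x + \<psi> x \<noteq> 0" for x
    using that test_functionD(4)[OF assms(1), of x] test_functionD(4)[OF assms(2), of x] by fastforce
qed

lemma test_function_zero: "test_function \<Omega> (\<lambda>_. 0)"
  by (rule test_functionI[OF smooth_const compact_empty]) auto

lemma test_function_sum: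
  "(\<And>j. j \<in> A \<Longrightarrow> test_function \<Omega> (f j)) \<Longrightarrow> test_function \<Omega> (\<lambda>x. \<Sum>j\<in>A. f j x)"
  by (induction A rule: infinite_finite_induct) (auto intro: test_function_zero test_function_add)

lemma test_function_integrable:
  assumes "test_function \<Omega> \<phi>" shows "integrable lebesgue \<phi>"
  by (rule integrable_compact_support[OF smooth_continuous_on test_functionD(2)]) (use test_functionD[OF assms] assms in blast)+

lemma test_function_bounded:
  assumes "test_function \<Omega> \<phi>" obtains C where "0 \<le> C" "\<And>x. \<bar>\<phi> x\<bar> \<le> C"
proof -
  have "bounded (\<phi> ` closure {x. \<phi> x \<noteq> 0})"
    by (intro compact_imp_bounded compact_continuous_image smooth_continuous_on test_functionD[OF assms])
  then obtain C where C: "\<And>x. x \<in> closure {x. \<phi> x \<noteq> 0} \<Longrightarrow> \<bar>\<phi> x\<bar> \<le> C"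
    unfolding bounded_iff by auto
  have "\<bar>\<phi> x\<bar> \<le> max 0 C" for x
    using C[of x] test_functionD(4)[OF assms, of x] by (cases "\<phi> x = 0") auto
  then show thesis using that[of "max 0 C"] by auto
qed

lemma line_has_derivative:
  assumes "smooth \<theta>"
  shows "((\<lambda>t. \<theta> (x + t *\<^sub>R axis i 1)) has_real_derivative partial_deriv i \<theta> (x + t *\<^sub>R axis i 1)) (at t)"
proof -
  let ?D = "frechet_derivative \<theta> (at (x + t *\<^sub>R axis i 1))"
  have D: "(\<theta> has_derivative ?D) (at (x + t *\<^sub>R axis i 1))" by (rule smooth_has_derivative) fact
  have "((\<lambda>t. \<theta> (x + t *\<^sub>R axis i 1)) has_derivative (\<lambda>s. ?D (s *\<^sub>R axis i 1))) (at t)"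
    by (rule has_derivative_compose[of "\<lambda>t. x + t *\<^sub>R axis i 1" "\<lambda>s. s *\<^sub>R axis i 1" t UNIV \<theta> ?D])
      (use D in \<open>auto intro!: derivative_eq_intros\<close>)
  moreover have "?D (s *\<^sub>R axis i 1) = partial_deriv i \<theta> (x + t *\<^sub>R axis i 1) * s" for s
    using linear_scale[OF has_derivative_linear[OF D]] by (simp add: partial_deriv_def)
  ultimately show ?thesis by (simp add: has_field_derivative_def)
qed

text \<open>The integrals of the difference quotients vanish by translation invariance.\<close>

lemma integral_partial_deriv_eq_0:
  fixes \<theta> :: "real ^ 'n \<Rightarrow> real"
  assumes \<theta>: "test_function \<Omega> \<theta>"
  shows "(\<integral>x. partial_deriv i \<theta> x \<partial>lebesgue) = 0"
proof -
  let ?K = "closure {x. \<theta> x \<noteq> 0}" and ?e = "axis i 1 :: real ^ 'n"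
  obtain C where C: "0 \<le> C" "\<And>x. \<bar>partial_deriv i \<theta> x\<bar> \<le> C"
    using test_function_bounded[OF test_function_partial_deriv[OF \<theta>]] by blast
  define t where "t n = 1 / (real n + 1)" for n
  have t: "0 < t n" "t n \<le> 1" for n by (auto simp: t_def)
  define s where "s n x = (\<theta> (x + t n *\<^sub>R ?e) - \<theta> x) / t n" for n x
  have cont: "continuous_on UNIV \<theta>" by (rule smooth_continuous_on[OF test_functionD(1)[OF \<theta>]])
  have tint: "integrable lebesgue \<theta>" by (rule test_function_integrable) fact
  have mb: "\<theta> \<in> borel_measurable borel" using cont by (rule borel_measurable_continuous_onI)
  have mshift: "(\<lambda>x. \<theta> (x + a)) \<in> borel_measurable borel" for a
    by (rule borel_measurable_continuous_onI, rule continuous_on_compose2[OF cont]) (auto intro!: continuous_intros)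
  have zero: "s n x = 0" if "x \<notin> thick ?K 1" for n x
  proof -
    have "x + a *\<^sub>R ?e \<notin> ?K" if "0 \<le> a" "a \<le> 1" for a
    proof
      assume "x + a *\<^sub>R ?e \<in> ?K"
      then have "x \<in> thick ?K 1" by (rule thickI) (use that in \<open>auto simp: axis_def\<close>)
      with \<open>x \<notin> thick ?K 1\<close> show False by simp
    qed
    from this[of "t n"] this[of 0] have "\<theta> (x + t n *\<^sub>R ?e) = 0" "\<theta> x = 0"
      using t[of n] test_functionD(4)[OF \<theta>] by (auto simp del: closure_closure)
    then show ?thesis by (simp add: s_def)
  qed
  have bd: "\<bar>s n x\<bar> \<le> C" for n x
  proof -
    obtain \<xi> where "\<theta> (x + t n *\<^sub>R ?e) - \<theta> (x + 0 *\<^sub>R ?e) = (t n - 0) * partial_deriv i \<theta> (x + \<xi> *\<^sub>R ?e)"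
      using MVT2[OF t(1)[of n] line_has_derivative[OF test_functionD(1)[OF \<theta>], of x i]] by blast
    then have "s n x = partial_deriv i \<theta> (x + \<xi> *\<^sub>R ?e)" using t[of n] by (simp add: s_def)
    then show ?thesis using C by simp
  qed
  have "(\<lambda>n. \<integral>x. s n x \<partial>lebesgue) \<longlonglongrightarrow> (\<integral>x. partial_deriv i \<theta> x \<partial>lebesgue)"
  proof (rule integral_dominated_convergence[where w="\<lambda>x. C * indicator (thick ?K 1) x"])
    show "partial_deriv i \<theta> \<in> borel_measurable lebesgue"
      using test_function_integrable[OF test_function_partial_deriv[OF \<theta>]] by auto
    show "s n \<in> borel_measurable lebesgue" for n
      unfolding s_def by (intro measurable_completion borel_measurable_divide borel_measurable_diff) (simp_all add: mb mshift)
    have "thick ?K 1 \<in> lmeasurable" by (rule lmeasurable_compact[OF compact_thick[OF test_functionD(2)[OF \<theta>]]])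
    then show "integrable lebesgue (\<lambda>x. C * indicator (thick ?K 1) x :: real)"
      by (intro integrable_mult_right integrable_real_indicator) (auto simp: fmeasurable_def)
    show "AE x in lebesgue. norm (s n x) \<le> C * indicator (thick ?K 1) x" for n
      using bd zero C by (intro AE_I2) (auto simp: indicator_def)
    show "AE x in lebesgue. (\<lambda>n. s n x) \<longlonglongrightarrow> partial_deriv i \<theta> x"
    proof (rule AE_I2)
      fix x
      have "((\<lambda>h. (\<theta> (x + (0 + h) *\<^sub>R ?e) - \<theta> (x + 0 *\<^sub>R ?e)) / h) \<longlongrightarrow> partial_deriv i \<theta> (x + 0 *\<^sub>R ?e)) (at 0)"
        using line_has_derivative[OF test_functionD(1)[OF \<theta>], of x i 0] unfolding DERIV_def .
      moreover have "filterlim t (at 0) sequentially"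
      proof (rule filterlim_atI)
        show "t \<longlonglongrightarrow> 0" unfolding t_def by real_asymp
        show "eventually (\<lambda>n. t n \<noteq> 0) sequentially" using t(1) by (auto intro!: always_eventually simp: less_imp_neq[symmetric])
      qed
      ultimately show "(\<lambda>n. s n x) \<longlonglongrightarrow> partial_deriv i \<theta> x"
        unfolding s_def using filterlim_compose by fastforce
    qed
  qed
  moreover have "(\<integral>x. s n x \<partial>lebesgue) = 0" for n
  proof -
    have shift: "(\<integral>x. \<theta> (x + a) \<partial>lebesgue) = (\<integral>x. \<theta> x \<partial>lebesgue)" for a
      using integral_affine_lborel[OF mb, of 1 a] mb mshift by (subst (1 2) integral_completion) auto
    have "integrable lborel (\<lambda>x. \<theta> (x + a))" for a
    proof -
      have "(\<lambda>x. \<theta> (x + a)) = (\<lambda>x. \<theta> (1 *\<^sub>R x + a))" by simp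
      have "compact ((\<lambda>x. x - a) ` ?K)"
        by (intro compact_continuous_image continuous_intros test_functionD(2)[OF \<theta>])
      moreover have "continuous_on UNIV (\<lambda>x. \<theta> (x + a))"
        by (rule continuous_on_compose2[OF cont]) (auto intro!: continuous_intros)
      moreover have "x \<in> (\<lambda>x. x - a) ` ?K" if "\<theta> (x + a) \<noteq> 0" for x
        using test_functionD(4)[OF \<theta> that] by (intro image_eqI[of _ _ "x + a"]) auto
      ultimately show ?thesis by (intro integrable_compact_support) auto
    qed
    then have "integrable lebesgue (\<lambda>x. \<theta> (x + a))" for a using mshift by (simp add: integrable_completion)
    then show ?thesis unfolding s_def using tint by (simp add: shift)
  qed
  ultimately show ?thesis by (simp add: LIMSEQ_const_iff)
qed

lemma integration_by_parts:
  assumes \<phi>: "test_function \<Omega> \<phi>" and \<theta>: "smooth \<theta>"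
  shows "(\<integral>x. \<phi> x * partial_deriv i \<theta> x \<partial>lebesgue) = - (\<integral>x. partial_deriv i \<phi> x * \<theta> x \<partial>lebesgue)"
proof -
  have "(\<integral>x. partial_deriv i (\<lambda>x. \<phi> x * \<theta> x) x \<partial>lebesgue) = 0"
    by (rule integral_partial_deriv_eq_0[OF test_function_mult_smooth[OF \<phi> \<theta>]])
  also have "(\<lambda>x. partial_deriv i (\<lambda>x. \<phi> x * \<theta> x) x) = (\<lambda>x. \<phi> x * partial_deriv i \<theta> x + partial_deriv i \<phi> x * \<theta> x)"
    by (intro ext partial_deriv_mult smooth_differentiable \<theta> test_functionD(1)[OF \<phi>])
  also have "(\<integral>x. \<phi> x * partial_deriv i \<theta> x + partial_deriv i \<phi> x * \<theta> x \<partial>lebesgue) =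
    (\<integral>x. \<phi> x * partial_deriv i \<theta> x \<partial>lebesgue) + (\<integral>x. partial_deriv i \<phi> x * \<theta> x \<partial>lebesgue)"
    by (intro Bochner_Integration.integral_add test_function_integrable[of \<Omega>] test_function_mult_smooth[of \<Omega>]
        test_function_partial_deriv[of \<Omega>] \<phi> smooth_partial_deriv \<theta>)
  finally show ?thesis by linarith
qed

lemma finite_lattice_bounded:
  assumes "compact K" "h > 0" shows "finite {z :: int ^ 'n. h *\<^sub>R lat z \<in> K}"
proof -
  obtain B where B: "\<And>x. x \<in> K \<Longrightarrow> norm x \<le> B" using compact_imp_bounded[OF assms(1)] unfolding bounded_iff by blast
  obtain N where N: "\<And>z::int ^ 'n. (\<forall>i. \<bar>(0 - lat z) $ i\<bar> \<le> B / h) \<Longrightarrow> z \<in> zbox N"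
    using real_bounded_in_zbox[of 0 "B / h"] by blast
  have "{z :: int ^ 'n. h *\<^sub>R lat z \<in> K} \<subseteq> zbox N"
  proof
    fix z :: "int ^ 'n" assume "z \<in> {z. h *\<^sub>R lat z \<in> K}"
    then have "norm (h *\<^sub>R lat z) \<le> B" using B by blast
    then have "\<bar>(h *\<^sub>R lat z) $ i\<bar> \<le> B" for i using component_le_norm_cart order_trans by blast
    then show "z \<in> zbox N" using assms(2) by (intro N) (auto simp: abs_mult pos_le_divide_eq mult.commute)
  qed
  then show ?thesis using finite_subset finite_zbox by blast
qed

lemma smooth_kern_scaled: "smooth p \<Longrightarrow> smooth (\<lambda>x. p ((1/h) *\<^sub>R x - lat z))"
  using smooth_affine[of p "1/h" "- lat z"] by simp

lemma partial_deriv_kern_scaled: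
  assumes "smooth p"
  shows "partial_deriv i (\<lambda>x. p ((1/h) *\<^sub>R x - lat z)) x = (1/h) * partial_deriv i p ((1/h) *\<^sub>R x - lat z)"
  using partial_deriv_affine(1)[of p i "1/h" "- lat z" x] smooth_differentiable[OF assms] by simp

lemma kern_scaled_test_function:
  assumes "kern p" "smooth p" "h > 0" "thick {h *\<^sub>R lat z} (3 * h) \<subseteq> \<Omega>"
  shows "test_function \<Omega> (\<lambda>x. p ((1/h) *\<^sub>R x - lat z))"
  by (rule test_functionI[OF smooth_kern_scaled[OF assms(2)] compact_thick[of "{h *\<^sub>R lat z}"] assms(4)])
    (use kern_scaled_support[OF assms(1,3)] in \<open>auto intro!: thickI\<close>)

text \<open>Sum the kernels of all nodes near \<open>K\<close>: by the partition of unity the sum is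
  1 wherever no relevant node is missing, and the supports stay close to \<open>K\<close>.\<close>

lemma cutoff_exists:
  fixes \<Omega> :: "(real ^ 'n) set"
  assumes "compact K" "open \<Omega>" "K \<subseteq> \<Omega>"
  obtains \<zeta> d where "test_function \<Omega> \<zeta>" "\<And>x. 0 \<le> \<zeta> x" "\<And>x. \<zeta> x \<le> 1" "d > 0" "\<And>x. x \<in> thick K d \<Longrightarrow> \<zeta> x = 1"
    "thick K d \<subseteq> \<Omega>"
proof -
  obtain p :: "real ^ 'n \<Rightarrow> real" where p: "kern p" "smooth p"
    using lattice_kernels_exist lattice_kernels.K by blast
  obtain d where d: "d > 0" "thick K d \<subseteq> \<Omega>" using thick_subset_open[OF assms] by blast
  \<comment> \<open>Nodes lie within 4h of \<open>K\<close> and kernels reach 3h further, in total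
    7h = d. Points within \<open>h\<close> of \<open>K\<close> see only nodes within h + 3h, so none
    is missing there.\<close>
  define h where "h = d / 7"
  have h: "h > 0" using d by (simp add: h_def)
  define Z where "Z = {z :: int ^ 'n. h *\<^sub>R lat z \<in> thick K (4 * h)}"
  have finZ: "finite Z" unfolding Z_def by (rule finite_lattice_bounded[OF compact_thick[OF assms(1)] h])
  define \<zeta> where "\<zeta> x = (\<Sum>z\<in>Z. p ((1/h) *\<^sub>R x - lat z))" for x
  have sub: "thick {h *\<^sub>R lat z} (3 * h) \<subseteq> \<Omega>" if "z \<in> Z" for z
  proof -
    have "thick {h *\<^sub>R lat z} (3 * h) \<subseteq> thick (thick K (4 * h)) (3 * h)" using that by (intro thick_mono) (auto simp: Z_def)
    also have "\<dots> \<subseteq> thick K (4 * h + 3 * h)" by (rule thick_thick)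
    finally show ?thesis using d(2) by (simp add: h_def)
  qed
  show thesis
  proof
    show "test_function \<Omega> \<zeta>" unfolding \<zeta>_def using sub by (intro test_function_sum kern_scaled_test_function p h)
    show "0 \<le> \<zeta> x" for x unfolding \<zeta>_def by (intro sum_nonneg kernD(2)[OF p(1)])
    show "\<zeta> x \<le> 1" for x unfolding \<zeta>_def by (rule kern_sum_le_1[OF p(1) finZ])
    show "h > 0" by fact
    show "thick K h \<subseteq> \<Omega>" using thick_mono[of K K h d] d h by (auto simp: h_def)
    show "\<zeta> x = 1" if x: "x \<in> thick K h" for x
      unfolding \<zeta>_def
    proof (rule kernD(4)[OF p(1) finZ])
      fix z assume "p ((1/h) *\<^sub>R x - lat z) \<noteq> 0"
      then have "h *\<^sub>R lat z \<in> thick {x} (3 * h)"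
        using kern_scaled_support[OF p(1) h] by (intro thickI) (auto simp: abs_minus_commute)
      also have "\<dots> \<subseteq> thick (thick K h) (3 * h)" using x by (intro thick_mono) auto
      also have "\<dots> \<subseteq> thick K (h + 3 * h)" by (rule thick_thick)
      finally show "z \<in> Z" by (simp add: Z_def)
    qed
  qed
qed

section \<open>Zero extension, local integrability and compact exhaustion\<close>

definition zext :: "(real ^ 'n) set \<Rightarrow> (real ^ 'n \<Rightarrow> real) \<Rightarrow> real ^ 'n \<Rightarrow> real" where
  "zext \<Omega> u x = (if x \<in> \<Omega> then u x else 0)"

lemma zext_eq: "zext \<Omega> u = (\<lambda>x. indicator \<Omega> x *\<^sub>R u x)" by (auto simp: zext_def fun_eq_iff)

lemma zext_integrable: "S \<in> sets lebesgue \<Longrightarrow> integrable (lebesgue_on S) u \<longleftrightarrow> integrable lebesgue (zext S u)"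
  unfolding zext_eq by (rule integrable_restrict_space) auto

lemma zext_integral: "S \<in> sets lebesgue \<Longrightarrow> integral\<^sup>L (lebesgue_on S) u = integral\<^sup>L lebesgue (zext S u)"
  unfolding zext_eq by (rule integral_restrict_space) auto

lemma zext_measurable: "S \<in> sets lebesgue \<Longrightarrow> u \<in> borel_measurable (lebesgue_on S) \<longleftrightarrow> zext S u \<in> borel_measurable lebesgue"
  unfolding zext_eq by (rule borel_measurable_restrict_space_iff) auto

lemma Lp1_iff: "u \<in> Lp 1 S \<longleftrightarrow> integrable (lebesgue_on S) u"
  unfolding Lp_def by (auto simp: integrable_abs_iff)

lemma open_sets_lebesgue: "open S \<Longrightarrow> S \<in> sets lebesgue" for S :: "(real ^ 'n) set" by simp

lemma Lp_locD: "g \<in> Lp_loc p \<Omega> \<Longrightarrow> compact K \<Longrightarrow> K \<subseteq> \<Omega> \<Longrightarrow> g \<in> Lp p K"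
  by (simp add: Lp_loc_def)

lemma compact_sets_lebesgue: "compact S \<Longrightarrow> S \<in> sets lebesgue" for S :: "(real ^ 'n) set"
  by (simp add: borel_compact)

text \<open>Distance to the complement is expressed point by point, so that the case of an empty
  complement needs no convention; closedness is then an intersection of closed conditions.\<close>

definition exhaustion :: "(real ^ 'n) set \<Rightarrow> nat \<Rightarrow> (real ^ 'n) set" where
  "exhaustion \<Omega> k = {x. norm x \<le> real k \<and> (\<forall>y. y \<notin> \<Omega> \<longrightarrow> 1 / (real k + 1) \<le> dist x y)}"

lemma compact_exhaustion: "compact (exhaustion \<Omega> k)"
proof -
  have "exhaustion \<Omega> k = cball 0 (real k) \<inter> (\<Inter>y\<in>-\<Omega>. {x. 1 / (real k + 1) \<le> dist x y})"
    by (auto simp: exhaustion_def)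
  moreover have "closed (\<Inter>y\<in>-\<Omega>. {x. 1 / (real k + 1) \<le> dist x y})"
    by (intro closed_INT ballI closed_Collect_le continuous_intros)
  ultimately show ?thesis by (simp add: compact_Int_closed)
qed

lemma exhaustion_subset: "exhaustion \<Omega> k \<subseteq> \<Omega>"
proof
  fix x assume x: "x \<in> exhaustion \<Omega> k"
  show "x \<in> \<Omega>"
  proof (rule ccontr)
    assume "x \<notin> \<Omega>"
    then have "1 / (real k + 1) \<le> dist x x" using x unfolding exhaustion_def by blast
    then show False by (simp add: field_simps)
  qed
qed

lemma exhaustion_mono: "j \<le> k \<Longrightarrow> exhaustion \<Omega> j \<subseteq> exhaustion \<Omega> k"
proof -
  assume "j \<le> k"
  then have "1 / (real k + 1) \<le> 1 / (real j + 1)" "real j \<le> real k" by (auto intro!: frac_le)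
  then show ?thesis unfolding exhaustion_def using order_trans by blast
qed

lemma compact_subset_exhaustion:
  assumes "compact K" "open \<Omega>" "K \<subseteq> \<Omega>"
  obtains k where "K \<subseteq> exhaustion \<Omega> k"
proof -
  obtain \<epsilon> where \<epsilon>: "\<epsilon> > 0" "(\<Union>x\<in>K. cball x \<epsilon>) \<subseteq> \<Omega>"
    using compact_subset_open_imp_cball_epsilon_subset[OF assms] by blast
  obtain B where B: "\<And>x. x \<in> K \<Longrightarrow> norm x \<le> B" using compact_imp_bounded[OF assms(1)] unfolding bounded_iff by blast
  obtain k :: nat where k: "max B (1 / \<epsilon>) \<le> real k" using real_arch_simple by blast
  have "1 / (real k + 1) \<le> \<epsilon>" using k \<epsilon>(1) by (simp add: field_simps)
  moreover have "\<epsilon> \<le> dist x y" if "x \<in> K" "y \<notin> \<Omega>" for x y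
  proof (rule ccontr)
    assume "\<not> \<epsilon> \<le> dist x y"
    then have "y \<in> cball x \<epsilon>" by simp
    then show False using that \<epsilon>(2) by blast
  qed
  ultimately have "K \<subseteq> exhaustion \<Omega> k"
    unfolding exhaustion_def using B k by (fastforce intro: order_trans)
  then show thesis using that by blast
qed

lemma exhaustion_UN:
  assumes "open \<Omega>" shows "(\<Union>k. exhaustion \<Omega> k) = \<Omega>"
proof
  show "(\<Union>k. exhaustion \<Omega> k) \<subseteq> \<Omega>" using exhaustion_subset by blast
  show "\<Omega> \<subseteq> (\<Union>k. exhaustion \<Omega> k)"
  proof
    fix x assume "x \<in> \<Omega>"
    then obtain k where "{x} \<subseteq> exhaustion \<Omega> k" using compact_subset_exhaustion[of "{x}" \<Omega>] assms by auto
    then show "x \<in> (\<Union>k. exhaustion \<Omega> k)" by blast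
  qed
qed

lemma exhaustion_tendsto:
  assumes "open \<Omega>" shows "(\<lambda>k. zext (exhaustion \<Omega> k) g x) \<longlonglongrightarrow> zext \<Omega> g x"
proof (cases "x \<in> \<Omega>")
  case True
  then obtain k where k: "x \<in> exhaustion \<Omega> k" using exhaustion_UN[OF assms] by blast
  have "eventually (\<lambda>j. zext (exhaustion \<Omega> j) g x = zext \<Omega> g x) sequentially"
    using eventually_ge_at_top[of k]
  proof eventually_elim
    case (elim j)
    then have "x \<in> exhaustion \<Omega> j" using k exhaustion_mono by blast
    then show ?case using True by (simp add: zext_def)
  qed
  then show ?thesis by (rule tendsto_eventually)
next
  case False
  then have "x \<notin> exhaustion \<Omega> k" for k using exhaustion_subset by blast
  then show ?thesis using False by (simp add: zext_def)
qed

lemma Lp_loc_1_measurable: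
  assumes "open \<Omega>" "g \<in> Lp_loc 1 \<Omega>"
  shows "zext \<Omega> g \<in> borel_measurable lebesgue"
proof (rule borel_measurable_LIMSEQ_real[OF exhaustion_tendsto[OF assms(1)]])
  fix k
  have "g \<in> Lp 1 (exhaustion \<Omega> k)" by (rule Lp_locD[OF assms(2) compact_exhaustion exhaustion_subset])
  then show "zext (exhaustion \<Omega> k) g \<in> borel_measurable lebesgue"
    unfolding Lp_def using zext_measurable[OF compact_sets_lebesgue[OF compact_exhaustion]] by blast
qed

lemma Lp1_mono:
  fixes S T :: "(real ^ 'n) set" and u :: "real ^ 'n \<Rightarrow> real"
  assumes "integrable (lebesgue_on S) u" "T \<subseteq> S" "S \<in> sets lebesgue" "T \<in> sets lebesgue"
  shows "integrable (lebesgue_on T) u"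
proof -
  have "integrable lebesgue (\<lambda>x. indicator T x *\<^sub>R zext S u x)"
    using assms by (intro integrable_mult_indicator) (auto simp: zext_integrable)
  also have "(\<lambda>x. indicator T x *\<^sub>R zext S u x) = zext T u"
    using assms(2) by (auto simp: zext_def fun_eq_iff)
  finally show ?thesis using assms(4) by (simp add: zext_integrable)
qed

lemma integrable_imp_Lp_loc:
  assumes "integrable (lebesgue_on \<Omega>) u" "open \<Omega>" shows "u \<in> Lp_loc 1 \<Omega>"
  unfolding Lp_loc_def Lp1_iff using Lp1_mono[OF assms(1)] assms(2) compact_sets_lebesgue by auto

section \<open>Weak derivatives: linearity, uniqueness, test functions\<close>

lemma weak_partialD:
  assumes "has_weak_partial \<Omega> i u g" "open \<Omega>" "test_function \<Omega> \<phi>"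
  shows "(\<integral>x. zext \<Omega> u x * partial_deriv i \<phi> x \<partial>lebesgue) = - (\<integral>x. zext \<Omega> g x * \<phi> x \<partial>lebesgue)"
proof -
  have eq: "(\<integral>x. v x * w x \<partial>lebesgue_on \<Omega>) = (\<integral>x. zext \<Omega> v x * w x \<partial>lebesgue)" for v w
    unfolding zext_integral[OF open_sets_lebesgue[OF assms(2)]]
    by (rule arg_cong[where f="integral\<^sup>L lebesgue"]) (auto simp: zext_def)
  show ?thesis using assms unfolding has_weak_partial_def eq by blast
qed

lemma weak_partialI:
  assumes "open \<Omega>" "u \<in> Lp_loc 1 \<Omega>" "g \<in> Lp_loc 1 \<Omega>"
    and "\<And>\<phi>. test_function \<Omega> \<phi> \<Longrightarrow> (\<integral>x. zext \<Omega> u x * partial_deriv i \<phi> x \<partial>lebesgue) = - (\<integral>x. zext \<Omega> g x * \<phi> x \<partial>lebesgue)"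
  shows "has_weak_partial \<Omega> i u g"
proof -
  have eq: "(\<integral>x. v x * w x \<partial>lebesgue_on \<Omega>) = (\<integral>x. zext \<Omega> v x * w x \<partial>lebesgue)" for v w
    unfolding zext_integral[OF open_sets_lebesgue[OF assms(1)]]
    by (rule arg_cong[where f="integral\<^sup>L lebesgue"]) (auto simp: zext_def)
  show ?thesis using assms unfolding has_weak_partial_def eq by blast
qed

lemma Lp_loc_times_test_function:
  assumes "open \<Omega>" "u \<in> Lp_loc 1 \<Omega>" "test_function \<Omega> \<phi>"
  shows "integrable lebesgue (\<lambda>x. zext \<Omega> u x * \<phi> x)"
proof -
  let ?K = "closure {x. \<phi> x \<noteq> 0}"
  obtain C where C: "0 \<le> C" "\<And>x. \<bar>\<phi> x\<bar> \<le> C" using test_function_bounded[OF assms(3)] by blast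
  have "u \<in> Lp 1 ?K" using assms(2) test_functionD(2,3)[OF assms(3)] unfolding Lp_loc_def by blast
  then have int: "integrable lebesgue (zext ?K u)"
    unfolding Lp1_iff using zext_integrable[OF compact_sets_lebesgue[OF test_functionD(2)[OF assms(3)]]] by blast
  have "integrable lebesgue (\<lambda>x. C * zext ?K u x)" using int by simp
  then show ?thesis
  proof (rule Bochner_Integration.integrable_bound)
    show "(\<lambda>x. zext \<Omega> u x * \<phi> x) \<in> borel_measurable lebesgue"
      using Lp_loc_1_measurable[OF assms(1,2)] test_function_integrable[OF assms(3)] by auto
    show "AE x in lebesgue. norm (zext \<Omega> u x * \<phi> x) \<le> norm (C * zext ?K u x)"
    proof (rule AE_I2)
      fix x
      show "norm (zext \<Omega> u x * \<phi> x) \<le> norm (C * zext ?K u x)"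
      proof (cases "\<phi> x = 0")
        case False
        then have "x \<in> ?K" using test_functionD(4)[OF assms(3)] by blast
        moreover from this have "x \<in> \<Omega>" using test_functionD(3)[OF assms(3)] by blast
        ultimately show ?thesis using C by (simp add: zext_def abs_mult mult.commute[of C] mult_left_mono)
      qed simp
    qed
  qed
qed

lemma weak_partial_test_function:
  assumes "open \<Omega>" "test_function \<Omega> \<phi>" shows "has_weak_partial \<Omega> i \<phi> (partial_deriv i \<phi>)"
proof (rule weak_partialI[OF assms(1)])
  have zx: "zext \<Omega> \<psi> = \<psi>" if "test_function \<Omega> \<psi>" for \<psi>
    using test_functionD(5)[OF that] by (auto simp: zext_def)
  have "integrable (lebesgue_on \<Omega>) \<psi>" if "test_function \<Omega> \<psi>" for \<psi>
    using zext_integrable[OF open_sets_lebesgue[OF assms(1)]] test_function_integrable[OF that] zx[OF that] by simp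
  then show "\<phi> \<in> Lp_loc 1 \<Omega>" "partial_deriv i \<phi> \<in> Lp_loc 1 \<Omega>"
    using assms test_function_partial_deriv by (auto intro!: integrable_imp_Lp_loc)
  show "(\<integral>x. zext \<Omega> \<phi> x * partial_deriv i \<theta> x \<partial>lebesgue) = - (\<integral>x. zext \<Omega> (partial_deriv i \<phi>) x * \<theta> x \<partial>lebesgue)"
    if "test_function \<Omega> \<theta>" for \<theta>
    using integration_by_parts[OF assms(2) test_functionD(1)[OF that]]
    by (simp add: zx[OF assms(2)] zx[OF test_function_partial_deriv[OF assms(2)]])
qed

lemma Lp_loc_1_lincomb:
  assumes "u \<in> Lp_loc 1 \<Omega>" "v \<in> Lp_loc 1 \<Omega>"
  shows "(\<lambda>x. a * u x + b * v x) \<in> Lp_loc 1 \<Omega>"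
  using assms unfolding Lp_loc_def Lp1_iff by (auto intro!: Bochner_Integration.integrable_add)

lemma weak_partial_lincomb:
  assumes \<Omega>: "open \<Omega>" and u: "has_weak_partial \<Omega> i u g" and v: "has_weak_partial \<Omega> i v g'"
  shows "has_weak_partial \<Omega> i (\<lambda>x. a * u x + b * v x) (\<lambda>x. a * g x + b * g' x)"
proof (rule weak_partialI[OF \<Omega>])
  have loc: "u \<in> Lp_loc 1 \<Omega>" "g \<in> Lp_loc 1 \<Omega>" "v \<in> Lp_loc 1 \<Omega>" "g' \<in> Lp_loc 1 \<Omega>"
    using u v by (auto simp: has_weak_partial_def)
  then show "(\<lambda>x. a * u x + b * v x) \<in> Lp_loc 1 \<Omega>" "(\<lambda>x. a * g x + b * g' x) \<in> Lp_loc 1 \<Omega>"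
    by (auto intro: Lp_loc_1_lincomb)
  fix \<phi> assume \<phi>: "test_function \<Omega> \<phi>"
  have split: "(\<integral>x. zext \<Omega> (\<lambda>x. a * s x + b * t x) x * \<psi> x \<partial>lebesgue) = a * (\<integral>x. zext \<Omega> s x * \<psi> x \<partial>lebesgue) + b * (\<integral>x. zext \<Omega> t x * \<psi> x \<partial>lebesgue)"
    if "s \<in> Lp_loc 1 \<Omega>" "t \<in> Lp_loc 1 \<Omega>" "test_function \<Omega> \<psi>" for s t \<psi>
  proof -
    have "(\<integral>x. zext \<Omega> (\<lambda>x. a * s x + b * t x) x * \<psi> x \<partial>lebesgue) = (\<integral>x. a * (zext \<Omega> s x * \<psi> x) + b * (zext \<Omega> t x * \<psi> x) \<partial>lebesgue)"
      by (rule arg_cong[where f="integral\<^sup>L lebesgue"]) (auto simp: zext_def algebra_simps)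
    also have "\<dots> = a * (\<integral>x. zext \<Omega> s x * \<psi> x \<partial>lebesgue) + b * (\<integral>x. zext \<Omega> t x * \<psi> x \<partial>lebesgue)"
      using that by (subst Bochner_Integration.integral_add) (auto intro!: Lp_loc_times_test_function \<Omega>)
    finally show ?thesis .
  qed
  show "(\<integral>x. zext \<Omega> (\<lambda>x. a * u x + b * v x) x * partial_deriv i \<phi> x \<partial>lebesgue) = - (\<integral>x. zext \<Omega> (\<lambda>x. a * g x + b * g' x) x * \<phi> x \<partial>lebesgue)"
    using weak_partialD[OF u \<Omega> \<phi>] weak_partialD[OF v \<Omega> \<phi>] loc \<phi> test_function_partial_deriv[OF \<phi>]
    by (simp add: split)
qed

text \<open>Sampling against test functions and interpolating reproduces a locally integrable function.\<close>

lemma fundamental_lemma: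
  fixes \<Omega> :: "(real ^ 'n) set"
  assumes \<Omega>: "open \<Omega>" and d: "d \<in> Lp_loc 1 \<Omega>"
    and zero: "\<And>\<phi>. test_function \<Omega> \<phi> \<Longrightarrow> (\<integral>x. zext \<Omega> d x * \<phi> x \<partial>lebesgue) = 0"
  shows "AE x in lebesgue. x \<in> \<Omega> \<longrightarrow> d x = 0"
proof -
  obtain p :: "real ^ 'n \<Rightarrow> real" where p: "kern p" "smooth p"
    using lattice_kernels_exist lattice_kernels.K by blast
  have "AE x in lebesgue. x \<in> K \<longrightarrow> d x = 0" if K: "compact K" "K \<subseteq> \<Omega>" for K
  proof -
    obtain r where r: "r > 0" "thick K r \<subseteq> \<Omega>" using thick_subset_open[OF K(1) \<Omega> K(2)] by blast
    define K' where "K' = thick K r"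
    have K': "compact K'" "K' \<subseteq> \<Omega>" unfolding K'_def using compact_thick[OF K(1)] r by auto
    define V where "V = zext K' d"
    have V: "integrable lebesgue V"
      using d K' unfolding Lp_loc_def Lp1_iff V_def using zext_integrable[OF compact_sets_lebesgue[OF K'(1)]] by blast
    obtain R where R: "R \<ge> 0" "\<And>x. x \<notin> cube R \<Longrightarrow> V x = 0"
    proof -
      obtain B where B: "\<And>x. x \<in> K' \<Longrightarrow> norm x \<le> B" using compact_imp_bounded[OF K'(1)] unfolding bounded_iff by blast
      have "x \<in> cube (max 0 B)" if "x \<in> K'" for x
        unfolding mem_cube using B[OF that] component_le_norm_cart[of x] order_trans by (metis max.coboundedI2)
      then have "V x = 0" if "x \<notin> cube (max 0 B)" for x using that unfolding V_def zext_def by metis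
      then show thesis using that[of "max 0 B"] by simp
    qed
    have "(\<integral>x. \<bar>zext K d x\<bar> \<partial>lebesgue) < \<epsilon>" if \<epsilon>: "\<epsilon> > 0" for \<epsilon>
    proof -
      obtain h0 where h0: "h0 > 0" "\<And>h S. 0 < h \<Longrightarrow> h < h0 \<Longrightarrow> covers h (R + 10) S \<Longrightarrow> (\<integral>x. \<bar>V x - intp p h S (samp p h V) x\<bar> \<partial>lebesgue) < \<epsilon>"
        using intp_samp_converges[OF p(1) p(1) V R(2) \<epsilon> R(1)] by blast
      \<comment> \<open>From a point of \<open>K\<close> to a node is at most 3h, and from there the
        kernel reaches 3h further; \<open>6 * h \<le> r\<close> keeps these kernels inside
        \<open>K'\<close>, so they are test functions.\<close>
      define h where "h = min (h0 / 2) (r / 6)"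
      have h: "0 < h" "h < h0" "6 * h \<le> r" using h0 r by (auto simp: h_def)
      obtain S :: "(int ^ 'n) set" where S: "covers h (R + 10) S" using covers_exists[OF h(1)] by blast
      have T0: "intp p h S (samp p h V) x = 0" if x: "x \<in> K" for x
        unfolding intp_def
      proof (intro sum.neutral ballI)
        fix z
        show "samp p h V z * p ((1/h) *\<^sub>R x - lat z) = 0"
        proof (cases "p ((1/h) *\<^sub>R x - lat z) = 0")
          case False
          have near: "thick {h *\<^sub>R lat z} (3 * h) \<subseteq> K'"
          proof -
            have "h *\<^sub>R lat z \<in> thick {x} (3 * h)"
              using kern_scaled_support[OF p(1) h(1) False] by (intro thickI) (auto simp: abs_minus_commute)
            then have "thick {h *\<^sub>R lat z} (3 * h) \<subseteq> thick (thick {x} (3 * h)) (3 * h)" by (intro thick_mono) auto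
            also have "\<dots> \<subseteq> thick {x} (3 * h + 3 * h)" by (rule thick_thick)
            also have "\<dots> \<subseteq> K'" unfolding K'_def using x h by (intro thick_mono) auto
            finally show ?thesis .
          qed
          then have "test_function \<Omega> (\<lambda>x. p ((1/h) *\<^sub>R x - lat z))"
            using K' by (intro kern_scaled_test_function p h) auto
          then have "(\<integral>x. zext \<Omega> d x * p ((1/h) *\<^sub>R x - lat z) \<partial>lebesgue) = 0" by (rule zero)
          also have "(\<lambda>y. zext \<Omega> d y * p ((1/h) *\<^sub>R y - lat z)) = (\<lambda>y. V y * p ((1/h) *\<^sub>R y - lat z))"
          proof
            fix y
            have "y \<in> K'" if "p ((1/h) *\<^sub>R y - lat z) \<noteq> 0"
              using near kern_scaled_support[OF p(1) h(1) that] by (auto intro!: thickI subsetD[OF near])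
            then show "zext \<Omega> d y * p ((1/h) *\<^sub>R y - lat z) = V y * p ((1/h) *\<^sub>R y - lat z)"
              using K'(2) by (cases "p ((1/h) *\<^sub>R y - lat z) = 0") (auto simp: V_def zext_def)
          qed
          finally show ?thesis by (simp add: samp_def)
        qed simp
      qed
      have "(\<integral>x. \<bar>zext K d x\<bar> \<partial>lebesgue) \<le> (\<integral>x. \<bar>V x - intp p h S (samp p h V) x\<bar> \<partial>lebesgue)"
      proof (rule integral_mono')
        have "K \<subseteq> K'" unfolding K'_def using r by (intro subset_thick) auto
        then show "\<bar>zext K d x\<bar> \<le> \<bar>V x - intp p h S (samp p h V) x\<bar>" for x
          using T0[of x] by (auto simp: zext_def V_def)
      qed (use V intp_integrable[OF p(1) h(1)] in auto)
      also have "\<dots> < \<epsilon>" by (rule h0(2)[OF h(1,2) S])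
      finally show ?thesis .
    qed
    then have "(\<integral>x. \<bar>zext K d x\<bar> \<partial>lebesgue) \<le> 0" using field_le_epsilon by (metis add_0 less_eq_real_def)
    moreover have "0 \<le> (\<integral>x. \<bar>zext K d x\<bar> \<partial>lebesgue)" by simp
    moreover have int: "integrable lebesgue (zext K d)"
      using d K unfolding Lp_loc_def Lp1_iff using zext_integrable[OF compact_sets_lebesgue[OF K(1)]] by blast
    ultimately have "AE x in lebesgue. \<bar>zext K d x\<bar> = 0"
      using integral_nonneg_eq_0_iff_AE[of lebesgue "\<lambda>x. \<bar>zext K d x\<bar>"] by auto
    then show ?thesis by eventually_elim (auto simp: zext_def split: if_splits)
  qed
  then have "AE x in lebesgue. \<forall>k. x \<in> exhaustion \<Omega> k \<longrightarrow> d x = 0"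
    unfolding AE_all_countable by (intro allI) (simp add: compact_exhaustion exhaustion_subset)
  then show ?thesis by eventually_elim (use exhaustion_UN[OF \<Omega>] in blast)
qed

lemma weak_partial_unique:
  assumes \<Omega>: "open \<Omega>" and u: "has_weak_partial \<Omega> i u g" "has_weak_partial \<Omega> i u g'"
  shows "AE x in lebesgue. x \<in> \<Omega> \<longrightarrow> g x = g' x"
proof -
  let ?d = "\<lambda>x. 1 * g x + (-1) * g' x"
  have d: "has_weak_partial \<Omega> i (\<lambda>x. 1 * u x + (-1) * u x) ?d" by (rule weak_partial_lincomb[OF \<Omega> u])
  have "AE x in lebesgue. x \<in> \<Omega> \<longrightarrow> ?d x = 0"
  proof (rule fundamental_lemma[OF \<Omega>])
    show "?d \<in> Lp_loc 1 \<Omega>" using d by (simp add: has_weak_partial_def)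
    show "(\<integral>x. zext \<Omega> ?d x * \<phi> x \<partial>lebesgue) = 0" if "test_function \<Omega> \<phi>" for \<phi>
      using weak_partialD[OF d \<Omega> that] by (simp add: zext_def)
  qed
  then show ?thesis by eventually_elim auto
qed

text \<open>Relates the representative selected by \<open>SOME\<close> in
  \<open>weak_gradient\<close> to any explicit one, so that energies can be computed with the
  latter.\<close>

lemma weak_gradient_unique:
  assumes "open \<Omega>" "has_weak_partial \<Omega> i u g"
  shows "AE x in lebesgue. x \<in> \<Omega> \<longrightarrow> weak_gradient \<Omega> u x $ i = g x"
  using weak_partial_unique[OF assms(1) someI[of "has_weak_partial \<Omega> i u", OF assms(2)] assms(2)]
  by (simp add: weak_gradient_def)

lemma test_function_Sobolev0:
  fixes \<phi> :: "real ^ 'n \<Rightarrow> real"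
  assumes \<Omega>: "open \<Omega>" and \<phi>: "test_function \<Omega> \<phi>"
  shows "\<phi> \<in> Sobolev0 1 \<Omega>"
proof -
  have zx: "zext \<Omega> \<psi> = \<psi>" if "test_function \<Omega> \<psi>" for \<psi>
    using test_functionD(5)[OF that] by (auto simp: zext_def)
  have Lp: "\<psi> \<in> Lp 1 \<Omega>" if "test_function \<Omega> \<psi>" for \<psi>
    unfolding Lp1_iff using zext_integrable[OF open_sets_lebesgue[OF \<Omega>]] test_function_integrable[OF that] zx[OF that] by simp
  have "Lp_norm 1 \<Omega> (\<lambda>x. partial_deriv i \<phi> x - weak_gradient \<Omega> \<phi> x $ i) = 0" for i
  proof -
    have "AE x in lebesgue. x \<in> \<Omega> \<longrightarrow> \<bar>partial_deriv i \<phi> x - weak_gradient \<Omega> \<phi> x $ i\<bar> powr 1 = 0"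
      using weak_gradient_unique[OF \<Omega> weak_partial_test_function[OF \<Omega> \<phi>], of i] by eventually_elim auto
    then have "AE x in lebesgue_on \<Omega>. \<bar>partial_deriv i \<phi> x - weak_gradient \<Omega> \<phi> x $ i\<bar> powr 1 = 0"
      by (subst AE_restrict_space_iff) (use \<Omega> in auto)
    then show ?thesis unfolding Lp_norm_def by (subst integral_eq_zero_AE) auto
  qed
  moreover have "Lp_norm 1 \<Omega> (\<lambda>x. \<phi> x - \<phi> x) = 0" by (simp add: Lp_norm_def)
  moreover have "\<phi> \<in> Sobolev 1 \<Omega>"
    unfolding Sobolev_def using Lp[OF \<phi>] Lp[OF test_function_partial_deriv[OF \<phi>]] weak_partial_test_function[OF \<Omega> \<phi>] by blast
  ultimately show ?thesis
    unfolding Sobolev0_def using \<phi> by (intro CollectI conjI exI[of _ "\<lambda>_. \<phi>"]) auto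
qed

section \<open>Discretisation of competitors\<close>

context lattice_kernels
begin

text \<open>Integration by parts against the scaled \<open>M i\<close>, whose partial derivative is
  a difference of two neighbouring kernels \<open>L\<close>: the difference quotient of averages is
  an average of the derivative, with no error term.\<close>

lemma samp_difference_quotient:
  assumes h: "h > 0" and V: "integrable lebesgue V"
    and weak: "\<And>\<theta>. smooth \<theta> \<Longrightarrow> (\<integral>x. V x * partial_deriv i \<theta> x \<partial>lebesgue) = - (\<integral>x. V' x * \<theta> x \<partial>lebesgue)"
  shows "(samp L h V (z + axis i 1) - samp L h V z) / h = samp (M i) h V' z"
proof -
  let ?L = "\<lambda>z x. L ((1/h) *\<^sub>R x - lat z)"
  have "partial_deriv i (\<lambda>x. M i ((1/h) *\<^sub>R x - lat z)) x = (1/h) * (?L z x - ?L (z + axis i 1) x)" for x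
    unfolding partial_deriv_kern_scaled[OF M(2)] partial_M lat_add lat_axis by (simp add: diff_diff_add)
  then have "- (\<integral>x. V' x * M i ((1/h) *\<^sub>R x - lat z) \<partial>lebesgue) = (\<integral>x. (1/h) * (V x * ?L z x - V x * ?L (z + axis i 1) x) \<partial>lebesgue)"
    unfolding weak[OF smooth_kern_scaled[OF M(2)], symmetric] by (simp add: right_diff_distrib mult_ac)
  also have "\<dots> = (1/h) * ((\<integral>x. V x * ?L z x \<partial>lebesgue) - (\<integral>x. V x * ?L (z + axis i 1) x \<partial>lebesgue))"
    by (subst integral_mult_right_zero, subst Bochner_Integration.integral_diff) (auto intro!: samp_integrable L V)
  also have "\<dots> = - (((\<integral>x. V x * ?L (z + axis i 1) x \<partial>lebesgue) - (\<integral>x. V x * ?L z x \<partial>lebesgue)) / h)"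
    by (simp add: diff_divide_distrib)
  finally have "(\<integral>x. V' x * M i ((1/h) *\<^sub>R x - lat z) \<partial>lebesgue)
    = ((\<integral>x. V x * ?L (z + axis i 1) x \<partial>lebesgue) - (\<integral>x. V x * ?L z x \<partial>lebesgue)) / h" by linarith
  then show ?thesis unfolding samp_def by (simp add: diff_divide_distrib mult.commute)
qed

text \<open>The dual identity: the derivative of \<open>K\<close> is a difference of kernels
  \<open>Ki i\<close>, and summation by parts moves the difference to the values. Since
  \<open>w\<close> vanishes off \<open>P\<close>, no boundary terms appear. Hence Jensen's
  inequality applies to the gradient of an interpolant.\<close>

lemma intp_partial:
  assumes S: "finite S" "P \<subseteq> S" "\<And>z. z \<in> P \<Longrightarrow> z - axis i 1 \<in> S" and w: "\<And>z. z \<notin> P \<Longrightarrow> w z = 0"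
  shows "partial_deriv i (intp K h P w) x = intp (Ki i) h S (\<lambda>z. (w (z + axis i 1) - w z) / h) x"
proof -
  let ?k = "\<lambda>z. Ki i ((1/h) *\<^sub>R x - lat z)"
  have "partial_deriv i (intp K h P w) x = (\<Sum>z\<in>P. partial_deriv i (\<lambda>x. w z * K ((1/h) *\<^sub>R x - lat z)) x)"
    unfolding intp_def by (rule partial_deriv_sum)
      (intro smooth_differentiable smooth_cmult smooth_kern_scaled K)
  also have "\<dots> = (\<Sum>z\<in>P. (1/h) * (w z * ?k (z - axis i 1) - w z * ?k z))"
  proof (intro sum.cong refl)
    fix z
    have "partial_deriv i (\<lambda>x. w z * K ((1/h) *\<^sub>R x - lat z)) x = w z * ((1/h) * partial_deriv i K ((1/h) *\<^sub>R x - lat z))"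
      using partial_deriv_cmult[OF smooth_differentiable[OF smooth_kern_scaled[OF K(2)]]] partial_deriv_kern_scaled[OF K(2)] by simp
    also have "\<dots> = (1/h) * (w z * ?k (z - axis i 1) - w z * ?k z)"
      unfolding partial_K lat_diff lat_axis by (simp add: algebra_simps)
    finally show "partial_deriv i (\<lambda>x. w z * K ((1/h) *\<^sub>R x - lat z)) x = (1/h) * (w z * ?k (z - axis i 1) - w z * ?k z)" .
  qed
  also have "\<dots> = (\<Sum>z\<in>S. (1/h) * (w z * ?k (z - axis i 1) - w z * ?k z))"
    using S w by (intro sum.mono_neutral_left) auto
  also have "\<dots> = (1/h) * ((\<Sum>z\<in>S. w z * ?k (z - axis i 1)) - (\<Sum>z\<in>S. w z * ?k z))"
    by (simp add: sum_divide_distrib[symmetric] sum_subtractf)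
  also have "(\<Sum>z\<in>S. w z * ?k (z - axis i 1)) = (\<Sum>z\<in>S. w (z + axis i 1) * ?k z)"
    using sum_translate[OF S(1), of "\<lambda>z. w z * ?k (z - axis i 1)" "axis i 1"] S w by fastforce
  also have "(1/h) * ((\<Sum>z\<in>S. w (z + axis i 1) * ?k z) - (\<Sum>z\<in>S. w z * ?k z)) = intp (Ki i) h S (\<lambda>z. (w (z + axis i 1) - w z) / h) x"
    unfolding intp_def by (simp add: sum_subtractf[symmetric] sum_distrib_left algebra_simps diff_divide_distrib)
  finally show ?thesis .
qed

end

text \<open>The constant 1 is subtracted because \<open>intp_jensen\<close> needs a function
  vanishing at 0. The derivative is a multiple of the increasing function
  \<open>pw (a - 1)\<close>.\<close>

lemma convex_Gam_powr:
  assumes "1 \<le> a" shows "convex_on UNIV (\<lambda>t. Gam t powr a - 1)"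
proof (rule convex_on_realI)
  fix t
  have "((\<lambda>t. Gam t powr a - 1) has_real_derivative a * Gam t powr (a - 1) * (2 * t)) (at t)"
    unfolding Gam_def using Gam_pos[of t, unfolded Gam_def] by (auto intro!: derivative_eq_intros simp: powr_diff field_simps)
  then show "((\<lambda>t. Gam t powr a - 1) has_real_derivative 2 * a * pw (a - 1) t) (at t)"
    by (simp add: pw_def mult_ac)
next
  fix s t :: real assume "s \<le> t"
  then have "pw (a - 1) s \<le> pw (a - 1) t" using assms by (intro pw_mono) auto
  then show "2 * a * pw (a - 1) s \<le> 2 * a * pw (a - 1) t" using assms by (intro mult_left_mono) auto
qed simp

text \<open>Makes the count of nodes in \<open>higher_integrability\<close> independent of the step,
  once it is multiplied by the cell volume.\<close>

lemma card_lattice_cube_le: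
  assumes "0 < h" "h \<le> 1" "0 \<le> R" and E: "\<And>z. z \<in> E \<Longrightarrow> h *\<^sub>R lat z \<in> (cube R :: (real ^ 'n) set)"
  shows "h ^ CARD('n) * card E \<le> (2 * R + 1) ^ CARD('n)"
proof -
  define N where "N = nat \<lfloor>R / h\<rfloor>"
  have N: "real N \<le> R / h" using assms by (simp add: N_def)
  have "E \<subseteq> zbox N"
  proof
    fix z assume "z \<in> E"
    from E[OF this] have z: "\<bar>h * real_of_int (z $ i)\<bar> \<le> R" for i unfolding mem_cube by simp
    show "z \<in> zbox N" unfolding zbox_def
    proof (intro CollectI allI)
      fix i
      have "real_of_int \<bar>z $ i\<bar> \<le> R / h" using z[of i] assms(1) by (simp add: abs_mult pos_le_divide_eq mult.commute)
      then show "\<bar>z $ i\<bar> \<le> int N" unfolding N_def by linarith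
    qed
  qed
  then have "card E \<le> (2 * N + 1) ^ CARD('n)" using card_mono[OF finite_zbox] card_zbox by metis
  then have "real (card E) \<le> (2 * real N + 1) ^ CARD('n)"
    by (metis (mono_tags, lifting) of_nat_1 of_nat_add of_nat_le_iff of_nat_mult of_nat_numeral of_nat_power)
  then have "h ^ CARD('n) * card E \<le> h ^ CARD('n) * (2 * real N + 1) ^ CARD('n)"
    using assms by (intro mult_left_mono) auto
  also have "\<dots> = (h * (2 * real N + 1)) ^ CARD('n)" by (simp add: power_mult_distrib)
  also have "\<dots> \<le> (2 * R + 1) ^ CARD('n)"
  proof (rule power_mono)
    have "h * real N \<le> R" using N assms by (simp add: pos_le_divide_eq mult.commute)
    then show "h * (2 * real N + 1) \<le> 2 * R + 1" using assms by (simp add: algebra_simps)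
  qed (use assms in simp)
  finally show ?thesis .
qed

text \<open>The densities \<open>F i\<close> have their tangent at 0 removed, so they vanish to
  first order at 0 and are nonnegative; \<open>lip\<close> bounds their slopes. The degenerate lower
  bound is stated for direction \<open>one\<close> alone and in integrated form with
  \<open>Gam\<close>, as the lattice estimate needs it. \<open>g\<close> collects weak partial
  derivatives of the boundary datum.\<close>

locale splitting_problem = lattice_kernels K L Ki M
  for K L :: "real ^ 'n \<Rightarrow> real" and Ki M :: "'n \<Rightarrow> real ^ 'n \<Rightarrow> real" +
  fixes \<Omega> :: "(real ^ 'n) set" and u0 :: "real ^ 'n \<Rightarrow> real" and g :: "'n \<Rightarrow> real ^ 'n \<Rightarrow> real"
    and F F' :: "'n \<Rightarrow> real \<Rightarrow> real" and one :: 'n and \<mu> c cbar B R lip :: real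
  assumes \<Omega>: "open \<Omega>" "\<Omega> \<subseteq> cube R" "0 \<le> R"
    and g: "\<And>i. has_weak_partial \<Omega> i u0 (g i)" "integrable (lebesgue_on \<Omega>) u0" "\<And>i. integrable (lebesgue_on \<Omega>) (g i)"
    and B: "AE x in lebesgue. x \<in> \<Omega> \<longrightarrow> \<bar>u0 x\<bar> \<le> B" "0 \<le> B"
    and F: "\<And>i. F i 0 = 0" "\<And>i t. (F i has_real_derivative F' i t) (at t)" "\<And>i. F' i 0 = 0"
    and F'_mono: "\<And>i s t. s \<le> t \<Longrightarrow> F' i s \<le> F' i t"
    and F'_lip: "\<And>i s t. s \<le> t \<Longrightarrow> F' i t - F' i s \<le> cbar * (t - s)"
    and F'_lower: "\<And>s t. s \<le> t \<Longrightarrow> c * max (Gam s) (Gam t) powr (- \<mu> / 2) * (t - s) \<le> F' one t - F' one s"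
    and c: "0 < c" "0 \<le> cbar" and lip: "\<And>i t. \<bar>F' i t\<bar> \<le> lip" "0 \<le> lip"
    and \<mu>: "1 < \<mu>" "\<mu> < 2"
begin

lemma F_tangent: "F i y \<ge> F i m + F' i m * (y - m)"
proof -
  consider "y = m" | "m < y" | "y < m" by linarith
  then show ?thesis
  proof cases
    case 2
    then obtain z where z: "m < z" "z < y" "F i y - F i m = (y - m) * F' i z" using MVT2[of m y "F i" "F' i"] F(2) by blast
    then have "(y - m) * F' i m \<le> (y - m) * F' i z" using F'_mono by (intro mult_left_mono) auto
    then show ?thesis using z(3) by (simp add: algebra_simps)
  next
    case 3
    then obtain z where z: "y < z" "z < m" "F i m - F i y = (m - y) * F' i z" using MVT2[of y m "F i" "F' i"] F(2) by blast
    then have "(m - y) * F' i z \<le> (m - y) * F' i m" using F'_mono by (intro mult_left_mono) auto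
    then show ?thesis using z(3) by (simp add: algebra_simps)
  qed simp
qed

lemma F_nonneg: "0 \<le> F i t" using F_tangent[of i 0 t] F by simp

lemma F_convex: "convex_on UNIV (F i)"
  by (rule convex_on_realI[where f'="F' i"]) (use F(2) F'_mono in auto)

lemma F_mono_pos: "0 \<le> s \<Longrightarrow> s \<le> t \<Longrightarrow> F i s \<le> F i t"
  using F_tangent[of i s t] F'_mono[of 0 s i] F(3)[of i] by (smt (verit) mult_nonneg_nonneg)

lemma F_mono_neg: "t \<le> s \<Longrightarrow> s \<le> 0 \<Longrightarrow> F i s \<le> F i t"
  using F_tangent[of i s t] F'_mono[of s 0 i] F(3)[of i] by (smt (verit) mult_nonpos_nonpos)

lemma F_lipschitz: "F i s \<le> F i t + lip * \<bar>s - t\<bar>"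
proof -
  have "F i s - F i t \<le> F' i s * (s - t)" using F_tangent[of i s t] by (simp add: algebra_simps)
  also have "\<dots> \<le> \<bar>F' i s\<bar> * \<bar>s - t\<bar>" by (metis abs_ge_self abs_mult)
  also have "\<dots> \<le> lip * \<bar>s - t\<bar>" by (intro mult_right_mono lip) auto
  finally show ?thesis by simp
qed

lemma F_le: "F i t \<le> lip * \<bar>t\<bar>" using F_lipschitz[of i t 0] F(1) by simp

lemma F_continuous: "continuous_on A (F i)"
  by (meson DERIV_isCont F(2) continuous_at_imp_continuous_on)

lemma F_integrable:
  assumes "integrable lebesgue V" shows "integrable lebesgue (\<lambda>x. F i (V x))"
proof (rule Bochner_Integration.integrable_bound)
  show "integrable lebesgue (\<lambda>x. lip * \<bar>V x\<bar>)" using assms by simp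
  show "(\<lambda>x. F i (V x)) \<in> borel_measurable lebesgue"
    using assms by (intro measurable_compose[OF _ borel_measurable_continuous_onI[OF F_continuous]]) auto
  show "AE x in lebesgue. norm (F i (V x)) \<le> norm (lip * \<bar>V x\<bar>)"
    using F_nonneg F_le lip by (intro AE_I2) (simp add: abs_mult)
qed

text \<open>The energy of u0 + \<psi> for the reduced densities, written over the whole space:
  outside \<Omega> the argument of \<open>F i\<close> is 0 when \<psi> is a test function.\<close>

definition energy_of :: "(real ^ 'n \<Rightarrow> real) \<Rightarrow> real" where
  "energy_of \<psi> = (\<Sum>i\<in>UNIV. \<integral>x. F i (zext \<Omega> (g i) x + partial_deriv i \<psi> x) \<partial>lebesgue)"

text \<open>The lattice constant for N = q, cut-off slope 2/\<delta> and the smallest convenient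
  power k, times the volume bound for the nodes. Neither the step nor the competitor occurs in
  it.\<close>

definition local_const :: "real \<Rightarrow> real \<Rightarrow> real" where
  "local_const q \<delta> = (1 + \<bar>discrete_solution.higher_const TYPE('n) (2 / \<delta>) B c cbar q ((2 - \<mu>) / 4) (nat \<lceil>(q + 1) / ((2 - \<mu>) / 4)\<rceil> + 2)\<bar>)
     * (2 * R + 1) ^ CARD('n)"

text \<open>Multiplying the datum by a cut-off that equals 1 near \<open>K0\<close> gives a
  compactly supported function on the whole space, with the datum's own gradient near
  \<open>K0\<close>. All later changes happen inside this region, so the altered values elsewhere
  cancel in energy differences.\<close>

lemma global_extension:
  assumes K0: "compact K0" "K0 \<subseteq> \<Omega>"
  obtains U U' d where "integrable lebesgue U" "\<And>i. integrable lebesgue (U' i)"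
    "\<And>i \<theta>. smooth \<theta> \<Longrightarrow> (\<integral>x. U x * partial_deriv i \<theta> x \<partial>lebesgue) = - (\<integral>x. U' i x * \<theta> x \<partial>lebesgue)"
    "AE x in lebesgue. \<bar>U x\<bar> \<le> B" "\<And>x. x \<notin> cube R \<Longrightarrow> U x = 0" "\<And>i x. x \<notin> cube R \<Longrightarrow> U' i x = 0"
    "d > 0" "thick K0 d \<subseteq> \<Omega>" "\<And>i x. x \<in> thick K0 (3 * d / 4) \<Longrightarrow> U' i x = zext \<Omega> (g i) x"
proof -
  obtain \<zeta> d where \<zeta>: "test_function \<Omega> \<zeta>" "\<And>x. 0 \<le> \<zeta> x" "\<And>x. \<zeta> x \<le> 1" and d: "d > 0" "\<And>x. x \<in> thick K0 d \<Longrightarrow> \<zeta> x = 1"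
    "thick K0 d \<subseteq> \<Omega>"
    using cutoff_exists[OF K0(1) \<Omega>(1) K0(2)] by blast
  define U where "U x = zext \<Omega> u0 x * \<zeta> x" for x
  define U' where "U' i x = zext \<Omega> (g i) x * \<zeta> x + zext \<Omega> u0 x * partial_deriv i \<zeta> x" for i x
  note d\<zeta> = test_function_partial_deriv[OF \<zeta>(1)]
  note loc = integrable_imp_Lp_loc[OF g(2) \<Omega>(1)] integrable_imp_Lp_loc[OF g(3) \<Omega>(1)]
  have out: "zext \<Omega> f x = 0" if "x \<notin> cube R" for f x using that \<Omega>(2) by (auto simp: zext_def)
  show thesis
  proof
    show "integrable lebesgue U" unfolding U_def by (intro Lp_loc_times_test_function \<Omega> loc \<zeta>)
    show "integrable lebesgue (U' i)" for i
      unfolding U'_def by (intro Bochner_Integration.integrable_add Lp_loc_times_test_function \<Omega> loc \<zeta> d\<zeta>)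
    show "AE x in lebesgue. \<bar>U x\<bar> \<le> B"
      using B(1)
    proof eventually_elim
      case (elim x)
      have "\<bar>U x\<bar> = \<bar>zext \<Omega> u0 x\<bar> * \<zeta> x" using \<zeta>(2) by (simp add: U_def abs_mult)
      also have "\<dots> \<le> B * 1" using elim \<zeta>(2,3) B(2) by (intro mult_mono) (auto simp: zext_def)
      finally show ?case by simp
    qed
    show "U x = 0" "U' i x = 0" if "x \<notin> cube R" for i x using out[OF that] by (auto simp: U_def U'_def)
    show "d > 0" "thick K0 d \<subseteq> \<Omega>" by fact+
    \<comment> \<open>The margin d/4 leaves a ball around \<open>x\<close> on which the cut-off is
      1, so its derivative vanishes at \<open>x\<close> as well.\<close>
    show "U' i x = zext \<Omega> (g i) x" if x: "x \<in> thick K0 (3 * d / 4)" for i x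
    proof -
      have near: "\<zeta> y = 1" if "y \<in> ball x (d / 4)" for y
      proof (rule d(2))
        have "\<bar>y $ i - x $ i\<bar> \<le> d / 4" for i
        proof -
          have "\<bar>(y - x) $ i\<bar> \<le> norm (y - x)" by (rule component_le_norm_cart)
          also have "\<dots> \<le> d / 4" using that by (simp add: dist_norm norm_minus_commute)
          finally show ?thesis by simp
        qed
        then have "y \<in> thick (thick K0 (3 * d / 4)) (d / 4)" by (rule thickI[OF x])
        also have "\<dots> \<subseteq> thick K0 (3 * d / 4 + d / 4)" by (rule thick_thick)
        finally show "y \<in> thick K0 d" by simp
      qed
      have "((\<lambda>_. 1) has_derivative (\<lambda>_. 0)) (at x)" by simp
      then have "(\<zeta> has_derivative (\<lambda>_. 0)) (at x)"
        by (rule has_derivative_transform_within_open[of _ _ _ _ "ball x (d / 4)"]) (use near d(1) in auto)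
      then have "partial_deriv i \<zeta> x = 0" using partial_deriv_eq by fastforce
      moreover have "\<zeta> x = 1" using near[of x] d(1) by simp
      ultimately show ?thesis by (simp add: U'_def)
    qed
    fix i \<theta> assume \<theta>: "smooth (\<theta> :: real ^ 'n \<Rightarrow> real)"
    have t: "test_function \<Omega> (\<lambda>x. \<zeta> x * \<theta> x)" by (rule test_function_mult_smooth[OF \<zeta>(1) \<theta>])
    have int: "integrable lebesgue (\<lambda>x. zext \<Omega> v x * (\<psi> x * \<theta>' x))" if "v \<in> Lp_loc 1 \<Omega>" "test_function \<Omega> \<psi>" "smooth \<theta>'" for v \<psi> \<theta>'
      by (rule Lp_loc_times_test_function[OF \<Omega>(1) that(1) test_function_mult_smooth[OF that(2,3)]])
    have "partial_deriv i (\<lambda>x. \<zeta> x * \<theta> x) = (\<lambda>x. \<zeta> x * partial_deriv i \<theta> x + partial_deriv i \<zeta> x * \<theta> x)"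
      by (intro ext partial_deriv_mult smooth_differentiable \<theta> test_functionD(1)[OF \<zeta>(1)])
    then have "(\<integral>x. zext \<Omega> u0 x * (\<zeta> x * partial_deriv i \<theta> x) + zext \<Omega> u0 x * (partial_deriv i \<zeta> x * \<theta> x) \<partial>lebesgue)
       = - (\<integral>x. zext \<Omega> (g i) x * (\<zeta> x * \<theta> x) \<partial>lebesgue)"
      using weak_partialD[OF g(1) \<Omega>(1) t, of i] by (simp add: distrib_left)
    then have "(\<integral>x. zext \<Omega> u0 x * (\<zeta> x * partial_deriv i \<theta> x) \<partial>lebesgue) + (\<integral>x. zext \<Omega> u0 x * (partial_deriv i \<zeta> x * \<theta> x) \<partial>lebesgue)
       = - (\<integral>x. zext \<Omega> (g i) x * (\<zeta> x * \<theta> x) \<partial>lebesgue)"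
      by (subst (asm) Bochner_Integration.integral_add) (intro int loc \<zeta>(1) d\<zeta> \<theta> smooth_partial_deriv)+
    then have "(\<integral>x. zext \<Omega> u0 x * (\<zeta> x * partial_deriv i \<theta> x) \<partial>lebesgue) =
       - ((\<integral>x. zext \<Omega> (g i) x * (\<zeta> x * \<theta> x) \<partial>lebesgue) + (\<integral>x. zext \<Omega> u0 x * (partial_deriv i \<zeta> x * \<theta> x) \<partial>lebesgue))" by linarith
    also have "\<dots> = - (\<integral>x. zext \<Omega> (g i) x * (\<zeta> x * \<theta> x) + zext \<Omega> u0 x * (partial_deriv i \<zeta> x * \<theta> x) \<partial>lebesgue)"
      by (subst Bochner_Integration.integral_add) (intro int loc \<zeta>(1) d\<zeta> \<theta> refl)+
    finally show "(\<integral>x. U x * partial_deriv i \<theta> x \<partial>lebesgue) = - (\<integral>x. U' i x * \<theta> x \<partial>lebesgue)"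
      by (simp add: U_def U'_def distrib_right mult.assoc)
  qed
qed

text \<open>Applies the lattice estimate with N = q and transports it by Jensen's inequality to the
  interpolated difference quotient. The condition on \<open>h\<close> makes kernels seen from
  \<open>A\<close> reach only nodes where the cut-off is 1.\<close>

lemma local_estimate:
  fixes S P :: "(int ^ 'n) set" and A :: "(real ^ 'n) set"
  defines "G u h \<equiv> intp (Ki one) h S (\<lambda>z. (u (z + axis one 1) - u z) / h)"
  assumes h: "0 < h" "h \<le> 1" "6 * real CARD('n) * h \<le> \<delta>" and q: "1 \<le> q"
    and u: "\<And>z. \<bar>u z\<bar> \<le> B"
    and min: "\<And>w. (\<And>z. z \<notin> P \<Longrightarrow> w z = u z) \<Longrightarrow> lattice_energy F (\<lambda>i. axis i 1) h S u \<le> lattice_energy F (\<lambda>i. axis i 1) h S w"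
    and P: "\<And>z. h *\<^sub>R lat z \<in> K' \<Longrightarrow> z \<in> P \<and> z + axis one 1 \<in> P"
    and S: "covers h (R + 10) S" and K': "K' \<subseteq> cube R" and A: "compact A" "thick A \<delta> \<subseteq> K'"
  shows "integrable lebesgue (zext A (\<lambda>x. \<bar>G u h x\<bar> powr q))"
    "(\<integral>x. zext A (\<lambda>x. \<bar>G u h x\<bar> powr q) x \<partial>lebesgue) \<le> local_const q \<delta>"
proof -
  let ?n = "CARD('n)"
  define \<tau> k a where "\<tau> = (2 - \<mu>) / 4" and "k = nat \<lceil>(q + 1) / \<tau>\<rceil> + 2" and "a = q + 1 + \<tau>"
  have \<tau>: "0 < \<tau>" "4 * \<tau> = 2 - \<mu>" "\<tau> \<le> 1/2" using \<mu> by (auto simp: \<tau>_def)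
  have \<delta>: "\<delta> > 0" using h by (smt (verit) mult_pos_pos of_nat_0_less_iff zero_less_card_finite)
  have finS: "finite S" using S by (simp add: covers_def)
  define v where "v z = (u (z + axis one 1) - u z) / h" for z
  have Gc: "continuous_on UNIV (G u h)"
    unfolding G_def intp_def by (intro continuous_on_sum continuous_intros kern_scaled_continuous Ki)
  have Gm: "(\<lambda>x. zext A (\<lambda>x. \<bar>G u h x\<bar> powr q) x) \<in> borel_measurable lebesgue"
  proof -
    have "G u h \<in> borel_measurable borel" using Gc by (rule borel_measurable_continuous_onI)
    then have [measurable]: "G u h \<in> borel_measurable lebesgue" by (intro measurable_completion) simp
    have [measurable]: "A \<in> sets lebesgue" using A(1) by (rule compact_sets_lebesgue)
    show ?thesis unfolding zext_eq by measurable
  qed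
  \<comment> \<open>Equal to 1 up to distance \<delta>/2 from \<open>A\<close>, zero from distance
    \<delta> on, with slope 2/\<delta>. The empty set is treated separately because
    \<open>infdist\<close> to it is 0 by convention.\<close>
  define \<eta> where "\<eta> z = (if A = {} then 0 else min 1 (max 0 (2 - 2 / \<delta> * infdist (h *\<^sub>R lat z) A)))" for z
  define E where "E = {z. \<eta> z \<noteq> 0}"
  have EK: "h *\<^sub>R lat z \<in> K'" if "z \<in> E" for z
  proof -
    have ne: "A \<noteq> {}" and "2 - 2 / \<delta> * infdist (h *\<^sub>R lat z) A > 0" using that by (auto simp: E_def \<eta>_def split: if_splits)
    then have "infdist (h *\<^sub>R lat z) A < \<delta>" using \<delta> by (simp add: field_simps)
    then obtain y where y: "y \<in> A" "dist (h *\<^sub>R lat z) y < \<delta>"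
      unfolding infdist_notempty[OF ne] using cINF_less_iff[of A "dist (h *\<^sub>R lat z)"] ne by (auto intro: bdd_belowI[of _ 0])
    have "\<bar>(h *\<^sub>R lat z) $ i - y $ i\<bar> \<le> \<delta>" for i
      using component_le_norm_cart[of "h *\<^sub>R lat z - y" i] y(2) by (simp add: dist_norm)
    then have "h *\<^sub>R lat z \<in> thick A \<delta>" using y(1) by (intro thickI)
    then show ?thesis using A(2) by blast
  qed
  have Ecube: "\<bar>h * real_of_int (z $ i)\<bar> \<le> R" if "z \<in> E" for z i
    using EK[OF that] K' unfolding mem_cube[symmetric] subset_iff by (metis lat_nth mem_cube vector_scaleR_component real_scaleR_def)
  have SI: "z \<in> S" if "\<And>i. \<bar>h * real_of_int (z $ i)\<bar> \<le> R + 2" for z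
    using S that unfolding covers_def by (meson add_left_mono order_trans numeral_le_iff semiring_norm(68) semiring_norm(69) semiring_norm(71))
  have ax: "\<bar>h * real_of_int ((axis j 1 :: int ^ 'n) $ i)\<bar> \<le> 1" for i j
    using h by (simp add: axis_def)
  have E_S: "z \<in> S \<and> z - axis i 1 \<in> S \<and> z + axis one 1 \<in> S \<and> z - axis i 1 + axis one 1 \<in> S" if z: "z \<in> E" for z i
  proof (intro conjI SI)
    fix j
    have 1: "\<bar>h * real_of_int (z $ j)\<bar> \<le> R" by (rule Ecube[OF z])
    show "\<bar>h * real_of_int (z $ j)\<bar> \<le> R + 2" using 1 by simp
    show "\<bar>h * real_of_int ((z - axis i 1) $ j)\<bar> \<le> R + 2" using 1 ax[of i j] by (simp add: right_diff_distrib)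
    show "\<bar>h * real_of_int ((z + axis one 1) $ j)\<bar> \<le> R + 2" using 1 ax[of one j] by (simp add: distrib_left)
    show "\<bar>h * real_of_int ((z - axis i 1 + axis one 1) $ j)\<bar> \<le> R + 2"
      using 1 ax[of i j] ax[of one j] by (simp add: distrib_left right_diff_distrib)
  qed
  interpret d: discrete_solution "\<lambda>i. axis i 1 :: int ^ 'n" one h "2 / \<delta>" B c cbar \<mu> q \<tau> k S E u \<eta> F'
  proof
    show "0 \<le> \<eta> z" "\<eta> z \<le> 1" "\<eta> z \<noteq> 0 \<Longrightarrow> z \<in> E" for z by (auto simp: \<eta>_def E_def)
    show "\<bar>\<eta> (z + axis i 1) - \<eta> z\<bar> \<le> h * (2 / \<delta>)" for z i
    proof (cases "A = {}")
      case False
      have "\<bar>infdist (h *\<^sub>R lat (z + axis i 1)) A - infdist (h *\<^sub>R lat z) A\<bar> \<le> dist (h *\<^sub>R lat (z + axis i 1)) (h *\<^sub>R lat z)"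
        by (rule infdist_triangle_abs)
      also have "\<dots> = h" using h by (simp add: dist_norm lat_add lat_axis scaleR_add_right)
      finally have "2 / \<delta> * \<bar>infdist (h *\<^sub>R lat (z + axis i 1)) A - infdist (h *\<^sub>R lat z) A\<bar> \<le> 2 / \<delta> * h"
        using \<delta> by (intro mult_left_mono) auto
      moreover have "\<bar>min 1 (max 0 (2 - s)) - min 1 (max 0 (2 - t))\<bar> \<le> \<bar>s - t\<bar>" for s t :: real
        by (smt (verit))
      from this[of "2 / \<delta> * infdist (h *\<^sub>R lat (z + axis i 1)) A" "2 / \<delta> * infdist (h *\<^sub>R lat z) A"]
      have "\<bar>\<eta> (z + axis i 1) - \<eta> z\<bar> \<le> \<bar>2 / \<delta> * (infdist (h *\<^sub>R lat (z + axis i 1)) A - infdist (h *\<^sub>R lat z) A)\<bar>"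
        using False by (simp add: \<eta>_def right_diff_distrib)
      moreover have "\<dots> = 2 / \<delta> * \<bar>infdist (h *\<^sub>R lat (z + axis i 1)) A - infdist (h *\<^sub>R lat z) A\<bar>"
        unfolding abs_mult using \<delta> by simp
      ultimately show ?thesis by (simp add: mult.commute)
    qed (use \<delta> h in \<open>simp add: \<eta>_def\<close>)
    show "finite S" by fact
    show "(\<Sum>i\<in>UNIV. \<Sum>z\<in>S. F' i ((u (z + axis i 1) - u z) / h) * (\<phi> (z + axis i 1) - \<phi> z)) = 0"
      if "\<And>z. \<phi> z \<noteq> 0 \<Longrightarrow> z \<in> E \<or> z - axis one 1 \<in> E" for \<phi>
    proof (rule lattice_minimiser_euler[where P=P, OF F(2) h(1) min])
      show "z \<in> P" if "\<phi> z \<noteq> 0" for z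
        using \<open>\<And>z. \<phi> z \<noteq> 0 \<Longrightarrow> z \<in> E \<or> z - axis one 1 \<in> E\<close>[OF that] P[OF EK[of z]] P[OF EK[of "z - axis one 1"]] by auto
    qed
    show "(q + 1) / \<tau> \<le> real k - 1" unfolding k_def by (simp add: of_nat_add) linarith
  qed (use h \<delta> u E_S F'_mono F'_lip F'_lower c q \<tau> in \<open>auto simp: k_def\<close>)
  have near: "\<eta> z = 1" if x: "x \<in> A" and nz: "Ki one ((1/h) *\<^sub>R x - lat z) \<noteq> 0" for x z
  proof -
    have "norm (h *\<^sub>R lat z - x) \<le> real ?n * (3 * h)"
      by (rule norm_le_sup) (use kern_scaled_support[OF Ki h(1) nz] in \<open>simp add: abs_minus_commute\<close>)
    then have "dist (h *\<^sub>R lat z) x \<le> \<delta> / 2" using h(3) by (simp add: dist_norm)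
    then have "infdist (h *\<^sub>R lat z) A \<le> \<delta> / 2" using infdist_le[OF x] order_trans by blast
    then have "2 / \<delta> * infdist (h *\<^sub>R lat z) A \<le> 1" using \<delta> by (simp add: field_simps)
    then show ?thesis using x by (auto simp: \<eta>_def)
  qed
  define H where "H = intp (Ki one) h S (\<lambda>z. \<eta> z ^ (2 * k) * Gam (v z) powr a)"
  have a: "1 \<le> a" using q \<tau> by (simp add: a_def)
  have H0: "0 \<le> H x" for x
    unfolding H_def intp_def using d.\<eta>(1) by (intro sum_nonneg mult_nonneg_nonneg kernD(2)[OF Ki]) auto
  have bound: "zext A (\<lambda>x. \<bar>G u h x\<bar> powr q) x \<le> indicator (cube R) x + H x" for x
  proof (cases "x \<in> A")
    case True
    have "\<bar>G u h x\<bar> powr q \<le> Gam (G u h x) powr (q / 2)"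
    proof -
      have "\<bar>G u h x\<bar> powr q = ((G u h x)\<^sup>2) powr (q / 2)"
      proof (cases "G u h x = 0")
        case False
        then have sq: "(G u h x)\<^sup>2 = \<bar>G u h x\<bar> powr 2" by simp
        show ?thesis unfolding sq powr_powr by simp
      qed simp
      also have "\<dots> \<le> Gam (G u h x) powr (q / 2)" using q by (intro powr_mono2) (auto simp: Gam_def)
      finally show ?thesis .
    qed
    also have "\<dots> \<le> Gam (G u h x) powr a" using q \<tau> Gam_ge_1 by (intro powr_mono) (auto simp: a_def)
    \<comment> \<open>The exponent a = q + 1 + \<tau> is at least 1, so the function is convex. The
      nodes whose kernels contribute at \<open>x\<close> all carry cut-off value 1, hence the
      cut-off can be inserted afterwards.\<close>
    also have "\<dots> - 1 \<le> intp (Ki one) h S (\<lambda>z. Gam (v z) powr a - 1) x"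
      unfolding G_def v_def[abs_def] using intp_jensen[OF convex_Gam_powr[OF a] _ Ki finS] by (simp add: Gam_def)
    also have "\<dots> \<le> H x"
      unfolding H_def intp_def
    proof (rule sum_mono)
      fix z
      show "(Gam (v z) powr a - 1) * Ki one ((1/h) *\<^sub>R x - lat z) \<le> \<eta> z ^ (2 * k) * Gam (v z) powr a * Ki one ((1/h) *\<^sub>R x - lat z)"
        using near[OF True, of z] kernD(2)[OF Ki, of one "(1/h) *\<^sub>R x - lat z"]
        by (cases "Ki one ((1/h) *\<^sub>R x - lat z) = 0") (auto intro!: mult_right_mono)
    qed
    finally have "\<bar>G u h x\<bar> powr q \<le> 1 + H x" by simp
    moreover have "x \<in> cube R" using True A(2) K' subset_thick[of \<delta> A] \<delta> by auto
    ultimately show ?thesis using True by (simp add: zext_def)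
  qed (use H0 in \<open>simp add: zext_def\<close>)
  have Hint: "integrable lebesgue (\<lambda>x. indicator (cube R) x + H x)"
    unfolding H_def by (intro Bochner_Integration.integrable_add integrable_indicator_cube intp_integrable Ki h)
  show int: "integrable lebesgue (zext A (\<lambda>x. \<bar>G u h x\<bar> powr q))"
  proof (rule Bochner_Integration.integrable_bound[OF Hint Gm], rule AE_I2)
    fix x
    have "0 \<le> zext A (\<lambda>x. \<bar>G u h x\<bar> powr q) x" by (simp add: zext_def)
    then show "norm (zext A (\<lambda>x. \<bar>G u h x\<bar> powr q) x) \<le> norm (indicat_real (cube R) x + H x)" using bound[of x] by simp
  qed
  have "(\<integral>x. zext A (\<lambda>x. \<bar>G u h x\<bar> powr q) x \<partial>lebesgue) \<le> (\<integral>x. indicator (cube R) x + H x \<partial>lebesgue)"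
    by (rule Bochner_Integration.integral_mono[OF int Hint bound])
  also have "\<dots> = (2 * R) ^ ?n + (\<integral>x. H x \<partial>lebesgue)"
    using integral_indicator_cube[OF \<Omega>(3), where 'n='n]
    by (subst Bochner_Integration.integral_add) (auto intro: integrable_indicator_cube simp: H_def intp_integrable[OF Ki h(1)])
  also have "(\<integral>x. H x \<partial>lebesgue) = h ^ ?n * (\<Sum>z\<in>S. \<eta> z ^ (2 * k) * Gam (v z) powr a)"
    unfolding H_def by (rule integral_intp[OF Ki h(1)])
  also have "(\<Sum>z\<in>S. \<eta> z ^ (2 * k) * Gam (v z) powr a) \<le> d.higher_const * card E"
    using d.higher_integrability unfolding a_def v_def[abs_def] d.v_def[abs_def] .
  also have "h ^ ?n * (d.higher_const * card E) \<le> \<bar>d.higher_const\<bar> * (2 * R + 1) ^ ?n"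
  proof -
    have "h ^ ?n * (d.higher_const * card E) \<le> h ^ ?n * (\<bar>d.higher_const\<bar> * card E)"
      using h by (intro mult_left_mono mult_right_mono) auto
    also have "\<dots> = \<bar>d.higher_const\<bar> * (h ^ ?n * card E)" by simp
    also have "\<dots> \<le> \<bar>d.higher_const\<bar> * (2 * R + 1) ^ ?n"
      using EK K' by (intro mult_left_mono card_lattice_cube_le h \<Omega>) auto
    finally show ?thesis .
  qed
  also have "(2 * R) ^ ?n \<le> (2 * R + 1) ^ ?n" using \<Omega>(3) by (intro power_mono) auto
  finally have fin: "(\<integral>x. zext A (\<lambda>x. \<bar>G u h x\<bar> powr q) x \<partial>lebesgue) \<le> (2 * R + 1) ^ ?n + \<bar>d.higher_const\<bar> * (2 * R + 1) ^ ?n"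
    using h by (simp add: mult_left_mono)
  show "(\<integral>x. zext A (\<lambda>x. \<bar>G u h x\<bar> powr q) x \<partial>lebesgue) \<le> local_const q \<delta>"
    using fin unfolding local_const_def \<tau>_def[symmetric] k_def[symmetric] by (simp add: distrib_right)
qed

text \<open>Sampling the given competitor and interpolating the lattice minimiser both lower the
  energy by Jensen's inequality, up to the smoothing error of the fixed function \<open>U'\<close>.
  The result \<psi> is again a test function, while \<open>G\<close> is the exact interpolated
  difference quotient, for which the lattice estimate holds; the two gradients differ locally only
  by that error.\<close>

lemma regularise:
  assumes \<phi>: "test_function \<Omega> \<phi>" and K': "compact K'" "K' \<subseteq> \<Omega>" and \<epsilon>: "\<epsilon> > 0"
  obtains \<psi> G where "test_function \<Omega> \<psi>" "\<And>x. \<bar>\<psi> x\<bar> \<le> 2 * B" "energy_of \<psi> \<le> energy_of \<phi> + \<epsilon>"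
    "G \<in> borel_measurable lebesgue"
    "integrable lebesgue (zext K' (\<lambda>x. g one x + partial_deriv one \<psi> x - G x))"
    "(\<integral>x. \<bar>zext K' (\<lambda>x. g one x + partial_deriv one \<psi> x - G x) x\<bar> \<partial>lebesgue) \<le> \<epsilon>"
    "\<And>q \<delta> A. 1 \<le> q \<Longrightarrow> \<epsilon> \<le> \<delta> \<Longrightarrow> compact A \<Longrightarrow> thick A \<delta> \<subseteq> K' \<Longrightarrow>
       integrable lebesgue (zext A (\<lambda>x. \<bar>G x\<bar> powr q)) \<and> (\<integral>x. zext A (\<lambda>x. \<bar>G x\<bar> powr q) x \<partial>lebesgue) \<le> local_const q \<delta>"
proof -
  let ?n = "CARD('n)"
  define K0 where "K0 = K' \<union> closure {x. \<phi> x \<noteq> 0}"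
  have K0: "compact K0" "K0 \<subseteq> \<Omega>" using K' test_functionD(2,3)[OF \<phi>] by (auto simp: K0_def)
  obtain U U' d where U: "integrable lebesgue U" "\<And>i. integrable lebesgue (U' i)"
    and weakU: "\<And>i \<theta>. smooth \<theta> \<Longrightarrow> (\<integral>x. U x * partial_deriv i \<theta> x \<partial>lebesgue) = - (\<integral>x. U' i x * \<theta> x \<partial>lebesgue)"
    and UB: "AE x in lebesgue. \<bar>U x\<bar> \<le> B" and U0: "\<And>x. x \<notin> cube R \<Longrightarrow> U x = 0" "\<And>i x. x \<notin> cube R \<Longrightarrow> U' i x = 0"
    and d: "d > 0" "thick K0 d \<subseteq> \<Omega>" and Ug: "\<And>i x. x \<in> thick K0 (3 * d / 4) \<Longrightarrow> U' i x = zext \<Omega> (g i) x"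
  proof (rule global_extension[OF K0], goal_cases)
    case (1 U U' d)
    show ?case by (rule that; fact 1)
  qed
  \<comment> \<open>The errors of all directions, each multiplied by \<open>lip\<close>, must add up
    to at most \<epsilon>; \<open>lip + 1\<close> keeps the divisor positive.\<close>
  define \<epsilon>' where "\<epsilon>' = \<epsilon> / (real ?n * (lip + 1))"
  have \<epsilon>': "\<epsilon>' > 0" using \<epsilon> lip(2) by (simp add: \<epsilon>'_def)
  have "\<forall>i. \<exists>h0>0. h0 \<le> 1 \<and> (\<forall>h S. 0 < h \<and> h < h0 \<and> covers h (R + 10) S \<longrightarrow>
     (\<integral>x. \<bar>U' i x - intp (Ki i) h S (samp (M i) h (U' i)) x\<bar> \<partial>lebesgue) < \<epsilon>')"
    using intp_samp_converges[OF Ki M(1) U(2) U0(2) \<epsilon>' \<Omega>(3)] by blast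
  then obtain H where H: "\<And>i. H i > 0" "\<And>i. H i \<le> 1" "\<And>i h S. 0 < h \<Longrightarrow> h < H i \<Longrightarrow> covers h (R + 10) S \<Longrightarrow>
     (\<integral>x. \<bar>U' i x - intp (Ki i) h S (samp (M i) h (U' i)) x\<bar> \<partial>lebesgue) < \<epsilon>'"
    by metis
  \<comment> \<open>The bound d/12 gives d/2 + 3h \<le> 3d/4, so kernels of free nodes stay where
    \<open>U'\<close> is the true gradient; the second bound is the requirement of
    \<open>local_estimate\<close>; the others make the smoothing errors small.\<close>
  define h where "h = Min ({d / 12, \<epsilon> / (6 * real ?n)} \<union> range (\<lambda>i. H i / 2))"
  have h: "h > 0" "h \<le> d / 12" "6 * real ?n * h \<le> \<epsilon>" "\<And>i. h < H i" "h \<le> 1"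
  proof -
    show "h > 0" unfolding h_def using d \<epsilon> H(1) by (subst Min_gr_iff) auto
    show "h \<le> d / 12" unfolding h_def by (rule Min_le) auto
    have "h \<le> \<epsilon> / (6 * real ?n)" unfolding h_def by (rule Min_le) auto
    then show "6 * real ?n * h \<le> \<epsilon>" by (simp add: pos_le_divide_eq mult.commute)
    have "h \<le> H i / 2" for i unfolding h_def by (rule Min_le) auto
    then show "h < H i" for i using H(1)[of i] by (smt (verit) field_sum_of_halves)
    then show "h \<le> 1" using H(2)[of one] by (meson less_imp_le order_trans)
  qed
  obtain S :: "(int ^ 'n) set" where S: "covers h (R + 10) S" using covers_exists[OF h(1)] by blast
  have finS: "finite S" using S by (simp add: covers_def)
  \<comment> \<open>The free nodes. The width d/2 includes every node whose kernel meets the support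
    of \<phi>, and both ends of edges in direction \<open>one\<close> that start over
    \<open>K'\<close>.\<close>
  define P where "P = {z :: int ^ 'n. h *\<^sub>R lat z \<in> thick K0 (d / 2)}"
  have PR: "\<bar>h * real_of_int (z $ i)\<bar> \<le> R" if "z \<in> P" for z i
  proof -
    have "h *\<^sub>R lat z \<in> thick K0 d" using that thick_mono[of K0 K0 "d / 2" d] d(1) by (auto simp: P_def)
    then have "h *\<^sub>R lat z \<in> cube R" using d(2) \<Omega>(2) by blast
    then have "\<bar>(h *\<^sub>R lat z) $ i\<bar> \<le> R" unfolding mem_cube by blast
    then show ?thesis by simp
  qed
  have PS: "P \<subseteq> S" "\<And>z i. z \<in> P \<Longrightarrow> z - axis i 1 \<in> S"
  proof -
    show "P \<subseteq> S"
    proof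
      fix z assume "z \<in> P"
      then have "\<bar>h * real_of_int (z $ i)\<bar> \<le> R + 10" for i using PR[of z i] by simp
      then show "z \<in> S" using S unfolding covers_def by blast
    qed
    fix z i assume "z \<in> P"
    have "\<bar>h * real_of_int ((axis i 1 :: int ^ 'n) $ j)\<bar> \<le> 1" for j using h by (simp add: axis_def)
    then have "\<bar>h * real_of_int ((z - axis i 1) $ j)\<bar> \<le> R + 10" for j
      using PR[OF \<open>z \<in> P\<close>, of j] by (simp add: right_diff_distrib) (smt (verit))
    then show "z - axis i 1 \<in> S" using S unfolding covers_def by blast
  qed
  have finP: "finite P" using PS(1) finS finite_subset by blast
  define Uh where "Uh = samp L h U"
  have UhB: "\<bar>Uh z\<bar> \<le> B" for z
  proof -
    have "AE x in lebesgue. L ((1/h) *\<^sub>R x - lat z) \<noteq> 0 \<longrightarrow> \<bar>U x - 0\<bar> \<le> B" using UB by eventually_elim simp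
    from samp_local_bound[OF L h(1) U(1) this] show ?thesis by (simp add: Uh_def)
  qed
  obtain u where u: "\<And>z. z \<notin> P \<Longrightarrow> u z = Uh z" "\<And>z. \<bar>u z\<bar> \<le> B"
    "\<And>w. (\<And>z. z \<notin> P \<Longrightarrow> w z = Uh z) \<Longrightarrow> lattice_energy F (\<lambda>i. axis i 1) h S u \<le> lattice_energy F (\<lambda>i. axis i 1) h S w"
  proof (rule lattice_minimiser_exists[of F h B Uh P "\<lambda>i. axis i 1 :: int ^ 'n" S], goal_cases)
    case (7 u)
    show ?case by (rule that; fact 7)
  qed (rule F_continuous F_mono_pos F_mono_neg h(1) B(2) UhB; assumption)+
  \<comment> \<open>Interpolating only the difference to the sampled datum gives compact support,
    since that difference vanishes off \<open>P\<close>.\<close>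
  define \<psi> where "\<psi> = intp K h P (\<lambda>z. u z - Uh z)"
  let ?Z = "thick K0 (3 * d / 4)"
  have Z: "compact ?Z" "?Z \<subseteq> \<Omega>" using compact_thick[OF K0(1)] thick_mono[of K0 K0 "3 * d / 4" d] d by auto
  have near: "thick {h *\<^sub>R lat z} (3 * h) \<subseteq> ?Z" if "z \<in> P" for z
  proof -
    have "thick {h *\<^sub>R lat z} (3 * h) \<subseteq> thick (thick K0 (d / 2)) (3 * h)" using that by (intro thick_mono) (auto simp: P_def)
    also have "\<dots> \<subseteq> thick K0 (d / 2 + 3 * h)" by (rule thick_thick)
    also have "\<dots> \<subseteq> ?Z" using h(2) by (intro thick_mono) auto
    finally show ?thesis .
  qed
  have \<psi>Z: "test_function \<Omega> \<psi>" "closure {x. \<psi> x \<noteq> 0} \<subseteq> ?Z"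
  proof -
    have sm: "smooth \<psi>" unfolding \<psi>_def intp_def by (intro smooth_sum smooth_cmult smooth_kern_scaled K)
    have supp: "x \<in> ?Z" if nz: "\<psi> x \<noteq> 0" for x
    proof -
      obtain z where z: "z \<in> P" "K ((1/h) *\<^sub>R x - lat z) \<noteq> 0"
        using nz unfolding \<psi>_def intp_def by (metis (mono_tags, lifting) mult_zero_right sum.neutral)
      have "x \<in> thick {h *\<^sub>R lat z} (3 * h)" using kern_scaled_support[OF K(1) h(1) z(2)] by (intro thickI) auto
      then show ?thesis using near[OF z(1)] by blast
    qed
    show "test_function \<Omega> \<psi>" by (rule test_functionI[OF sm Z supp])
    show "closure {x. \<psi> x \<noteq> 0} \<subseteq> ?Z" using supp Z(1) compact_imp_closed by (intro closure_minimal) auto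
  qed
  have \<phi>Z: "closure {x. \<phi> x \<noteq> 0} \<subseteq> ?Z"
    using subset_thick[of "3 * d / 4" K0] d(1) by (auto simp: K0_def)
  have K'Z: "K' \<subseteq> ?Z" using subset_thick[of "3 * d / 4" K0] d(1) by (auto simp: K0_def)
  define D where "D i w z = (w (z + axis i 1) - w z) / h" for i and w :: "int ^ 'n \<Rightarrow> real" and z
  define G where "G i = intp (Ki i) h S (D i u)" for i
  define T where "T i = intp (Ki i) h S (samp (M i) h (U' i))" for i
  define r where "r i x = U' i x - T i x" for i x
  have Gint: "integrable lebesgue (G i)" for i unfolding G_def by (rule intp_integrable[OF Ki h(1)])
  have rint: "integrable lebesgue (r i)" for i
    unfolding r_def T_def by (intro Bochner_Integration.integrable_diff U intp_integrable Ki h)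
  have rsmall: "(\<integral>x. \<bar>r i x\<bar> \<partial>lebesgue) \<le> \<epsilon>'" for i
    unfolding r_def T_def using H(3)[OF h(1) h(4) S, of i] by (simp add: less_imp_le)
  have d\<psi>: "partial_deriv i \<psi> x = G i x - T i x" for i x
  proof -
    have "partial_deriv i \<psi> x = intp (Ki i) h S (D i (\<lambda>z. u z - Uh z)) x"
      unfolding \<psi>_def D_def by (rule intp_partial[OF finS PS(1)]) (use PS(2) u(1) in auto)
    also have "D i (\<lambda>z. u z - Uh z) = (\<lambda>z. D i u z - samp (M i) h (U' i) z)"
    proof
      fix z
      have "(samp L h U (z + axis i 1) - samp L h U z) / h = samp (M i) h (U' i) z"
        by (rule samp_difference_quotient[OF h(1) U(1)]) (rule weakU)
      then show "D i (\<lambda>z. u z - Uh z) z = D i u z - samp (M i) h (U' i) z"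
        by (simp add: D_def Uh_def diff_divide_distrib)
    qed
    also have "intp (Ki i) h S (\<lambda>z. D i u z - samp (M i) h (U' i) z) x = G i x - T i x"
      unfolding G_def T_def intp_def by (simp add: left_diff_distrib sum_subtractf)
    finally show ?thesis .
  qed
  \<comment> \<open>The gradient of the new competitor is the interpolated difference quotient plus
    an error \<open>r i\<close> that depends on the datum and the step but not on the
    minimiser.\<close>
  have decomp: "U' i x + partial_deriv i \<psi> x = r i x + G i x" for i x by (simp add: d\<psi> r_def)
  define W' where "W' i x = U' i x + partial_deriv i \<phi> x" for i x
  have W'int: "integrable lebesgue (W' i)" for i
    unfolding W'_def by (intro Bochner_Integration.integrable_add U test_function_integrable[OF test_function_partial_deriv[OF \<phi>]])
  define wh where "wh = samp L h (\<lambda>x. U x + \<phi> x)"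
  have \<phi>int: "integrable lebesgue \<phi>" by (rule test_function_integrable[OF \<phi>])
  have Dwh: "D i wh z = samp (M i) h (W' i) z" for i z
    unfolding D_def wh_def
  proof (rule samp_difference_quotient[OF h(1)])
    show "integrable lebesgue (\<lambda>x. U x + \<phi> x)" using U(1) \<phi>int by simp
    fix \<theta> assume \<theta>: "smooth (\<theta> :: real ^ 'n \<Rightarrow> real)"
    have bdd: "integrable lebesgue (\<lambda>x. V x * t x)" if V: "integrable lebesgue V" "\<And>x. x \<notin> cube R \<Longrightarrow> V x = 0" and t: "smooth (t :: real ^ 'n \<Rightarrow> real)" for V t
    proof -
      have "bounded (t ` cube R)" by (intro compact_imp_bounded compact_continuous_image smooth_continuous_on t compact_cbox)
      then obtain C where C: "\<And>x. x \<in> cube R \<Longrightarrow> \<bar>t x\<bar> \<le> C" unfolding bounded_iff by auto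
      show ?thesis
      proof (rule Bochner_Integration.integrable_bound[of lebesgue "\<lambda>x. C * V x"])
        have "t \<in> borel_measurable lebesgue"
          by (intro measurable_completion) (simp add: borel_measurable_continuous_onI[OF smooth_continuous_on[OF t]])
        then show "(\<lambda>x. V x * t x) \<in> borel_measurable lebesgue" using V by (intro borel_measurable_times) auto
        show "AE x in lebesgue. norm (V x * t x) \<le> norm (C * V x)"
        proof (rule AE_I2)
          fix x show "norm (V x * t x) \<le> norm (C * V x)"
          proof (cases "x \<in> cube R")
            case True
            have "\<bar>V x\<bar> * \<bar>t x\<bar> \<le> \<bar>V x\<bar> * \<bar>C\<bar>" using C[OF True] by (intro mult_left_mono) auto
            then show ?thesis by (simp add: abs_mult mult.commute)
          qed (simp add: V(2))
        qed
      qed (use V in simp)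
    qed
    have t1: "integrable lebesgue (\<lambda>x. \<phi> x * partial_deriv i \<theta> x)" "integrable lebesgue (\<lambda>x. partial_deriv i \<phi> x * \<theta> x)"
      by (rule test_function_integrable[OF test_function_mult_smooth[OF \<phi> smooth_partial_deriv[OF \<theta>]]],
          rule test_function_integrable[OF test_function_mult_smooth[OF test_function_partial_deriv[OF \<phi>] \<theta>]])
    have t2: "integrable lebesgue (\<lambda>x. U x * partial_deriv i \<theta> x)" "integrable lebesgue (\<lambda>x. U' i x * \<theta> x)"
      by (intro bdd U U0 \<theta> smooth_partial_deriv; assumption)+
    show "(\<integral>x. (U x + \<phi> x) * partial_deriv i \<theta> x \<partial>lebesgue) = - (\<integral>x. W' i x * \<theta> x \<partial>lebesgue)"
      unfolding W'_def distrib_right using weakU[OF \<theta>, of i] integration_by_parts[OF \<phi> \<theta>, of i] t1 t2 by simp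
  qed
  \<comment> \<open>The samples of the given competitor agree with those of the datum off
    \<open>P\<close>, so they compete with \<open>u\<close> on the lattice.\<close>
  have wh_off: "wh z = Uh z" if "z \<notin> P" for z
  proof -
    have "samp L h \<phi> z = 0"
    proof (rule samp_eq_0[OF L])
      fix x assume nz: "L ((1/h) *\<^sub>R x - lat z) \<noteq> 0"
      show "\<phi> x = 0"
      proof (rule ccontr)
        assume "\<phi> x \<noteq> 0"
        then have "x \<in> K0" using test_functionD(4)[OF \<phi>] by (auto simp: K0_def)
        then have "h *\<^sub>R lat z \<in> thick K0 (3 * h)"
          by (rule thickI) (use kern_scaled_support[OF L h(1) nz] in \<open>simp add: abs_minus_commute\<close>)
        also have "\<dots> \<subseteq> thick K0 (d / 2)" using h(1,2) d(1) by (intro thick_mono) auto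
        finally show False using that by (simp add: P_def)
      qed
    qed
    moreover have "wh z = samp L h U z + samp L h \<phi> z"
      unfolding wh_def samp_def distrib_right
      by (subst Bochner_Integration.integral_add) (auto intro!: samp_integrable L U \<phi>int simp: add_divide_distrib)
    ultimately show ?thesis by (simp add: Uh_def)
  qed
  \<comment> \<open>Jensen for interpolation, minimality of \<open>u\<close>, and Jensen for
    sampling, in this order.\<close>
  have energy: "(\<Sum>i\<in>UNIV. \<integral>x. F i (G i x) \<partial>lebesgue) \<le> (\<Sum>i\<in>UNIV. \<integral>x. F i (W' i x) \<partial>lebesgue)"
  proof -
    have "(\<integral>x. F i (G i x) \<partial>lebesgue) \<le> h ^ ?n * (\<Sum>z\<in>S. F i (D i u z))" for i
    proof -
      have "(\<integral>x. F i (G i x) \<partial>lebesgue) \<le> (\<integral>x. intp (Ki i) h S (\<lambda>z. F i (D i u z)) x \<partial>lebesgue)"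
        unfolding G_def
        by (rule Bochner_Integration.integral_mono)
          (auto intro!: F_integrable intp_integrable Ki h intp_jensen F_convex F(1) finS)
      then show ?thesis unfolding integral_intp[OF Ki h(1)] .
    qed
    then have "(\<Sum>i\<in>UNIV. \<integral>x. F i (G i x) \<partial>lebesgue) \<le> (\<Sum>i\<in>UNIV. h ^ ?n * (\<Sum>z\<in>S. F i (D i u z)))" by (rule sum_mono)
    also have "\<dots> = h ^ ?n * lattice_energy F (\<lambda>i. axis i 1) h S u" by (simp add: lattice_energy_def D_def sum_distrib_left)
    also have "\<dots> \<le> h ^ ?n * lattice_energy F (\<lambda>i. axis i 1) h S wh" using h(1) wh_off by (intro mult_left_mono u(3)) auto
    also have "\<dots> = (\<Sum>i\<in>UNIV. h ^ ?n * (\<Sum>z\<in>S. F i (samp (M i) h (W' i) z)))"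
      by (simp add: lattice_energy_def Dwh[symmetric] D_def sum_distrib_left)
    also have "\<dots> \<le> (\<Sum>i\<in>UNIV. \<integral>x. F i (W' i x) \<partial>lebesgue)"
    proof (rule sum_mono)
      fix i
      have "h ^ ?n * (\<Sum>z\<in>S. F i (samp (M i) h (W' i) z)) \<le> h ^ ?n * (\<Sum>z\<in>S. samp (M i) h (\<lambda>x. F i (W' i x)) z)"
        using h(1) by (intro mult_left_mono sum_mono samp_jensen[where D="F' i"] M W'int F_integrable F_tangent) auto
      also have "\<dots> \<le> (\<integral>x. F i (W' i x) \<partial>lebesgue)"
        by (rule sum_samp_le[OF M(1) h(1) F_integrable[OF W'int] F_nonneg finS])
      finally show "h ^ ?n * (\<Sum>z\<in>S. F i (samp (M i) h (W' i) z)) \<le> (\<integral>x. F i (W' i x) \<partial>lebesgue)" .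
    qed
    finally show ?thesis .
  qed
  have zg: "integrable lebesgue (zext \<Omega> (g i))" for i using g(3) zext_integrable[OF open_sets_lebesgue[OF \<Omega>(1)]] by blast
  have main: "energy_of \<psi> \<le> energy_of \<phi> + \<epsilon>"
  proof -
    have "(\<integral>x. F i (zext \<Omega> (g i) x + partial_deriv i \<psi> x) \<partial>lebesgue) \<le>
       (\<integral>x. F i (zext \<Omega> (g i) x + partial_deriv i \<phi> x) \<partial>lebesgue) + ((\<integral>x. F i (G i x) \<partial>lebesgue) - (\<integral>x. F i (W' i x) \<partial>lebesgue)) + lip * \<epsilon>'" for i
    proof -
      note ints = F_integrable[OF Gint[of i], of i] F_integrable[OF W'int[of i], of i] rint[of i]
        F_integrable[OF Bochner_Integration.integrable_add[OF zg[of i] test_function_integrable[OF test_function_partial_deriv[OF \<phi>]]], of i i]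
        F_integrable[OF Bochner_Integration.integrable_add[OF zg[of i] test_function_integrable[OF test_function_partial_deriv[OF \<psi>Z(1)]]], of i i]
      have pt: "F i (zext \<Omega> (g i) x + partial_deriv i \<psi> x) \<le> F i (zext \<Omega> (g i) x + partial_deriv i \<phi> x) + (F i (G i x) - F i (W' i x)) + lip * \<bar>r i x\<bar>" for x
      proof -
        have "F i (U' i x + partial_deriv i \<psi> x) \<le> F i (G i x) + lip * \<bar>r i x\<bar>"
          unfolding decomp using F_lipschitz[of i "r i x + G i x" "G i x"] by simp
        \<comment> \<open>On \<open>?Z\<close> the extension has the gradient of the datum; off
          \<open>?Z\<close> both test functions have zero gradient and the two sides coincide,
          whatever \<open>U'\<close> is there.\<close>
        moreover have "F i (zext \<Omega> (g i) x + partial_deriv i \<psi> x) = F i (zext \<Omega> (g i) x + partial_deriv i \<phi> x) + (F i (U' i x + partial_deriv i \<psi> x) - F i (W' i x))"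
        proof (cases "x \<in> ?Z")
          case True
          then show ?thesis by (simp add: Ug W'_def)
        next
          case False
          then have "partial_deriv i \<psi> x = 0" "partial_deriv i \<phi> x = 0"
            using \<psi>Z(2) \<phi>Z by (auto intro!: partial_deriv_outside)
          then show ?thesis by (simp add: W'_def)
        qed
        ultimately show ?thesis by linarith
      qed
      have "(\<integral>x. F i (zext \<Omega> (g i) x + partial_deriv i \<psi> x) \<partial>lebesgue) \<le>
        (\<integral>x. F i (zext \<Omega> (g i) x + partial_deriv i \<phi> x) + (F i (G i x) - F i (W' i x)) + lip * \<bar>r i x\<bar> \<partial>lebesgue)"
        using ints by (intro Bochner_Integration.integral_mono pt) (auto intro!: Bochner_Integration.integrable_add Bochner_Integration.integrable_diff)
      also have "\<dots> = (\<integral>x. F i (zext \<Omega> (g i) x + partial_deriv i \<phi> x) \<partial>lebesgue) + ((\<integral>x. F i (G i x) \<partial>lebesgue) - (\<integral>x. F i (W' i x) \<partial>lebesgue)) + lip * (\<integral>x. \<bar>r i x\<bar> \<partial>lebesgue)"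
        using ints by simp
      also have "lip * (\<integral>x. \<bar>r i x\<bar> \<partial>lebesgue) \<le> lip * \<epsilon>'" by (intro mult_left_mono rsmall lip)
      finally show ?thesis by simp
    qed
    then have "energy_of \<psi> \<le> (\<Sum>i\<in>UNIV. (\<integral>x. F i (zext \<Omega> (g i) x + partial_deriv i \<phi> x) \<partial>lebesgue) + ((\<integral>x. F i (G i x) \<partial>lebesgue) - (\<integral>x. F i (W' i x) \<partial>lebesgue)) + lip * \<epsilon>')"
      unfolding energy_of_def by (rule sum_mono)
    also have "\<dots> = energy_of \<phi> + ((\<Sum>i\<in>UNIV. \<integral>x. F i (G i x) \<partial>lebesgue) - (\<Sum>i\<in>UNIV. \<integral>x. F i (W' i x) \<partial>lebesgue)) + real ?n * (lip * \<epsilon>')"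
      by (simp add: energy_of_def sum.distrib sum_subtractf)
    also have "real ?n * (lip * \<epsilon>') \<le> \<epsilon>"
    proof -
      have "real ?n * (lip * \<epsilon>') = \<epsilon> * (lip / (lip + 1))" by (simp add: \<epsilon>'_def)
      also have "\<dots> \<le> \<epsilon> * 1" using \<epsilon> lip(2) by (intro mult_left_mono) auto
      finally show ?thesis by simp
    qed
    finally show ?thesis using energy by linarith
  qed
  have \<epsilon>'_le: "\<epsilon>' \<le> \<epsilon>"
  proof -
    have "1 \<le> real ?n" by (simp add: Suc_leI)
    then have "1 * 1 \<le> real ?n * (lip + 1)" using lip(2) by (intro mult_mono) auto
    then show ?thesis unfolding \<epsilon>'_def using \<epsilon> by (simp add: divide_le_eq mult_left_le)
  qed
  have gr: "zext K' (\<lambda>x. g one x + partial_deriv one \<psi> x - G one x) = zext K' (r one)"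
  proof
    fix x
    show "zext K' (\<lambda>x. g one x + partial_deriv one \<psi> x - G one x) x = zext K' (r one) x"
    proof (cases "x \<in> K'")
      case True
      then have "x \<in> ?Z" "x \<in> \<Omega>" using K'Z K'(2) by blast+
      then have "g one x = U' one x" using Ug[of x one] by (simp add: zext_def)
      then show ?thesis using decomp[of one x] True by (simp add: zext_def)
    qed (simp add: zext_def)
  qed
  have rK: "integrable lebesgue (zext K' (r one))"
    unfolding zext_eq by (rule integrable_mult_indicator[OF compact_sets_lebesgue[OF K'(1)] rint])
  show thesis
  proof (rule that[of \<psi> "G one"])
    show "\<bar>\<psi> x\<bar> \<le> 2 * B" for x
      unfolding \<psi>_def
    proof (rule intp_bound[OF K(1) finP])
      show "\<bar>u z - Uh z\<bar> \<le> 2 * B" for z using u(2)[of z] UhB[of z] by linarith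
    qed (use B(2) in simp)
    show "G one \<in> borel_measurable lebesgue" using Gint by auto
    have "(\<integral>x. \<bar>zext K' (r one) x\<bar> \<partial>lebesgue) \<le> (\<integral>x. \<bar>r one x\<bar> \<partial>lebesgue)"
      by (intro Bochner_Integration.integral_mono integrable_abs rK rint) (simp add: zext_def)
    then show "(\<integral>x. \<bar>zext K' (\<lambda>x. g one x + partial_deriv one \<psi> x - G one x) x\<bar> \<partial>lebesgue) \<le> \<epsilon>"
      unfolding gr using rsmall[of one] \<epsilon>'_le by linarith
    show "integrable lebesgue (zext K' (\<lambda>x. g one x + partial_deriv one \<psi> x - G one x))" unfolding gr by fact
    fix q \<delta> :: real and A assume q: "1 \<le> q" "\<epsilon> \<le> \<delta>" and A: "compact (A :: (real ^ 'n) set)" "thick A \<delta> \<subseteq> K'"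
    have Pn: "z \<in> P \<and> z + axis one 1 \<in> P" if "h *\<^sub>R lat z \<in> K'" for z
    proof -
      have z0: "h *\<^sub>R lat z \<in> K0" using that by (simp add: K0_def)
      have "h *\<^sub>R lat z \<in> thick K0 (d / 2)" using z0 subset_thick[of "d / 2" K0] d(1) by auto
      moreover have "h *\<^sub>R lat (z + axis one 1) \<in> thick K0 (d / 2)"
        by (rule thickI[OF z0]) (use h d(1) in \<open>auto simp: axis_def algebra_simps\<close>)
      ultimately show ?thesis by (simp add: P_def)
    qed
    have K'c: "K' \<subseteq> cube R" using K'(2) \<Omega>(2) by blast
    have min: "lattice_energy F (\<lambda>i. axis i 1) h S u \<le> lattice_energy F (\<lambda>i. axis i 1) h S w" if "\<And>z. z \<notin> P \<Longrightarrow> w z = u z" for w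
      by (rule u(3)) (use that u(1) in auto)
    have h\<delta>: "6 * real ?n * h \<le> \<delta>" using h(3) q(2) by simp
    note le = local_estimate[of h \<delta> q u P S K' A, OF h(1) h(5) h\<delta> q(1) u(2) _ _ S K'c A]
    have G1: "G one = intp (Ki one) h S (\<lambda>z. (u (z + axis one 1) - u z) / h)" by (simp add: G_def D_def[abs_def])
    show "integrable lebesgue (zext A (\<lambda>x. \<bar>G one x\<bar> powr q)) \<and> (\<integral>x. zext A (\<lambda>x. \<bar>G one x\<bar> powr q) x \<partial>lebesgue) \<le> local_const q \<delta>"
      unfolding G1
    proof
      show "integrable lebesgue (zext A (\<lambda>x. \<bar>intp (Ki one) h S (\<lambda>z. (u (z + axis one 1) - u z) / h) x\<bar> powr q))"
        by (rule le(1)) (rule min, simp, simp add: Pn)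
      show "(\<integral>x. zext A (\<lambda>x. \<bar>intp (Ki one) h S (\<lambda>z. (u (z + axis one 1) - u z) / h) x\<bar> powr q) x \<partial>lebesgue) \<le> local_const q \<delta>"
        by (rule le(2)) (rule min, simp, simp add: Pn)
    qed
  qed (use \<psi>Z(1) main in auto)
qed

end

section \<open>Passage to the limit\<close>

text \<open>For quadratic \<open>Q\<close> the differences in the conclusion are squared distances, by the parallelogram law;
  the sets \<open>C\<close> need only be closed under midpoints.\<close>

lemma almost_minimal_cauchy:
  fixes Q :: "nat \<Rightarrow> 'v \<Rightarrow> real" and C :: "nat \<Rightarrow> 'v set"
  assumes ne: "\<And>m. C m \<noteq> {}" and dec: "\<And>m k. m \<le> k \<Longrightarrow> C k \<subseteq> C m"
    and mid: "\<And>m x y. x \<in> C m \<Longrightarrow> y \<in> C m \<Longrightarrow> mid x y \<in> C m"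
    and Q: "\<And>m x. 0 \<le> Q m x" "\<And>m k x. m \<le> k \<Longrightarrow> Q m x \<le> Q k x" "\<And>m x. x \<in> C m \<Longrightarrow> Q m x \<le> b"
  obtains v where "\<And>m. v m \<in> C m"
    "\<And>\<epsilon>. \<epsilon> > 0 \<Longrightarrow> \<exists>N. \<forall>m\<ge>N. \<forall>k\<ge>m. Q m (v m) / 2 + Q m (v k) / 2 - Q m (mid (v m) (v k)) < \<epsilon>"
proof -
  define I where "I m = Inf (Q m ` C m)" for m
  have bdd: "bdd_below (Q m ` C m)" for m using Q(1) by (intro bdd_belowI[of _ 0]) auto
  have I_le: "I m \<le> Q m x" if "x \<in> C m" for m x
    unfolding I_def using bdd that by (intro cInf_lower) auto
  have "\<exists>x\<in>C m. Q m x < I m + 1 / (real m + 1)" for m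
    using cInf_less_iff[OF _ bdd, of m "I m + 1 / (real m + 1)"] ne[of m] unfolding I_def by auto
  then obtain v where v: "\<And>m. v m \<in> C m" "\<And>m. Q m (v m) < I m + 1 / (real m + 1)" by metis
  \<comment> \<open>The infima increase because \<open>Q m\<close> grows while \<open>C m\<close>
    shrinks. Being bounded by \<open>b\<close> they converge, so \<open>v k\<close> is almost
    minimal for \<open>Q m\<close> as well when \<open>k \<ge> m\<close>, while the midpoint cannot
    fall below \<open>I m\<close>.\<close>
  have I_mono: "I m \<le> I k" if "m \<le> k" for m k
    unfolding I_def[of k]
  proof (rule cInf_greatest)
    fix y assume "y \<in> Q k ` C k"
    then obtain x where x: "x \<in> C k" "y = Q k x" by blast
    then have "I m \<le> Q m x" using dec[OF that] I_le by blast
    then show "I m \<le> y" using Q(2)[OF that, of x] x by simp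
  qed (use ne in simp)
  have "I m \<le> b" for m using I_le[OF v(1)] Q(3)[OF v(1)] by (rule order_trans)
  moreover have "incseq I" using I_mono by (simp add: incseq_def)
  ultimately obtain l where "I \<longlonglongrightarrow> l" using incseq_convergent[of I b] by blast
  then have "Cauchy I" by (rule LIMSEQ_imp_Cauchy)
  have "\<exists>N. \<forall>m\<ge>N. \<forall>k\<ge>m. Q m (v m) / 2 + Q m (v k) / 2 - Q m (mid (v m) (v k)) < \<epsilon>" if \<epsilon>: "\<epsilon> > 0" for \<epsilon>
  proof -
    obtain N1 where N1: "\<And>m k. m \<ge> N1 \<Longrightarrow> k \<ge> N1 \<Longrightarrow> \<bar>I m - I k\<bar> < \<epsilon>"
      using \<open>Cauchy I\<close> \<epsilon> unfolding Cauchy_def dist_real_def by metis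
    obtain N2 :: nat where N2: "1 / \<epsilon> < real N2 / 2" using reals_Archimedean2[of "2 * (1 / \<epsilon>)"] by auto
    have "Q m (v m) / 2 + Q m (v k) / 2 - Q m (mid (v m) (v k)) < \<epsilon>" if m: "m \<ge> max N1 N2" and k: "k \<ge> m" for m k
    proof -
      have vk: "v k \<in> C m" using v(1)[of k] dec[OF k] by blast
      have 1: "I m \<le> Q m (mid (v m) (v k))" by (rule I_le[OF mid[OF v(1) vk]])
      have 2: "Q m (v k) \<le> I k + 1 / (real k + 1)" using Q(2)[OF k, of "v k"] v(2)[of k] by linarith
      have 3: "I k < I m + \<epsilon>" using N1[of m k] m k by auto
      have small: "1 / (real j + 1) < \<epsilon> / 2" if "j \<ge> N2" for j
      proof -
        have "2 < \<epsilon> * real N2" using N2 \<epsilon> by (simp add: field_simps)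
        also have "\<dots> \<le> \<epsilon> * (real j + 1)" using that \<epsilon> by (intro mult_left_mono) auto
        finally show ?thesis by (simp add: field_simps)
      qed
      show ?thesis using 1 2 3 v(2)[of m] small[of m] small[of k] m k by simp
    qed
    then show ?thesis by blast
  qed
  with v(1) show thesis using that by blast
qed

text \<open>A subsequence with geometrically small increments converges absolutely almost everywhere
  and in the mean. The Cauchy condition is asked for \<open>k \<ge> m\<close> only, the form
  delivered by \<open>almost_minimal_cauchy\<close>.\<close>

lemma L1_complete:
  fixes f :: "nat \<Rightarrow> 'a \<Rightarrow> real"
  assumes f: "\<And>n. integrable M (f n)"
    and cauchy: "\<And>\<epsilon>. \<epsilon> > 0 \<Longrightarrow> \<exists>N. \<forall>m\<ge>N. \<forall>k\<ge>m. (\<integral>x. \<bar>f m x - f k x\<bar> \<partial>M) < \<epsilon>"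
  obtains l where "integrable M l" "(\<lambda>n. \<integral>x. \<bar>f n x - l x\<bar> \<partial>M) \<longlonglongrightarrow> 0"
proof -
  have "\<forall>j. \<exists>N. \<forall>m\<ge>N. \<forall>k\<ge>m. (\<integral>x. \<bar>f m x - f k x\<bar> \<partial>M) < (1/2)^j" using cauchy by simp
  then obtain N where N: "\<And>j m k. m \<ge> N j \<Longrightarrow> k \<ge> m \<Longrightarrow> (\<integral>x. \<bar>f m x - f k x\<bar> \<partial>M) < (1/2)^j" by metis
  define r where "r = rec_nat (N 0) (\<lambda>j s. max (Suc s) (N (Suc j)))"
  have r_Suc: "r (Suc j) = max (Suc (r j)) (N (Suc j))" for j by (simp add: r_def)
  have rN: "r j \<ge> N j" for j by (cases j) (auto simp: r_def)
  have r_mono: "strict_mono r" by (rule strict_monoI_Suc) (simp add: r_Suc)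
  define d where "d j x = f (r (Suc j)) x - f (r j) x" for j x
  have dint: "integrable M (d j)" for j unfolding d_def by (intro Bochner_Integration.integrable_diff f)
  have dsmall: "(\<integral>x. \<bar>d j x\<bar> \<partial>M) < (1/2)^j" for j
    using N[of j "r j" "r (Suc j)"] rN[of j] r_Suc[of j] by (simp add: d_def abs_minus_commute)
  have sumint: "summable (\<lambda>j. \<integral>x. norm (d j x) \<partial>M)"
    by (rule summable_comparison_test'[of "\<lambda>j. (1/2)^j" 0])
      (use dsmall in \<open>auto intro: less_imp_le simp: summable_geometric\<close>)
  have AEsum: "AE x in M. summable (\<lambda>j. norm (d j x))"
  proof -
    have "(\<integral>\<^sup>+x. (\<Sum>j. ennreal (norm (d j x))) \<partial>M) = (\<Sum>j. \<integral>\<^sup>+x. ennreal (norm (d j x)) \<partial>M)"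
      using dint by (intro nn_integral_suminf) auto
    also have "\<dots> = (\<Sum>j. ennreal (\<integral>x. norm (d j x) \<partial>M))"
      using dint by (intro suminf_cong nn_integral_eq_integral) auto
    also have "\<dots> \<noteq> \<infinity>" using sumint by (simp add: ennreal_suminf_neq_top)
    finally have "AE x in M. (\<Sum>j. ennreal (norm (d j x))) \<noteq> \<infinity>"
      using dint by (intro nn_integral_PInf_AE) auto
    then show ?thesis by eventually_elim (intro summable_suminf_not_top, auto)
  qed
  define l where "l x = f (r 0) x + (\<Sum>j. d j x)" for x
  have sint: "integrable M (\<lambda>x. \<Sum>j. d j x)" by (rule integrable_suminf[OF dint AEsum sumint])
  have lint: "integrable M l" unfolding l_def by (intro Bochner_Integration.integrable_add f sint)
  have tele: "f (r n) x = f (r 0) x + (\<Sum>j<n. d j x)" for n x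
    by (induction n) (auto simp: d_def)
  have sub: "(\<lambda>n. \<integral>x. \<bar>f (r n) x - l x\<bar> \<partial>M) \<longlonglongrightarrow> (\<integral>x. 0 \<partial>M)"
  proof (rule integral_dominated_convergence[where w="\<lambda>x. 2 * (\<Sum>j. norm (d j x))"])
    show "integrable M (\<lambda>x. 2 * (\<Sum>j. norm (d j x)))"
      by (intro integrable_mult_right integrable_suminf) (use dint AEsum sumint in auto)
    show "AE x in M. (\<lambda>n. \<bar>f (r n) x - l x\<bar>) \<longlonglongrightarrow> 0"
      using AEsum
    proof eventually_elim
      case (elim x)
      then have "(\<lambda>n. \<Sum>j<n. d j x) \<longlonglongrightarrow> (\<Sum>j. d j x)" by (rule summable_LIMSEQ[OF summable_norm_cancel])
      then have "(\<lambda>n. \<bar>(\<Sum>j<n. d j x) - (\<Sum>j. d j x)\<bar>) \<longlonglongrightarrow> 0" by (rule tendsto_rabs_zero[OF LIM_zero])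
      moreover have "f (r n) x - l x = (\<Sum>j<n. d j x) - (\<Sum>j. d j x)" for n using tele[of n x] by (simp add: l_def)
      ultimately show ?case by simp
    qed
    show "AE x in M. norm \<bar>f (r n) x - l x\<bar> \<le> 2 * (\<Sum>j. norm (d j x))" for n
      using AEsum
    proof eventually_elim
      case (elim x)
      have "\<bar>\<Sum>j<n. d j x\<bar> \<le> (\<Sum>j<n. norm (d j x))" unfolding real_norm_def by (rule sum_abs)
      also have "\<dots> \<le> (\<Sum>j. norm (d j x))" using elim by (intro sum_le_suminf) auto
      finally have "\<bar>\<Sum>j<n. d j x\<bar> \<le> (\<Sum>j. norm (d j x))" .
      moreover have "\<bar>\<Sum>j. d j x\<bar> \<le> (\<Sum>j. norm (d j x))" using summable_norm[OF elim] by simp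
      ultimately show ?case using tele[of n x] by (simp add: l_def)
    qed
  qed (use f lint in auto)
  have "(\<lambda>n. \<integral>x. \<bar>f n x - l x\<bar> \<partial>M) \<longlonglongrightarrow> 0"
  proof (rule LIMSEQ_I)
    fix \<epsilon> :: real assume \<epsilon>: "\<epsilon> > 0"
    obtain N1 where N1: "\<And>m k. m \<ge> N1 \<Longrightarrow> k \<ge> m \<Longrightarrow> (\<integral>x. \<bar>f m x - f k x\<bar> \<partial>M) < \<epsilon> / 2" using cauchy[of "\<epsilon> / 2"] \<epsilon> by auto
    have "eventually (\<lambda>n. (\<integral>x. \<bar>f (r n) x - l x\<bar> \<partial>M) < \<epsilon> / 2) sequentially"
      using order_tendstoD(2)[OF sub, of "\<epsilon> / 2"] \<epsilon> by simp
    then obtain N2 where N2: "\<And>n. n \<ge> N2 \<Longrightarrow> (\<integral>x. \<bar>f (r n) x - l x\<bar> \<partial>M) < \<epsilon> / 2" unfolding eventually_sequentially by blast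
    have "norm ((\<integral>x. \<bar>f n x - l x\<bar> \<partial>M) - 0) < \<epsilon>" if n: "n \<ge> N1" for n
    proof -
      let ?k = "r (max n N2)"
      have k: "?k \<ge> n" using strict_mono_imp_increasing[OF r_mono, of "max n N2"] by simp
      have "(\<integral>x. \<bar>f n x - l x\<bar> \<partial>M) \<le> (\<integral>x. \<bar>f n x - f ?k x\<bar> + \<bar>f ?k x - l x\<bar> \<partial>M)"
        by (intro Bochner_Integration.integral_mono) (use f lint in \<open>auto intro!: Bochner_Integration.integrable_add\<close>)
      also have "\<dots> = (\<integral>x. \<bar>f n x - f ?k x\<bar> \<partial>M) + (\<integral>x. \<bar>f ?k x - l x\<bar> \<partial>M)"
        by (intro Bochner_Integration.integral_add) (use f lint in auto)
      also have "\<dots> < \<epsilon>" using N1[OF n k] N2[of "max n N2"] by simp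
      finally show ?thesis by simp
    qed
    then show "\<exists>no. \<forall>n\<ge>no. norm ((\<integral>x. \<bar>f n x - l x\<bar> \<partial>M) - 0) < \<epsilon>" by blast
  qed
  with lint show thesis using that by blast
qed

lemma abs_powr_2: "\<bar>t\<bar> powr 2 = t\<^sup>2" for t :: real
  by (cases "t = 0") auto

text \<open>Convexity of the power for positive arguments; if one argument is 0, the estimate
  (1/2)^q \<le> 1/2 takes its place.\<close>

lemma powr_midpoint:
  fixes a b q :: real
  assumes "1 \<le> q"
  shows "\<bar>(a + b) / 2\<bar> powr q \<le> (\<bar>a\<bar> powr q + \<bar>b\<bar> powr q) / 2"
proof -
  have key: "((s + t) / 2) powr q \<le> (s powr q + t powr q) / 2" if "0 \<le> s" "0 \<le> t" for s t :: real
  proof -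
    have half: "(x / 2) powr q \<le> x powr q / 2" if "0 \<le> x" for x :: real
    proof -
      have "(1/2) powr q \<le> (1/2 :: real) powr 1" using assms by (intro powr_mono') auto
      then have "x powr q * (1/2) powr q \<le> x powr q * (1/2)" by (intro mult_left_mono) auto
      moreover have "(x / 2) powr q = x powr q * (1/2) powr q" using that by (simp add: powr_divide)
      ultimately show ?thesis by simp
    qed
    consider "s = 0" | "t = 0" | "0 < s" "0 < t" using \<open>0 \<le> s\<close> \<open>0 \<le> t\<close> by linarith
    then show ?thesis
    proof cases
      case 3
      have "((1 - 1/2) *\<^sub>R s + (1/2) *\<^sub>R t) powr q \<le> (1 - 1/2) * s powr q + (1/2) * t powr q"
        by (rule convex_onD[OF powr_convex[OF assms]]) (use 3 in auto)
      then show ?thesis by (simp add: add_divide_distrib)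
    qed (use half that in auto)
  qed
  have "\<bar>(a + b) / 2\<bar> powr q \<le> ((\<bar>a\<bar> + \<bar>b\<bar>) / 2) powr q" using assms by (intro powr_mono2) auto
  also have "\<dots> \<le> (\<bar>a\<bar> powr q + \<bar>b\<bar> powr q) / 2" by (rule key) auto
  finally show ?thesis .
qed

lemma thick_exhaustion: "\<exists>\<delta>>0. thick (exhaustion \<Omega> j) \<delta> \<subseteq> exhaustion \<Omega> (Suc j)" for \<Omega> :: "(real ^ 'n) set"
proof -
  let ?n = "real CARD('n)"
  define s where "s = min 1 (1 / (real j + 1) - 1 / (real (Suc j) + 1))"
  have "1 / (real (Suc j) + 1) < 1 / (real j + 1)" by (rule divide_strict_left_mono) auto
  then have s: "s > 0" by (simp add: s_def)
  have "thick (exhaustion \<Omega> j) (s / ?n) \<subseteq> exhaustion \<Omega> (Suc j)"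
  proof
    fix x assume "x \<in> thick (exhaustion \<Omega> j) (s / ?n)"
    then obtain y where y: "y \<in> exhaustion \<Omega> j" "\<And>i. \<bar>x $ i - y $ i\<bar> \<le> s / ?n" unfolding thick_def by blast
    have "norm (x - y) \<le> ?n * (s / ?n)" by (rule norm_le_sup) (use y(2) in simp)
    then have xy: "norm (x - y) \<le> s" by simp
    have "norm x \<le> norm y + norm (x - y)" by (metis add.commute diff_add_cancel norm_triangle_ineq)
    also have "\<dots> \<le> real j + 1" using y(1) xy by (auto simp: exhaustion_def s_def)
    finally have "norm x \<le> real (Suc j)" by simp
    moreover have "1 / (real (Suc j) + 1) \<le> dist x w" if "w \<notin> \<Omega>" for w
    proof -
      have "1 / (real j + 1) \<le> dist y w" using y(1) that by (simp add: exhaustion_def)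
      also have "\<dots> \<le> dist y x + dist x w" by (rule dist_triangle)
      also have "dist y x \<le> s" using xy by (simp add: dist_norm norm_minus_commute)
      finally show ?thesis by (simp add: s_def)
    qed
    ultimately show "x \<in> exhaustion \<Omega> (Suc j)" by (simp add: exhaustion_def)
  qed
  then show ?thesis using s by (intro exI[of _ "s / ?n"]) auto
qed

text \<open>Split at height \<open>e\<close>: below it the function is bounded on the cube, above it
  |t| \<le> t^2/e. Keeping \<open>e\<close> free gives smallness in L1 from smallness in L2.\<close>

lemma L1_le_L2:
  fixes f :: "real ^ 'n \<Rightarrow> real"
  assumes "integrable lebesgue f" "integrable lebesgue (\<lambda>x. (f x)\<^sup>2)" "\<And>x. x \<notin> cube R \<Longrightarrow> f x = 0" "0 \<le> R" "0 < e"
  shows "(\<integral>x. \<bar>f x\<bar> \<partial>lebesgue) \<le> e * (2 * R) ^ CARD('n) + (\<integral>x. (f x)\<^sup>2 \<partial>lebesgue) / e"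
proof -
  have "(\<integral>x. \<bar>f x\<bar> \<partial>lebesgue) \<le> (\<integral>x. e * indicator (cube R :: (real ^ 'n) set) x + (f x)\<^sup>2 / e \<partial>lebesgue)"
  proof (rule Bochner_Integration.integral_mono)
    fix x
    have "\<bar>t\<bar> \<le> e + t\<^sup>2 / e" for t :: real
    proof (cases "\<bar>t\<bar> \<le> e")
      case False
      then have "e * \<bar>t\<bar> \<le> \<bar>t\<bar> * \<bar>t\<bar>" using assms(5) by (intro mult_right_mono) auto
      then have "\<bar>t\<bar> \<le> t\<^sup>2 / e" using assms(5) by (simp add: le_divide_eq power2_eq_square mult.commute abs_mult[symmetric])
      then show ?thesis using assms(5) by simp
    qed (use assms(5) in \<open>simp add: add_increasing2\<close>)
    then show "\<bar>f x\<bar> \<le> e * indicator (cube R) x + (f x)\<^sup>2 / e" using assms(3)[of x] by (cases "x \<in> cube R") auto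
  qed (use assms in \<open>auto intro!: Bochner_Integration.integrable_add integrable_mult_right integrable_indicator_cube\<close>)
  also have "\<dots> = e * (2 * R) ^ CARD('n) + (\<integral>x. (f x)\<^sup>2 \<partial>lebesgue) / e"
    using integral_indicator_cube[OF assms(4), where 'n='n] assms(2)
    by (subst Bochner_Integration.integral_add) (auto intro!: integrable_mult_right integrable_indicator_cube)
  finally show ?thesis .
qed

lemma L1_convergence_times_bounded:
  fixes b :: "'a \<Rightarrow> real"
  assumes f: "eventually (\<lambda>n. integrable M (f n)) sequentially" "integrable M l" "(\<lambda>n. \<integral>x. \<bar>f n x - l x\<bar> \<partial>M) \<longlonglongrightarrow> 0"
    and b: "b \<in> borel_measurable M" "\<And>x. \<bar>b x\<bar> \<le> C"
  shows "(\<lambda>n. \<integral>x. f n x * b x \<partial>M) \<longlonglongrightarrow> (\<integral>x. l x * b x \<partial>M)"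
proof -
  have int: "integrable M (\<lambda>x. v x * b x)" if "integrable M v" for v
  proof (rule Bochner_Integration.integrable_bound[of M "\<lambda>x. C * v x"])
    show "AE x in M. norm (v x * b x) \<le> norm (C * v x)"
    proof (rule AE_I2)
      fix x
      have "\<bar>v x\<bar> * \<bar>b x\<bar> \<le> \<bar>v x\<bar> * \<bar>C\<bar>" using b(2)[of x] by (intro mult_left_mono) auto
      then show "norm (v x * b x) \<le> norm (C * v x)" by (simp add: abs_mult mult.commute)
    qed
  qed (use that b in auto)
  have "(\<lambda>n. (\<integral>x. f n x * b x \<partial>M) - (\<integral>x. l x * b x \<partial>M)) \<longlonglongrightarrow> 0"
  proof (rule tendsto_0_le[OF f(3), of _ C])
    show "eventually (\<lambda>n. norm ((\<integral>x. f n x * b x \<partial>M) - (\<integral>x. l x * b x \<partial>M)) \<le> norm (\<integral>x. \<bar>f n x - l x\<bar> \<partial>M) * C) sequentially"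
      using f(1)
    proof eventually_elim
      case (elim n)
      have "(\<integral>x. f n x * b x \<partial>M) - (\<integral>x. l x * b x \<partial>M) = (\<integral>x. (f n x - l x) * b x \<partial>M)"
        unfolding left_diff_distrib by (rule Bochner_Integration.integral_diff[symmetric]) (intro int elim f(2))+
      also have "norm \<dots> \<le> (\<integral>x. norm ((f n x - l x) * b x) \<partial>M)" by (rule integral_norm_bound)
      also have "\<dots> \<le> (\<integral>x. \<bar>f n x - l x\<bar> * C \<partial>M)"
      proof (rule Bochner_Integration.integral_mono)
        show "integrable M (\<lambda>x. norm ((f n x - l x) * b x))" using int[of "\<lambda>x. f n x - l x"] elim f(2) by simp
        show "integrable M (\<lambda>x. \<bar>f n x - l x\<bar> * C)" using elim f(2) by simp
      qed (auto simp: abs_mult intro!: mult_left_mono b)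
      finally show ?case by simp
    qed
  qed
  then show ?thesis by (rule LIM_zero_cancel)
qed

text \<open>An almost everywhere convergent subsequence and Fatou's lemma. Convergence is needed in
  L1 only, so the same limit function serves every exponent.\<close>

lemma L1_convergence_fatou:
  fixes f :: "nat \<Rightarrow> 'a \<Rightarrow> real"
  assumes f: "\<And>n. integrable M (f n)" "integrable M l" "(\<lambda>n. \<integral>x. \<bar>f n x - l x\<bar> \<partial>M) \<longlonglongrightarrow> 0"
    and q: "0 < q" and bound: "\<And>n. integrable M (\<lambda>x. \<bar>f n x\<bar> powr q)" "\<And>n. (\<integral>x. \<bar>f n x\<bar> powr q \<partial>M) \<le> C"
  shows "integrable M (\<lambda>x. \<bar>l x\<bar> powr q)"
proof -
  have "\<exists>r::nat\<Rightarrow>nat. strict_mono r \<and> (AE x in M. (\<lambda>n. f (r n) x - l x) \<longlonglongrightarrow> 0)"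
    using tendsto_L1_AE_subseq[of M "\<lambda>n x. f n x - l x"] f by simp
  then obtain r :: "nat \<Rightarrow> nat" where r: "AE x in M. (\<lambda>n. f (r n) x - l x) \<longlonglongrightarrow> 0" by blast
  have meas: "(\<lambda>x. \<bar>l x\<bar> powr q) \<in> borel_measurable M" using f(2) by simp
  have "(\<integral>\<^sup>+x. ennreal (\<bar>l x\<bar> powr q) \<partial>M) = (\<integral>\<^sup>+x. liminf (\<lambda>n. ennreal (\<bar>f (r n) x\<bar> powr q)) \<partial>M)"
  proof (rule nn_integral_cong_AE)
    show "AE x in M. ennreal (\<bar>l x\<bar> powr q) = liminf (\<lambda>n. ennreal (\<bar>f (r n) x\<bar> powr q))"
      using r
    proof eventually_elim
      case (elim x)
      then have "(\<lambda>n. f (r n) x) \<longlonglongrightarrow> l x" by (rule LIM_zero_cancel)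
      then have "(\<lambda>n. ennreal (\<bar>f (r n) x\<bar> powr q)) \<longlonglongrightarrow> ennreal (\<bar>l x\<bar> powr q)"
        by (intro tendsto_ennrealI tendsto_powr2 tendsto_rabs tendsto_const) (use q in auto)
      from lim_imp_Liminf[OF sequentially_bot this] show ?case by simp
    qed
  qed
  also have "\<dots> \<le> liminf (\<lambda>n. \<integral>\<^sup>+x. ennreal (\<bar>f (r n) x\<bar> powr q) \<partial>M)"
    by (rule nn_integral_liminf) (use f(1) in simp)
  also have "\<dots> \<le> ennreal C"
  proof (rule Liminf_le[of sequentially])
    show "eventually (\<lambda>n. (\<integral>\<^sup>+x. ennreal (\<bar>f (r n) x\<bar> powr q) \<partial>M) \<le> ennreal C) sequentially"
    proof (rule always_eventually, rule allI)
      fix n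
      have "(\<integral>\<^sup>+x. ennreal (\<bar>f (r n) x\<bar> powr q) \<partial>M) = ennreal (\<integral>x. \<bar>f (r n) x\<bar> powr q \<partial>M)"
        by (rule nn_integral_eq_integral[OF bound(1)]) simp
      also have "\<dots> \<le> ennreal C" by (intro ennreal_leI bound(2))
      finally show "(\<integral>\<^sup>+x. ennreal (\<bar>f (r n) x\<bar> powr q) \<partial>M) \<le> ennreal C" .
    qed
  qed simp
  finally have "(\<integral>\<^sup>+x. ennreal (\<bar>l x\<bar> powr q) \<partial>M) \<le> ennreal C" .
  then have "(\<integral>\<^sup>+x. ennreal (norm (\<bar>l x\<bar> powr q)) \<partial>M) < \<infinity>"
    by (simp add: order.strict_trans1[OF _ ennreal_less_top])
  then show ?thesis by (rule integrableI_bounded[OF meas])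
qed

text \<open>Limits on the members of an exhaustion are glued along the first member containing a point.\<close>

lemma glue_L1_limits:
  fixes G :: "nat \<Rightarrow> real ^ 'n \<Rightarrow> real"
  assumes int: "\<And>j m. j < m \<Longrightarrow> integrable lebesgue (zext (exhaustion \<Omega> j) (G m))"
    and l: "\<And>j. integrable lebesgue (l j)" "\<And>j. (\<lambda>m. \<integral>x. \<bar>zext (exhaustion \<Omega> j) (G m) x - l j x\<bar> \<partial>lebesgue) \<longlonglongrightarrow> 0"
  obtains g where "\<And>j. zext (exhaustion \<Omega> j) g \<in> borel_measurable lebesgue"
    "\<And>j. AE x in lebesgue. zext (exhaustion \<Omega> j) g x = l j x"
proof -
  let ?E = "exhaustion \<Omega>"
  have Es: "?E j \<in> sets lebesgue" for j by (rule compact_sets_lebesgue[OF compact_exhaustion])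
  have agree: "AE x in lebesgue. l j x = zext (?E j) (l k) x" if "j \<le> k" for j k
  proof -
    let ?b = "\<lambda>m. (\<integral>x. \<bar>zext (?E j) (G m) x - l j x\<bar> \<partial>lebesgue) + (\<integral>x. \<bar>zext (?E k) (G m) x - l k x\<bar> \<partial>lebesgue)"
    have zl: "integrable lebesgue (zext (?E j) (l k))"
      unfolding zext_eq by (rule integrable_mult_indicator[OF Es l(1)])
    have "(\<integral>x. \<bar>l j x - zext (?E j) (l k) x\<bar> \<partial>lebesgue) \<le> ?b m" if m: "m > k" for m
    proof -
      note i = int[of j m] int[of k m]
      have "(\<integral>x. \<bar>l j x - zext (?E j) (l k) x\<bar> \<partial>lebesgue) \<le> (\<integral>x. \<bar>zext (?E j) (G m) x - l j x\<bar> + \<bar>zext (?E k) (G m) x - l k x\<bar> \<partial>lebesgue)"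
      proof (rule Bochner_Integration.integral_mono)
        have "?E j \<subseteq> ?E k" by (rule exhaustion_mono) fact
        then show "\<bar>l j x - zext (?E j) (l k) x\<bar> \<le> \<bar>zext (?E j) (G m) x - l j x\<bar> + \<bar>zext (?E k) (G m) x - l k x\<bar>" for x
          by (cases "x \<in> ?E j") (auto simp: zext_def subset_iff)
      qed (use zl l i m \<open>j \<le> k\<close> in auto)
      also have "\<dots> = ?b m" using i l m \<open>j \<le> k\<close> by (intro Bochner_Integration.integral_add) auto
      finally show ?thesis .
    qed
    moreover have "?b \<longlonglongrightarrow> 0 + 0" by (intro tendsto_add l)
    ultimately have "(\<integral>x. \<bar>l j x - zext (?E j) (l k) x\<bar> \<partial>lebesgue) \<le> 0 + 0"
      by (intro LIMSEQ_le_const[of ?b] exI[of _ "Suc k"]) auto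
    then have "(\<integral>x. \<bar>l j x - zext (?E j) (l k) x\<bar> \<partial>lebesgue) = 0" by (intro antisym) auto
    then have "AE x in lebesgue. \<bar>l j x - zext (?E j) (l k) x\<bar> = 0"
      using integral_nonneg_eq_0_iff_AE[of lebesgue "\<lambda>x. \<bar>l j x - zext (?E j) (l k) x\<bar>"] zl l(1)[of j] by auto
    then show ?thesis by eventually_elim simp
  qed
  define J where "J x = (LEAST j. x \<in> ?E j)" for x
  define g where "g x = l (J x) x" for x
  have J: "x \<in> ?E (J x)" "J x \<le> j" if "x \<in> ?E j" for x j
    unfolding J_def using that by (auto intro: LeastI Least_le)
  show thesis
  proof
    fix j
    have "zext (?E j) g x = (\<Sum>i\<le>j. indicator (?E i - (\<Union>k<i. ?E k)) x * l i x)" for x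
    proof (cases "x \<in> ?E j")
      case True
      have iff: "x \<in> ?E i - (\<Union>k<i. ?E k) \<longleftrightarrow> i = J x" for i
      proof
        assume i: "x \<in> ?E i - (\<Union>k<i. ?E k)"
        then have "J x \<le> i" using J(2) by blast
        moreover have "\<not> J x < i" using i J(1)[OF True] by blast
        ultimately show "i = J x" by simp
      next
        assume i: "i = J x"
        have "x \<notin> ?E k" if "k < J x" for k using J(2)[of x k] that by auto
        then show "x \<in> ?E i - (\<Union>k<i. ?E k)" using i J(1)[OF True] by auto
      qed
      have "(\<Sum>i\<le>j. indicator (?E i - (\<Union>k<i. ?E k)) x * l i x) = (\<Sum>i\<le>j. if i = J x then l i x else 0)"
        by (intro sum.cong refl) (simp add: indicator_def iff del: Diff_iff UN_iff)
      also have "\<dots> = l (J x) x" using J(2)[OF True] by simp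
      finally show ?thesis using True by (simp add: zext_def g_def)
    next
      case False
      have "x \<notin> ?E i" if "i \<le> j" for i using False exhaustion_mono[OF that] by blast
      then show ?thesis using False by (simp add: zext_def)
    qed
    then have eq: "zext (?E j) g = (\<lambda>x. \<Sum>i\<le>j. indicator (?E i - (\<Union>k<i. ?E k)) x * l i x)" by blast
    have "l i \<in> borel_measurable lebesgue" for i using l(1) by auto
    moreover have "?E i - (\<Union>k<i. ?E k) \<in> sets lebesgue" for i using Es by auto
    ultimately show "zext (?E j) g \<in> borel_measurable lebesgue"
      unfolding eq by (intro borel_measurable_sum borel_measurable_times borel_measurable_indicator)
    have self: "AE x in lebesgue. l j x = zext (?E j) (l j) x" using agree[of j j] by simp
    have "AE x in lebesgue. \<forall>i\<in>{..j}. l i x = zext (?E i) (l j) x"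
      by (rule AE_finite_allI) (auto intro: agree)
    with self show "AE x in lebesgue. zext (?E j) g x = l j x"
    proof eventually_elim
      case (elim x)
      show ?case
      proof (cases "x \<in> ?E j")
        case True
        then have "l (J x) x = zext (?E (J x)) (l j) x" using elim(2) J(2)[OF True] by auto
        then show ?thesis using True J(1)[OF True] by (simp add: zext_def g_def)
      next
        case False
        then show ?thesis using elim(1) by (simp add: zext_def)
      qed
    qed
  qed
qed

section \<open>Almost minimal pairs and their limit\<close>

context splitting_problem
begin

abbreviation "residual \<psi> G x \<equiv> g one x + partial_deriv one \<psi> x - G x"

text \<open>Every condition is stable under midpoints: test functions and the residual by linearity,
  the rest by convexity. \<open>G\<close> is kept apart from the gradient of \<psi> because the
  estimates hold for the interpolated quotient only. All exponents are imposed at once, so that one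
  limit satisfies all bounds.\<close>

definition good :: "real \<Rightarrow> (nat \<Rightarrow> real) \<Rightarrow> nat \<Rightarrow> ((real ^ 'n \<Rightarrow> real) \<times> (real ^ 'n \<Rightarrow> real)) set" where
  "good I \<delta> m = {(\<psi>, G). test_function \<Omega> \<psi> \<and> (\<forall>x. \<bar>\<psi> x\<bar> \<le> 2 * B) \<and> energy_of \<psi> \<le> I + 2 / (real m + 1) \<and>
     G \<in> borel_measurable lebesgue \<and> integrable lebesgue (zext (exhaustion \<Omega> m) (residual \<psi> G)) \<and>
     (\<integral>x. \<bar>zext (exhaustion \<Omega> m) (residual \<psi> G) x\<bar> \<partial>lebesgue) \<le> 1 / (real m + 1) \<and>
     (\<forall>j<m. \<forall>q\<ge>1. integrable lebesgue (zext (exhaustion \<Omega> j) (\<lambda>x. \<bar>G x\<bar> powr q)) \<and>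
        (\<integral>x. zext (exhaustion \<Omega> j) (\<lambda>x. \<bar>G x\<bar> powr q) x \<partial>lebesgue) \<le> local_const q (\<delta> j))}"

definition mid :: "((real ^ 'n \<Rightarrow> real) \<times> (real ^ 'n \<Rightarrow> real)) \<Rightarrow> ((real ^ 'n \<Rightarrow> real) \<times> (real ^ 'n \<Rightarrow> real)) \<Rightarrow>
    ((real ^ 'n \<Rightarrow> real) \<times> (real ^ 'n \<Rightarrow> real))" where
  "mid X Y = (\<lambda>x. (fst X x + fst Y x) / 2, \<lambda>x. (snd X x + snd Y x) / 2)"

lemma local_const_nonneg: "0 \<le> local_const q \<delta>"
  unfolding local_const_def using \<Omega>(3) by simp

lemma zg_integrable: "integrable lebesgue (zext \<Omega> (g i))"
  using g(3) zext_integrable[OF open_sets_lebesgue[OF \<Omega>(1)]] by blast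

text \<open>Regularise a competitor whose energy is within 1/(m+1) of \<open>I\<close>, with an
  accuracy below 1/(m+1) and below all \<open>\<delta> j\<close> with j < m. The two losses account
  for the 2 in \<open>good\<close>.\<close>

lemma good_nonempty:
  assumes \<delta>: "\<And>j. \<delta> j > 0" "\<And>j. thick (exhaustion \<Omega> j) (\<delta> j) \<subseteq> exhaustion \<Omega> (Suc j)"
    and I: "\<And>\<epsilon>. \<epsilon> > 0 \<Longrightarrow> \<exists>\<phi>. test_function \<Omega> \<phi> \<and> energy_of \<phi> < I + \<epsilon>"
  shows "good I \<delta> m \<noteq> {}"
proof -
  define \<epsilon> where "\<epsilon> = Min (insert (1 / (real m + 1)) (\<delta> ` {..<m}))"
  have \<epsilon>: "\<epsilon> > 0" "\<epsilon> \<le> 1 / (real m + 1)" "\<And>j. j < m \<Longrightarrow> \<epsilon> \<le> \<delta> j"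
  proof -
    show "\<epsilon> > 0" unfolding \<epsilon>_def using \<delta>(1) by (subst Min_gr_iff) auto
    show "\<epsilon> \<le> 1 / (real m + 1)" unfolding \<epsilon>_def by (rule Min_le) auto
    show "\<epsilon> \<le> \<delta> j" if "j < m" for j unfolding \<epsilon>_def using that by (intro Min_le) auto
  qed
  obtain \<phi> where \<phi>: "test_function \<Omega> \<phi>" "energy_of \<phi> < I + 1 / (real m + 1)" using I[of "1 / (real m + 1)"] by auto
  show ?thesis
  proof (rule regularise[OF \<phi>(1) compact_exhaustion exhaustion_subset \<epsilon>(1), of m], goal_cases)
    case (1 \<psi> G)
    have "thick (exhaustion \<Omega> j) (\<delta> j) \<subseteq> exhaustion \<Omega> m" if "j < m" for j
      using \<delta>(2)[of j] exhaustion_mono[of "Suc j" m \<Omega>] that by auto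
    then have loc: "\<forall>j<m. \<forall>q\<ge>1. integrable lebesgue (zext (exhaustion \<Omega> j) (\<lambda>x. \<bar>G x\<bar> powr q)) \<and>
        (\<integral>x. zext (exhaustion \<Omega> j) (\<lambda>x. \<bar>G x\<bar> powr q) x \<partial>lebesgue) \<le> local_const q (\<delta> j)"
      using 1(7)[OF _ \<epsilon>(3) compact_exhaustion] by blast
    have "energy_of \<psi> \<le> I + 1 / (real m + 1) + 1 / (real m + 1)" using 1(3) \<phi>(2) \<epsilon>(2) by linarith
    also have "\<dots> = I + 2 / (real m + 1)" by (simp add: add_divide_distrib[symmetric])
    finally have "energy_of \<psi> \<le> I + 2 / (real m + 1)" .
    then have "(\<psi>, G) \<in> good I \<delta> m"
      unfolding good_def using 1(1,2,4,5,6) loc \<epsilon>(2) by auto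
    then show ?case by blast
  qed
qed

lemma good_decreasing:
  assumes "m \<le> k" shows "good I \<delta> k \<subseteq> good I \<delta> m"
proof
  fix X assume X: "X \<in> good I \<delta> k"
  obtain \<psi> G where XG: "X = (\<psi>, G)" by (cases X)
  have le: "1 / (real k + 1) \<le> 1 / (real m + 1)" "2 / (real k + 1) \<le> 2 / (real m + 1)" using assms by (auto intro!: frac_le)
  have G: "test_function \<Omega> \<psi>" "\<forall>x. \<bar>\<psi> x\<bar> \<le> 2 * B" "energy_of \<psi> \<le> I + 2 / (real k + 1)" "G \<in> borel_measurable lebesgue"
    "integrable lebesgue (zext (exhaustion \<Omega> k) (residual \<psi> G))"
    "(\<integral>x. \<bar>zext (exhaustion \<Omega> k) (residual \<psi> G) x\<bar> \<partial>lebesgue) \<le> 1 / (real k + 1)"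
    "\<forall>j<k. \<forall>q\<ge>1. integrable lebesgue (zext (exhaustion \<Omega> j) (\<lambda>x. \<bar>G x\<bar> powr q)) \<and>
        (\<integral>x. zext (exhaustion \<Omega> j) (\<lambda>x. \<bar>G x\<bar> powr q) x \<partial>lebesgue) \<le> local_const q (\<delta> j)"
    using X unfolding XG good_def by auto
  have sub: "exhaustion \<Omega> m \<subseteq> exhaustion \<Omega> k" by (rule exhaustion_mono[OF assms])
  have i: "integrable lebesgue (zext (exhaustion \<Omega> m) (residual \<psi> G))"
    using Lp1_mono[of "exhaustion \<Omega> k" "residual \<psi> G" "exhaustion \<Omega> m"] G(5) sub
    by (simp add: zext_integrable compact_sets_lebesgue compact_exhaustion)
  have "(\<integral>x. \<bar>zext (exhaustion \<Omega> m) (residual \<psi> G) x\<bar> \<partial>lebesgue) \<le> (\<integral>x. \<bar>zext (exhaustion \<Omega> k) (residual \<psi> G) x\<bar> \<partial>lebesgue)"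
    by (intro Bochner_Integration.integral_mono integrable_abs i G) (use sub in \<open>auto simp: zext_def\<close>)
  then show "X \<in> good I \<delta> m"
    unfolding XG good_def using G i le assms by auto
qed

lemma energy_of_midpoint:
  assumes \<psi>: "test_function \<Omega> \<psi>" "test_function \<Omega> \<psi>'"
  shows "energy_of (\<lambda>x. (\<psi> x + \<psi>' x) / 2) \<le> (energy_of \<psi> + energy_of \<psi>') / 2"
    and "partial_deriv i (\<lambda>x. (\<psi> x + \<psi>' x) / 2) x = (partial_deriv i \<psi> x + partial_deriv i \<psi>' x) / 2"
    and "test_function \<Omega> (\<lambda>x. (\<psi> x + \<psi>' x) / 2)"
proof -
  note d = smooth_differentiable[OF test_functionD(1)[OF \<psi>(1)]] smooth_differentiable[OF test_functionD(1)[OF \<psi>(2)]]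
  have eq: "(\<lambda>x. (\<psi> x + \<psi>' x) / 2) = (\<lambda>x. (1/2) * (\<psi> x + \<psi>' x))" by auto
  show "test_function \<Omega> (\<lambda>x. (\<psi> x + \<psi>' x) / 2)" unfolding eq by (intro test_function_cmult test_function_add \<psi>)
  show pd: "partial_deriv i (\<lambda>x. (\<psi> x + \<psi>' x) / 2) x = (partial_deriv i \<psi> x + partial_deriv i \<psi>' x) / 2" for i x
    unfolding eq by (subst partial_deriv_cmult) (auto intro!: differentiable_add d simp: partial_deriv_add d)
  have int: "integrable lebesgue (\<lambda>x. F i (zext \<Omega> (g i) x + partial_deriv i \<phi> x))" if "test_function \<Omega> \<phi>" for i \<phi>
    by (intro F_integrable Bochner_Integration.integrable_add zg_integrable test_function_integrable[OF test_function_partial_deriv[OF that]])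
  have "energy_of (\<lambda>x. (\<psi> x + \<psi>' x) / 2) \<le>
     (\<Sum>i\<in>UNIV. ((\<integral>x. F i (zext \<Omega> (g i) x + partial_deriv i \<psi> x) \<partial>lebesgue) + (\<integral>x. F i (zext \<Omega> (g i) x + partial_deriv i \<psi>' x) \<partial>lebesgue)) / 2)"
    unfolding energy_of_def
  proof (rule sum_mono)
    fix i
    have "(\<integral>x. F i (zext \<Omega> (g i) x + partial_deriv i (\<lambda>x. (\<psi> x + \<psi>' x) / 2) x) \<partial>lebesgue) \<le>
      (\<integral>x. (F i (zext \<Omega> (g i) x + partial_deriv i \<psi> x) + F i (zext \<Omega> (g i) x + partial_deriv i \<psi>' x)) / 2 \<partial>lebesgue)"
    proof (rule Bochner_Integration.integral_mono)
      fix x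
      let ?a = "zext \<Omega> (g i) x + partial_deriv i \<psi> x" and ?b = "zext \<Omega> (g i) x + partial_deriv i \<psi>' x"
      have "F i ((1 - 1/2) *\<^sub>R ?a + (1/2) *\<^sub>R ?b) \<le> (1 - 1/2) * F i ?a + (1/2) * F i ?b"
        by (rule convex_onD[OF F_convex]) auto
      moreover have "(1 - 1/2) *\<^sub>R ?a + (1/2) *\<^sub>R ?b = zext \<Omega> (g i) x + partial_deriv i (\<lambda>x. (\<psi> x + \<psi>' x) / 2) x"
        unfolding pd by (simp add: field_simps)
      ultimately have "F i (zext \<Omega> (g i) x + partial_deriv i (\<lambda>x. (\<psi> x + \<psi>' x) / 2) x) \<le> (1 - 1/2) * F i ?a + (1/2) * F i ?b"
        by (simp only:)
      then show "F i (zext \<Omega> (g i) x + partial_deriv i (\<lambda>x. (\<psi> x + \<psi>' x) / 2) x) \<le> (F i ?a + F i ?b) / 2"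
        by (simp add: add_divide_distrib)
    next
      show "integrable lebesgue (\<lambda>x. F i (zext \<Omega> (g i) x + partial_deriv i (\<lambda>x. (\<psi> x + \<psi>' x) / 2) x))"
        by (rule int) (unfold eq, intro test_function_cmult test_function_add \<psi>)
    qed (use int[OF \<psi>(1)] int[OF \<psi>(2)] in simp)
    also have "\<dots> = ((\<integral>x. F i (zext \<Omega> (g i) x + partial_deriv i \<psi> x) \<partial>lebesgue) + (\<integral>x. F i (zext \<Omega> (g i) x + partial_deriv i \<psi>' x) \<partial>lebesgue)) / 2"
      using int[OF \<psi>(1)] int[OF \<psi>(2)] by simp
    finally show "(\<integral>x. F i (zext \<Omega> (g i) x + partial_deriv i (\<lambda>x. (\<psi> x + \<psi>' x) / 2) x) \<partial>lebesgue) \<le> \<dots>" .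
  qed
  also have "\<dots> = (energy_of \<psi> + energy_of \<psi>') / 2" by (simp add: energy_of_def sum.distrib sum_divide_distrib[symmetric])
  finally show "energy_of (\<lambda>x. (\<psi> x + \<psi>' x) / 2) \<le> (energy_of \<psi> + energy_of \<psi>') / 2" .
qed

text \<open>Energy, L1 norm, powers with q \<ge> 1 and absolute value are convex, so a bound common
  to both pairs passes to the midpoint.\<close>

lemma good_midpoint:
  assumes "X \<in> good I \<delta> m" "Y \<in> good I \<delta> m" shows "mid X Y \<in> good I \<delta> m"
proof -
  obtain \<psi> G where X: "X = (\<psi>, G)" by (cases X)
  obtain \<psi>' G' where Y: "Y = (\<psi>', G')" by (cases Y)
  note a = assms[unfolded X Y good_def mem_Collect_eq prod.case]
  have half: "(s + t) / 2 \<le> r" if "s \<le> r" "t \<le> r" for r s t :: real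
    using that by (simp add: field_simps)
  let ?\<psi> = "\<lambda>x. (\<psi> x + \<psi>' x) / 2" and ?G = "\<lambda>x. (G x + G' x) / 2" and ?E = "exhaustion \<Omega> m"
  have t: "test_function \<Omega> \<psi>" "test_function \<Omega> \<psi>'" using a by auto
  have Gm: "G \<in> borel_measurable lebesgue" "G' \<in> borel_measurable lebesgue" using a by auto
  have ri: "integrable lebesgue (zext ?E (residual \<psi> G))" "integrable lebesgue (zext ?E (residual \<psi>' G'))" using a by auto
  have rb: "(\<integral>x. \<bar>zext ?E (residual \<psi> G) x\<bar> \<partial>lebesgue) \<le> 1 / (real m + 1)" "(\<integral>x. \<bar>zext ?E (residual \<psi>' G') x\<bar> \<partial>lebesgue) \<le> 1 / (real m + 1)" using a by auto
  have res: "zext ?E (residual ?\<psi> ?G) = (\<lambda>x. (zext ?E (residual \<psi> G) x + zext ?E (residual \<psi>' G') x) / 2)"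
    unfolding energy_of_midpoint(2)[OF t] by (auto simp: zext_def fun_eq_iff field_simps)
  have rint: "integrable lebesgue (zext ?E (residual ?\<psi> ?G))" unfolding res using ri by simp
  have rbd: "(\<integral>x. \<bar>zext ?E (residual ?\<psi> ?G) x\<bar> \<partial>lebesgue) \<le> 1 / (real m + 1)"
  proof -
    have "(\<integral>x. \<bar>zext ?E (residual ?\<psi> ?G) x\<bar> \<partial>lebesgue) \<le> (\<integral>x. (\<bar>zext ?E (residual \<psi> G) x\<bar> + \<bar>zext ?E (residual \<psi>' G') x\<bar>) / 2 \<partial>lebesgue)"
      unfolding res using ri by (intro Bochner_Integration.integral_mono) auto
    also have "\<dots> = ((\<integral>x. \<bar>zext ?E (residual \<psi> G) x\<bar> \<partial>lebesgue) + (\<integral>x. \<bar>zext ?E (residual \<psi>' G') x\<bar> \<partial>lebesgue)) / 2"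
      using ri by simp
    also have "\<dots> \<le> 1 / (real m + 1)" by (rule half[OF rb])
    finally show ?thesis .
  qed
  have loc: "integrable lebesgue (zext (exhaustion \<Omega> j) (\<lambda>x. \<bar>?G x\<bar> powr q)) \<and>
        (\<integral>x. zext (exhaustion \<Omega> j) (\<lambda>x. \<bar>?G x\<bar> powr q) x \<partial>lebesgue) \<le> local_const q (\<delta> j)" if jq: "j < m" "1 \<le> q" for j q
  proof -
    let ?z = "\<lambda>G. zext (exhaustion \<Omega> j) (\<lambda>x. \<bar>G x\<bar> powr q)"
    have i: "integrable lebesgue (?z G)" "integrable lebesgue (?z G')" and b: "(\<integral>x. ?z G x \<partial>lebesgue) \<le> local_const q (\<delta> j)" "(\<integral>x. ?z G' x \<partial>lebesgue) \<le> local_const q (\<delta> j)"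
      using a jq by auto
    have le: "?z ?G x \<le> (?z G x + ?z G' x) / 2" "0 \<le> ?z ?G x" for x
      using powr_midpoint[OF jq(2), of "G x" "G' x"] by (auto simp: zext_def)
    have int2: "integrable lebesgue (\<lambda>x. (?z G x + ?z G' x) / 2)" using i by simp
    have int: "integrable lebesgue (?z ?G)"
    proof (rule Bochner_Integration.integrable_bound[OF int2])
      have [measurable]: "exhaustion \<Omega> j \<in> sets lebesgue" by (rule compact_sets_lebesgue[OF compact_exhaustion])
      note Gm[measurable]
      show "?z ?G \<in> borel_measurable lebesgue" unfolding zext_eq by measurable
      show "AE x in lebesgue. norm (?z ?G x) \<le> norm ((?z G x + ?z G' x) / 2)"
      proof (rule AE_I2)
        fix x
        have "norm (?z ?G x) = ?z ?G x" using le(2) by simp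
        also have "\<dots> \<le> (?z G x + ?z G' x) / 2" by (rule le(1))
        also have "\<dots> \<le> norm ((?z G x + ?z G' x) / 2)" unfolding real_norm_def by (rule abs_ge_self)
        finally show "norm (?z ?G x) \<le> norm ((?z G x + ?z G' x) / 2)" .
      qed
    qed
    have "(\<integral>x. ?z ?G x \<partial>lebesgue) \<le> (\<integral>x. (?z G x + ?z G' x) / 2 \<partial>lebesgue)"
      by (rule Bochner_Integration.integral_mono[OF int int2 le(1)])
    also have "\<dots> = ((\<integral>x. ?z G x \<partial>lebesgue) + (\<integral>x. ?z G' x \<partial>lebesgue)) / 2" using i by simp
    also have "\<dots> \<le> local_const q (\<delta> j)" by (rule half[OF b])
    finally show ?thesis using int by blast
  qed
  have en: "energy_of ?\<psi> \<le> I + 2 / (real m + 1)" using energy_of_midpoint(1)[OF t] a by auto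
  have bd: "\<bar>?\<psi> x\<bar> \<le> 2 * B" for x
  proof -
    have "\<bar>\<psi> x\<bar> \<le> 2 * B" "\<bar>\<psi>' x\<bar> \<le> 2 * B" using a by auto
    then have "(\<bar>\<psi> x\<bar> + \<bar>\<psi>' x\<bar>) / 2 \<le> 2 * B" by (rule half)
    then show ?thesis using abs_triangle_ineq[of "\<psi> x" "\<psi>' x"] by simp
  qed
  show ?thesis
    unfolding X Y mid_def good_def mem_Collect_eq prod.case fst_conv snd_conv
    using energy_of_midpoint(3)[OF t] bd en Gm rint rbd loc by (intro conjI allI impI) auto
qed

text \<open>Normalised by the local L2 bound of a good pair, so that the weighted terms are at most
  (1/2)^j and \<open>quad\<close> stays bounded as \<open>m\<close> grows.\<close>

definition weight :: "(nat \<Rightarrow> real) \<Rightarrow> nat \<Rightarrow> real" where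
  "weight \<delta> j = (1/2) ^ j / (1 + local_const 2 (\<delta> j))"

text \<open>A quadratic form taking only the sets with j < m, on which a pair of
  \<open>good I \<delta> m\<close> is square integrable; it therefore increases with
  \<open>m\<close>.\<close>

definition quad :: "(nat \<Rightarrow> real) \<Rightarrow> nat \<Rightarrow> ((real ^ 'n \<Rightarrow> real) \<times> (real ^ 'n \<Rightarrow> real)) \<Rightarrow> real" where
  "quad \<delta> m X = (\<integral>x. (fst X x)\<^sup>2 \<partial>lebesgue) + (\<Sum>j<m. weight \<delta> j * (\<integral>x. zext (exhaustion \<Omega> j) (\<lambda>x. (snd X x)\<^sup>2) x \<partial>lebesgue))"

lemma weight_pos: "0 < weight \<delta> j"
  unfolding weight_def using local_const_nonneg[of 2 "\<delta> j"] by simp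

lemma goodD:
  assumes "X \<in> good I \<delta> m"
  shows "test_function \<Omega> (fst X)" "\<bar>fst X x\<bar> \<le> 2 * B" "energy_of (fst X) \<le> I + 2 / (real m + 1)"
    "snd X \<in> borel_measurable lebesgue" "integrable lebesgue (zext (exhaustion \<Omega> m) (residual (fst X) (snd X)))"
    "(\<integral>x. \<bar>zext (exhaustion \<Omega> m) (residual (fst X) (snd X)) x\<bar> \<partial>lebesgue) \<le> 1 / (real m + 1)"
    "j < m \<Longrightarrow> 1 \<le> q \<Longrightarrow> integrable lebesgue (zext (exhaustion \<Omega> j) (\<lambda>x. \<bar>snd X x\<bar> powr q))"
    "j < m \<Longrightarrow> 1 \<le> q \<Longrightarrow> (\<integral>x. zext (exhaustion \<Omega> j) (\<lambda>x. \<bar>snd X x\<bar> powr q) x \<partial>lebesgue) \<le> local_const q (\<delta> j)"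
    "j < m \<Longrightarrow> integrable lebesgue (zext (exhaustion \<Omega> j) (\<lambda>x. (snd X x)\<^sup>2))"
    "j < m \<Longrightarrow> integrable lebesgue (zext (exhaustion \<Omega> j) (snd X))"
    "integrable lebesgue (\<lambda>x. (fst X x)\<^sup>2)"
    "x \<notin> cube R \<Longrightarrow> fst X x = 0"
proof -
  note a = assms[unfolded good_def mem_Collect_eq case_prod_unfold]
  show t: "test_function \<Omega> (fst X)" "\<bar>fst X x\<bar> \<le> 2 * B" "energy_of (fst X) \<le> I + 2 / (real m + 1)"
    "integrable lebesgue (zext (exhaustion \<Omega> m) (residual (fst X) (snd X)))"
    "(\<integral>x. \<bar>zext (exhaustion \<Omega> m) (residual (fst X) (snd X)) x\<bar> \<partial>lebesgue) \<le> 1 / (real m + 1)"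
    using a by auto
  show sm: "snd X \<in> borel_measurable lebesgue" using a by blast
  show loc: "integrable lebesgue (zext (exhaustion \<Omega> j) (\<lambda>x. \<bar>snd X x\<bar> powr q))"
    "(\<integral>x. zext (exhaustion \<Omega> j) (\<lambda>x. \<bar>snd X x\<bar> powr q) x \<partial>lebesgue) \<le> local_const q (\<delta> j)" if "j < m" "1 \<le> q" for q
    using a that by auto
  show "integrable lebesgue (zext (exhaustion \<Omega> j) (\<lambda>x. (snd X x)\<^sup>2))" if "j < m"
    using loc(1)[OF that, of 2] by (simp add: abs_powr_2)
  show "integrable lebesgue (zext (exhaustion \<Omega> j) (snd X))" if "j < m"
  proof (rule Bochner_Integration.integrable_bound[OF loc(1)[OF that order_refl]])
    have [measurable]: "exhaustion \<Omega> j \<in> sets lebesgue" by (rule compact_sets_lebesgue[OF compact_exhaustion])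
    note sm[measurable]
    show "zext (exhaustion \<Omega> j) (snd X) \<in> borel_measurable lebesgue" unfolding zext_eq by measurable
  qed (simp add: zext_def)
  have "(\<lambda>x. (fst X x)\<^sup>2) = (\<lambda>x. fst X x * fst X x)" by (simp add: power2_eq_square)
  then show "integrable lebesgue (\<lambda>x. (fst X x)\<^sup>2)"
    using test_function_integrable[OF test_function_mult_smooth[OF t(1) test_functionD(1)[OF t(1)]]] by simp
  show "fst X x = 0" if "x \<notin> cube R" using that \<Omega>(2) test_functionD(5)[OF t(1)] by blast
qed

lemma quad_nonneg: "0 \<le> quad \<delta> m X"
  unfolding quad_def using weight_pos[of \<delta>]
  by (intro add_nonneg_nonneg sum_nonneg mult_nonneg_nonneg Bochner_Integration.integral_nonneg) (auto simp: zext_def less_imp_le)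

lemma quad_mono: "m \<le> k \<Longrightarrow> quad \<delta> m X \<le> quad \<delta> k X"
  unfolding quad_def using weight_pos[of \<delta>]
  by (intro add_left_mono sum_mono2 mult_nonneg_nonneg Bochner_Integration.integral_nonneg) (auto simp: zext_def less_imp_le)

lemma quad_bounded:
  assumes X: "X \<in> good I \<delta> m"
  shows "quad \<delta> m X \<le> (2 * B)\<^sup>2 * (2 * R) ^ CARD('n) + 2"
proof -
  have "(\<integral>x. (fst X x)\<^sup>2 \<partial>lebesgue) \<le> (\<integral>x. (2 * B)\<^sup>2 * indicator (cube R :: (real ^ 'n) set) x \<partial>lebesgue)"
  proof (rule Bochner_Integration.integral_mono)
    show "(fst X x)\<^sup>2 \<le> (2 * B)\<^sup>2 * indicator (cube R) x" for x
    proof (cases "x \<in> cube R")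
      case True
      have "\<bar>fst X x\<bar>\<^sup>2 \<le> (2 * B)\<^sup>2" by (rule power_mono[OF goodD(2)[OF X]]) simp
      then show ?thesis using True by simp
    qed (simp add: goodD(12)[OF X])
  qed (auto intro!: goodD(11)[OF X] integrable_mult_right integrable_indicator_cube)
  also have "\<dots> = (2 * B)\<^sup>2 * (2 * R) ^ CARD('n)"
    using integral_indicator_cube[OF \<Omega>(3), where 'n='n] by simp
  finally have 1: "(\<integral>x. (fst X x)\<^sup>2 \<partial>lebesgue) \<le> (2 * B)\<^sup>2 * (2 * R) ^ CARD('n)" .
  have "(\<Sum>j<m. weight \<delta> j * (\<integral>x. zext (exhaustion \<Omega> j) (\<lambda>x. (snd X x)\<^sup>2) x \<partial>lebesgue)) \<le> (\<Sum>j<m. (1/2) ^ j)"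
  proof (rule sum_mono)
    fix j assume "j \<in> {..<m}"
    then have j: "j < m" by simp
    let ?c = "local_const 2 (\<delta> j)"
    have "(\<integral>x. zext (exhaustion \<Omega> j) (\<lambda>x. (snd X x)\<^sup>2) x \<partial>lebesgue) \<le> ?c"
      using goodD(8)[OF X j, of 2] by (simp add: abs_powr_2)
    then have "weight \<delta> j * (\<integral>x. zext (exhaustion \<Omega> j) (\<lambda>x. (snd X x)\<^sup>2) x \<partial>lebesgue) \<le> weight \<delta> j * (1 + ?c)"
      using weight_pos[of \<delta> j] by (intro mult_left_mono) auto
    also have "\<dots> = (1/2) ^ j" using local_const_nonneg[of 2 "\<delta> j"] by (simp add: weight_def)
    finally show "weight \<delta> j * (\<integral>x. zext (exhaustion \<Omega> j) (\<lambda>x. (snd X x)\<^sup>2) x \<partial>lebesgue) \<le> (1/2) ^ j" .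
  qed
  also have "(\<Sum>j<m. (1/2) ^ j) = 2 - 2 * (1/2 :: real) ^ m" by (induction m) auto
  also have "\<dots> \<le> 2" by simp
  finally show ?thesis using 1 by (simp add: quad_def)
qed

text \<open>The parallelogram law in each summand. Almost minimality of the pairs thereby bounds
  their weighted L2 distance.\<close>

lemma quad_parallelogram:
  assumes X: "X \<in> good I \<delta> m" and Y: "Y \<in> good I \<delta> m"
  shows "quad \<delta> m X / 2 + quad \<delta> m Y / 2 - quad \<delta> m (mid X Y) =
     (\<integral>x. (fst X x - fst Y x)\<^sup>2 \<partial>lebesgue) / 4 +
     (\<Sum>j<m. weight \<delta> j * ((\<integral>x. zext (exhaustion \<Omega> j) (\<lambda>x. (snd X x - snd Y x)\<^sup>2) x \<partial>lebesgue) / 4))"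
    and "integrable lebesgue (\<lambda>x. (fst X x - fst Y x)\<^sup>2)"
    and "j < m \<Longrightarrow> integrable lebesgue (zext (exhaustion \<Omega> j) (\<lambda>x. (snd X x - snd Y x)\<^sup>2))"
proof -
  note M = good_midpoint[OF X Y]
  have eq: "(s - t)\<^sup>2 = 2 * s\<^sup>2 + 2 * t\<^sup>2 - 4 * ((s + t) / 2)\<^sup>2" for s t :: real
    by (simp add: power2_eq_square field_simps)
  have f: "(\<lambda>x. (fst X x - fst Y x)\<^sup>2) = (\<lambda>x. 2 * (fst X x)\<^sup>2 + 2 * (fst Y x)\<^sup>2 - 4 * (fst (mid X Y) x)\<^sup>2)"
    unfolding eq by (simp add: mid_def)
  show i1: "integrable lebesgue (\<lambda>x. (fst X x - fst Y x)\<^sup>2)"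
    unfolding f by (intro Bochner_Integration.integrable_diff Bochner_Integration.integrable_add integrable_mult_right goodD(11)[OF X] goodD(11)[OF Y] goodD(11)[OF M])
  have s: "zext (exhaustion \<Omega> j) (\<lambda>x. (snd X x - snd Y x)\<^sup>2) = (\<lambda>x. 2 * zext (exhaustion \<Omega> j) (\<lambda>x. (snd X x)\<^sup>2) x
      + 2 * zext (exhaustion \<Omega> j) (\<lambda>x. (snd Y x)\<^sup>2) x - 4 * zext (exhaustion \<Omega> j) (\<lambda>x. (snd (mid X Y) x)\<^sup>2) x)" for j
    unfolding eq by (auto simp: mid_def zext_def)
  show i2: "integrable lebesgue (zext (exhaustion \<Omega> j) (\<lambda>x. (snd X x - snd Y x)\<^sup>2))" if "j < m" for j
    unfolding s by (intro Bochner_Integration.integrable_diff Bochner_Integration.integrable_add integrable_mult_right goodD(9)[OF X that] goodD(9)[OF Y that] goodD(9)[OF M that])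
  have 1: "(\<integral>x. (fst X x - fst Y x)\<^sup>2 \<partial>lebesgue) = 2 * (\<integral>x. (fst X x)\<^sup>2 \<partial>lebesgue) + 2 * (\<integral>x. (fst Y x)\<^sup>2 \<partial>lebesgue) - 4 * (\<integral>x. (fst (mid X Y) x)\<^sup>2 \<partial>lebesgue)"
    unfolding f using goodD(11)[OF X] goodD(11)[OF Y] goodD(11)[OF M] by simp
  have 2: "(\<integral>x. zext (exhaustion \<Omega> j) (\<lambda>x. (snd X x - snd Y x)\<^sup>2) x \<partial>lebesgue) = 2 * (\<integral>x. zext (exhaustion \<Omega> j) (\<lambda>x. (snd X x)\<^sup>2) x \<partial>lebesgue)
      + 2 * (\<integral>x. zext (exhaustion \<Omega> j) (\<lambda>x. (snd Y x)\<^sup>2) x \<partial>lebesgue) - 4 * (\<integral>x. zext (exhaustion \<Omega> j) (\<lambda>x. (snd (mid X Y) x)\<^sup>2) x \<partial>lebesgue)" if "j < m" for j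
    unfolding s using goodD(9)[OF X that] goodD(9)[OF Y that] goodD(9)[OF M that] by simp
  have 3: "(\<Sum>j<m. weight \<delta> j * ((\<integral>x. zext (exhaustion \<Omega> j) (\<lambda>x. (snd X x - snd Y x)\<^sup>2) x \<partial>lebesgue) / 4)) =
     (\<Sum>j<m. weight \<delta> j * (\<integral>x. zext (exhaustion \<Omega> j) (\<lambda>x. (snd X x)\<^sup>2) x \<partial>lebesgue) / 2 + weight \<delta> j * (\<integral>x. zext (exhaustion \<Omega> j) (\<lambda>x. (snd Y x)\<^sup>2) x \<partial>lebesgue) / 2
        - weight \<delta> j * (\<integral>x. zext (exhaustion \<Omega> j) (\<lambda>x. (snd (mid X Y) x)\<^sup>2) x \<partial>lebesgue))"
  proof (intro sum.cong refl)
    have "W * ((2 * a + 2 * b - 4 * c) / 4) = W * a / 2 + W * b / 2 - W * c" for W a b c :: real by (simp add: field_simps)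
    then show "weight \<delta> j * ((\<integral>x. zext (exhaustion \<Omega> j) (\<lambda>x. (snd X x - snd Y x)\<^sup>2) x \<partial>lebesgue) / 4) =
      weight \<delta> j * (\<integral>x. zext (exhaustion \<Omega> j) (\<lambda>x. (snd X x)\<^sup>2) x \<partial>lebesgue) / 2 + weight \<delta> j * (\<integral>x. zext (exhaustion \<Omega> j) (\<lambda>x. (snd Y x)\<^sup>2) x \<partial>lebesgue) / 2
        - weight \<delta> j * (\<integral>x. zext (exhaustion \<Omega> j) (\<lambda>x. (snd (mid X Y) x)\<^sup>2) x \<partial>lebesgue)" if "j \<in> {..<m}" for j
      using that by (simp only: 2 lessThan_iff)
  qed
  show "quad \<delta> m X / 2 + quad \<delta> m Y / 2 - quad \<delta> m (mid X Y) =
     (\<integral>x. (fst X x - fst Y x)\<^sup>2 \<partial>lebesgue) / 4 +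
     (\<Sum>j<m. weight \<delta> j * ((\<integral>x. zext (exhaustion \<Omega> j) (\<lambda>x. (snd X x - snd Y x)\<^sup>2) x \<partial>lebesgue) / 4))"
    unfolding 1 3 quad_def by (simp add: sum.distrib sum_subtractf sum_divide_distrib[symmetric] add_divide_distrib diff_divide_distrib)
qed

text \<open>Uses \<open>L1_le_L2\<close> with \<open>e\<close> so small that its volume term stays
  below \<epsilon>/2. The index \<open>N0\<close> is there because on the j-th exhausting set the
  differences are known to be integrable only from m > j on.\<close>

lemma L1_cauchy_from_L2:
  fixes f :: "nat \<Rightarrow> nat \<Rightarrow> real ^ 'n \<Rightarrow> real"
  assumes "\<And>m k. N0 \<le> m \<Longrightarrow> m \<le> k \<Longrightarrow> integrable lebesgue (f m k)" "\<And>m k. N0 \<le> m \<Longrightarrow> m \<le> k \<Longrightarrow> integrable lebesgue (\<lambda>x. (f m k x)\<^sup>2)"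
    and "\<And>m k x. x \<notin> cube R \<Longrightarrow> f m k x = 0"
    and "\<And>\<epsilon>. \<epsilon> > 0 \<Longrightarrow> \<exists>N. \<forall>m\<ge>N. \<forall>k\<ge>m. (\<integral>x. (f m k x)\<^sup>2 \<partial>lebesgue) < \<epsilon>"
    and \<epsilon>: "\<epsilon> > 0"
  shows "\<exists>N. \<forall>m\<ge>N. \<forall>k\<ge>m. (\<integral>x. \<bar>f m k x\<bar> \<partial>lebesgue) < \<epsilon>"
proof -
  define V where "V = (2 * R) ^ CARD('n)"
  have V: "V + 1 > 0" unfolding V_def using \<Omega>(3) by (simp add: add_nonneg_pos)
  define e where "e = \<epsilon> / (2 * (V + 1))"
  have e: "e > 0" using \<epsilon> V by (simp add: e_def)
  have "a / (2 * b) * b = a / 2" if "b > 0" for a b :: real using that by simp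
  from this[OF V] have "e * (V + 1) = \<epsilon> / 2" by (simp only: e_def)
  then have e1: "e * (2 * R) ^ CARD('n) < \<epsilon> / 2" using e unfolding V_def[symmetric] by (simp add: distrib_left)
  obtain N where N: "\<And>m k. m \<ge> N \<Longrightarrow> k \<ge> m \<Longrightarrow> (\<integral>x. (f m k x)\<^sup>2 \<partial>lebesgue) < e * (\<epsilon> / 2)"
    using assms(4)[of "e * (\<epsilon> / 2)"] e \<epsilon> by auto
  have "(\<integral>x. \<bar>f m k x\<bar> \<partial>lebesgue) < \<epsilon>" if "m \<ge> max N N0" "k \<ge> m" for m k
  proof -
    have "(\<integral>x. \<bar>f m k x\<bar> \<partial>lebesgue) \<le> e * (2 * R) ^ CARD('n) + (\<integral>x. (f m k x)\<^sup>2 \<partial>lebesgue) / e"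
      by (rule L1_le_L2) (use that assms e \<Omega>(3) in auto)
    moreover have "(\<integral>x. (f m k x)\<^sup>2 \<partial>lebesgue) / e < \<epsilon> / 2" using N[of m k] that e by (simp add: divide_less_eq mult.commute)
    ultimately show ?thesis using e1 by linarith
  qed
  then show ?thesis by blast
qed

text \<open>The almost minimal good pairs converge: the first components in L1 on the whole space,
  the second ones in L1 on each exhausting set. The vanishing residual then identifies the second
  limit as the weak derivative of the first.\<close>

theorem regular_limit:
  assumes lower: "\<And>\<phi>. test_function \<Omega> \<phi> \<Longrightarrow> I \<le> energy_of \<phi>"
    and inf: "\<And>\<epsilon>. \<epsilon> > 0 \<Longrightarrow> \<exists>\<phi>. test_function \<Omega> \<phi> \<and> energy_of \<phi> < I + \<epsilon>"
  obtains \<psi> w G where "\<And>m. test_function \<Omega> (\<psi> m)" "(\<lambda>m. energy_of (\<psi> m)) \<longlonglongrightarrow> I"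
    "integrable lebesgue w" "(\<lambda>m. \<integral>x. \<bar>\<psi> m x - w x\<bar> \<partial>lebesgue) \<longlonglongrightarrow> 0"
    "\<And>q. 1 \<le> q \<Longrightarrow> G \<in> Lp_loc q \<Omega>" "has_weak_partial \<Omega> one (\<lambda>x. u0 x + w x) G"
proof -
  let ?E = "exhaustion \<Omega>"
  have Es: "?E j \<in> sets lebesgue" for j by (rule compact_sets_lebesgue[OF compact_exhaustion])
  have EO: "?E j \<subseteq> \<Omega>" for j by (rule exhaustion_subset)
  obtain \<delta> where \<delta>: "\<And>j. \<delta> j > 0" "\<And>j. thick (?E j) (\<delta> j) \<subseteq> ?E (Suc j)"
    using thick_exhaustion[of \<Omega>] by metis
  obtain v where v: "\<And>m. v m \<in> good I \<delta> m"
    and cauchy: "\<And>\<epsilon>. \<epsilon> > 0 \<Longrightarrow> \<exists>N. \<forall>m\<ge>N. \<forall>k\<ge>m. quad \<delta> m (v m) / 2 + quad \<delta> m (v k) / 2 - quad \<delta> m (mid (v m) (v k)) < \<epsilon>"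
  proof (rule almost_minimal_cauchy[of "good I \<delta>" mid "quad \<delta>" "(2 * B)\<^sup>2 * (2 * R) ^ CARD('n) + 2"], goal_cases)
    case 1 show ?case by (rule good_nonempty[OF \<delta> inf])
  next
    case 2 show ?case by (rule good_decreasing[OF 2(2)])
  next
    case 3 show ?case by (rule good_midpoint[OF 3(2,3)])
  next
    case 4 show ?case by (rule quad_nonneg)
  next
    case 5 show ?case by (rule quad_mono[OF 5(2)])
  next
    case 6 show ?case by (rule quad_bounded[OF 6(2)])
  next
    case (7 v) show ?case by (rule that; fact 7)
  qed
  define \<psi> G where "\<psi> m = fst (v m)" and "G m = snd (v m)" for m
  have vk: "v k \<in> good I \<delta> m" if "m \<le> k" for m k using v[of k] good_decreasing[OF that] by blast
  have t: "test_function \<Omega> (\<psi> m)" for m unfolding \<psi>_def by (rule goodD(1)[OF v])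
  have tint: "integrable lebesgue (\<psi> m)" for m by (rule test_function_integrable[OF t])
  have psi2: "\<exists>N. \<forall>m\<ge>N. \<forall>k\<ge>m. (\<integral>x. (\<psi> m x - \<psi> k x)\<^sup>2 \<partial>lebesgue) < \<epsilon>" if \<epsilon>: "\<epsilon> > 0" for \<epsilon>
  proof -
    obtain N where N: "\<And>m k. m \<ge> N \<Longrightarrow> k \<ge> m \<Longrightarrow> quad \<delta> m (v m) / 2 + quad \<delta> m (v k) / 2 - quad \<delta> m (mid (v m) (v k)) < \<epsilon> / 4"
      using cauchy[of "\<epsilon> / 4"] \<epsilon> by auto
    have "(\<integral>x. (\<psi> m x - \<psi> k x)\<^sup>2 \<partial>lebesgue) < \<epsilon>" if "m \<ge> N" "k \<ge> m" for m k
    proof -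
      have "0 \<le> (\<Sum>j<m. weight \<delta> j * ((\<integral>x. zext (?E j) (\<lambda>x. (snd (v m) x - snd (v k) x)\<^sup>2) x \<partial>lebesgue) / 4))"
        using weight_pos[of \<delta>] by (intro sum_nonneg mult_nonneg_nonneg divide_nonneg_nonneg Bochner_Integration.integral_nonneg) (auto simp: zext_def less_imp_le)
      then show ?thesis
        using N[OF that] quad_parallelogram(1)[OF v vk[OF that(2)]] unfolding \<psi>_def by linarith
    qed
    then show ?thesis by blast
  qed
  have psi1: "\<exists>N. \<forall>m\<ge>N. \<forall>k\<ge>m. (\<integral>x. \<bar>\<psi> m x - \<psi> k x\<bar> \<partial>lebesgue) < \<epsilon>" if \<epsilon>: "\<epsilon> > 0" for \<epsilon>
  proof (rule L1_cauchy_from_L2[where f="\<lambda>m k x. \<psi> m x - \<psi> k x" and ?N0.0=0])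
    show "\<exists>N. \<forall>m\<ge>N. \<forall>k\<ge>m. (\<integral>x. (\<psi> m x - \<psi> k x)\<^sup>2 \<partial>lebesgue) < e" if "e > 0" for e by (rule psi2[OF that])
    show "\<epsilon> > 0" by (rule \<epsilon>)
    show "integrable lebesgue (\<lambda>x. (\<psi> m x - \<psi> k x)\<^sup>2)" if "m \<le> k" for m k
      unfolding \<psi>_def by (rule quad_parallelogram(2)[OF v vk[OF that]])
    show "\<psi> m x - \<psi> k x = 0" if "x \<notin> cube R" for m k x
      using goodD(12)[OF v that] by (simp add: \<psi>_def)
  qed (use tint in auto)
  obtain w where w: "integrable lebesgue w" "(\<lambda>m. \<integral>x. \<bar>\<psi> m x - w x\<bar> \<partial>lebesgue) \<longlonglongrightarrow> 0"
    using L1_complete[OF tint psi1] by blast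
  have Gint: "integrable lebesgue (zext (?E j) (G m))" if "j < m" for j m
    unfolding G_def by (rule goodD(10)[OF v that])
  have G2: "\<exists>N. \<forall>m\<ge>N. \<forall>k\<ge>m. (\<integral>x. (zext (?E j) (\<lambda>x. G m x - G k x) x)\<^sup>2 \<partial>lebesgue) < \<epsilon>" if \<epsilon>: "\<epsilon> > 0" for \<epsilon> j
  proof -
    have wp: "weight \<delta> j > 0" by (rule weight_pos)
    obtain N where N: "\<And>m k. m \<ge> N \<Longrightarrow> k \<ge> m \<Longrightarrow> quad \<delta> m (v m) / 2 + quad \<delta> m (v k) / 2 - quad \<delta> m (mid (v m) (v k)) < weight \<delta> j * (\<epsilon> / 4)"
      using cauchy[of "weight \<delta> j * (\<epsilon> / 4)"] \<epsilon> wp by auto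
    have "(\<integral>x. (zext (?E j) (\<lambda>x. G m x - G k x) x)\<^sup>2 \<partial>lebesgue) < \<epsilon>" if mk: "m \<ge> max N (Suc j)" "k \<ge> m" for m k
    proof -
      let ?s = "\<lambda>j. weight \<delta> j * ((\<integral>x. zext (?E j) (\<lambda>x. (snd (v m) x - snd (v k) x)\<^sup>2) x \<partial>lebesgue) / 4)"
      have "?s j \<le> (\<Sum>j<m. ?s j)"
        using mk weight_pos[of \<delta>]
        by (intro member_le_sum mult_nonneg_nonneg divide_nonneg_nonneg Bochner_Integration.integral_nonneg) (auto simp: zext_def less_imp_le)
      moreover have "0 \<le> (\<integral>x. (fst (v m) x - fst (v k) x)\<^sup>2 \<partial>lebesgue) / 4" by simp
      ultimately have "?s j < weight \<delta> j * (\<epsilon> / 4)"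
        using N[of m k] mk quad_parallelogram(1)[OF v vk[OF mk(2)]] by linarith
      then have "(\<integral>x. zext (?E j) (\<lambda>x. (snd (v m) x - snd (v k) x)\<^sup>2) x \<partial>lebesgue) < \<epsilon>" using wp by simp
      moreover have "zext (?E j) (\<lambda>x. (snd (v m) x - snd (v k) x)\<^sup>2) = (\<lambda>x. (zext (?E j) (\<lambda>x. G m x - G k x) x)\<^sup>2)"
        by (auto simp: zext_def G_def)
      ultimately show ?thesis by simp
    qed
    then show ?thesis by blast
  qed
  have G1: "\<exists>N. \<forall>m\<ge>N. \<forall>k\<ge>m. (\<integral>x. \<bar>zext (?E j) (\<lambda>x. G m x - G k x) x\<bar> \<partial>lebesgue) < \<epsilon>" if \<epsilon>: "\<epsilon> > 0" for \<epsilon> j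
  proof (rule L1_cauchy_from_L2[where f="\<lambda>m k. zext (?E j) (\<lambda>x. G m x - G k x)" and ?N0.0="Suc j"])
    show "\<exists>N. \<forall>m\<ge>N. \<forall>k\<ge>m. (\<integral>x. (zext (?E j) (\<lambda>x. G m x - G k x) x)\<^sup>2 \<partial>lebesgue) < e" if "e > 0" for e by (rule G2[OF that])
    show "\<epsilon> > 0" by (rule \<epsilon>)
  next
    fix m k assume mk: "Suc j \<le> m" "m \<le> k"
    have "zext (?E j) (\<lambda>x. G m x - G k x) = (\<lambda>x. zext (?E j) (G m) x - zext (?E j) (G k) x)" by (auto simp: zext_def)
    then show "integrable lebesgue (zext (?E j) (\<lambda>x. G m x - G k x))" using Gint[of j m] Gint[of j k] mk by simp
    have "(\<lambda>x. (zext (?E j) (\<lambda>x. G m x - G k x) x)\<^sup>2) = zext (?E j) (\<lambda>x. (snd (v m) x - snd (v k) x)\<^sup>2)"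
      by (auto simp: zext_def G_def)
    then show "integrable lebesgue (\<lambda>x. (zext (?E j) (\<lambda>x. G m x - G k x) x)\<^sup>2)"
      using quad_parallelogram(3)[OF v vk[OF mk(2)], of j] mk by simp
  next
    show "zext (?E j) (\<lambda>x. G m x - G k x) x = 0" if "x \<notin> cube R" for m k x
      using that EO[of j] \<Omega>(2) by (auto simp: zext_def)
  qed
  have exl: "\<exists>l. integrable lebesgue l \<and> (\<lambda>m. \<integral>x. \<bar>zext (?E j) (G m) x - l x\<bar> \<partial>lebesgue) \<longlonglongrightarrow> 0" for j
  proof -
    \<comment> \<open>The index is shifted so that every member is integrable on the j-th exhausting
      set.\<close>
    define f where "f m = zext (?E j) (G (m + Suc j))" for m
    have fint: "integrable lebesgue (f m)" for m unfolding f_def by (rule Gint) simp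
    have "\<exists>N. \<forall>m\<ge>N. \<forall>k\<ge>m. (\<integral>x. \<bar>f m x - f k x\<bar> \<partial>lebesgue) < \<epsilon>" if \<epsilon>: "\<epsilon> > 0" for \<epsilon>
    proof -
      obtain N where N: "\<And>m k. m \<ge> N \<Longrightarrow> k \<ge> m \<Longrightarrow> (\<integral>x. \<bar>zext (?E j) (\<lambda>x. G m x - G k x) x\<bar> \<partial>lebesgue) < \<epsilon>" using G1[OF \<epsilon>, of j] by blast
      have "(\<integral>x. \<bar>f m x - f k x\<bar> \<partial>lebesgue) < \<epsilon>" if "m \<ge> N" "k \<ge> m" for m k
      proof -
        have "(\<lambda>x. \<bar>f m x - f k x\<bar>) = (\<lambda>x. \<bar>zext (?E j) (\<lambda>x. G (m + Suc j) x - G (k + Suc j) x) x\<bar>)"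
          by (auto simp: f_def zext_def)
        then show ?thesis using N[of "m + Suc j" "k + Suc j"] that by simp
      qed
      then show ?thesis by blast
    qed
    from L1_complete[OF fint this]
    obtain l where l: "integrable lebesgue l" "(\<lambda>m. \<integral>x. \<bar>f m x - l x\<bar> \<partial>lebesgue) \<longlonglongrightarrow> 0" .
    have "(\<lambda>m. \<integral>x. \<bar>zext (?E j) (G m) x - l x\<bar> \<partial>lebesgue) \<longlonglongrightarrow> 0"
      by (rule LIMSEQ_offset[where k="Suc j"]) (use l(2) in \<open>simp add: f_def\<close>)
    with l(1) show ?thesis by blast
  qed
  define l where "l j = (SOME l. integrable lebesgue l \<and> (\<lambda>m. \<integral>x. \<bar>zext (?E j) (G m) x - l x\<bar> \<partial>lebesgue) \<longlonglongrightarrow> 0)" for j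
  have l: "integrable lebesgue (l j)" "(\<lambda>m. \<integral>x. \<bar>zext (?E j) (G m) x - l j x\<bar> \<partial>lebesgue) \<longlonglongrightarrow> 0" for j
    using someI_ex[OF exl[of j]] unfolding l_def by blast+
  obtain H where H: "\<And>j. zext (?E j) H \<in> borel_measurable lebesgue" "\<And>j. AE x in lebesgue. zext (?E j) H x = l j x"
    using glue_L1_limits[of \<Omega> G l, OF Gint l] by blast
  have Hq: "integrable lebesgue (zext (?E j) (\<lambda>x. \<bar>H x\<bar> powr q))" if q: "1 \<le> q" for j q
  proof -
    have "integrable lebesgue (\<lambda>x. \<bar>l j x\<bar> powr q)"
    proof (rule L1_convergence_fatou[where f="\<lambda>n. zext (?E j) (G (n + Suc j))" and C="local_const q (\<delta> j)"])
      show "(\<lambda>n. \<integral>x. \<bar>zext (?E j) (G (n + Suc j)) x - l j x\<bar> \<partial>lebesgue) \<longlonglongrightarrow> 0"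
        by (rule LIMSEQ_ignore_initial_segment[OF l(2)])
      have eq: "(\<lambda>x. \<bar>zext (?E j) (G (n + Suc j)) x\<bar> powr q) = zext (?E j) (\<lambda>x. \<bar>snd (v (n + Suc j)) x\<bar> powr q)" for n
        by (auto simp: zext_def G_def)
      show "integrable lebesgue (\<lambda>x. \<bar>zext (?E j) (G (n + Suc j)) x\<bar> powr q)"
        "(\<integral>x. \<bar>zext (?E j) (G (n + Suc j)) x\<bar> powr q \<partial>lebesgue) \<le> local_const q (\<delta> j)" for n
        unfolding eq by (rule goodD(7)[OF v _ q] goodD(8)[OF v _ q], simp)+
    qed (use q l(1) Gint in auto)
    moreover have eqH: "zext (?E j) (\<lambda>x. \<bar>H x\<bar> powr q) = (\<lambda>x. \<bar>zext (?E j) H x\<bar> powr q)" by (auto simp: zext_def)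
    moreover have "(\<lambda>x. \<bar>zext (?E j) H x\<bar> powr q) \<in> borel_measurable lebesgue" using H(1)[of j] by simp
    moreover have "AE x in lebesgue. \<bar>l j x\<bar> powr q = \<bar>zext (?E j) H x\<bar> powr q" using H(2)[of j] by eventually_elim simp
    ultimately show ?thesis unfolding eqH using integrable_cong_AE_imp by blast
  qed
  have HLp: "H \<in> Lp_loc q \<Omega>" if q: "1 \<le> q" for q
    unfolding Lp_loc_def
  proof (intro CollectI allI impI)
    fix K assume K: "compact K \<and> K \<subseteq> \<Omega>"
    obtain j where j: "K \<subseteq> ?E j" using compact_subset_exhaustion[of K \<Omega>] K \<Omega>(1) by blast
    have Ks: "K \<in> sets lebesgue" using K compact_sets_lebesgue by blast
    have "zext K H = (\<lambda>x. indicator K x *\<^sub>R zext (?E j) H x)" using j by (auto simp: zext_def fun_eq_iff)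
    moreover have "(\<lambda>x. indicator K x *\<^sub>R zext (?E j) H x) \<in> borel_measurable lebesgue"
      using H(1)[of j] Ks by (intro borel_measurable_scaleR borel_measurable_indicator) auto
    ultimately have "H \<in> borel_measurable (lebesgue_on K)" using zext_measurable[OF Ks, of H] by simp
    moreover have "integrable (lebesgue_on K) (\<lambda>x. \<bar>H x\<bar> powr q)"
      by (rule Lp1_mono[OF _ j Es Ks]) (simp add: zext_integrable[OF Es] Hq[OF q])
    ultimately show "H \<in> Lp q K" unfolding Lp_def by blast
  qed
  have weak: "has_weak_partial \<Omega> one (\<lambda>x. u0 x + w x) H"
  proof (rule weak_partialI[OF \<Omega>(1)])
    have wO: "integrable (lebesgue_on \<Omega>) w"
      unfolding zext_integrable[OF open_sets_lebesgue[OF \<Omega>(1)]] zext_eq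
      by (rule integrable_mult_indicator[OF open_sets_lebesgue[OF \<Omega>(1)] w(1)])
    show "(\<lambda>x. u0 x + w x) \<in> Lp_loc 1 \<Omega>" by (intro integrable_imp_Lp_loc \<Omega>(1) Bochner_Integration.integrable_add g(2) wO)
    show "H \<in> Lp_loc 1 \<Omega>" by (rule HLp) simp
    fix \<theta> assume \<theta>: "test_function \<Omega> \<theta>"
    note d\<theta> = test_function_partial_deriv[OF \<theta>, of one]
    obtain C where C: "\<And>x. \<bar>\<theta> x\<bar> \<le> C" using test_function_bounded[OF \<theta>] by blast
    obtain C' where C': "\<And>x. \<bar>partial_deriv one \<theta> x\<bar> \<le> C'" using test_function_bounded[OF d\<theta>] by blast
    have \<theta>m: "\<theta> \<in> borel_measurable lebesgue" "partial_deriv one \<theta> \<in> borel_measurable lebesgue"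
      using test_function_integrable[OF \<theta>] test_function_integrable[OF d\<theta>] by auto
    \<comment> \<open>The test function lives in one exhausting set, so convergence there is enough
      to pass to the limit in its identity.\<close>
    obtain j where j: "closure {x. \<theta> x \<noteq> 0} \<subseteq> ?E j"
      using compact_subset_exhaustion[OF test_functionD(2)[OF \<theta>] \<Omega>(1) test_functionD(3)[OF \<theta>]] by blast
    have off: "\<theta> x = 0" if "x \<notin> ?E j" for x using that j test_functionD(4)[OF \<theta>] by blast
    have u0\<theta>: "integrable lebesgue (\<lambda>x. zext \<Omega> u0 x * partial_deriv one \<theta> x)"
      by (rule Lp_loc_times_test_function[OF \<Omega>(1) integrable_imp_Lp_loc[OF g(2) \<Omega>(1)] d\<theta>])
    have g\<theta>: "integrable lebesgue (\<lambda>x. zext \<Omega> (g one) x * \<theta> x)"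
      by (rule Lp_loc_times_test_function[OF \<Omega>(1) integrable_imp_Lp_loc[OF g(3) \<Omega>(1)] \<theta>])
    define a where "a m = (\<integral>x. zext \<Omega> u0 x * partial_deriv one \<theta> x \<partial>lebesgue) + (\<integral>x. \<psi> m x * partial_deriv one \<theta> x \<partial>lebesgue)" for m
    have w\<theta>: "integrable lebesgue (\<lambda>x. w x * partial_deriv one \<theta> x)"
    proof (rule Bochner_Integration.integrable_bound[of lebesgue "\<lambda>x. C' * w x"])
      show "AE x in lebesgue. norm (w x * partial_deriv one \<theta> x) \<le> norm (C' * w x)"
      proof (rule AE_I2)
        fix x
        have "\<bar>w x\<bar> * \<bar>partial_deriv one \<theta> x\<bar> \<le> \<bar>w x\<bar> * \<bar>C'\<bar>" using C'[of x] by (intro mult_left_mono) auto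
        then show "norm (w x * partial_deriv one \<theta> x) \<le> norm (C' * w x)" by (simp add: abs_mult mult.commute)
      qed
    qed (use w(1) \<theta>m in auto)
    have eq: "(\<integral>x. zext \<Omega> u0 x * partial_deriv one \<theta> x \<partial>lebesgue) + (\<integral>x. w x * partial_deriv one \<theta> x \<partial>lebesgue)
        = (\<integral>x. zext \<Omega> (\<lambda>x. u0 x + w x) x * partial_deriv one \<theta> x \<partial>lebesgue)"
    proof -
      have "(\<lambda>x. zext \<Omega> u0 x * partial_deriv one \<theta> x + w x * partial_deriv one \<theta> x) = (\<lambda>x. zext \<Omega> (\<lambda>x. u0 x + w x) x * partial_deriv one \<theta> x)"
        using test_functionD(5)[OF d\<theta>] by (auto simp: zext_def fun_eq_iff distrib_right)
      then show ?thesis using Bochner_Integration.integral_add[OF u0\<theta> w\<theta>] by simp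
    qed
    have "(\<lambda>m. \<integral>x. \<psi> m x * partial_deriv one \<theta> x \<partial>lebesgue) \<longlonglongrightarrow> (\<integral>x. w x * partial_deriv one \<theta> x \<partial>lebesgue)"
      by (rule L1_convergence_times_bounded[OF _ w \<theta>m(2) C']) (simp add: tint)
    then have lim1: "a \<longlonglongrightarrow> (\<integral>x. zext \<Omega> (\<lambda>x. u0 x + w x) x * partial_deriv one \<theta> x \<partial>lebesgue)"
      unfolding a_def eq[symmetric] by (intro tendsto_add tendsto_const)
    define r where "r m = zext (?E j) (residual (\<psi> m) (G m))" for m
    have rint: "integrable lebesgue (r m)" and rsmall: "(\<integral>x. \<bar>r m x\<bar> \<partial>lebesgue) \<le> 1 / (real m + 1)" if m: "m \<ge> j" for m
    proof -
      have sub: "?E j \<subseteq> ?E m" by (rule exhaustion_mono[OF m])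
      show i: "integrable lebesgue (r m)"
        unfolding r_def zext_integrable[OF Es, symmetric]
        by (rule Lp1_mono[OF _ sub Es Es]) (simp only: zext_integrable[OF Es] \<psi>_def G_def goodD(5)[OF v[of m]])
      have "(\<integral>x. \<bar>r m x\<bar> \<partial>lebesgue) \<le> (\<integral>x. \<bar>zext (?E m) (residual (\<psi> m) (G m)) x\<bar> \<partial>lebesgue)"
        by (intro Bochner_Integration.integral_mono integrable_abs i goodD(5)[OF v[of m], folded \<psi>_def G_def])
          (use sub in \<open>auto simp: zext_def r_def\<close>)
      then show "(\<integral>x. \<bar>r m x\<bar> \<partial>lebesgue) \<le> 1 / (real m + 1)" using goodD(6)[OF v[of m]] by (simp add: \<psi>_def G_def)
    qed
    have lim2: "(\<lambda>m. \<integral>x. r m x * \<theta> x \<partial>lebesgue) \<longlonglongrightarrow> (\<integral>x. 0 * \<theta> x \<partial>lebesgue)"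
    proof (rule L1_convergence_times_bounded[OF _ _ _ \<theta>m(1) C])
      show "eventually (\<lambda>m. integrable lebesgue (r m)) sequentially" using eventually_ge_at_top[of j] by eventually_elim (rule rint)
      have lim: "(\<lambda>m. 1 / (real m + 1)) \<longlonglongrightarrow> 0" by real_asymp
      show "(\<lambda>m. \<integral>x. \<bar>r m x - 0\<bar> \<partial>lebesgue) \<longlonglongrightarrow> 0"
        by (rule tendsto_sandwich[OF _ _ tendsto_const lim])
          (auto intro: eventually_mono[OF eventually_ge_at_top[of j]] rsmall)
    qed simp
    have lim3: "(\<lambda>m. \<integral>x. zext (?E j) (G m) x * \<theta> x \<partial>lebesgue) \<longlonglongrightarrow> (\<integral>x. l j x * \<theta> x \<partial>lebesgue)"
    proof (rule L1_convergence_times_bounded[OF _ l \<theta>m(1) C])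
      show "eventually (\<lambda>m. integrable lebesgue (zext (?E j) (G m))) sequentially"
        using eventually_gt_at_top[of j] by eventually_elim (rule Gint)
    qed
    have bint: "integrable lebesgue (\<lambda>x. f x * \<theta> x)" if "integrable lebesgue f" for f
    proof (rule Bochner_Integration.integrable_bound[of lebesgue "\<lambda>x. C * f x"])
      show "AE x in lebesgue. norm (f x * \<theta> x) \<le> norm (C * f x)"
      proof (rule AE_I2)
        fix x
        have "\<bar>f x\<bar> * \<bar>\<theta> x\<bar> \<le> \<bar>f x\<bar> * \<bar>C\<bar>" using C[of x] by (intro mult_left_mono) auto
        then show "norm (f x * \<theta> x) \<le> norm (C * f x)" by (simp add: abs_mult mult.commute)
      qed
    qed (use that \<theta>m in auto)
    \<comment> \<open>For m > j the derivative u0 + \<psi>_m has in direction \<open>one\<close> is,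
      on the support of \<theta>, the residual plus \<open>G m\<close>; the first part vanishes in
      the limit.\<close>
    have "eventually (\<lambda>m. - ((\<integral>x. r m x * \<theta> x \<partial>lebesgue) + (\<integral>x. zext (?E j) (G m) x * \<theta> x \<partial>lebesgue)) = a m) sequentially"
      using eventually_gt_at_top[of j]
    proof eventually_elim
      case (elim m)
      have "a m = - ((\<integral>x. zext \<Omega> (g one) x * \<theta> x \<partial>lebesgue) + (\<integral>x. partial_deriv one (\<psi> m) x * \<theta> x \<partial>lebesgue))"
        unfolding a_def weak_partialD[OF g(1) \<Omega>(1) \<theta>] integration_by_parts[OF t test_functionD(1)[OF \<theta>]] by simp
      also have "(\<integral>x. zext \<Omega> (g one) x * \<theta> x \<partial>lebesgue) + (\<integral>x. partial_deriv one (\<psi> m) x * \<theta> x \<partial>lebesgue)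
         = (\<integral>x. zext \<Omega> (g one) x * \<theta> x + partial_deriv one (\<psi> m) x * \<theta> x \<partial>lebesgue)"
        by (rule Bochner_Integration.integral_add[symmetric, OF g\<theta>])
          (rule test_function_integrable[OF test_function_mult_smooth[OF test_function_partial_deriv[OF t] test_functionD(1)[OF \<theta>]]])
      also have "(\<lambda>x. zext \<Omega> (g one) x * \<theta> x + partial_deriv one (\<psi> m) x * \<theta> x) = (\<lambda>x. r m x * \<theta> x + zext (?E j) (G m) x * \<theta> x)"
      proof
        fix x
        show "zext \<Omega> (g one) x * \<theta> x + partial_deriv one (\<psi> m) x * \<theta> x = r m x * \<theta> x + zext (?E j) (G m) x * \<theta> x"
        proof (cases "x \<in> ?E j")
          case True
          then have "x \<in> \<Omega>" using EO by blast
          with True show ?thesis by (simp add: r_def zext_def algebra_simps)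
        qed (simp add: off)
      qed
      also have "(\<integral>x. r m x * \<theta> x + zext (?E j) (G m) x * \<theta> x \<partial>lebesgue) = (\<integral>x. r m x * \<theta> x \<partial>lebesgue) + (\<integral>x. zext (?E j) (G m) x * \<theta> x \<partial>lebesgue)"
        by (rule Bochner_Integration.integral_add) (intro bint rint Gint; use elim in simp)+
      finally show ?case by simp
    qed
    moreover have "(\<lambda>m. - ((\<integral>x. r m x * \<theta> x \<partial>lebesgue) + (\<integral>x. zext (?E j) (G m) x * \<theta> x \<partial>lebesgue))) \<longlonglongrightarrow> - (0 + (\<integral>x. l j x * \<theta> x \<partial>lebesgue))"
      using lim2 by (intro tendsto_minus tendsto_add lim3) simp
    ultimately have "a \<longlonglongrightarrow> - (\<integral>x. l j x * \<theta> x \<partial>lebesgue)" using Lim_transform_eventually by fastforce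
    moreover have "(\<integral>x. l j x * \<theta> x \<partial>lebesgue) = (\<integral>x. zext \<Omega> H x * \<theta> x \<partial>lebesgue)"
    proof -
      have "(\<integral>x. l j x * \<theta> x \<partial>lebesgue) = (\<integral>x. zext (?E j) H x * \<theta> x \<partial>lebesgue)"
      proof (rule integral_cong_AE)
        show "(\<lambda>x. l j x * \<theta> x) \<in> borel_measurable lebesgue" using l(1)[of j] \<theta>m by auto
        show "(\<lambda>x. zext (?E j) H x * \<theta> x) \<in> borel_measurable lebesgue" using H(1)[of j] \<theta>m by auto
        show "AE x in lebesgue. l j x * \<theta> x = zext (?E j) H x * \<theta> x" using H(2)[of j] by eventually_elim simp
      qed
      also have "(\<lambda>x. zext (?E j) H x * \<theta> x) = (\<lambda>x. zext \<Omega> H x * \<theta> x)"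
        using off EO[of j] by (auto simp: zext_def fun_eq_iff)
      finally show ?thesis .
    qed
    ultimately show "(\<integral>x. zext \<Omega> (\<lambda>x. u0 x + w x) x * partial_deriv one \<theta> x \<partial>lebesgue) = - (\<integral>x. zext \<Omega> H x * \<theta> x \<partial>lebesgue)"
      using LIMSEQ_unique[OF lim1] by simp
  qed
  have "(\<lambda>m. energy_of (\<psi> m)) \<longlonglongrightarrow> I"
  proof (rule tendsto_sandwich[OF _ _ tendsto_const])
    show "eventually (\<lambda>m. I \<le> energy_of (\<psi> m)) sequentially" using lower t by simp
    show "eventually (\<lambda>m. energy_of (\<psi> m) \<le> I + 2 / (real m + 1)) sequentially"
      unfolding \<psi>_def by (rule always_eventually) (use goodD(3)[OF v] in blast)
    have "(\<lambda>m. I + 2 / (real m + 1)) \<longlonglongrightarrow> I + 0" by (intro tendsto_add tendsto_const) real_asymp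
    then show "(\<lambda>m. I + 2 / (real m + 1)) \<longlonglongrightarrow> I" by simp
  qed
  then show thesis using that[OF t _ w HLp weak] by blast
qed

end

section \<open>Minimizing sequences\<close>

text \<open>By convexity a slope steeper than \<open>a3\<close> persists in its own direction, and
  the function would finally exceed its linear upper bound.\<close>

lemma linear_growth_bounded_derivative:
  fixes \<phi> p :: "real \<Rightarrow> real"
  assumes growth: "linear_growth \<phi>" and pos: "\<And>t. 0 \<le> \<phi> t"
    and D: "\<And>t. (\<phi> has_real_derivative p t) (at t)" and p: "\<And>s t. s \<le> t \<Longrightarrow> p s \<le> p t"
  obtains l where "0 \<le> l" "\<And>t. \<bar>p t\<bar> \<le> l"
proof -
  obtain a3 a4 where a: "a3 > 0" "a4 \<ge> 0" "\<And>t. \<phi> t \<le> a3 * \<bar>t\<bar> + a4"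
    using growth unfolding linear_growth_def by blast
  have "\<bar>p t\<bar> \<le> a3" for t
  proof (rule ccontr)
    assume "\<not> \<bar>p t\<bar> \<le> a3"
    then have gt: "\<bar>p t\<bar> - a3 > 0" by simp
    \<comment> \<open>Moving by \<open>s\<close> in the direction of the slope raises \<phi> by at
      least a3 s + a3 |t| + a4 + 1, more than the growth bound allows at a point of modulus at most
      |t| + s.\<close>
    define s where "s = (a3 * \<bar>t\<bar> + a4 + 1) / (\<bar>p t\<bar> - a3)"
    have s: "s > 0" unfolding s_def by (rule divide_pos_pos[OF _ gt]) (use a in \<open>auto intro: add_nonneg_pos\<close>)
    have eq: "s * \<bar>p t\<bar> = a3 * s + a3 * \<bar>t\<bar> + a4 + 1" using gt by (simp add: s_def field_simps)
    have "\<exists>x. \<bar>x - t\<bar> = s \<and> s * \<bar>p t\<bar> \<le> \<phi> x - \<phi> t"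
    proof (cases "0 \<le> p t")
      case True
      obtain z where z: "t < z" "\<phi> (t + s) - \<phi> t = (t + s - t) * p z"
        using MVT2[of t "t + s" \<phi> p] s D by auto
      have "s * p t \<le> s * p z" using s p[of t z] z(1) by simp
      then show ?thesis using True z(2) s by (intro exI[of _ "t + s"]) simp
    next
      case False
      obtain z where z: "z < t" "\<phi> t - \<phi> (t - s) = (t - (t - s)) * p z"
        using MVT2[of "t - s" t \<phi> p] s D by auto
      have "s * p z \<le> s * p t" using s p[of z t] z(1) by simp
      then show ?thesis using False z(2) s by (intro exI[of _ "t - s"]) (simp add: algebra_simps)
    qed
    then obtain x where x: "\<bar>x - t\<bar> = s" "s * \<bar>p t\<bar> \<le> \<phi> x - \<phi> t" by blast
    have "a3 * \<bar>x\<bar> \<le> a3 * (\<bar>t\<bar> + s)" using a(1) x(1) by (intro mult_left_mono) auto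
    then show False using a(3)[of x] pos[of t] x(2) eq by (simp add: distrib_left)
  qed
  then show ?thesis using a(1) that[of a3] by simp
qed

text \<open>The mean value theorem together with (1 + |z|)^2 \<le> 2 (1 + z^2), the origin of the
  factor 2 to the power -\<mu>/2, and the fact that \<open>Gam\<close> between two points is at most
  its larger end value.\<close>

lemma increment_lower_bound:
  fixes p p' :: "real \<Rightarrow> real"
  assumes D: "\<And>t. (p has_real_derivative p' t) (at t)" and low: "\<And>t. c * (1 + \<bar>t\<bar>) powr (- \<mu>) \<le> p' t"
    and "0 < c" "0 < \<mu>" "s \<le> t"
  shows "c * 2 powr (- \<mu> / 2) * max (Gam s) (Gam t) powr (- \<mu> / 2) * (t - s) \<le> p t - p s"
proof (cases "s = t")
  case False
  with \<open>s \<le> t\<close> have st: "s < t" by simp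
  obtain z where z: "s < z" "z < t" "p t - p s = (t - s) * p' z"
    using MVT2[OF st D] by blast
  let ?m = "max (Gam s) (Gam t)"
  have m: "?m > 0" using Gam_pos[of s] by simp
  have zm: "Gam z \<le> ?m"
  proof (cases "0 \<le> z")
    case True then show ?thesis using Gam_mono[of z t] z by simp
  next
    case False then show ?thesis using Gam_mono[of z s] z by simp
  qed
  have "0 \<le> (1 - \<bar>z\<bar>)\<^sup>2" by simp
  then have "(1 + \<bar>z\<bar>)\<^sup>2 \<le> 2 * Gam z" by (simp add: Gam_def power2_eq_square algebra_simps)
  then have sq: "(1 + \<bar>z\<bar>)\<^sup>2 \<le> 2 * ?m" using zm by linarith
  have "2 powr (- \<mu> / 2) * ?m powr (- \<mu> / 2) = (2 * ?m) powr (- \<mu> / 2)" using m by (simp add: powr_mult)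
  also have "\<dots> \<le> ((1 + \<bar>z\<bar>)\<^sup>2) powr (- \<mu> / 2)"
    using sq \<open>0 < \<mu>\<close> by (intro powr_mono2') auto
  also have "\<dots> = (1 + \<bar>z\<bar>) powr (- \<mu>)"
  proof -
    have "(1 + \<bar>z\<bar>)\<^sup>2 = (1 + \<bar>z\<bar>) powr 2" by (simp add: powr_numeral add_pos_nonneg)
    then show ?thesis by (simp only: powr_powr) simp
  qed
  finally have "c * (2 powr (- \<mu> / 2) * ?m powr (- \<mu> / 2)) \<le> c * (1 + \<bar>z\<bar>) powr (- \<mu>)"
    using \<open>0 < c\<close> by (intro mult_left_mono) auto
  with low[of z] have "c * 2 powr (- \<mu> / 2) * ?m powr (- \<mu> / 2) \<le> p' z" by (simp add: mult.assoc)
  from mult_right_mono[OF this, of "t - s"] st z(3) show ?thesis by (simp add: mult.commute)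
qed simp

lemma Lp_norm_1: "Lp_norm 1 S u = (\<integral>x. \<bar>u x\<bar> \<partial>lebesgue_on S)"
  unfolding Lp_norm_def by (simp add: Bochner_Integration.integral_nonneg)

lemma weak_gradient_partial:
  "has_weak_partial \<Omega> i u g \<Longrightarrow> has_weak_partial \<Omega> i u (\<lambda>x. weak_gradient \<Omega> u x $ i)"
  unfolding weak_gradient_def vec_lambda_beta by (rule someI[of "has_weak_partial \<Omega> i u" g])

text \<open>The integrable derivative provided by \<open>Sobolev\<close> agrees almost everywhere
  with the one selected in \<open>weak_gradient\<close>, so integrability carries over.\<close>

lemma Sobolev_1_weak_gradient:
  assumes "open \<Omega>" "u \<in> Sobolev 1 \<Omega>"
  shows "has_weak_partial \<Omega> i u (\<lambda>x. weak_gradient \<Omega> u x $ i)" "integrable (lebesgue_on \<Omega>) (\<lambda>x. weak_gradient \<Omega> u x $ i)"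
proof -
  have "\<exists>g\<in>Lp 1 \<Omega>. has_weak_partial \<Omega> i u g" using assms(2) by (simp add: Sobolev_def)
  then obtain g where "g \<in> Lp 1 \<Omega>" and g: "integrable (lebesgue_on \<Omega>) g" "has_weak_partial \<Omega> i u g"
    using Lp1_iff[of _ \<Omega>] by metis
  show w: "has_weak_partial \<Omega> i u (\<lambda>x. weak_gradient \<Omega> u x $ i)" by (rule weak_gradient_partial[OF g(2)])
  have s: "\<Omega> \<in> sets lebesgue" by (rule open_sets_lebesgue[OF assms(1)])
  have "zext \<Omega> (\<lambda>x. weak_gradient \<Omega> u x $ i) \<in> borel_measurable lebesgue"
    using w by (intro Lp_loc_1_measurable assms(1)) (simp add: has_weak_partial_def)
  moreover have "AE x in lebesgue. zext \<Omega> g x = zext \<Omega> (\<lambda>x. weak_gradient \<Omega> u x $ i) x"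
    using weak_gradient_unique[OF assms(1) g(2)] by eventually_elim (auto simp: zext_def)
  ultimately show "integrable (lebesgue_on \<Omega>) (\<lambda>x. weak_gradient \<Omega> u x $ i)"
    using g(1) unfolding zext_integrable[OF s] by (rule integrable_cong_AE_imp[rotated])
qed

section \<open>From the reduced densities back to the given energy\<close>

context splitting_problem
begin

context
  fixes f :: "real ^ 'n \<Rightarrow> real" and a b :: "'n \<Rightarrow> real"
  assumes f: "\<And>\<xi>. f \<xi> = (\<Sum>i\<in>UNIV. F i (\<xi> $ i) + a i + b i * (\<xi> $ i))" and f_nonneg: "\<And>\<xi>. 0 \<le> f \<xi>"
begin

lemma integrable_zext_const: "integrable lebesgue (zext \<Omega> (\<lambda>_. k))"
proof -
  have "integrable lebesgue (\<lambda>x. k * (indicator \<Omega> x *\<^sub>R indicator (cube R :: (real ^ 'n) set) x))"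
    by (intro integrable_mult_right integrable_mult_indicator open_sets_lebesgue \<Omega>(1) integrable_indicator_cube)
  also have "(\<lambda>x. k * (indicator \<Omega> x *\<^sub>R indicator (cube R :: (real ^ 'n) set) x)) = zext \<Omega> (\<lambda>_. k)"
    using \<Omega>(2) by (auto simp: zext_def indicator_def fun_eq_iff)
  finally show ?thesis .
qed

text \<open>Frees the energy from the representative selected by \<open>SOME\<close>, and splits off
  the affine parts of the densities.\<close>

lemma energy_weak_partials:
  assumes G: "\<And>i. has_weak_partial \<Omega> i u (G i)" "\<And>i. integrable lebesgue (zext \<Omega> (G i))"
  shows "energy f \<Omega> u = (\<Sum>i\<in>UNIV. (\<integral>x. F i (zext \<Omega> (G i) x) \<partial>lebesgue) + (\<integral>x. zext \<Omega> (\<lambda>_. a i) x \<partial>lebesgue) + b i * (\<integral>x. zext \<Omega> (G i) x \<partial>lebesgue))"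
proof -
  have s: "\<Omega> \<in> sets lebesgue" by (rule open_sets_lebesgue[OF \<Omega>(1)])
  have Fm: "F i \<in> borel_measurable borel" for i by (rule borel_measurable_continuous_onI[OF F_continuous])
  have eq: "zext \<Omega> (\<lambda>x. f (V x)) = (\<lambda>x. \<Sum>i\<in>UNIV. F i (zext \<Omega> (\<lambda>x. V x $ i) x) + zext \<Omega> (\<lambda>_. a i) x + b i * zext \<Omega> (\<lambda>x. V x $ i) x)" for V
    by (auto simp: f zext_def fun_eq_iff F(1))
  define H where "H x = (\<Sum>i\<in>UNIV. F i (zext \<Omega> (G i) x) + zext \<Omega> (\<lambda>_. a i) x + b i * zext \<Omega> (G i) x)" for x
  have wm: "zext \<Omega> (\<lambda>x. weak_gradient \<Omega> u x $ i) \<in> borel_measurable lebesgue" for i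
    using weak_gradient_partial[OF G(1)[of i]] by (intro Lp_loc_1_measurable \<Omega>(1)) (simp add: has_weak_partial_def)
  have am: "zext \<Omega> (\<lambda>_. a i) \<in> borel_measurable lebesgue" for i using integrable_zext_const by blast
  have Gm: "zext \<Omega> (G i) \<in> borel_measurable lebesgue" for i using G(2) by blast
  have "AE x in lebesgue. \<forall>i\<in>UNIV. x \<in> \<Omega> \<longrightarrow> weak_gradient \<Omega> u x $ i = G i x"
    by (intro AE_finite_allI weak_gradient_unique \<Omega>(1) G(1)) simp
  then have ae: "AE x in lebesgue. zext \<Omega> (\<lambda>x. f (weak_gradient \<Omega> u x)) x = H x"
    unfolding eq H_def by eventually_elim (rule sum.cong, auto simp: zext_def)
  have "energy f \<Omega> u = (\<integral>x. zext \<Omega> (\<lambda>x. f (weak_gradient \<Omega> u x)) x \<partial>lebesgue)"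
    unfolding energy_def by (rule zext_integral[OF s])
  also have "\<dots> = integral\<^sup>L lebesgue H"
  proof (rule integral_cong_AE[OF _ _ ae])
    show "zext \<Omega> (\<lambda>x. f (weak_gradient \<Omega> u x)) \<in> borel_measurable lebesgue" unfolding eq
      by (intro borel_measurable_sum borel_measurable_add borel_measurable_times borel_measurable_const measurable_compose[OF wm Fm] wm am)
    show "H \<in> borel_measurable lebesgue" unfolding H_def
      by (intro borel_measurable_sum borel_measurable_add borel_measurable_times borel_measurable_const measurable_compose[OF Gm Fm] Gm am)
  qed
  also have "\<dots> = (\<Sum>i\<in>UNIV. \<integral>x. F i (zext \<Omega> (G i) x) + zext \<Omega> (\<lambda>_. a i) x + b i * zext \<Omega> (G i) x \<partial>lebesgue)"
    unfolding H_def by (intro Bochner_Integration.integral_sum Bochner_Integration.integrable_add F_integrable G(2) integrable_zext_const integrable_mult_right)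
  also have "\<dots> = (\<Sum>i\<in>UNIV. (\<integral>x. F i (zext \<Omega> (G i) x) \<partial>lebesgue) + (\<integral>x. zext \<Omega> (\<lambda>_. a i) x \<partial>lebesgue) + b i * (\<integral>x. zext \<Omega> (G i) x \<partial>lebesgue))"
    using F_integrable[OF G(2)] G(2) integrable_zext_const by (intro sum.cong refl) simp
  finally show ?thesis .
qed

definition affine_part :: real where
  "affine_part = (\<Sum>i\<in>UNIV. (\<integral>x. zext \<Omega> (\<lambda>_. a i) x \<partial>lebesgue) + b i * (\<integral>x. zext \<Omega> (g i) x \<partial>lebesgue))"

lemma competitor_partials:
  assumes \<phi>: "test_function \<Omega> \<phi>"
  shows "has_weak_partial \<Omega> i (\<lambda>x. u0 x + \<phi> x) (\<lambda>x. g i x + partial_deriv i \<phi> x)"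
    and "zext \<Omega> (\<lambda>x. g i x + partial_deriv i \<phi> x) = (\<lambda>x. zext \<Omega> (g i) x + partial_deriv i \<phi> x)"
    and "integrable lebesgue (zext \<Omega> (\<lambda>x. g i x + partial_deriv i \<phi> x))"
proof -
  show "has_weak_partial \<Omega> i (\<lambda>x. u0 x + \<phi> x) (\<lambda>x. g i x + partial_deriv i \<phi> x)"
    using weak_partial_lincomb[OF \<Omega>(1) g(1) weak_partial_test_function[OF \<Omega>(1) \<phi>], where a=1 and b=1 and i=i] by simp
  show eq: "zext \<Omega> (\<lambda>x. g i x + partial_deriv i \<phi> x) = (\<lambda>x. zext \<Omega> (g i) x + partial_deriv i \<phi> x)"
    using test_functionD(5)[OF test_function_partial_deriv[OF \<phi>]] by (auto simp: zext_def)
  show "integrable lebesgue (zext \<Omega> (\<lambda>x. g i x + partial_deriv i \<phi> x))"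
    unfolding eq by (intro Bochner_Integration.integrable_add zg_integrable test_function_integrable[OF test_function_partial_deriv[OF \<phi>]])
qed

text \<open>Partial derivatives of a test function have integral 0, so the tangents contribute the
  same amount for every competitor and do not affect minimisation.\<close>

lemma energy_competitor:
  assumes \<phi>: "test_function \<Omega> \<phi>"
  shows "energy f \<Omega> (\<lambda>x. u0 x + \<phi> x) = energy_of \<phi> + affine_part"
proof -
  note d\<phi> = test_function_partial_deriv[OF \<phi>]
  note gi = zg_integrable
  have "(\<integral>x. zext \<Omega> (g i) x + partial_deriv i \<phi> x \<partial>lebesgue) = (\<integral>x. zext \<Omega> (g i) x \<partial>lebesgue)" for i
    using Bochner_Integration.integral_add[OF gi[of i] test_function_integrable[OF d\<phi>[of i]]] integral_partial_deriv_eq_0[OF \<phi>, of i] by simp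
  then show ?thesis
    unfolding energy_weak_partials[of "\<lambda>x. u0 x + \<phi> x" "\<lambda>i x. g i x + partial_deriv i \<phi> x", OF competitor_partials(1,3)[OF \<phi>]]
      competitor_partials(2)[OF \<phi>] energy_of_def affine_part_def by (simp add: sum.distrib)
qed

text \<open>The densities have bounded slopes, so the energy is Lipschitz with respect to the L1
  norm of the gradient.\<close>

lemma energy_lipschitz:
  assumes G: "\<And>i. has_weak_partial \<Omega> i u (G i)" "\<And>i. integrable lebesgue (zext \<Omega> (G i))"
    and H: "\<And>i. has_weak_partial \<Omega> i v (H i)" "\<And>i. integrable lebesgue (zext \<Omega> (H i))"
  shows "energy f \<Omega> u - energy f \<Omega> v \<le> (\<Sum>i\<in>UNIV. (lip + \<bar>b i\<bar>) * (\<integral>x. \<bar>zext \<Omega> (G i) x - zext \<Omega> (H i) x\<bar> \<partial>lebesgue))"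
proof -
  have d: "integrable lebesgue (\<lambda>x. \<bar>zext \<Omega> (G i) x - zext \<Omega> (H i) x\<bar>)" for i
    by (intro integrable_abs Bochner_Integration.integrable_diff G(2) H(2))
  have "(\<integral>x. F i (zext \<Omega> (G i) x) \<partial>lebesgue) \<le> (\<integral>x. F i (zext \<Omega> (H i) x) + lip * \<bar>zext \<Omega> (G i) x - zext \<Omega> (H i) x\<bar> \<partial>lebesgue)" for i
    by (intro Bochner_Integration.integral_mono Bochner_Integration.integrable_add integrable_mult_right d F_integrable G(2) H(2) F_lipschitz)
  also have "(\<integral>x. F i (zext \<Omega> (H i) x) + lip * \<bar>zext \<Omega> (G i) x - zext \<Omega> (H i) x\<bar> \<partial>lebesgue)
      = (\<integral>x. F i (zext \<Omega> (H i) x) \<partial>lebesgue) + lip * (\<integral>x. \<bar>zext \<Omega> (G i) x - zext \<Omega> (H i) x\<bar> \<partial>lebesgue)" for i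
    using F_integrable[OF H(2)] d by simp
  finally have 1: "(\<integral>x. F i (zext \<Omega> (G i) x) \<partial>lebesgue) \<le> (\<integral>x. F i (zext \<Omega> (H i) x) \<partial>lebesgue) + lip * (\<integral>x. \<bar>zext \<Omega> (G i) x - zext \<Omega> (H i) x\<bar> \<partial>lebesgue)" for i .
  have 2: "b i * (\<integral>x. zext \<Omega> (G i) x \<partial>lebesgue) - b i * (\<integral>x. zext \<Omega> (H i) x \<partial>lebesgue) \<le> \<bar>b i\<bar> * (\<integral>x. \<bar>zext \<Omega> (G i) x - zext \<Omega> (H i) x\<bar> \<partial>lebesgue)" for i
  proof -
    have "b i * (\<integral>x. zext \<Omega> (G i) x \<partial>lebesgue) - b i * (\<integral>x. zext \<Omega> (H i) x \<partial>lebesgue) = b i * (\<integral>x. zext \<Omega> (G i) x - zext \<Omega> (H i) x \<partial>lebesgue)"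
      using G(2)[of i] H(2)[of i] by (simp add: right_diff_distrib)
    also have "\<dots> \<le> \<bar>b i\<bar> * \<bar>\<integral>x. zext \<Omega> (G i) x - zext \<Omega> (H i) x \<partial>lebesgue\<bar>"
      using abs_ge_self[of "b i * (\<integral>x. zext \<Omega> (G i) x - zext \<Omega> (H i) x \<partial>lebesgue)"] by (simp only: abs_mult)
    also have "\<dots> \<le> \<bar>b i\<bar> * (\<integral>x. \<bar>zext \<Omega> (G i) x - zext \<Omega> (H i) x\<bar> \<partial>lebesgue)"
      by (intro mult_left_mono integral_abs_bound) simp
    finally show ?thesis .
  qed
  show ?thesis
    unfolding energy_weak_partials[of u G, OF G] energy_weak_partials[of v H, OF H] sum_subtractf[symmetric]
  proof (rule sum_mono)
    fix i
    show "(\<integral>x. F i (zext \<Omega> (G i) x) \<partial>lebesgue) + (\<integral>x. zext \<Omega> (\<lambda>_. a i) x \<partial>lebesgue) + b i * (\<integral>x. zext \<Omega> (G i) x \<partial>lebesgue)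
        - ((\<integral>x. F i (zext \<Omega> (H i) x) \<partial>lebesgue) + (\<integral>x. zext \<Omega> (\<lambda>_. a i) x \<partial>lebesgue) + b i * (\<integral>x. zext \<Omega> (H i) x \<partial>lebesgue))
      \<le> (lip + \<bar>b i\<bar>) * (\<integral>x. \<bar>zext \<Omega> (G i) x - zext \<Omega> (H i) x\<bar> \<partial>lebesgue)"
      using 1[of i] 2[of i] unfolding distrib_right by linarith
  qed
qed

lemma competitor_admissible: "test_function \<Omega> \<phi> \<Longrightarrow> (\<lambda>x. u0 x + \<phi> x) \<in> admissible \<Omega> u0"
  unfolding admissible_def using test_function_Sobolev0[OF \<Omega>(1)] by simp

text \<open>By definition of \<open>Sobolev0\<close> the gradients are L1 limits of gradients of
  test functions, and the energy is continuous in this norm. The infimum may thus be taken over u0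
  plus test functions.\<close>

lemma admissible_approximation:
  assumes w: "w \<in> admissible \<Omega> u0" and \<epsilon>: "\<epsilon> > 0"
  obtains \<phi> where "test_function \<Omega> \<phi>" "energy f \<Omega> (\<lambda>x. u0 x + \<phi> x) < energy f \<Omega> w + \<epsilon>"
proof -
  have s: "\<Omega> \<in> sets lebesgue" by (rule open_sets_lebesgue[OF \<Omega>(1)])
  define v where "v x = w x - u0 x" for x
  define V where "V i x = weak_gradient \<Omega> v x $ i" for i x
  have "v \<in> Sobolev0 1 \<Omega>" using w unfolding admissible_def v_def by simp
  then obtain \<phi> where v: "v \<in> Sobolev 1 \<Omega>" and \<phi>: "\<And>k::nat. test_function \<Omega> (\<phi> k)"
    "\<And>i. (\<lambda>k. Lp_norm 1 \<Omega> (\<lambda>x. partial_deriv i (\<phi> k) x - V i x)) \<longlonglongrightarrow> 0"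
    unfolding Sobolev0_def V_def by blast
  have V: "has_weak_partial \<Omega> i v (V i)" "integrable lebesgue (zext \<Omega> (V i))" for i
    using Sobolev_1_weak_gradient[OF \<Omega>(1) v, of i] unfolding V_def zext_integrable[OF s] by blast+
  note gi = zg_integrable
  define W where "W i x = g i x + V i x" for i x
  have W1: "has_weak_partial \<Omega> i w (W i)" for i
    using weak_partial_lincomb[OF \<Omega>(1) g(1) V(1), where a=1 and b=1 and i=i] unfolding v_def W_def by simp
  have Weq: "zext \<Omega> (W i) = (\<lambda>x. zext \<Omega> (g i) x + zext \<Omega> (V i) x)" for i by (auto simp: zext_def W_def)
  have W2: "integrable lebesgue (zext \<Omega> (W i))" for i
    unfolding Weq by (intro Bochner_Integration.integrable_add gi V(2))
  define D where "D k i = (\<integral>x. \<bar>zext \<Omega> (\<lambda>x. g i x + partial_deriv i (\<phi> k) x) x - zext \<Omega> (W i) x\<bar> \<partial>lebesgue)" for k i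
  have "D k i = Lp_norm 1 \<Omega> (\<lambda>x. partial_deriv i (\<phi> k) x - V i x)" for k i
    unfolding D_def Lp_norm_1 zext_integral[OF s] by (intro Bochner_Integration.integral_cong refl) (auto simp: zext_def W_def)
  then have D: "(\<lambda>k. D k i) \<longlonglongrightarrow> 0" for i using \<phi>(2)[of i] by simp
  have "(\<lambda>k. \<Sum>i\<in>UNIV. (lip + \<bar>b i\<bar>) * D k i) \<longlonglongrightarrow> (\<Sum>i\<in>UNIV. (lip + \<bar>b i\<bar>) * 0)"
    by (intro tendsto_sum tendsto_mult tendsto_const D)
  then have "eventually (\<lambda>k. (\<Sum>i\<in>UNIV. (lip + \<bar>b i\<bar>) * D k i) < \<epsilon>) sequentially"
    using \<epsilon> by (intro order_tendstoD(2)) auto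
  then obtain k where k: "(\<Sum>i\<in>UNIV. (lip + \<bar>b i\<bar>) * D k i) < \<epsilon>" using eventually_happens' sequentially_bot by blast
  have "energy f \<Omega> (\<lambda>x. u0 x + \<phi> k x) - energy f \<Omega> w \<le> (\<Sum>i\<in>UNIV. (lip + \<bar>b i\<bar>) * D k i)"
    unfolding D_def by (rule energy_lipschitz[OF competitor_partials(1,3)[OF \<phi>(1)] W1 W2])
  with k have "energy f \<Omega> (\<lambda>x. u0 x + \<phi> k x) < energy f \<Omega> w + \<epsilon>" by linarith
  with \<phi>(1) show ?thesis by (rule that)
qed

text \<open>The sequence of \<open>regular_limit\<close>, added to the datum, minimises the original
  energy and converges in L1, so its limit is a cluster point; one weak derivative serves all
  exponents.\<close>

theorem regular_generalized_minimizer: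
  "\<exists>u \<in> generalized_minimizers f \<Omega> u0. \<forall>q \<ge> 1. \<exists>g \<in> Lp_loc q \<Omega>. has_weak_partial \<Omega> one u g"
proof -
  have s: "\<Omega> \<in> sets lebesgue" by (rule open_sets_lebesgue[OF \<Omega>(1)])
  define J where "J = (INF v \<in> admissible \<Omega> u0. energy f \<Omega> v)"
  have bdd: "bdd_below (energy f \<Omega> ` admissible \<Omega> u0)"
    by (intro bdd_belowI[of _ 0]) (auto simp: energy_def f_nonneg intro!: Bochner_Integration.integral_nonneg)
  have ne: "admissible \<Omega> u0 \<noteq> {}" using competitor_admissible[OF test_function_zero] by blast
  have lower: "J - affine_part \<le> energy_of \<phi>" if \<phi>: "test_function \<Omega> \<phi>" for \<phi>
    using cINF_lower[OF bdd competitor_admissible[OF \<phi>]] energy_competitor[OF \<phi>] unfolding J_def by simp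
  have inf: "\<exists>\<phi>. test_function \<Omega> \<phi> \<and> energy_of \<phi> < (J - affine_part) + \<epsilon>" if \<epsilon>: "\<epsilon> > 0" for \<epsilon>
  proof -
    have "J < J + \<epsilon> / 2" using \<epsilon> by simp
    then obtain w where w: "w \<in> admissible \<Omega> u0" "energy f \<Omega> w < J + \<epsilon> / 2"
      unfolding J_def cINF_less_iff[OF ne bdd] by blast
    have "\<epsilon> / 2 > 0" using \<epsilon> by simp
    from admissible_approximation[OF w(1) this]
    obtain \<phi> where \<phi>: "test_function \<Omega> \<phi>" "energy f \<Omega> (\<lambda>x. u0 x + \<phi> x) < energy f \<Omega> w + \<epsilon> / 2" .
    then show ?thesis using w(2) energy_competitor[OF \<phi>(1)] by (intro exI[of _ \<phi>]) simp
  qed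
  obtain \<psi> w G where \<psi>: "\<And>m. test_function \<Omega> (\<psi> m)" "(\<lambda>m. energy_of (\<psi> m)) \<longlonglongrightarrow> J - affine_part"
    and w: "integrable lebesgue w" "(\<lambda>m. \<integral>x. \<bar>\<psi> m x - w x\<bar> \<partial>lebesgue) \<longlonglongrightarrow> 0"
    and G: "\<And>q. 1 \<le> q \<Longrightarrow> G \<in> Lp_loc q \<Omega>" "has_weak_partial \<Omega> one (\<lambda>x. u0 x + w x) G"
  proof (rule regular_limit[of "J - affine_part"], goal_cases)
    case 1 show ?case by (rule lower[OF 1(2)])
  next
    case 2 show ?case by (rule inf[OF 2(2)])
  next
    case (3 \<psi> w G) show ?case by (rule that; fact 3)
  qed
  have wO: "integrable (lebesgue_on \<Omega>) w"
    unfolding zext_integrable[OF s] zext_eq by (rule integrable_mult_indicator[OF s w(1)])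
  have "(\<lambda>m. energy_of (\<psi> m) + affine_part) \<longlonglongrightarrow> J - affine_part + affine_part" by (intro tendsto_add \<psi>(2) tendsto_const)
  then have ms: "minimizing_sequence f \<Omega> u0 (\<lambda>m x. u0 x + \<psi> m x)"
    unfolding minimizing_sequence_def J_def[symmetric] using competitor_admissible[OF \<psi>(1)] energy_competitor[OF \<psi>(1)] by simp
  have le: "Lp_norm 1 \<Omega> (\<lambda>x. u0 x + \<psi> m x - (u0 x + w x)) \<le> (\<integral>x. \<bar>\<psi> m x - w x\<bar> \<partial>lebesgue)" for m
  proof -
    have i: "integrable lebesgue (\<lambda>x. \<bar>\<psi> m x - w x\<bar>)"
      by (intro integrable_abs Bochner_Integration.integrable_diff test_function_integrable[OF \<psi>(1)] w(1))
    have "(\<integral>x. zext \<Omega> (\<lambda>x. \<bar>\<psi> m x - w x\<bar>) x \<partial>lebesgue) \<le> (\<integral>x. \<bar>\<psi> m x - w x\<bar> \<partial>lebesgue)"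
    proof (rule Bochner_Integration.integral_mono[OF _ i])
      show "integrable lebesgue (zext \<Omega> (\<lambda>x. \<bar>\<psi> m x - w x\<bar>))" unfolding zext_eq by (rule integrable_mult_indicator[OF s i])
    qed (simp add: zext_def)
    then show ?thesis unfolding Lp_norm_1 by (simp add: zext_integral[OF s])
  qed
  have "\<exists>\<^sub>F m in sequentially. Lp_norm 1 \<Omega> (\<lambda>x. u0 x + \<psi> m x - (u0 x + w x)) < e" if "e > 0" for e
  proof -
    have "eventually (\<lambda>m. (\<integral>x. \<bar>\<psi> m x - w x\<bar> \<partial>lebesgue) < e) sequentially" by (rule order_tendstoD(2)[OF w(2) that])
    then have "eventually (\<lambda>m. Lp_norm 1 \<Omega> (\<lambda>x. u0 x + \<psi> m x - (u0 x + w x)) < e) sequentially"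
      by eventually_elim (rule le_less_trans[OF le])
    then show ?thesis by (intro eventually_frequently) auto
  qed
  moreover have "(\<lambda>x. u0 x + w x) \<in> Lp 1 \<Omega>" unfolding Lp1_iff by (intro Bochner_Integration.integrable_add g(2) wO)
  ultimately have "(\<lambda>x. u0 x + w x) \<in> generalized_minimizers f \<Omega> u0"
    unfolding generalized_minimizers_def using ms by blast
  then show ?thesis using G by blast
qed

end

end

lemma Lp2_imp_integrable:
  fixes \<Omega> :: "(real ^ 'n) set"
  assumes "open \<Omega>" "\<Omega> \<subseteq> cube R" "u \<in> Lp 2 \<Omega>"
  shows "integrable (lebesgue_on \<Omega>) u"
proof -
  have s: "\<Omega> \<in> sets lebesgue" by (rule open_sets_lebesgue[OF assms(1)])
  have u: "zext \<Omega> u \<in> borel_measurable lebesgue" "integrable lebesgue (zext \<Omega> (\<lambda>x. \<bar>u x\<bar> powr 2))"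
    using assms(3) unfolding Lp_def zext_integrable[OF s, symmetric] zext_measurable[OF s, symmetric] by auto
  have "integrable lebesgue (\<lambda>x. indicator (cube R) x + zext \<Omega> (\<lambda>x. \<bar>u x\<bar> powr 2) x)"
    by (intro Bochner_Integration.integrable_add integrable_indicator_cube u(2))
  then have "integrable lebesgue (zext \<Omega> u)"
  proof (rule Bochner_Integration.integrable_bound[OF _ u(1)])
    have "\<bar>t\<bar> \<le> 1 + \<bar>t\<bar> powr 2" for t :: real
    proof -
      have "0 \<le> (\<bar>t\<bar> - 1)\<^sup>2" by simp
      then have "2 * \<bar>t\<bar> \<le> 1 + t\<^sup>2" by (simp add: power2_eq_square algebra_simps)
      then show ?thesis by (simp add: abs_powr_2)
    qed
    then show "AE x in lebesgue. norm (zext \<Omega> u x) \<le> norm (indicator (cube R) x + zext \<Omega> (\<lambda>x. \<bar>u x\<bar> powr 2) x)"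
      using assms(2) by (intro AE_I2) (auto simp: zext_def indicator_def)
  qed
  then show ?thesis unfolding zext_integrable[OF s] .
qed

theorem theorem1p1:
  fixes \<Omega> :: "(real ^ 'n) set"
    and u0 :: "real ^ 'n \<Rightarrow> real"
    and f :: "real ^ 'n \<Rightarrow> real"
    and fi :: "'n \<Rightarrow> real \<Rightarrow> real"
    and \<mu> c cbar :: "'n \<Rightarrow> real"
    and one :: 'n
  assumes "CARD('n) \<ge> 2"
    and "bounded \<Omega>" and "Lipschitz_domain \<Omega>"
    and "u0 \<in> Sobolev 2 \<Omega> \<inter> Linfty \<Omega>"
    and "\<And>\<xi>. f \<xi> = (\<Sum>i\<in>UNIV. fi i (\<xi> $ i))"
    and "\<And>i t. fi i t \<ge> 0"
    and "\<And>i. strictly_convex (fi i)"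
    and "\<And>i. class_C2 (fi i)"
    and "\<And>i. linear_growth (fi i)"
    and "\<And>i. \<mu> i > 1" and "\<And>i. c i > 0" and "\<And>i. cbar i > 0"
    and "\<And>i t. c i * (1 + \<bar>t\<bar>) powr (- \<mu> i) \<le> deriv (deriv (fi i)) t"
    and "\<And>i t. deriv (deriv (fi i)) t \<le> cbar i"
    and "\<mu> one < 2"
  shows "\<exists>u \<in> generalized_minimizers f \<Omega> u0.
           \<forall>q \<ge> 1. \<exists>g \<in> Lp_loc q \<Omega>. has_weak_partial \<Omega> one u g"
proof -
  note f = assms(5) and fi_nonneg = assms(6) and C2 = assms(8) and growth = assms(9)
  have "open \<Omega>" using assms(3) unfolding Lipschitz_domain_def by blast
  obtain R where R: "0 \<le> R" "\<Omega> \<subseteq> cube R"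
  proof -
    obtain r where r: "0 < r" "\<And>x. x \<in> \<Omega> \<Longrightarrow> norm x \<le> r" using assms(2) bounded_pos by blast
    have "\<Omega> \<subseteq> cube r" using r(2) component_le_norm_cart order_trans by (fastforce simp: mem_cube)
    with r(1) show ?thesis by (intro that[of r]) auto
  qed
  define p where "p i = deriv (fi i)" for i
  have D1: "(fi i has_real_derivative p i t) (at t)" and D2: "(p i has_real_derivative deriv (p i) t) (at t)" for i t
    using C2[of i] unfolding class_C2_def p_def by (simp_all add: DERIV_deriv_iff_real_differentiable)
  have p_low: "c i * (1 + \<bar>t\<bar>) powr (- \<mu> i) \<le> deriv (p i) t" and p_up: "deriv (p i) t \<le> cbar i" for i t
    using assms(13,14) unfolding p_def by auto
  have p_pos: "0 \<le> deriv (p i) t" for i t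
  proof -
    have "0 \<le> c i * (1 + \<bar>t\<bar>) powr (- \<mu> i)" using assms(11)[of i] by simp
    then show ?thesis using p_low[of i t] by linarith
  qed
  have p_mono: "p i s \<le> p i t" if "s \<le> t" for i s t
    by (rule DERIV_nonneg_imp_nondecreasing[OF that]) (use D2 p_pos in blast)
  have "\<forall>i. \<exists>l\<ge>0. \<forall>t. \<bar>p i t\<bar> \<le> l"
    using linear_growth_bounded_derivative[OF growth fi_nonneg D1 p_mono] by metis
  then obtain l where l: "\<And>i. 0 \<le> l i" "\<And>i t. \<bar>p i t\<bar> \<le> l i" by metis
  \<comment> \<open>The factor 2 allows for subtracting the slope at 0. Sums over the directions
    give bounds common to all of them, here and for \<open>C\<close>.\<close>
  define lip where "lip = 2 * (\<Sum>i\<in>UNIV. l i)"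
  define C where "C = (\<Sum>i\<in>UNIV. cbar i)"
  have lle: "l i \<le> (\<Sum>i\<in>UNIV. l i)" and Cle: "cbar i \<le> C" for i
    unfolding C_def using l(1) assms(12) by (auto intro!: member_le_sum simp: less_imp_le)
  have u0: "u0 \<in> Sobolev 2 \<Omega>" "u0 \<in> Linfty \<Omega>" using assms(4) by auto
  have u0int: "integrable (lebesgue_on \<Omega>) u0"
    using u0(1) by (intro Lp2_imp_integrable[OF \<open>open \<Omega>\<close> R(2)]) (simp add: Sobolev_def)
  have "\<forall>i. \<exists>g. g \<in> Lp 2 \<Omega> \<and> has_weak_partial \<Omega> i u0 g" using u0(1) unfolding Sobolev_def by blast
  then obtain g where g: "\<And>i. g i \<in> Lp 2 \<Omega>" "\<And>i. has_weak_partial \<Omega> i u0 (g i)" by metis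
  have gint: "integrable (lebesgue_on \<Omega>) (g i)" for i by (rule Lp2_imp_integrable[OF \<open>open \<Omega>\<close> R(2) g(1)])
  obtain B where B: "AE x in lebesgue_on \<Omega>. \<bar>u0 x\<bar> \<le> B" using u0(2) unfolding Linfty_def by blast
  have "AE x in lebesgue. x \<in> \<Omega> \<longrightarrow> \<bar>u0 x\<bar> \<le> B"
    using B AE_restrict_space_iff[of \<Omega> lebesgue] open_sets_lebesgue[OF \<open>open \<Omega>\<close>] by simp
  then have B': "AE x in lebesgue. x \<in> \<Omega> \<longrightarrow> \<bar>u0 x\<bar> \<le> \<bar>B\<bar>" by eventually_elim auto
  \<comment> \<open>Removing the tangent at 0 makes 0 a minimum of each density without changing its
    second derivative.\<close>
  define F where "F i t = fi i t - fi i 0 - p i 0 * t" for i t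
  define F' where "F' i t = p i t - p i 0" for i t
  obtain K L :: "real ^ 'n \<Rightarrow> real" and Ki M where kernels: "lattice_kernels K L Ki M"
    using lattice_kernels_exist by blast
  interpret splitting_problem K L Ki M \<Omega> u0 g F F' one "\<mu> one" "c one * 2 powr (- \<mu> one / 2)" C "\<bar>B\<bar>" R lip
  proof (intro splitting_problem.intro splitting_problem_axioms.intro kernels \<open>open \<Omega>\<close> R g(2) u0int gint B')
    fix i and s t :: real
    show "F i 0 = 0" "F' i 0 = 0" by (simp_all add: F_def F'_def)
    show "(F i has_real_derivative F' i t) (at t)"
      unfolding F_def F'_def by (auto intro!: derivative_eq_intros D1)
    show "\<bar>F' i t\<bar> \<le> lip"
      using l(2)[of i t] l(2)[of i 0] lle[of i] unfolding F'_def lip_def by linarith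
    assume st: "s \<le> t"
    show "F' i s \<le> F' i t" unfolding F'_def using p_mono[OF st] by simp
    show "F' i t - F' i s \<le> C * (t - s)"
    proof (cases "s = t")
      case False
      then obtain z where z: "p i t - p i s = (t - s) * deriv (p i) z" using MVT2[of s t "p i" "deriv (p i)"] D2 st by auto
      have "deriv (p i) z * (t - s) \<le> C * (t - s)" using p_up[of i z] Cle[of i] st by (intro mult_right_mono) auto
      then show ?thesis using z by (simp add: F'_def mult.commute)
    qed simp
    show "c one * 2 powr (- \<mu> one / 2) * max (Gam s) (Gam t) powr (- \<mu> one / 2) * (t - s) \<le> F' one t - F' one s"
      using increment_lower_bound[where p="p one" and \<mu>="\<mu> one", OF D2 p_low assms(11) _ st] assms(10)[of one] by (simp add: F'_def)
  next
    show "0 \<le> lip" unfolding lip_def using l(1) by (simp add: sum_nonneg)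
    show "0 \<le> C" unfolding C_def using assms(12) by (intro sum_nonneg less_imp_le)
  qed (use assms(10,11,15) in auto)
  show ?thesis
  proof (rule regular_generalized_minimizer[where a="\<lambda>i. fi i 0" and b="\<lambda>i. p i 0"])
    show "f \<xi> = (\<Sum>i\<in>UNIV. F i (\<xi> $ i) + fi i 0 + p i 0 * (\<xi> $ i))" for \<xi> by (simp add: f F_def)
    show "0 \<le> f \<xi>" for \<xi> unfolding f by (intro sum_nonneg fi_nonneg)
  qed
qed

end
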